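(* Let $H$ be a Hopf algebra with a modular pair in involution $(\delta,\sigma)$. Let $\mathcal{D}_H$ be a left $H$-category and let $T^H=\{T^H_X\}_{X\in Ob(\mathcal D_H)}$ be a $\delta$-invariant $\sigma$-trace on $\mathcal{D}_H$. Then the maps $\gamma^n:C^n(H)\longrightarrow CN^n(\mathcal D_H)$ given by $$\big(\gamma^n(h^1 \otimes \ldots \otimes h^n)\big)(f^0 \otimes \ldots \otimes f^{n}):=T_{X_0}^H\big(f^0(h^1f^1)\ldots (h^nf^n)\big)$$ for $h^1 \otimes \ldots \otimes h^n \in H^{\otimes n}$ and $f^0 \otimes \ldots \otimes f^{n} \in Hom_{\mathcal{D}_H}(X_1,X_0) \otimes Hom_{\mathcal{D}_H}(X_2,X_1) \otimes \ldots \otimes Hom_{\mathcal{D}_H}(X_0,X_n)$ define a morphism $\gamma^\bullet:C^\bullet (H_{(\delta,\sigma)}) \longrightarrow CN^\bullet(\mathcal{D}_H)$ of cocyclic modules. This induces a homomorphism in cyclic cohomology $$\gamma^\bullet:HC^\bullet_{(\delta,\sigma)}(H) \longrightarrow HC^\bullet(\mathcal{D}_H).$$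
   Context: $k$ is a field of characteristic zero; $H$ is a Hopf algebra over $k$ with coproduct $\Delta(h)=h_1\otimes h_2$ (Sweedler notation), counit $\varepsilon$ and bijective antipode $S$. A left $H$-category is a small $k$-linear category $\mathcal D_H$ such that each $Hom_{\mathcal D_H}(X,Y)$ is a left $H$-module, $h(id_X)=\varepsilon(h)id_X$, and $h(gf)=(h_1g)(h_2f)$ for all $h\in H$ and composable $f,g$. Modular pair in involution: $\delta:H\to k$ is a character (algebra map), $\sigma\in H$ is group-like, $\delta(\sigma)=1$, and, with $S_\delta(h):=\delta(h_1)S(h_2)$, one has $S_\delta^2(h)=\sigma h\sigma^{-1}$ for all $h\in H$. The cocyclic module ($\Lambda$-module, $\Lambda$ being Connes' cyclic category) $C^\bullet(H_{(\delta,\sigma)})$: $C^n(H)=H^{\otimes n}$ for $n\ge1$, $C^0(H)=k$; for $n>1$, $\delta_0(h^1\otimes\ldots\otimes h^{n-1})=1\otimes h^1\otimes\ldots\otimes h^{n-1}$, $\delta_i(h^1\otimes\ldots\otimes h^{n-1})=h^1\otimes\ldots\otimes\Delta(h^i)\otimes\ldots\otimes h^{n-1}$ for $1\le i\le n-1$, $\delta_n(h^1\otimes\ldots\otimes h^{n-1})=h^1\otimes\ldots\otimes h^{n-1}\otimes\sigma$; for $n=1$, $\delta_0(1)=1$, $\delta_1(1)=\sigma$; degeneracies $\sigma_i(h^1\otimes\ldots\otimes h^{n+1})=h^1\otimes\ldots\otimes\varepsilon(h^{i+1})\otimes\ldots\otimes h^{n+1}$, $0\le i\le n$ (with $\sigma_0(h)=\varepsilon(h)$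 for $n=0$); cyclic operator $\tau_n(h^1\otimes\ldots\otimes h^n)=S_\delta(h^1)\cdot(h^2\otimes\ldots\otimes h^n\otimes\sigma)$ (diagonal left multiplication by $H$ on $H^{\otimes n}$). Its cyclic cohomology is $HC^\bullet_{(\delta,\sigma)}(H)$. For a small $k$-linear category $\mathcal C$, $CN_n(\mathcal C)=\bigoplus Hom_{\mathcal C}(X_1,X_0)\otimes Hom_{\mathcal C}(X_2,X_1)\otimes\ldots\otimes Hom_{\mathcal C}(X_0,X_n)$, the sum over all $(X_0,\ldots,X_n)\in Ob(\mathcal C)^{n+1}$, is a cyclic module with $d_i(f^0\otimes\ldots\otimes f^n)=f^0\otimes\ldots\otimes f^if^{i+1}\otimes\ldots\otimes f^n$ ($0\le i\le n-1$), $d_n(f^0\otimes\ldots\otimes f^n)=f^nf^0\otimes f^1\otimes\ldots\otimes f^{n-1}$, $s_i$ inserting $id_{X_{i+1}}$ after $f^i$ for $0\le i\le n-1$, $s_n$ appending $id_{X_0}$ at the end, and $t_n(f^0\otimes\ldots\otimes f^n)=f^n\otimes f^0\otimes\ldots\otimes f^{n-1}$. $CN^\bullet(\mathcal C)=Hom_k(CN_\bullet(\mathcal C),k)$ is the dual cocyclic module ($\delta_i\phi=\phi\circ d_i$, $\sigma_i\phi=\phi\circ s_i$, $\tau_n\phi=\phi\circ t_n$), with cyclic cohomology $HC^\bullet(\mathcal C)$. A $\sigma$-trace on $\mathcal D_H$ is a collection of $k$-linear maps $T^H_X:Hom_{\mathcal D_H}(X,X)\to k$, $X\in Ob(\mathcal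 D_H)$, with $T^H_X(g\circ f)=T^H_Y(f\circ(\sigma g))$ for all $f\in Hom_{\mathcal D_H}(X,Y)$, $g\in Hom_{\mathcal D_H}(Y,X)$. It is $\delta$-invariant if $T^H_X(hf')=\delta(h)T^H_X(f')$ for all $h\in H$, $f'\in Hom_{\mathcal D_H}(X,X)$. *)

theory Defs
  imports "HOL-Algebra.Module" "HOL-Algebra.AbelCoset" "HOL-Algebra.RingHom"
begin

section \<open>Linear algebra over a field \<open>K\<close>\<close>

definition char_zero :: "('k, 'z) ring_scheme \<Rightarrow> bool" where
  "char_zero K \<longleftrightarrow> (\<forall>n::nat. n > 0 \<longrightarrow> [n] \<cdot>\<^bsub>K\<^esub> \<one>\<^bsub>K\<^esub> \<noteq> \<zero>\<^bsub>K\<^esub>)"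

definition linear_map ::
  "('k, 'z) ring_scheme \<Rightarrow> ('k, 'v, 'y) module_scheme \<Rightarrow> ('k, 'w, 'x) module_scheme
    \<Rightarrow> ('v \<Rightarrow> 'w) \<Rightarrow> bool" where
  "linear_map K V W f \<longleftrightarrow>
     f \<in> carrier V \<rightarrow> carrier W \<and>
     (\<forall>x\<in>carrier V. \<forall>y\<in>carrier V. f (x \<oplus>\<^bsub>V\<^esub> y) = f x \<oplus>\<^bsub>W\<^esub> f y) \<and>
     (\<forall>c\<in>carrier K. \<forall>x\<in>carrier V. f (c \<odot>\<^bsub>V\<^esub> x) = c \<odot>\<^bsub>W\<^esub> f x)"

text \<open>In the module records built below, only the module structure is meaningful; the
  ring multiplication and unit inherited from the record type are left unspecified.\<close>

definition self_module :: "('k, 'z) ring_scheme \<Rightarrow> ('k, 'k) module" where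
  "self_module K = \<lparr>carrier = carrier K, mult = mult K, one = one K,
     zero = zero K, add = add K, smult = mult K\<rparr>"

text \<open>Linear maps are made extensional, so that \<open>hom_module K V W\<close> has one element for
  each linear map on the carrier of \<open>V\<close>.\<close>

definition hom_module ::
  "('k, 'z) ring_scheme \<Rightarrow> ('k, 'v, 'y) module_scheme \<Rightarrow> ('k, 'w, 'x) module_scheme
    \<Rightarrow> ('k, 'v \<Rightarrow> 'w) module" where
  "hom_module K V W = \<lparr>carrier = {f \<in> extensional (carrier V). linear_map K V W f},
     mult = undefined, one = undefined,
     zero = (\<lambda>x\<in>carrier V. \<zero>\<^bsub>W\<^esub>),
     add = (\<lambda>f g. \<lambda>x\<in>carrier V. f x \<oplus>\<^bsub>W\<^esub> g x),
     smult = (\<lambda>c f. \<lambda>x\<in>carrier V. c \<odot>\<^bsub>W\<^esub> f x)\<rparr>"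

abbreviation dual_module ::
  "('k, 'z) ring_scheme \<Rightarrow> ('k, 'v, 'y) module_scheme \<Rightarrow> ('k, 'v \<Rightarrow> 'k) module" where
  "dual_module K V \<equiv> hom_module K V (self_module K)"

definition module_span ::
  "('k, 'z) ring_scheme \<Rightarrow> ('k, 'v, 'y) module_scheme \<Rightarrow> 'v set \<Rightarrow> 'v set" where
  "module_span K V A = \<Inter>{W. submodule W K V \<and> A \<subseteq> W}"

definition quotient_module ::
  "('k, 'v, 'y) module_scheme \<Rightarrow> 'v set \<Rightarrow> ('k, 'v set) module" where
  "quotient_module V W = \<lparr>carrier = a_rcosets\<^bsub>V\<^esub> W, mult = undefined, one = undefined,
     zero = W, add = set_add V,
     smult = (\<lambda>c X. \<Union>x\<in>X. W +>\<^bsub>V\<^esub> (c \<odot>\<^bsub>V\<^esub> x))\<rparr>"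

definition direct_sum ::
  "'i set \<Rightarrow> ('i \<Rightarrow> ('k, 'v, 'y) module_scheme) \<Rightarrow> ('k, 'i \<Rightarrow> 'v) module" where
  "direct_sum I V = \<lparr>
     carrier = {f \<in> (\<Pi>\<^sub>E i\<in>I. carrier (V i)). finite {i\<in>I. f i \<noteq> \<zero>\<^bsub>V i\<^esub>}},
     mult = undefined, one = undefined,
     zero = (\<lambda>i\<in>I. \<zero>\<^bsub>V i\<^esub>),
     add = (\<lambda>f g. \<lambda>i\<in>I. f i \<oplus>\<^bsub>V i\<^esub> g i),
     smult = (\<lambda>c f. \<lambda>i\<in>I. c \<odot>\<^bsub>V i\<^esub> f i)\<rparr>"

definition direct_sum_inj ::
  "'i set \<Rightarrow> ('i \<Rightarrow> ('k, 'v, 'y) module_scheme) \<Rightarrow> 'i \<Rightarrow> 'v \<Rightarrow> 'i \<Rightarrow> 'v" where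
  "direct_sum_inj I V i v = (\<lambda>j\<in>I. if j = i then v else \<zero>\<^bsub>V j\<^esub>)"

definition free_module :: "('k, 'z) ring_scheme \<Rightarrow> 'a set \<Rightarrow> ('k, 'a \<Rightarrow> 'k) module" where
  "free_module K A = \<lparr>
     carrier = {f. (\<forall>x. f x \<in> carrier K) \<and> (\<forall>x. x \<notin> A \<longrightarrow> f x = \<zero>\<^bsub>K\<^esub>) \<and>
                   finite {x. f x \<noteq> \<zero>\<^bsub>K\<^esub>}},
     mult = undefined, one = undefined,
     zero = (\<lambda>x. \<zero>\<^bsub>K\<^esub>),
     add = (\<lambda>f g x. f x \<oplus>\<^bsub>K\<^esub> g x),
     smult = (\<lambda>c f x. c \<otimes>\<^bsub>K\<^esub> f x)\<rparr>"

definition free_gen :: "('k, 'z) ring_scheme \<Rightarrow> 'a \<Rightarrow> 'a \<Rightarrow> 'k" where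
  "free_gen K x = (\<lambda>y. if y = x then \<one>\<^bsub>K\<^esub> else \<zero>\<^bsub>K\<^esub>)"


section \<open>Tensor products of finite lists of vector spaces\<close>

definition tuples :: "('k, 'v, 'y) module_scheme list \<Rightarrow> 'v list set" where
  "tuples Vs = {xs. list_all2 (\<lambda>x V. x \<in> carrier V) xs Vs}"

definition tensor_relations ::
  "('k, 'z) ring_scheme \<Rightarrow> ('k, 'v, 'y) module_scheme list \<Rightarrow> ('v list \<Rightarrow> 'k) set" where
  "tensor_relations K Vs = (let F = free_module K (tuples Vs); e = free_gen K in
     {e (xs[i := x \<oplus>\<^bsub>Vs ! i\<^esub> y]) \<ominus>\<^bsub>F\<^esub> (e (xs[i := x]) \<oplus>\<^bsub>F\<^esub> e (xs[i := y])) | xs i x y.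
        xs \<in> tuples Vs \<and> i < length Vs \<and> x \<in> carrier (Vs ! i) \<and> y \<in> carrier (Vs ! i)} \<union>
     {e (xs[i := c \<odot>\<^bsub>Vs ! i\<^esub> x]) \<ominus>\<^bsub>F\<^esub> (c \<odot>\<^bsub>F\<^esub> e (xs[i := x])) | xs i c x.
        xs \<in> tuples Vs \<and> i < length Vs \<and> c \<in> carrier K \<and> x \<in> carrier (Vs ! i)})"

text \<open>The tensor product of \<open>[V\<^sub>1, \<dots>, V\<^sub>n]\<close>. For the empty list it is free on the single
  generator \<open>pure_tensor K [] []\<close>, which stands for \<open>1 \<in> K\<close>.\<close>

definition tensor ::
  "('k, 'z) ring_scheme \<Rightarrow> ('k, 'v, 'y) module_scheme list
    \<Rightarrow> ('k, ('v list \<Rightarrow> 'k) set) module" where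
  "tensor K Vs = (let F = free_module K (tuples Vs) in
     quotient_module F (module_span K F (tensor_relations K Vs)))"

definition pure_tensor ::
  "('k, 'z) ring_scheme \<Rightarrow> ('k, 'v, 'y) module_scheme list \<Rightarrow> 'v list
    \<Rightarrow> ('v list \<Rightarrow> 'k) set" where
  "pure_tensor K Vs xs = (let F = free_module K (tuples Vs) in
     module_span K F (tensor_relations K Vs) +>\<^bsub>F\<^esub> free_gen K xs)"

text \<open>The linear map out of the tensor product determined by its values \<open>\<phi>\<close> on pure tensors.
  Only the values of \<open>\<phi>\<close> on \<open>tuples Vs\<close> matter; \<open>\<phi>\<close> has to be multilinear there.\<close>

definition tensor_lift ::
  "('k, 'z) ring_scheme \<Rightarrow> ('k, 'v, 'y) module_scheme list \<Rightarrow> ('k, 'w, 'x) module_scheme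
    \<Rightarrow> ('v list \<Rightarrow> 'w) \<Rightarrow> ('v list \<Rightarrow> 'k) set \<Rightarrow> 'w" where
  "tensor_lift K Vs W \<phi> = (THE f. f \<in> carrier (hom_module K (tensor K Vs) W) \<and>
     (\<forall>xs\<in>tuples Vs. f (pure_tensor K Vs xs) = \<phi> xs))"


section \<open>Hopf algebras\<close>

record ('k, 'h) hopf = "('k, 'h) module" +
  comult :: "'h \<Rightarrow> ('h list \<Rightarrow> 'k) set"
  counit :: "'h \<Rightarrow> 'k"
  antipode :: "'h \<Rightarrow> 'h"

abbreviation hpow ::
  "('k, 'z) ring_scheme \<Rightarrow> ('k, 'h, 'y) hopf_scheme \<Rightarrow> nat
    \<Rightarrow> ('k, ('h list \<Rightarrow> 'k) set) module" where
  "hpow K H n \<equiv> tensor K (replicate n H)"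

abbreviation hpure ::
  "('k, 'z) ring_scheme \<Rightarrow> ('k, 'h, 'y) hopf_scheme \<Rightarrow> 'h list \<Rightarrow> ('h list \<Rightarrow> 'k) set" where
  "hpure K H hs \<equiv> pure_tensor K (replicate (length hs) H) hs"

text \<open>\<open>sweedler K H W \<phi> h\<close> is \<open>\<phi>(h\<^sub>1, h\<^sub>2)\<close> in Sweedler notation, for bilinear \<open>\<phi>\<close> with
  values in \<open>W\<close>.\<close>

definition sweedler ::
  "('k, 'z) ring_scheme \<Rightarrow> ('k, 'h, 'y) hopf_scheme \<Rightarrow> ('k, 'w, 'x) module_scheme
    \<Rightarrow> ('h \<Rightarrow> 'h \<Rightarrow> 'w) \<Rightarrow> 'h \<Rightarrow> 'w" where
  "sweedler K H W \<phi> h =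
     tensor_lift K (replicate 2 H) W (\<lambda>xs. \<phi> (xs ! 0) (xs ! 1)) (comult H h)"

text \<open>The factorwise product of the algebra \<open>H\<^sup>\<otimes>\<^sup>n\<close>.\<close>

definition hpow_mult ::
  "('k, 'z) ring_scheme \<Rightarrow> ('k, 'h, 'y) hopf_scheme \<Rightarrow> nat
    \<Rightarrow> ('h list \<Rightarrow> 'k) set \<Rightarrow> ('h list \<Rightarrow> 'k) set \<Rightarrow> ('h list \<Rightarrow> 'k) set" where
  "hpow_mult K H n u v =
     tensor_lift K (replicate n H) (hpow K H n)
       (\<lambda>xs. tensor_lift K (replicate n H) (hpow K H n)
          (\<lambda>ys. hpure K H (map2 (mult H) xs ys)) v) u"

text \<open>\<open>id \<otimes> \<dots> \<otimes> \<Delta> \<otimes> \<dots> \<otimes> id : H\<^sup>\<otimes>\<^sup>n \<rightarrow> H\<^sup>\<otimes>\<^sup>n\<^sup>+\<^sup>1\<close>, with \<open>\<Delta>\<close> in position \<open>i\<close>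
  (counting from 0).\<close>

definition comult_at ::
  "('k, 'z) ring_scheme \<Rightarrow> ('k, 'h, 'y) hopf_scheme \<Rightarrow> nat \<Rightarrow> nat
    \<Rightarrow> ('h list \<Rightarrow> 'k) set \<Rightarrow> ('h list \<Rightarrow> 'k) set" where
  "comult_at K H n i = tensor_lift K (replicate n H) (hpow K H (Suc n))
     (\<lambda>xs. sweedler K H (hpow K H (Suc n))
        (\<lambda>a b. hpure K H (take i xs @ [a, b] @ drop (Suc i) xs)) (xs ! i))"

text \<open>\<open>h\<^sub>1 \<otimes> \<dots> \<otimes> h\<^sub>n\<close>, and the diagonal left action of \<open>H\<close> on \<open>H\<^sup>\<otimes>\<^sup>n\<close> it defines.\<close>

fun iter_comult ::
  "('k, 'z) ring_scheme \<Rightarrow> ('k, 'h, 'y) hopf_scheme \<Rightarrow> nat \<Rightarrow> 'h \<Rightarrow> ('h list \<Rightarrow> 'k) set" where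
  "iter_comult K H 0 h = counit H h \<odot>\<^bsub>hpow K H 0\<^esub> hpure K H []"
| "iter_comult K H (Suc 0) h = hpure K H [h]"
| "iter_comult K H (Suc (Suc n)) h = comult_at K H (Suc n) 0 (iter_comult K H (Suc n) h)"

definition diag_act ::
  "('k, 'z) ring_scheme \<Rightarrow> ('k, 'h, 'y) hopf_scheme \<Rightarrow> nat \<Rightarrow> 'h
    \<Rightarrow> ('h list \<Rightarrow> 'k) set \<Rightarrow> ('h list \<Rightarrow> 'k) set" where
  "diag_act K H n h u = hpow_mult K H n (iter_comult K H n h) u"

locale hopf_algebra = module K H + ring H
  for K :: "('k, 'z) ring_scheme" and H :: "('k, 'h, 'y) hopf_scheme" +
  assumes smult_mult_left: "\<lbrakk>c \<in> carrier K; x \<in> carrier H; y \<in> carrier H\<rbrakk>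
      \<Longrightarrow> (c \<odot>\<^bsub>H\<^esub> x) \<otimes>\<^bsub>H\<^esub> y = c \<odot>\<^bsub>H\<^esub> (x \<otimes>\<^bsub>H\<^esub> y)"
    and smult_mult_right: "\<lbrakk>c \<in> carrier K; x \<in> carrier H; y \<in> carrier H\<rbrakk>
      \<Longrightarrow> x \<otimes>\<^bsub>H\<^esub> (c \<odot>\<^bsub>H\<^esub> y) = c \<odot>\<^bsub>H\<^esub> (x \<otimes>\<^bsub>H\<^esub> y)"
    and comult_linear: "linear_map K H (hpow K H 2) (comult H)"
    and comult_mult: "\<lbrakk>x \<in> carrier H; y \<in> carrier H\<rbrakk>
      \<Longrightarrow> comult H (x \<otimes>\<^bsub>H\<^esub> y) = hpow_mult K H 2 (comult H x) (comult H y)"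
    and comult_one: "comult H \<one>\<^bsub>H\<^esub> = hpure K H [\<one>\<^bsub>H\<^esub>, \<one>\<^bsub>H\<^esub>]"
    and coassoc: "h \<in> carrier H
      \<Longrightarrow> comult_at K H 2 0 (comult H h) = comult_at K H 2 1 (comult H h)"
    and counit_linear: "linear_map K H (self_module K) (counit H)"
    and counit_ring_hom: "counit H \<in> ring_hom H K"
    and counit_left: "h \<in> carrier H \<Longrightarrow> sweedler K H H (\<lambda>a b. counit H a \<odot>\<^bsub>H\<^esub> b) h = h"
    and counit_right: "h \<in> carrier H \<Longrightarrow> sweedler K H H (\<lambda>a b. counit H b \<odot>\<^bsub>H\<^esub> a) h = h"
    and antipode_linear: "linear_map K H H (antipode H)"
    and antipode_left: "h \<in> carrier H
      \<Longrightarrow> sweedler K H H (\<lambda>a b. antipode H a \<otimes>\<^bsub>H\<^esub> b) h = counit H h \<odot>\<^bsub>H\<^esub> \<one>\<^bsub>H\<^esub>"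
    and antipode_right: "h \<in> carrier H
      \<Longrightarrow> sweedler K H H (\<lambda>a b. a \<otimes>\<^bsub>H\<^esub> antipode H b) h = counit H h \<odot>\<^bsub>H\<^esub> \<one>\<^bsub>H\<^esub>"
    and antipode_bij: "bij_betw (antipode H) (carrier H) (carrier H)"

definition twisted_antipode ::
  "('k, 'z) ring_scheme \<Rightarrow> ('k, 'h, 'y) hopf_scheme \<Rightarrow> ('h \<Rightarrow> 'k) \<Rightarrow> 'h \<Rightarrow> 'h" where
  "twisted_antipode K H \<delta> = sweedler K H H (\<lambda>a b. \<delta> a \<odot>\<^bsub>H\<^esub> antipode H b)"

definition group_like ::
  "('k, 'z) ring_scheme \<Rightarrow> ('k, 'h, 'y) hopf_scheme \<Rightarrow> 'h \<Rightarrow> bool" where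
  "group_like K H \<sigma> \<longleftrightarrow>
     \<sigma> \<in> carrier H \<and> comult H \<sigma> = hpure K H [\<sigma>, \<sigma>] \<and> counit H \<sigma> = \<one>\<^bsub>K\<^esub>"

definition hopf_character ::
  "('k, 'z) ring_scheme \<Rightarrow> ('k, 'h, 'y) hopf_scheme \<Rightarrow> ('h \<Rightarrow> 'k) \<Rightarrow> bool" where
  "hopf_character K H \<delta> \<longleftrightarrow> linear_map K H (self_module K) \<delta> \<and> \<delta> \<in> ring_hom H K"

definition modular_pair_in_involution ::
  "('k, 'z) ring_scheme \<Rightarrow> ('k, 'h, 'y) hopf_scheme \<Rightarrow> ('h \<Rightarrow> 'k) \<Rightarrow> 'h \<Rightarrow> bool" where
  "modular_pair_in_involution K H \<delta> \<sigma> \<longleftrightarrow>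
     hopf_character K H \<delta> \<and> group_like K H \<sigma> \<and> \<delta> \<sigma> = \<one>\<^bsub>K\<^esub> \<and>
     (\<forall>h\<in>carrier H. twisted_antipode K H \<delta> (twisted_antipode K H \<delta> h)
        = \<sigma> \<otimes>\<^bsub>H\<^esub> h \<otimes>\<^bsub>H\<^esub> inv\<^bsub>H\<^esub> \<sigma>)"


section \<open>Cocyclic modules and cyclic cohomology\<close>

text \<open>\<open>coface C n i : C\<^sup>n \<rightarrow> C\<^sup>n\<^sup>+\<^sup>1\<close> for \<open>i \<le> n + 1\<close>, \<open>codegen C n i : C\<^sup>n\<^sup>+\<^sup>1 \<rightarrow> C\<^sup>n\<close> for
  \<open>i \<le> n\<close>, and \<open>cocyc C n : C\<^sup>n \<rightarrow> C\<^sup>n\<close>.\<close>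

record ('k, 'v) cocyclic =
  cospace :: "nat \<Rightarrow> ('k, 'v) module"
  coface :: "nat \<Rightarrow> nat \<Rightarrow> 'v \<Rightarrow> 'v"
  codegen :: "nat \<Rightarrow> nat \<Rightarrow> 'v \<Rightarrow> 'v"
  cocyc :: "nat \<Rightarrow> 'v \<Rightarrow> 'v"

locale cocyclic_module =
  fixes K :: "('k, 'z) ring_scheme" and C :: "('k, 'v) cocyclic"
  assumes cospace_module: "module K (cospace C n)"
    and coface_linear: "i \<le> Suc n
      \<Longrightarrow> linear_map K (cospace C n) (cospace C (Suc n)) (coface C n i)"
    and codegen_linear: "i \<le> n
      \<Longrightarrow> linear_map K (cospace C (Suc n)) (cospace C n) (codegen C n i)"
    and cocyc_linear: "linear_map K (cospace C n) (cospace C n) (cocyc C n)"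
    and coface_coface: "\<lbrakk>i < j; j \<le> Suc (Suc n); x \<in> carrier (cospace C n)\<rbrakk>
      \<Longrightarrow> coface C (Suc n) j (coface C n i x) = coface C (Suc n) i (coface C n (j - 1) x)"
    and codegen_codegen: "\<lbrakk>i \<le> j; j \<le> n; x \<in> carrier (cospace C (Suc (Suc n)))\<rbrakk>
      \<Longrightarrow> codegen C n j (codegen C (Suc n) i x) = codegen C n i (codegen C (Suc n) (Suc j) x)"
    and codegen_coface_less: "\<lbrakk>i \<le> j; j \<le> n; x \<in> carrier (cospace C (Suc n))\<rbrakk>
      \<Longrightarrow> codegen C (Suc n) (Suc j) (coface C (Suc n) i x) = coface C n i (codegen C n j x)"
    and codegen_coface_same: "\<lbrakk>j \<le> n; i = j \<or> i = Suc j; x \<in> carrier (cospace C n)\<rbrakk>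
      \<Longrightarrow> codegen C n j (coface C n i x) = x"
    and codegen_coface_greater:
      "\<lbrakk>Suc j < i; i \<le> Suc (Suc n); x \<in> carrier (cospace C (Suc n))\<rbrakk>
      \<Longrightarrow> codegen C (Suc n) j (coface C (Suc n) i x) = coface C n (i - 1) (codegen C n j x)"
    and cocyc_coface: "\<lbrakk>1 \<le> i; i \<le> Suc n; x \<in> carrier (cospace C n)\<rbrakk>
      \<Longrightarrow> cocyc C (Suc n) (coface C n i x) = coface C n (i - 1) (cocyc C n x)"
    and cocyc_coface_0: "x \<in> carrier (cospace C n)
      \<Longrightarrow> cocyc C (Suc n) (coface C n 0 x) = coface C n (Suc n) x"
    and cocyc_codegen: "\<lbrakk>1 \<le> i; i \<le> n; x \<in> carrier (cospace C (Suc n))\<rbrakk>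
      \<Longrightarrow> cocyc C n (codegen C n i x) = codegen C n (i - 1) (cocyc C (Suc n) x)"
    and cocyc_codegen_0: "x \<in> carrier (cospace C (Suc n))
      \<Longrightarrow> cocyc C n (codegen C n 0 x) = codegen C n n (cocyc C (Suc n) (cocyc C (Suc n) x))"
    and cocyc_power: "x \<in> carrier (cospace C n) \<Longrightarrow> (cocyc C n ^^ Suc n) x = x"

locale cocyclic_morphism = C: cocyclic_module K C + D: cocyclic_module K D
  for K :: "('k, 'z) ring_scheme" and C :: "('k, 'v) cocyclic" and D :: "('k, 'w) cocyclic" +
  fixes \<gamma> :: "nat \<Rightarrow> 'v \<Rightarrow> 'w"
  assumes linear: "linear_map K (cospace C n) (cospace D n) (\<gamma> n)"
    and commutes_coface: "\<lbrakk>i \<le> Suc n; x \<in> carrier (cospace C n)\<rbrakk>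
      \<Longrightarrow> \<gamma> (Suc n) (coface C n i x) = coface D n i (\<gamma> n x)"
    and commutes_codegen: "\<lbrakk>i \<le> n; x \<in> carrier (cospace C (Suc n))\<rbrakk>
      \<Longrightarrow> \<gamma> n (codegen C n i x) = codegen D n i (\<gamma> (Suc n) x)"
    and commutes_cocyc: "x \<in> carrier (cospace C n)
      \<Longrightarrow> \<gamma> n (cocyc C n x) = cocyc D n (\<gamma> n x)"

text \<open>Cyclic cohomology in characteristic zero, via Connes' complex
  \<open>C\<^sub>\<lambda>\<^sup>n = Ker (1 - (-1)\<^sup>n \<tau>\<^sub>n)\<close> with differential \<open>b = \<Sum> (-1)\<^sup>i \<delta>\<^sub>i\<close>.\<close>

definition alt_sign :: "('k, 'z) ring_scheme \<Rightarrow> nat \<Rightarrow> 'k" where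
  "alt_sign K n = (\<ominus>\<^bsub>K\<^esub> \<one>\<^bsub>K\<^esub>) [^]\<^bsub>K\<^esub> n"

definition hochschild_b ::
  "('k, 'z) ring_scheme \<Rightarrow> ('k, 'v) cocyclic \<Rightarrow> nat \<Rightarrow> 'v \<Rightarrow> 'v" where
  "hochschild_b K C n x =
     (\<Oplus>\<^bsub>cospace C (Suc n)\<^esub> i\<in>{..Suc n}. alt_sign K i \<odot>\<^bsub>cospace C (Suc n)\<^esub> coface C n i x)"

definition cyclic_cochains ::
  "('k, 'z) ring_scheme \<Rightarrow> ('k, 'v) cocyclic \<Rightarrow> nat \<Rightarrow> 'v set" where
  "cyclic_cochains K C n = {x \<in> carrier (cospace C n).
     x \<ominus>\<^bsub>cospace C n\<^esub> (alt_sign K n \<odot>\<^bsub>cospace C n\<^esub> cocyc C n x) = \<zero>\<^bsub>cospace C n\<^esub>}"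

definition cyclic_cocycles ::
  "('k, 'z) ring_scheme \<Rightarrow> ('k, 'v) cocyclic \<Rightarrow> nat \<Rightarrow> 'v set" where
  "cyclic_cocycles K C n =
     {x \<in> cyclic_cochains K C n. hochschild_b K C n x = \<zero>\<^bsub>cospace C (Suc n)\<^esub>}"

fun cyclic_coboundaries ::
  "('k, 'z) ring_scheme \<Rightarrow> ('k, 'v) cocyclic \<Rightarrow> nat \<Rightarrow> 'v set" where
  "cyclic_coboundaries K C 0 = {\<zero>\<^bsub>cospace C 0\<^esub>}"
| "cyclic_coboundaries K C (Suc n) = hochschild_b K C n ` cyclic_cochains K C n"

definition cyclic_cohomology ::
  "('k, 'z) ring_scheme \<Rightarrow> ('k, 'v) cocyclic \<Rightarrow> nat \<Rightarrow> ('k, 'v set) module" where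
  "cyclic_cohomology K C n =
     quotient_module ((cospace C n)\<lparr>carrier := cyclic_cocycles K C n\<rparr>)
       (cyclic_coboundaries K C n)"

definition cyclic_class ::
  "('k, 'z) ring_scheme \<Rightarrow> ('k, 'v) cocyclic \<Rightarrow> nat \<Rightarrow> 'v \<Rightarrow> 'v set" where
  "cyclic_class K C n x = cyclic_coboundaries K C n +>\<^bsub>cospace C n\<^esub> x"


section \<open>The cocyclic module of a Hopf algebra\<close>

definition hopf_coface ::
  "('k, 'z) ring_scheme \<Rightarrow> ('k, 'h, 'y) hopf_scheme \<Rightarrow> 'h \<Rightarrow> nat \<Rightarrow> nat
    \<Rightarrow> ('h list \<Rightarrow> 'k) set \<Rightarrow> ('h list \<Rightarrow> 'k) set" where
  "hopf_coface K H \<sigma> n i =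
     (if i = 0 then
        tensor_lift K (replicate n H) (hpow K H (Suc n)) (\<lambda>hs. hpure K H (\<one>\<^bsub>H\<^esub> # hs))
      else if i = Suc n then
        tensor_lift K (replicate n H) (hpow K H (Suc n)) (\<lambda>hs. hpure K H (hs @ [\<sigma>]))
      else comult_at K H n (i - 1))"

definition hopf_codegen ::
  "('k, 'z) ring_scheme \<Rightarrow> ('k, 'h, 'y) hopf_scheme \<Rightarrow> nat \<Rightarrow> nat
    \<Rightarrow> ('h list \<Rightarrow> 'k) set \<Rightarrow> ('h list \<Rightarrow> 'k) set" where
  "hopf_codegen K H n i = tensor_lift K (replicate (Suc n) H) (hpow K H n)
     (\<lambda>hs. counit H (hs ! i) \<odot>\<^bsub>hpow K H n\<^esub> hpure K H (take i hs @ drop (Suc i) hs))"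

definition hopf_cocyc ::
  "('k, 'z) ring_scheme \<Rightarrow> ('k, 'h, 'y) hopf_scheme \<Rightarrow> ('h \<Rightarrow> 'k) \<Rightarrow> 'h \<Rightarrow> nat
    \<Rightarrow> ('h list \<Rightarrow> 'k) set \<Rightarrow> ('h list \<Rightarrow> 'k) set" where
  "hopf_cocyc K H \<delta> \<sigma> n =
     (if n = 0 then (\<lambda>u. u)
      else tensor_lift K (replicate n H) (hpow K H n)
        (\<lambda>hs. diag_act K H n (twisted_antipode K H \<delta> (hd hs)) (hpure K H (tl hs @ [\<sigma>]))))"

definition hopf_cocyclic ::
  "('k, 'z) ring_scheme \<Rightarrow> ('k, 'h, 'y) hopf_scheme \<Rightarrow> ('h \<Rightarrow> 'k) \<Rightarrow> 'h
    \<Rightarrow> ('k, ('h list \<Rightarrow> 'k) set) cocyclic" where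
  "hopf_cocyclic K H \<delta> \<sigma> = \<lparr>cospace = hpow K H, coface = hopf_coface K H \<sigma>,
     codegen = hopf_codegen K H, cocyc = hopf_cocyc K H \<delta> \<sigma>\<rparr>"


section \<open>Linear categories and \<open>H\<close>-categories\<close>

text \<open>\<open>Comp C X Y Z g f\<close> is the composite \<open>gf\<close> of \<open>f : X \<rightarrow> Y\<close> and \<open>g : Y \<rightarrow> Z\<close>. The
  objects occur as arguments because different hom-spaces may overlap as sets.\<close>

record ('k, 'o, 'm) lin_cat =
  Ob :: "'o set"
  Hom :: "'o \<Rightarrow> 'o \<Rightarrow> ('k, 'm) module"
  Comp :: "'o \<Rightarrow> 'o \<Rightarrow> 'o \<Rightarrow> 'm \<Rightarrow> 'm \<Rightarrow> 'm"
  Id :: "'o \<Rightarrow> 'm"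

locale linear_category =
  fixes K :: "('k, 'z) ring_scheme" and C :: "('k, 'o, 'm, 'x) lin_cat_scheme"
  assumes Hom_module: "\<lbrakk>X \<in> Ob C; Y \<in> Ob C\<rbrakk> \<Longrightarrow> module K (Hom C X Y)"
    and Id_closed: "X \<in> Ob C \<Longrightarrow> Id C X \<in> carrier (Hom C X X)"
    and Comp_linear_left:
      "\<lbrakk>X \<in> Ob C; Y \<in> Ob C; Z \<in> Ob C; f \<in> carrier (Hom C X Y)\<rbrakk>
        \<Longrightarrow> linear_map K (Hom C Y Z) (Hom C X Z) (\<lambda>g. Comp C X Y Z g f)"
    and Comp_linear_right:
      "\<lbrakk>X \<in> Ob C; Y \<in> Ob C; Z \<in> Ob C; g \<in> carrier (Hom C Y Z)\<rbrakk>
        \<Longrightarrow> linear_map K (Hom C X Y) (Hom C X Z) (Comp C X Y Z g)"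
    and Comp_assoc:
      "\<lbrakk>W \<in> Ob C; X \<in> Ob C; Y \<in> Ob C; Z \<in> Ob C; f \<in> carrier (Hom C W X);
        g \<in> carrier (Hom C X Y); h \<in> carrier (Hom C Y Z)\<rbrakk>
        \<Longrightarrow> Comp C W X Z (Comp C X Y Z h g) f = Comp C W Y Z h (Comp C W X Y g f)"
    and Id_left: "\<lbrakk>X \<in> Ob C; Y \<in> Ob C; f \<in> carrier (Hom C X Y)\<rbrakk>
        \<Longrightarrow> Comp C X Y Y (Id C Y) f = f"
    and Id_right: "\<lbrakk>X \<in> Ob C; Y \<in> Ob C; f \<in> carrier (Hom C X Y)\<rbrakk>
        \<Longrightarrow> Comp C X X Y f (Id C X) = f"

record ('k, 'h, 'o, 'm) hopf_cat = "('k, 'o, 'm) lin_cat" +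
  Act :: "'o \<Rightarrow> 'o \<Rightarrow> 'h \<Rightarrow> 'm \<Rightarrow> 'm"

locale left_hopf_module =
  fixes K :: "('k, 'z) ring_scheme" and H :: "('k, 'h, 'y) hopf_scheme"
    and M :: "('k, 'm, 'x) module_scheme" and act :: "'h \<Rightarrow> 'm \<Rightarrow> 'm"
  assumes act_linear_left: "x \<in> carrier M \<Longrightarrow> linear_map K H M (\<lambda>h. act h x)"
    and act_linear_right: "h \<in> carrier H \<Longrightarrow> linear_map K M M (act h)"
    and act_mult: "\<lbrakk>g \<in> carrier H; h \<in> carrier H; x \<in> carrier M\<rbrakk>
      \<Longrightarrow> act (g \<otimes>\<^bsub>H\<^esub> h) x = act g (act h x)"
    and act_one: "x \<in> carrier M \<Longrightarrow> act \<one>\<^bsub>H\<^esub> x = x"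

locale left_hopf_category = linear_category K D
  for K :: "('k, 'z) ring_scheme" and H :: "('k, 'h, 'y) hopf_scheme"
    and D :: "('k, 'h, 'o, 'm, 'x) hopf_cat_scheme" +
  assumes Act_module: "\<lbrakk>X \<in> Ob D; Y \<in> Ob D\<rbrakk>
      \<Longrightarrow> left_hopf_module K H (Hom D X Y) (Act D X Y)"
    and Act_Id: "\<lbrakk>X \<in> Ob D; h \<in> carrier H\<rbrakk>
      \<Longrightarrow> Act D X X h (Id D X) = counit H h \<odot>\<^bsub>Hom D X X\<^esub> Id D X"
    and Act_Comp:
      "\<lbrakk>X \<in> Ob D; Y \<in> Ob D; Z \<in> Ob D; h \<in> carrier H;
        f \<in> carrier (Hom D X Y); g \<in> carrier (Hom D Y Z)\<rbrakk>
      \<Longrightarrow> Act D X Z h (Comp D X Y Z g f)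
          = sweedler K H (Hom D X Z)
              (\<lambda>a b. Comp D X Y Z (Act D Y Z a g) (Act D X Y b f)) h"

definition sigma_trace ::
  "('k, 'z) ring_scheme \<Rightarrow> ('k, 'h, 'o, 'm, 'x) hopf_cat_scheme \<Rightarrow> 'h
    \<Rightarrow> ('o \<Rightarrow> 'm \<Rightarrow> 'k) \<Rightarrow> bool" where
  "sigma_trace K D \<sigma> T \<longleftrightarrow>
     (\<forall>X\<in>Ob D. linear_map K (Hom D X X) (self_module K) (T X)) \<and>
     (\<forall>X\<in>Ob D. \<forall>Y\<in>Ob D. \<forall>f\<in>carrier (Hom D X Y). \<forall>g\<in>carrier (Hom D Y X).
        T X (Comp D X Y X g f) = T Y (Comp D Y X Y f (Act D Y X \<sigma> g)))"

definition delta_invariant ::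
  "('k, 'z) ring_scheme \<Rightarrow> ('k, 'h, 'y) hopf_scheme \<Rightarrow> ('k, 'h, 'o, 'm, 'x) hopf_cat_scheme
    \<Rightarrow> ('h \<Rightarrow> 'k) \<Rightarrow> ('o \<Rightarrow> 'm \<Rightarrow> 'k) \<Rightarrow> bool" where
  "delta_invariant K H D \<delta> T \<longleftrightarrow>
     (\<forall>X\<in>Ob D. \<forall>h\<in>carrier H. \<forall>f\<in>carrier (Hom D X X).
        T X (Act D X X h f) = \<delta> h \<otimes>\<^bsub>K\<^esub> T X f)"


section \<open>The cyclic nerve of a linear category and its dual\<close>

text \<open>A tuple \<open>(X\<^sub>0, \<dots>, X\<^sub>n)\<close> of objects is a list of length \<open>n + 1\<close> with cyclic indexing
  \<open>X\<^sub>n\<^sub>+\<^sub>1 = X\<^sub>0\<close>; the \<open>i\<close>-th tensor factor is \<open>Hom(X\<^sub>i\<^sub>+\<^sub>1, X\<^sub>i)\<close>.\<close>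

definition ob_tuples :: "('k, 'o, 'm, 'x) lin_cat_scheme \<Rightarrow> nat \<Rightarrow> 'o list set" where
  "ob_tuples C n = {Xs. length Xs = Suc n \<and> set Xs \<subseteq> Ob C}"

definition cnth :: "'o list \<Rightarrow> nat \<Rightarrow> 'o" where
  "cnth Xs i = Xs ! (i mod length Xs)"

definition cyc_homs ::
  "('k, 'o, 'm, 'x) lin_cat_scheme \<Rightarrow> 'o list \<Rightarrow> ('k, 'm) module list" where
  "cyc_homs C Xs = map (\<lambda>i. Hom C (cnth Xs (Suc i)) (cnth Xs i)) [0..<length Xs]"

definition nerve ::
  "('k, 'z) ring_scheme \<Rightarrow> ('k, 'o, 'm, 'x) lin_cat_scheme \<Rightarrow> nat
    \<Rightarrow> ('k, 'o list \<Rightarrow> ('m list \<Rightarrow> 'k) set) module" where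
  "nerve K C n = direct_sum (ob_tuples C n) (\<lambda>Xs. tensor K (cyc_homs C Xs))"

text \<open>The element \<open>f\<^sup>0 \<otimes> \<dots> \<otimes> f\<^sup>n\<close> of the summand indexed by \<open>Xs\<close>.\<close>

definition nerve_pure ::
  "('k, 'z) ring_scheme \<Rightarrow> ('k, 'o, 'm, 'x) lin_cat_scheme \<Rightarrow> 'o list \<Rightarrow> 'm list
    \<Rightarrow> 'o list \<Rightarrow> ('m list \<Rightarrow> 'k) set" where
  "nerve_pure K C Xs fs =
     direct_sum_inj (ob_tuples C (length Xs - 1)) (\<lambda>Ys. tensor K (cyc_homs C Ys)) Xs
       (pure_tensor K (cyc_homs C Xs) fs)"

text \<open>The linear map on the nerve with given values, multilinear in the morphisms, on the
  elements \<open>nerve_pure K C Xs fs\<close>.\<close>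

definition nerve_lift ::
  "('k, 'z) ring_scheme \<Rightarrow> ('k, 'o, 'm, 'x) lin_cat_scheme \<Rightarrow> nat
    \<Rightarrow> ('k, 'w, 'y) module_scheme \<Rightarrow> ('o list \<Rightarrow> 'm list \<Rightarrow> 'w)
    \<Rightarrow> ('o list \<Rightarrow> ('m list \<Rightarrow> 'k) set) \<Rightarrow> 'w" where
  "nerve_lift K C n W \<phi> = (THE F. F \<in> carrier (hom_module K (nerve K C n) W) \<and>
     (\<forall>Xs\<in>ob_tuples C n. \<forall>fs\<in>tuples (cyc_homs C Xs). F (nerve_pure K C Xs fs) = \<phi> Xs fs))"

text \<open>\<open>nerve_face K C n i\<close> is \<open>d\<^sub>i : CN\<^sub>n\<^sub>+\<^sub>1 \<rightarrow> CN\<^sub>n\<close> for \<open>i \<le> n + 1\<close>, and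
  \<open>nerve_degen K C n i\<close> is \<open>s\<^sub>i : CN\<^sub>n \<rightarrow> CN\<^sub>n\<^sub>+\<^sub>1\<close> for \<open>i \<le> n\<close>.\<close>

definition nerve_face ::
  "('k, 'z) ring_scheme \<Rightarrow> ('k, 'o, 'm, 'x) lin_cat_scheme \<Rightarrow> nat \<Rightarrow> nat
    \<Rightarrow> ('o list \<Rightarrow> ('m list \<Rightarrow> 'k) set) \<Rightarrow> 'o list \<Rightarrow> ('m list \<Rightarrow> 'k) set" where
  "nerve_face K C n i = nerve_lift K C (Suc n) (nerve K C n) (\<lambda>Xs fs.
     if i \<le> n then
       nerve_pure K C (take (Suc i) Xs @ drop (i + 2) Xs)
         (take i fs
          @ [Comp C (cnth Xs (i + 2)) (cnth Xs (i + 1)) (cnth Xs i) (fs ! i) (fs ! (i + 1))]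
          @ drop (i + 2) fs)
     else
       nerve_pure K C (last Xs # tl (butlast Xs))
         (Comp C (cnth Xs 1) (cnth Xs 0) (last Xs) (last fs) (hd fs) # tl (butlast fs)))"

definition nerve_degen ::
  "('k, 'z) ring_scheme \<Rightarrow> ('k, 'o, 'm, 'x) lin_cat_scheme \<Rightarrow> nat \<Rightarrow> nat
    \<Rightarrow> ('o list \<Rightarrow> ('m list \<Rightarrow> 'k) set) \<Rightarrow> 'o list \<Rightarrow> ('m list \<Rightarrow> 'k) set" where
  "nerve_degen K C n i = nerve_lift K C n (nerve K C (Suc n)) (\<lambda>Xs fs.
     nerve_pure K C (take (Suc i) Xs @ [cnth Xs (Suc i)] @ drop (Suc i) Xs)
       (take (Suc i) fs @ [Id C (cnth Xs (Suc i))] @ drop (Suc i) fs))"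

definition nerve_cyc ::
  "('k, 'z) ring_scheme \<Rightarrow> ('k, 'o, 'm, 'x) lin_cat_scheme \<Rightarrow> nat
    \<Rightarrow> ('o list \<Rightarrow> ('m list \<Rightarrow> 'k) set) \<Rightarrow> 'o list \<Rightarrow> ('m list \<Rightarrow> 'k) set" where
  "nerve_cyc K C n = nerve_lift K C n (nerve K C n) (\<lambda>Xs fs.
     nerve_pure K C (last Xs # butlast Xs) (last fs # butlast fs))"

definition nerve_cocyclic ::
  "('k, 'z) ring_scheme \<Rightarrow> ('k, 'o, 'm, 'x) lin_cat_scheme
    \<Rightarrow> ('k, ('o list \<Rightarrow> ('m list \<Rightarrow> 'k) set) \<Rightarrow> 'k) cocyclic" where
  "nerve_cocyclic K C = \<lparr>
     cospace = (\<lambda>n. dual_module K (nerve K C n)),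
     coface = (\<lambda>n i \<phi>. \<lambda>x\<in>carrier (nerve K C (Suc n)). \<phi> (nerve_face K C n i x)),
     codegen = (\<lambda>n i \<phi>. \<lambda>x\<in>carrier (nerve K C n). \<phi> (nerve_degen K C n i x)),
     cocyc = (\<lambda>n \<phi>. \<lambda>x\<in>carrier (nerve K C n). \<phi> (nerve_cyc K C n x))\<rparr>"


section \<open>The characteristic map\<close>

text \<open>\<open>twisted_product D Xs hs fs j\<close> is the morphism
  \<open>f\<^sup>0 (h\<^sup>1 f\<^sup>1) \<dots> (h\<^sup>j f\<^sup>j) : X\<^sub>j\<^sub>+\<^sub>1 \<rightarrow> X\<^sub>0\<close>, where \<open>hs = [h\<^sup>1, \<dots>, h\<^sup>n]\<close> and
  \<open>fs = [f\<^sup>0, \<dots>, f\<^sup>n]\<close>.\<close>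

fun twisted_product ::
  "('k, 'h, 'o, 'm, 'x) hopf_cat_scheme \<Rightarrow> 'o list \<Rightarrow> 'h list \<Rightarrow> 'm list \<Rightarrow> nat \<Rightarrow> 'm" where
  "twisted_product D Xs hs fs 0 = fs ! 0"
| "twisted_product D Xs hs fs (Suc j) =
     Comp D (cnth Xs (j + 2)) (cnth Xs (j + 1)) (cnth Xs 0)
       (twisted_product D Xs hs fs j)
       (Act D (cnth Xs (j + 2)) (cnth Xs (j + 1)) (hs ! j) (fs ! (j + 1)))"

definition hopf_gamma ::
  "('k, 'z) ring_scheme \<Rightarrow> ('k, 'h, 'y) hopf_scheme \<Rightarrow> ('k, 'h, 'o, 'm, 'x) hopf_cat_scheme
    \<Rightarrow> ('o \<Rightarrow> 'm \<Rightarrow> 'k) \<Rightarrow> nat \<Rightarrow> ('h list \<Rightarrow> 'k) set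
    \<Rightarrow> ('o list \<Rightarrow> ('m list \<Rightarrow> 'k) set) \<Rightarrow> 'k" where
  "hopf_gamma K H D T n =
     tensor_lift K (replicate n H) (dual_module K (nerve K D n))
       (\<lambda>hs. nerve_lift K D n (self_module K)
          (\<lambda>Xs fs. T (Xs ! 0) (twisted_product D Xs hs fs n)))"

end

theory Submission
  imports Defs
begin

text \<open>A closed string of composable morphisms can be split anywhere, so on pure tensors the
  cocyclic identities of the nerve are identities of lists. On the Hopf side the only relation that needs the
  involution property is \<open>\<tau>\<^sub>n\<^sup>n\<^sup>+\<^sup>1 = id\<close>. For that relation, the map
  \<open>h\<^sup>0 \<otimes> u \<mapsto> S\<^sub>\<delta>(h\<^sup>0) \<cdot> u\<close> from \<open>H\<^sup>\<otimes>\<^sup>n\<^sup>+\<^sup>1\<close> onto \<open>H\<^sup>\<otimes>\<^sup>n\<close> intertwines the twisted rotation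
  \<open>h\<^sup>0 \<otimes> \<dots> \<otimes> h\<^sup>n \<mapsto> h\<^sup>1 \<otimes> \<dots> \<otimes> h\<^sup>n \<otimes> \<sigma>h\<^sup>0\<close> with \<open>\<tau>\<^sub>n\<close>, because \<open>S\<^sub>\<delta>\<close> is antimultiplicative and
  \<open>S\<^sub>\<delta>\<^sup>2(h)\<sigma> = \<sigma>h\<close>; the \<open>(n+1)\<close>st power of the rotation is multiplication by the group-like
  \<open>\<sigma>\<^sup>\<otimes>\<^sup>n\<^sup>+\<^sup>1\<close>, which the map sends to the action of \<open>S\<^sub>\<delta>(\<sigma>)\<sigma> = 1\<close>.

  Cofaces and codegeneracies are respected since \<open>h(gf) = (h\<^sub>1g)(h\<^sub>2f)\<close> and \<open>h(id) = \<epsilon>(h)id\<close>, the last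
  coface also by the \<open>\<sigma>\<close>-trace property. The cyclic operators are respected because
  \<open>\<delta>\<close>-invariance gives \<open>T(f \<cdot> S\<^sub>\<delta>(h)g) = T((hf) \<cdot> g)\<close>, after which the \<open>\<sigma>\<close>-trace property
  moves the last factor to the front.\<close>

section \<open>Linear maps\<close>

text \<open>\<open>tensor_lift\<close> and \<open>nerve_lift\<close> are definite descriptions, so
  no operator can be evaluated before existence and uniqueness of the lift are known. From then on
  an identity is proved by linearity of both sides and agreement on generators. The obstacle is the
  diagonal action: it turns a pure tensor into a sum that is not pure, so evaluation on lists of
  entries breaks down after one step. The Hopf half therefore works with concatenation
  \<open>cat\<close> of arbitrary tensors, with maps \<open>app\<close> at one position, and with
  Sweedler sums under which linear maps may be moved (\<open>sw_map\<close>). Two facts carry the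
  cyclic operators, \<open>act_Sd\<close> on tensors and \<open>trace_by_parts\<close> on morphisms.
  They are the same integration by parts: \<open>h\<^sub>2S(h\<^sub>3)\<close> is inserted next to
  the second factor, and what remains on the outside collapses to
  \<open>\<delta>(h\<^sub>1)\<close>, by
  \<open>S\<^sub>\<delta>(h\<^sub>1)h\<^sub>2 = \<delta>(h)1\<close> in the first case and by
  invariance of the trace in the second. In degree 0 the operator \<open>tau\<close> is the identity
  and there is no entry to rotate, so several arguments treat this degree separately.\<close>

lemma linear_mapI:
  assumes "\<And>x. x \<in> carrier V \<Longrightarrow> f x \<in> carrier W"
    and "\<And>x y. \<lbrakk>x \<in> carrier V; y \<in> carrier V\<rbrakk> \<Longrightarrow> f (x \<oplus>\<^bsub>V\<^esub> y) = f x \<oplus>\<^bsub>W\<^esub> f y"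
    and "\<And>c x. \<lbrakk>c \<in> carrier K; x \<in> carrier V\<rbrakk> \<Longrightarrow> f (c \<odot>\<^bsub>V\<^esub> x) = c \<odot>\<^bsub>W\<^esub> f x"
  shows "linear_map K V W f"
  using assms unfolding linear_map_def by blast

lemma linear_map_closed: "\<lbrakk>linear_map K V W f; x \<in> carrier V\<rbrakk> \<Longrightarrow> f x \<in> carrier W"
  unfolding linear_map_def by blast

lemma linear_map_add:
  "\<lbrakk>linear_map K V W f; x \<in> carrier V; y \<in> carrier V\<rbrakk> \<Longrightarrow> f (x \<oplus>\<^bsub>V\<^esub> y) = f x \<oplus>\<^bsub>W\<^esub> f y"
  unfolding linear_map_def by blast

lemma linear_map_smult:
  "\<lbrakk>linear_map K V W f; c \<in> carrier K; x \<in> carrier V\<rbrakk> \<Longrightarrow> f (c \<odot>\<^bsub>V\<^esub> x) = c \<odot>\<^bsub>W\<^esub> f x"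
  unfolding linear_map_def by blast

text \<open>\<open>f\<close> and \<open>g\<close> are only known to agree on the carrier;
  \<open>V\<close> being a module keeps sums and multiples of arguments inside it.\<close>

lemma linear_map_cong:
  assumes "module K V" and "\<And>x. x \<in> carrier V \<Longrightarrow> f x = g x"
  shows "linear_map K V W f \<longleftrightarrow> linear_map K V W g"
proof -
  interpret V: module K V by fact
  show ?thesis unfolding linear_map_def by (auto simp: assms(2) Pi_iff)
qed

lemma linear_map_zero:
  assumes "module K V" "module K W" "linear_map K V W f"
  shows "f \<zero>\<^bsub>V\<^esub> = \<zero>\<^bsub>W\<^esub>"
proof -
  interpret V: module K V by fact
  interpret W: module K W by fact
  have "f (\<zero>\<^bsub>K\<^esub> \<odot>\<^bsub>V\<^esub> \<zero>\<^bsub>V\<^esub>) = \<zero>\<^bsub>K\<^esub> \<odot>\<^bsub>W\<^esub> f \<zero>\<^bsub>V\<^esub>"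
    by (rule linear_map_smult[OF assms(3)]) auto
  then show ?thesis using linear_map_closed[OF assms(3), of "\<zero>\<^bsub>V\<^esub>"] by simp
qed

lemma linear_map_a_inv:
  assumes "module K V" "module K W" "linear_map K V W f" "x \<in> carrier V"
  shows "f (\<ominus>\<^bsub>V\<^esub> x) = \<ominus>\<^bsub>W\<^esub> f x"
proof -
  interpret V: module K V by fact
  interpret W: module K W by fact
  have "f (\<ominus>\<^bsub>V\<^esub> x) \<oplus>\<^bsub>W\<^esub> f x = f (\<ominus>\<^bsub>V\<^esub> x \<oplus>\<^bsub>V\<^esub> x)"
    by (rule linear_map_add[OF assms(3), symmetric]) (use assms in auto)
  also have "\<dots> = \<zero>\<^bsub>W\<^esub>" using assms by (simp add: V.l_neg linear_map_zero)
  finally show ?thesis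
    using assms linear_map_closed[OF assms(3)] by (metis V.a_inv_closed W.minus_equality)
qed

lemma linear_map_minus:
  assumes "module K V" "module K W" "linear_map K V W f" "x \<in> carrier V" "y \<in> carrier V"
  shows "f (x \<ominus>\<^bsub>V\<^esub> y) = f x \<ominus>\<^bsub>W\<^esub> f y"
proof -
  interpret V: module K V by fact
  show ?thesis using assms
    by (simp add: a_minus_def linear_map_add[OF assms(3)] linear_map_a_inv[OF assms(1-3)])
qed

lemma linear_map_finsum:
  assumes "module K V" "module K W" "linear_map K V W f" "finite A" "g \<in> A \<rightarrow> carrier V"
  shows "f (\<Oplus>\<^bsub>V\<^esub> i\<in>A. g i) = (\<Oplus>\<^bsub>W\<^esub> i\<in>A. f (g i))"
proof -
  interpret V: module K V by fact
  interpret W: module K W by fact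
  show ?thesis using assms(4,5)
  proof (induction A rule: finite_induct)
    case empty
    then show ?case by (simp add: linear_map_zero[OF assms(1-3)])
  next
    case (insert i A)
    then have "g i \<in> carrier V" "g \<in> A \<rightarrow> carrier V" by auto
    moreover from this have "(\<lambda>i. f (g i)) \<in> A \<rightarrow> carrier W" "f (g i) \<in> carrier W"
      using linear_map_closed[OF assms(3)] by auto
    ultimately show ?case
      using insert by (simp add: linear_map_add[OF assms(3)])
  qed
qed

lemma linear_map_compose:
  assumes "linear_map K V W f" "linear_map K U V g"
  shows "linear_map K U W (\<lambda>x. f (g x))"
  using assms unfolding linear_map_def by (simp add: Pi_iff)

lemma linear_map_ident: "linear_map K V V (\<lambda>x. x)"
  unfolding linear_map_def by auto

lemma linear_map_zero_fun:
  assumes "module K W"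
  shows "linear_map K V W (\<lambda>x. \<zero>\<^bsub>W\<^esub>)"
proof -
  interpret W: module K W by fact
  show ?thesis by (rule linear_mapI) auto
qed

lemma linear_map_add_fun:
  assumes "module K W" "linear_map K V W f" "linear_map K V W g"
  shows "linear_map K V W (\<lambda>x. f x \<oplus>\<^bsub>W\<^esub> g x)"
proof -
  interpret W: module K W by fact
  show ?thesis
    by (rule linear_mapI) (use assms(2,3) in \<open>auto simp: linear_map_def Pi_iff W.add.m_ac W.smult_r_distr\<close>)
qed

lemma linear_map_smult_fun:
  assumes "module K W" "linear_map K V W f" "c \<in> carrier K"
  shows "linear_map K V W (\<lambda>x. c \<odot>\<^bsub>W\<^esub> f x)"
proof -
  interpret W: module K W by fact
  show ?thesis
    by (rule linear_mapI)
      (use assms(2,3) in \<open>auto simp: linear_map_def Pi_iff W.smult_r_distr W.smult_assoc1[symmetric] W.R.m_comm\<close>)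
qed

lemma self_module_simps [simp]:
  "carrier (self_module K) = carrier K" "zero (self_module K) = zero K"
  "add (self_module K) = add K" "smult (self_module K) = mult K"
  by (simp_all add: self_module_def)

lemma module_self_module:
  assumes "cring K"
  shows "module K (self_module K)"
proof -
  interpret cring K by fact
  show ?thesis
    by (rule moduleI[OF assms abelian_groupI])
      (auto simp: a_ac m_ac l_distr r_distr intro: l_neg bexI[where x="\<ominus>\<^bsub>K\<^esub> _"])
qed

lemma linear_map_smult_scalar:
  assumes "module K W" "linear_map K V (self_module K) g" "w \<in> carrier W"
  shows "linear_map K V W (\<lambda>x. g x \<odot>\<^bsub>W\<^esub> w)"
proof -
  interpret W: module K W by fact
  show ?thesis
    by (rule linear_mapI)
      (use assms(2,3) in \<open>auto simp: linear_map_def Pi_iff W.smult_l_distr W.smult_assoc1\<close>)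
qed

text \<open>The source of the extensionality principles for tensor products and nerves: the
  equalizer is a submodule, so agreement on generators is enough. With \<open>g\<close> the zero map
  it yields kernels.\<close>

lemma submodule_equalizer:
  assumes "module K V" "module K W" "linear_map K V W f" "linear_map K V W g"
  shows "submodule {x \<in> carrier V. f x = g x} K V"
proof -
  interpret V: module K V by fact
  interpret W: module K W by fact
  show ?thesis
    by (rule V.submoduleI)
      (use assms in \<open>auto simp: linear_map_zero linear_map_a_inv linear_map_add linear_map_smult\<close>)
qed

lemma finsum_in_submodule:
  assumes "module K V" "submodule W K V" "finite A" "g \<in> A \<rightarrow> W"
  shows "(\<Oplus>\<^bsub>V\<^esub> i\<in>A. g i) \<in> W"
proof -
  interpret V: module K V by fact
  note W = V.submoduleE[OF assms(2)]
  \<comment> \<open>A submodule is nonempty, and zero times any of its elements is the zero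
    vector.\<close>
  have z: "\<zero>\<^bsub>V\<^esub> \<in> W"
    using W by (metis V.R.zero_closed V.smult_l_null ex_in_conv subset_iff)
  show ?thesis using assms(3,4)
  proof (induction A rule: finite_induct)
    case (insert i A)
    then have "g i \<in> W" "g \<in> A \<rightarrow> W" by auto
    moreover from this have "g i \<in> carrier V" "g \<in> A \<rightarrow> carrier V" using W(1) by auto
    ultimately show ?case using insert W(5) by simp
  qed (simp add: z)
qed

lemma submodule_zero_closed:
  assumes "module K V" "submodule W K V"
  shows "\<zero>\<^bsub>V\<^esub> \<in> W"
  using finsum_in_submodule[OF assms, of "{}" undefined] assms(1)
  by (simp add: module.axioms(2) abelian_group.axioms(1) abelian_monoid.finsum_empty)

lemma module_span_submodule:
  assumes "module K V" "A \<subseteq> carrier V"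
  shows "submodule (module_span K V A) K V"
proof -
  interpret V: module K V by fact
  show ?thesis
  proof (rule V.submoduleI)
    show "module_span K V A \<subseteq> carrier V"
      unfolding module_span_def using V.carrier_is_submodule assms(2) by blast
  qed (auto simp: module_span_def intro: V.submoduleE submodule_zero_closed[OF assms(1)])
qed

lemma module_span_superset: "A \<subseteq> module_span K V A"
  unfolding module_span_def by blast

lemma module_span_minimal: "\<lbrakk>submodule W K V; A \<subseteq> W\<rbrakk> \<Longrightarrow> module_span K V A \<subseteq> W"
  unfolding module_span_def by blast


section \<open>Modules of linear maps\<close>

lemma hom_module_simps [simp]:
  "zero (hom_module K V W) = (\<lambda>x\<in>carrier V. \<zero>\<^bsub>W\<^esub>)"
  "add (hom_module K V W) = (\<lambda>f g. \<lambda>x\<in>carrier V. f x \<oplus>\<^bsub>W\<^esub> g x)"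
  "smult (hom_module K V W) = (\<lambda>c f. \<lambda>x\<in>carrier V. c \<odot>\<^bsub>W\<^esub> f x)"
  by (simp_all add: hom_module_def)

lemma hom_module_carrier:
  "f \<in> carrier (hom_module K V W) \<longleftrightarrow> f \<in> extensional (carrier V) \<and> linear_map K V W f"
  by (simp add: hom_module_def)

lemma restrict_in_hom_module:
  assumes "module K V" "linear_map K V W f"
  shows "restrict f (carrier V) \<in> carrier (hom_module K V W)"
  using assms by (simp add: hom_module_carrier linear_map_cong[of K V "restrict f (carrier V)" f])

text \<open>Members are extensional, so an equation between them need only be checked on the carrier
  of \<open>V\<close>. The characteristic map takes its values in such a module, the dual of the
  nerve.\<close>

lemma module_hom_module:
  assumes V: "module K V" and W: "module K W"
  shows "module K (hom_module K V W)"
proof -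
  interpret V: module K V by fact
  interpret W: module K W by fact
  have lin: "linear_map K V W f" if "f \<in> carrier (hom_module K V W)" for f
    using that by (simp add: hom_module_carrier)
  have cl: "f x \<in> carrier W" if "f \<in> carrier (hom_module K V W)" "x \<in> carrier V" for f x
    using linear_map_closed[OF lin[OF that(1)] that(2)] .
  have ext: "f = g" if "f \<in> carrier (hom_module K V W)" "g \<in> carrier (hom_module K V W)"
    "\<And>x. x \<in> carrier V \<Longrightarrow> f x = g x" for f g
    using that by (auto simp: hom_module_carrier intro: extensionalityI)
  have add: "f \<oplus>\<^bsub>hom_module K V W\<^esub> g \<in> carrier (hom_module K V W)"
    if "f \<in> carrier (hom_module K V W)" "g \<in> carrier (hom_module K V W)" for f g
    using restrict_in_hom_module[OF V linear_map_add_fun[OF W lin[OF that(1)] lin[OF that(2)]]] by simp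
  have zero: "\<zero>\<^bsub>hom_module K V W\<^esub> \<in> carrier (hom_module K V W)"
    using restrict_in_hom_module[OF V linear_map_zero_fun[OF W]] by simp
  have smult: "c \<odot>\<^bsub>hom_module K V W\<^esub> f \<in> carrier (hom_module K V W)"
    if "c \<in> carrier K" "f \<in> carrier (hom_module K V W)" for c f
    using restrict_in_hom_module[OF V linear_map_smult_fun[OF W lin[OF that(2)] that(1)]] by simp
  show ?thesis
  proof (rule moduleI[OF V.R.is_cring abelian_groupI])
    fix f assume f: "f \<in> carrier (hom_module K V W)"
    show "\<exists>g\<in>carrier (hom_module K V W). g \<oplus>\<^bsub>hom_module K V W\<^esub> f = \<zero>\<^bsub>hom_module K V W\<^esub>"
    proof (rule bexI)
      \<comment> \<open>The additive inverse is taken to be \<open>-1\<close> times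
        \<open>f\<close>, so closure under multiples suffices.\<close>
      show n: "(\<ominus>\<^bsub>K\<^esub> \<one>\<^bsub>K\<^esub>) \<odot>\<^bsub>hom_module K V W\<^esub> f \<in> carrier (hom_module K V W)"
        using f smult by auto
      show "((\<ominus>\<^bsub>K\<^esub> \<one>\<^bsub>K\<^esub>) \<odot>\<^bsub>hom_module K V W\<^esub> f) \<oplus>\<^bsub>hom_module K V W\<^esub> f = \<zero>\<^bsub>hom_module K V W\<^esub>"
        using f cl by (auto simp: restrict_def W.smult_l_minus W.l_neg)
    qed
  qed (use add zero smult cl in \<open>auto intro!: ext simp del: hom_module_simps,
      auto simp: W.a_ac W.smult_l_distr W.smult_r_distr W.smult_assoc1\<close>)
qed

text \<open>Evaluation at a fixed element turns the dual-valued \<open>hopf_gamma\<close> into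
  scalar-valued linear maps, to which the Sweedler rules apply.\<close>

lemma linear_map_eval:
  assumes "x \<in> carrier V"
  shows "linear_map K (hom_module K V W) W (\<lambda>f. f x)"
  using assms by (intro linear_mapI) (auto simp: hom_module_carrier linear_map_closed)


section \<open>Free modules, quotients and direct sums\<close>

lemma free_module_simps [simp]:
  "zero (free_module K A) = (\<lambda>x. \<zero>\<^bsub>K\<^esub>)"
  "add (free_module K A) = (\<lambda>f g x. f x \<oplus>\<^bsub>K\<^esub> g x)"
  "smult (free_module K A) = (\<lambda>c f x. c \<otimes>\<^bsub>K\<^esub> f x)"
  by (simp_all add: free_module_def)

lemma free_module_carrier:
  "f \<in> carrier (free_module K A) \<longleftrightarrow> (\<forall>x. f x \<in> carrier K) \<and>
    (\<forall>x. x \<notin> A \<longrightarrow> f x = \<zero>\<^bsub>K\<^esub>) \<and> finite {x. f x \<noteq> \<zero>\<^bsub>K\<^esub>}"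
  by (simp add: free_module_def)

lemma module_free_module:
  assumes "cring K"
  shows "module K (free_module K A)"
proof -
  interpret cring K by fact
  let ?F = "free_module K A"
  have add: "f \<oplus>\<^bsub>?F\<^esub> g \<in> carrier ?F" if "f \<in> carrier ?F" "g \<in> carrier ?F" for f g
  proof -
    have "{x. f x \<oplus>\<^bsub>K\<^esub> g x \<noteq> \<zero>\<^bsub>K\<^esub>} \<subseteq> {x. f x \<noteq> \<zero>\<^bsub>K\<^esub>} \<union> {x. g x \<noteq> \<zero>\<^bsub>K\<^esub>}"
      using that by (auto simp: free_module_carrier)
    then show ?thesis using that
      by (auto simp: free_module_carrier intro: finite_subset)
  qed
  have smult: "c \<odot>\<^bsub>?F\<^esub> f \<in> carrier ?F" if "c \<in> carrier K" "f \<in> carrier ?F" for c f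
  proof -
    have "{x. c \<otimes>\<^bsub>K\<^esub> f x \<noteq> \<zero>\<^bsub>K\<^esub>} \<subseteq> {x. f x \<noteq> \<zero>\<^bsub>K\<^esub>}"
      using that by auto
    then show ?thesis using that
      by (auto simp: free_module_carrier intro: finite_subset)
  qed
  show ?thesis
  proof (rule moduleI[OF assms abelian_groupI])
    fix f assume f: "f \<in> carrier ?F"
    show "\<exists>g\<in>carrier ?F. g \<oplus>\<^bsub>?F\<^esub> f = \<zero>\<^bsub>?F\<^esub>"
    proof (rule bexI)
      show "(\<ominus>\<^bsub>K\<^esub> \<one>\<^bsub>K\<^esub>) \<odot>\<^bsub>?F\<^esub> f \<in> carrier ?F"
        using f smult by auto
      show "((\<ominus>\<^bsub>K\<^esub> \<one>\<^bsub>K\<^esub>) \<odot>\<^bsub>?F\<^esub> f) \<oplus>\<^bsub>?F\<^esub> f = \<zero>\<^bsub>?F\<^esub>"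
        using f by (auto simp: free_module_carrier l_minus l_neg)
    qed
  qed (use add smult in \<open>auto simp: free_module_carrier a_ac m_ac l_distr r_distr\<close>)
qed

lemma free_gen_closed:
  assumes "cring K" "x \<in> A"
  shows "free_gen K x \<in> carrier (free_module K A)"
proof -
  interpret cring K by fact
  have "{y. free_gen K x y \<noteq> \<zero>\<^bsub>K\<^esub>} \<subseteq> {x}" by (auto simp: free_gen_def)
  then have "finite {y. free_gen K x y \<noteq> \<zero>\<^bsub>K\<^esub>}" using finite_subset by blast
  then show ?thesis using assms by (auto simp: free_module_carrier free_gen_def)
qed

text \<open>Induction on a finite set \<open>B\<close> containing the support: splitting off the
  value at \<open>b\<close> as a multiple of the generator leaves a function supported in the
  smaller set.\<close>

lemma free_module_generated:
  assumes "cring K" and W: "submodule W K (free_module K A)"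
    and gen: "\<And>x. x \<in> A \<Longrightarrow> free_gen K x \<in> W"
    and f: "f \<in> carrier (free_module K A)"
  shows "f \<in> W"
proof -
  interpret cring K by fact
  let ?F = "free_module K A"
  interpret F: module K ?F by (rule module_free_module[OF assms(1)])
  note W = F.submoduleE[OF W] submodule_zero_closed[OF F.module_axioms W]
  have "\<forall>f\<in>carrier ?F. {x. f x \<noteq> \<zero>\<^bsub>K\<^esub>} \<subseteq> B \<longrightarrow> f \<in> W" if "finite B" for B
    using that
  proof (induction B rule: finite_induct)
    case empty
    have "f \<in> W" if "{x. f x \<noteq> \<zero>\<^bsub>K\<^esub>} \<subseteq> {}" for f
    proof -
      have "f = \<zero>\<^bsub>?F\<^esub>" using that by auto
      then show ?thesis using W(7) by simp
    qed
    then show ?case by blast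
  next
    case (insert b B)
    show ?case
    proof (intro ballI impI)
      fix f assume f: "f \<in> carrier ?F" and s: "{x. f x \<noteq> \<zero>\<^bsub>K\<^esub>} \<subseteq> insert b B"
      show "f \<in> W"
      proof (cases "b \<in> A")
        case False
        then have "{x. f x \<noteq> \<zero>\<^bsub>K\<^esub>} \<subseteq> B" using s f by (auto simp: free_module_carrier)
        then show ?thesis using insert.IH f by blast
      next
        case True
        define g where "g = (\<lambda>x. if x = b then \<zero>\<^bsub>K\<^esub> else f x)"
        have sg: "{x. g x \<noteq> \<zero>\<^bsub>K\<^esub>} \<subseteq> B" "{x. g x \<noteq> \<zero>\<^bsub>K\<^esub>} \<subseteq> {x. f x \<noteq> \<zero>\<^bsub>K\<^esub>}"
          using s by (auto simp: g_def)
        then have "g \<in> carrier ?F" using f insert.hyps(1)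
          by (auto simp: free_module_carrier g_def intro: finite_subset)
        then have "g \<in> W" using insert.IH sg by blast
        moreover have "f b \<odot>\<^bsub>?F\<^esub> free_gen K b \<in> W"
          using W(4) gen[OF True] f by (simp add: free_module_carrier del: free_module_simps)
        ultimately have "g \<oplus>\<^bsub>?F\<^esub> (f b \<odot>\<^bsub>?F\<^esub> free_gen K b) \<in> W"
          by (rule W(5))
        moreover have "f = g \<oplus>\<^bsub>?F\<^esub> (f b \<odot>\<^bsub>?F\<^esub> free_gen K b)"
          using f by (auto simp: g_def free_gen_def free_module_carrier)
        ultimately show ?thesis by argo
      qed
    qed
  qed
  then show ?thesis using f by (auto simp: free_module_carrier)
qed

text \<open>The linear extension of \<open>\<phi>\<close>. Summing over the support of
  \<open>f\<close> makes the index set depend on \<open>f\<close>, which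
  \<open>free_lift_superset\<close> repairs.\<close>

definition free_lift ::
  "('k, 'z) ring_scheme \<Rightarrow> ('k, 'w, 'x) module_scheme \<Rightarrow> ('a \<Rightarrow> 'w) \<Rightarrow> ('a \<Rightarrow> 'k) \<Rightarrow> 'w" where
  "free_lift K W \<phi> f = (\<Oplus>\<^bsub>W\<^esub> x\<in>{x. f x \<noteq> \<zero>\<^bsub>K\<^esub>}. f x \<odot>\<^bsub>W\<^esub> \<phi> x)"

lemma free_lift_superset:
  assumes "module K W" "\<And>x. x \<in> A \<Longrightarrow> \<phi> x \<in> carrier W" "f \<in> carrier (free_module K A)"
    "finite B" "{x. f x \<noteq> \<zero>\<^bsub>K\<^esub>} \<subseteq> B" "B \<subseteq> A"
  shows "free_lift K W \<phi> f = (\<Oplus>\<^bsub>W\<^esub> x\<in>B. f x \<odot>\<^bsub>W\<^esub> \<phi> x)"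
proof -
  interpret W: module K W by fact
  show ?thesis unfolding free_lift_def
    by (rule W.add.finprod_mono_neutral_cong_left)
      (use assms in \<open>auto simp: free_module_carrier subset_iff\<close>)
qed

lemma free_lift_linear:
  assumes "module K W" and \<phi>: "\<And>x. x \<in> A \<Longrightarrow> \<phi> x \<in> carrier W"
  shows "linear_map K (free_module K A) W (free_lift K W \<phi>)"
proof -
  interpret W: module K W by fact
  let ?F = "free_module K A"
  interpret F: module K ?F by (rule module_free_module) unfold_locales
  have supp: "{x. f x \<noteq> \<zero>\<^bsub>K\<^esub>} \<subseteq> A" "finite {x. f x \<noteq> \<zero>\<^bsub>K\<^esub>}" "f x \<in> carrier K"
    if "f \<in> carrier ?F" for f x
    using that by (auto simp: free_module_carrier)
  show ?thesis
  proof (rule linear_mapI)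
    fix f assume f: "f \<in> carrier ?F"
    then show "free_lift K W \<phi> f \<in> carrier W"
      unfolding free_lift_def using supp[OF f] \<phi> by (intro W.finsum_closed) auto
  next
    fix f g assume fg: "f \<in> carrier ?F" "g \<in> carrier ?F"
    \<comment> \<open>A common index set for \<open>f\<close>, \<open>g\<close> and their sum, on
      which the three sums can be compared term by term.\<close>
    let ?B = "{x. f x \<noteq> \<zero>\<^bsub>K\<^esub>} \<union> {x. g x \<noteq> \<zero>\<^bsub>K\<^esub>}"
    have B: "finite ?B" "?B \<subseteq> A" using supp fg by auto
    have "free_lift K W \<phi> (f \<oplus>\<^bsub>?F\<^esub> g)
        = (\<Oplus>\<^bsub>W\<^esub> x\<in>?B. (f \<oplus>\<^bsub>?F\<^esub> g) x \<odot>\<^bsub>W\<^esub> \<phi> x)"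
      by (rule free_lift_superset[OF assms _ B(1) _ B(2)]) (use fg F.a_closed in auto)
    also have "\<dots> = (\<Oplus>\<^bsub>W\<^esub> x\<in>?B. f x \<odot>\<^bsub>W\<^esub> \<phi> x \<oplus>\<^bsub>W\<^esub> g x \<odot>\<^bsub>W\<^esub> \<phi> x)"
      by (rule W.finsum_cong') (use B supp fg \<phi> in \<open>auto simp: W.smult_l_distr subset_iff\<close>)
    also have "\<dots> = (\<Oplus>\<^bsub>W\<^esub> x\<in>?B. f x \<odot>\<^bsub>W\<^esub> \<phi> x) \<oplus>\<^bsub>W\<^esub> (\<Oplus>\<^bsub>W\<^esub> x\<in>?B. g x \<odot>\<^bsub>W\<^esub> \<phi> x)"
      by (rule W.finsum_addf) (use B supp fg \<phi> in \<open>auto simp: subset_iff\<close>)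
    finally show "free_lift K W \<phi> (f \<oplus>\<^bsub>?F\<^esub> g) = free_lift K W \<phi> f \<oplus>\<^bsub>W\<^esub> free_lift K W \<phi> g"
      using free_lift_superset[OF assms _ B(1) _ B(2)] fg by simp
  next
    fix c f assume cf: "c \<in> carrier K" "f \<in> carrier ?F"
    let ?B = "{x. f x \<noteq> \<zero>\<^bsub>K\<^esub>}"
    have B: "finite ?B" "?B \<subseteq> A" using supp cf by auto
    have "free_lift K W \<phi> (c \<odot>\<^bsub>?F\<^esub> f) = (\<Oplus>\<^bsub>W\<^esub> x\<in>?B. (c \<odot>\<^bsub>?F\<^esub> f) x \<odot>\<^bsub>W\<^esub> \<phi> x)"
      by (rule free_lift_superset[OF assms _ B(1) _ B(2)]) (use cf F.smult_closed in auto)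
    also have "\<dots> = (\<Oplus>\<^bsub>W\<^esub> x\<in>?B. c \<odot>\<^bsub>W\<^esub> (f x \<odot>\<^bsub>W\<^esub> \<phi> x))"
      by (rule W.finsum_cong') (use B supp cf \<phi> in \<open>auto simp: W.smult_assoc1 subset_iff\<close>)
    also have "\<dots> = c \<odot>\<^bsub>W\<^esub> free_lift K W \<phi> f"
      unfolding free_lift_def
      by (rule W.finsum_smult_ldistr[symmetric]) (use B supp cf \<phi> in \<open>auto simp: subset_iff\<close>)
    finally show "free_lift K W \<phi> (c \<odot>\<^bsub>?F\<^esub> f) = c \<odot>\<^bsub>W\<^esub> free_lift K W \<phi> f" .
  qed
qed

lemma free_lift_gen:
  assumes "module K W" "\<And>x. x \<in> A \<Longrightarrow> \<phi> x \<in> carrier W" "x \<in> A"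
  shows "free_lift K W \<phi> (free_gen K x) = \<phi> x"
proof -
  interpret W: module K W by fact
  have "free_lift K W \<phi> (free_gen K x) = (\<Oplus>\<^bsub>W\<^esub> y\<in>{x}. free_gen K x y \<odot>\<^bsub>W\<^esub> \<phi> y)"
    by (rule free_lift_superset[OF assms(1,2) free_gen_closed[OF W.R.is_cring assms(3)]])
      (use assms in \<open>auto simp: free_gen_def split: if_splits\<close>)
  then show ?thesis using assms by (simp add: free_gen_def)
qed

context
  fixes K :: "('k, 'z) ring_scheme" and V :: "('k, 'v, 'y) module_scheme" and W
  assumes V: "module K V" and W: "submodule W K V"
begin

interpretation V: module K V by (fact V)

interpretation W: abelian_subgroup W V
  by (rule abelian_subgroupI3)
    (use W V.abelian_group_axioms in \<open>auto simp: additive_subgroup_def submodule_def\<close>)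

lemma quotient_module_simps:
  "carrier (quotient_module V W) = (\<lambda>x. W +>\<^bsub>V\<^esub> x) ` carrier V"
  "zero (quotient_module V W) = W"
  "\<lbrakk>x \<in> carrier V; y \<in> carrier V\<rbrakk>
    \<Longrightarrow> (W +>\<^bsub>V\<^esub> x) \<oplus>\<^bsub>quotient_module V W\<^esub> (W +>\<^bsub>V\<^esub> y) = W +>\<^bsub>V\<^esub> (x \<oplus>\<^bsub>V\<^esub> y)"
  by (auto simp: quotient_module_def A_RCOSETS_def' W.a_rcos_sum)

lemma quotient_coset_eq_iff:
  assumes "x \<in> carrier V" "y \<in> carrier V"
  shows "W +>\<^bsub>V\<^esub> x = W +>\<^bsub>V\<^esub> y \<longleftrightarrow> x \<ominus>\<^bsub>V\<^esub> y \<in> W"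
proof
  assume "W +>\<^bsub>V\<^esub> x = W +>\<^bsub>V\<^esub> y"
  then have "x \<in> W +>\<^bsub>V\<^esub> y" using W.a_rcos_self assms by blast
  then show "x \<ominus>\<^bsub>V\<^esub> y \<in> W" using W.a_rcos_module_imp assms by (simp add: a_minus_def)
next
  assume "x \<ominus>\<^bsub>V\<^esub> y \<in> W"
  then have "x \<in> W +>\<^bsub>V\<^esub> y" using W.a_rcos_module_rev assms by (simp add: a_minus_def)
  then show "W +>\<^bsub>V\<^esub> x = W +>\<^bsub>V\<^esub> y" using W.a_repr_independence' assms by blast
qed

text \<open>\<open>quotient_module\<close> defines the multiple of a coset as a union over its
  representatives; all cosets in that union coincide because \<open>W\<close> is stable under
  scalars.\<close>

lemma quotient_module_smult:
  assumes "c \<in> carrier K" "x \<in> carrier V"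
  shows "c \<odot>\<^bsub>quotient_module V W\<^esub> (W +>\<^bsub>V\<^esub> x) = W +>\<^bsub>V\<^esub> (c \<odot>\<^bsub>V\<^esub> x)"
proof -
  have "W +>\<^bsub>V\<^esub> (c \<odot>\<^bsub>V\<^esub> y) = W +>\<^bsub>V\<^esub> (c \<odot>\<^bsub>V\<^esub> x)" if y: "y \<in> W +>\<^bsub>V\<^esub> x" for y
  proof -
    have yc: "y \<in> carrier V" using y assms W.a_elemrcos_carrier by blast
    have "y \<ominus>\<^bsub>V\<^esub> x \<in> W" using y W.a_rcos_module_imp assms by (simp add: a_minus_def)
    then have "c \<odot>\<^bsub>V\<^esub> (y \<ominus>\<^bsub>V\<^esub> x) \<in> W" using V.submoduleE(4)[OF W] assms by blast
    then have "c \<odot>\<^bsub>V\<^esub> y \<ominus>\<^bsub>V\<^esub> c \<odot>\<^bsub>V\<^esub> x \<in> W"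
      using assms yc by (simp add: a_minus_def V.smult_r_distr V.smult_r_minus)
    then show ?thesis using assms yc by (simp add: quotient_coset_eq_iff)
  qed
  then have "(\<Union>y\<in>W +>\<^bsub>V\<^esub> x. W +>\<^bsub>V\<^esub> (c \<odot>\<^bsub>V\<^esub> y)) = (\<Union>y\<in>W +>\<^bsub>V\<^esub> x. W +>\<^bsub>V\<^esub> (c \<odot>\<^bsub>V\<^esub> x))"
    by (rule SUP_cong[OF refl])
  also have "\<dots> = W +>\<^bsub>V\<^esub> (c \<odot>\<^bsub>V\<^esub> x)" using W.a_rcos_self[OF assms(2)] by (intro SUP_const) blast
  finally show ?thesis by (simp add: quotient_module_def)
qed

lemma module_quotient_module: "module K (quotient_module V W)"
proof -
  \<comment> \<open>The zero of the quotient is \<open>W\<close> itself; written as the coset of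
    zero it obeys the same rewrite rules as the other cosets.\<close>
  have W0: "W = W +>\<^bsub>V\<^esub> \<zero>\<^bsub>V\<^esub>" using W.a_subset by simp
  let ?Q = "quotient_module V W"
  have z: "\<zero>\<^bsub>?Q\<^esub> = W +>\<^bsub>V\<^esub> \<zero>\<^bsub>V\<^esub>" using W0 quotient_module_simps(2) by simp
  note s = quotient_module_simps(1,3) quotient_module_smult z
  show ?thesis
  proof (rule moduleI[OF V.R.is_cring abelian_groupI])
    fix X assume "X \<in> carrier ?Q"
    then obtain x where x: "x \<in> carrier V" "X = W +>\<^bsub>V\<^esub> x" by (auto simp: s)
    show "\<exists>Y\<in>carrier ?Q. Y \<oplus>\<^bsub>?Q\<^esub> X = \<zero>\<^bsub>?Q\<^esub>"
      by (rule bexI[of _ "W +>\<^bsub>V\<^esub> (\<ominus>\<^bsub>V\<^esub> x)"]) (use x in \<open>auto simp: s V.l_neg\<close>)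
  qed (auto simp: s V.a_ac V.smult_l_distr V.smult_r_distr V.smult_assoc1 simp del: V.a_coset_add_zero)
qed

lemma linear_map_quotient: "linear_map K V (quotient_module V W) (\<lambda>x. W +>\<^bsub>V\<^esub> x)"
  by (rule linear_mapI) (auto simp: quotient_module_simps quotient_module_smult)

text \<open>\<open>F\<close> evaluates \<open>f\<close> at a chosen representative; the kernel
  condition makes the value independent of the choice.\<close>

lemma quotient_lift_exists:
  assumes U: "module K U" and f: "linear_map K V U f" and ker: "\<And>w. w \<in> W \<Longrightarrow> f w = \<zero>\<^bsub>U\<^esub>"
  shows "\<exists>F. linear_map K (quotient_module V W) U F \<and> (\<forall>x\<in>carrier V. F (W +>\<^bsub>V\<^esub> x) = f x)"
proof -
  interpret U: module K U by fact
  define F where "F X = f (SOME x. x \<in> carrier V \<and> X = W +>\<^bsub>V\<^esub> x)" for X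
  have F: "F (W +>\<^bsub>V\<^esub> x) = f x" if x: "x \<in> carrier V" for x
  proof -
    define y where "y = (SOME y. y \<in> carrier V \<and> W +>\<^bsub>V\<^esub> x = W +>\<^bsub>V\<^esub> y)"
    have y: "y \<in> carrier V \<and> W +>\<^bsub>V\<^esub> x = W +>\<^bsub>V\<^esub> y"
      unfolding y_def by (rule someI[of _ x]) (use x in auto)
    then have "f (x \<ominus>\<^bsub>V\<^esub> y) = \<zero>\<^bsub>U\<^esub>"
      using x ker quotient_coset_eq_iff by blast
    then have "f x \<ominus>\<^bsub>U\<^esub> f y = \<zero>\<^bsub>U\<^esub>"
      using x y linear_map_minus[OF V U f] by simp
    moreover have "f x \<in> carrier U" "f y \<in> carrier U"
      using x y linear_map_closed[OF f] by auto
    ultimately have "\<ominus>\<^bsub>U\<^esub> (\<ominus>\<^bsub>U\<^esub> f y) = f x"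
      by (intro U.minus_equality) (auto simp: a_minus_def)
    then have "f x = f y" using \<open>f y \<in> carrier U\<close> by simp
    then show ?thesis unfolding F_def y_def by simp
  qed
  have "linear_map K (quotient_module V W) U F"
    by (rule linear_mapI)
      (use linear_map_closed[OF f] linear_map_add[OF f] linear_map_smult[OF f] in
        \<open>auto simp: quotient_module_simps quotient_module_smult F\<close>)
  then show ?thesis using F by blast
qed

end

lemma direct_sum_simps [simp]:
  "zero (direct_sum I V) = (\<lambda>i\<in>I. \<zero>\<^bsub>V i\<^esub>)"
  "add (direct_sum I V) = (\<lambda>f g. \<lambda>i\<in>I. f i \<oplus>\<^bsub>V i\<^esub> g i)"
  "smult (direct_sum I V) = (\<lambda>c f. \<lambda>i\<in>I. c \<odot>\<^bsub>V i\<^esub> f i)"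
  by (simp_all add: direct_sum_def)

lemma direct_sum_carrier:
  "f \<in> carrier (direct_sum I V) \<longleftrightarrow>
    f \<in> (\<Pi>\<^sub>E i\<in>I. carrier (V i)) \<and> finite {i\<in>I. f i \<noteq> \<zero>\<^bsub>V i\<^esub>}"
  by (simp add: direct_sum_def)

context
  fixes K :: "('k, 'z) ring_scheme" and I :: "'i set"
    and V :: "'i \<Rightarrow> ('k, 'v, 'y) module_scheme"
  assumes cring: "cring K" and V: "\<And>i. i \<in> I \<Longrightarrow> module K (V i)"
begin

interpretation K: cring K by (fact cring)

abbreviation (input) "DS \<equiv> direct_sum I V"

lemma direct_sum_closed:
  "\<lbrakk>f \<in> carrier DS; i \<in> I\<rbrakk> \<Longrightarrow> f i \<in> carrier (V i)"
  "\<lbrakk>f \<in> carrier DS; g \<in> carrier DS\<rbrakk> \<Longrightarrow> f \<oplus>\<^bsub>DS\<^esub> g \<in> carrier DS"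
  "\<lbrakk>c \<in> carrier K; f \<in> carrier DS\<rbrakk> \<Longrightarrow> c \<odot>\<^bsub>DS\<^esub> f \<in> carrier DS"
  "\<zero>\<^bsub>DS\<^esub> \<in> carrier DS"
proof -
  show "\<lbrakk>f \<in> carrier DS; i \<in> I\<rbrakk> \<Longrightarrow> f i \<in> carrier (V i)"
    by (auto simp: direct_sum_carrier)
next
  assume fg: "f \<in> carrier DS" "g \<in> carrier DS"
  have "{i\<in>I. f i \<oplus>\<^bsub>V i\<^esub> g i \<noteq> \<zero>\<^bsub>V i\<^esub>} \<subseteq> {i\<in>I. f i \<noteq> \<zero>\<^bsub>V i\<^esub>} \<union> {i\<in>I. g i \<noteq> \<zero>\<^bsub>V i\<^esub>}"
    using V module.axioms(2) abelian_group.axioms(1) abelian_monoid.l_zero abelian_monoid.zero_closed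
    by fastforce
  then have "finite {i\<in>I. f i \<oplus>\<^bsub>V i\<^esub> g i \<noteq> \<zero>\<^bsub>V i\<^esub>}"
    using fg by (auto simp: direct_sum_carrier intro: finite_subset)
  moreover have "f i \<oplus>\<^bsub>V i\<^esub> g i \<in> carrier (V i)" if "i \<in> I" for i
    using fg that module.axioms(2)[OF V[OF that]]
    by (auto simp: direct_sum_carrier intro!: abelian_monoid.a_closed abelian_group.axioms(1))
  ultimately show "f \<oplus>\<^bsub>DS\<^esub> g \<in> carrier DS"
    by (auto simp: direct_sum_carrier cong: conj_cong)
next
  assume cf: "c \<in> carrier K" "f \<in> carrier DS"
  have "{i\<in>I. c \<odot>\<^bsub>V i\<^esub> f i \<noteq> \<zero>\<^bsub>V i\<^esub>} \<subseteq> {i\<in>I. f i \<noteq> \<zero>\<^bsub>V i\<^esub>}"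
    using V module.smult_r_null cf by fastforce
  then have "finite {i\<in>I. c \<odot>\<^bsub>V i\<^esub> f i \<noteq> \<zero>\<^bsub>V i\<^esub>}"
    using cf by (auto simp: direct_sum_carrier intro: finite_subset)
  moreover have "c \<odot>\<^bsub>V i\<^esub> f i \<in> carrier (V i)" if "i \<in> I" for i
    using cf that module.smult_closed[OF V[OF that]]
    by (auto simp: direct_sum_carrier)
  ultimately show "c \<odot>\<^bsub>DS\<^esub> f \<in> carrier DS"
    by (auto simp: direct_sum_carrier cong: conj_cong)
next
  have "\<zero>\<^bsub>V i\<^esub> \<in> carrier (V i)" if "i \<in> I" for i
    using module.axioms(2)[OF V[OF that]] abelian_group.axioms(1) abelian_monoid.zero_closed by blast
  then show "\<zero>\<^bsub>DS\<^esub> \<in> carrier DS"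
    by (auto simp: direct_sum_carrier cong: conj_cong)
qed

lemma direct_sum_ext:
  "\<lbrakk>f \<in> carrier DS; g \<in> carrier DS; \<And>i. i \<in> I \<Longrightarrow> f i = g i\<rbrakk> \<Longrightarrow> f = g"
  by (auto simp: direct_sum_carrier intro: PiE_ext)

lemma module_direct_sum: "module K DS"
proof -
  note cl = direct_sum_closed
  have am: "abelian_monoid (V i)" if "i \<in> I" for i
    using V[OF that] by (simp add: module.axioms(2) abelian_group.axioms(1))
  note s = abelian_monoid.a_closed[OF am] abelian_monoid.a_assoc[OF am] abelian_monoid.l_zero[OF am]
    module.smult_l_distr[OF V] module.smult_r_distr[OF V] module.smult_assoc1[OF V]
    module.smult_one[OF V] module.smult_closed[OF V] cl(1)
  have inv: "(\<ominus>\<^bsub>K\<^esub> \<one>\<^bsub>K\<^esub>) \<odot>\<^bsub>V i\<^esub> x \<oplus>\<^bsub>V i\<^esub> x = \<zero>\<^bsub>V i\<^esub>" if "i \<in> I" "x \<in> carrier (V i)" for i x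
  proof -
    interpret Vi: module K "V i" using that V by blast
    show ?thesis using that by (simp add: Vi.smult_l_minus Vi.l_neg)
  qed
  show ?thesis
  proof (rule moduleI[OF cring abelian_groupI])
    fix f assume f: "f \<in> carrier DS"
    show "\<exists>g\<in>carrier DS. g \<oplus>\<^bsub>DS\<^esub> f = \<zero>\<^bsub>DS\<^esub>"
    proof (rule bexI)
      show n: "(\<ominus>\<^bsub>K\<^esub> \<one>\<^bsub>K\<^esub>) \<odot>\<^bsub>DS\<^esub> f \<in> carrier DS" using f by (intro cl) auto
      show "((\<ominus>\<^bsub>K\<^esub> \<one>\<^bsub>K\<^esub>) \<odot>\<^bsub>DS\<^esub> f) \<oplus>\<^bsub>DS\<^esub> f = \<zero>\<^bsub>DS\<^esub>"
        using f by (intro direct_sum_ext cl) (auto simp: inv cl(1))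
    qed
  next
    fix f g assume "f \<in> carrier DS" "g \<in> carrier DS"
    then show "f \<oplus>\<^bsub>DS\<^esub> g = g \<oplus>\<^bsub>DS\<^esub> f"
      by (intro direct_sum_ext cl) (auto simp: cl(1) intro: abelian_monoid.a_comm[OF am])
  next
    fix f g h assume "f \<in> carrier DS" "g \<in> carrier DS" "h \<in> carrier DS"
    then show "f \<oplus>\<^bsub>DS\<^esub> g \<oplus>\<^bsub>DS\<^esub> h = f \<oplus>\<^bsub>DS\<^esub> (g \<oplus>\<^bsub>DS\<^esub> h)"
      by (intro direct_sum_ext cl) (auto simp: s)
  next
    fix f assume "f \<in> carrier DS"
    then show "\<zero>\<^bsub>DS\<^esub> \<oplus>\<^bsub>DS\<^esub> f = f" "\<one>\<^bsub>K\<^esub> \<odot>\<^bsub>DS\<^esub> f = f"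
      by (intro direct_sum_ext cl; auto simp: s)+
  next
    fix a b f assume "a \<in> carrier K" "b \<in> carrier K" "f \<in> carrier DS"
    then show "(a \<oplus>\<^bsub>K\<^esub> b) \<odot>\<^bsub>DS\<^esub> f = a \<odot>\<^bsub>DS\<^esub> f \<oplus>\<^bsub>DS\<^esub> b \<odot>\<^bsub>DS\<^esub> f"
      "(a \<otimes>\<^bsub>K\<^esub> b) \<odot>\<^bsub>DS\<^esub> f = a \<odot>\<^bsub>DS\<^esub> (b \<odot>\<^bsub>DS\<^esub> f)"
      by (intro direct_sum_ext cl K.a_closed K.m_closed; auto simp: s)+
  next
    fix a f g assume "a \<in> carrier K" "f \<in> carrier DS" "g \<in> carrier DS"
    then show "a \<odot>\<^bsub>DS\<^esub> (f \<oplus>\<^bsub>DS\<^esub> g) = a \<odot>\<^bsub>DS\<^esub> f \<oplus>\<^bsub>DS\<^esub> a \<odot>\<^bsub>DS\<^esub> g"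
      by (intro direct_sum_ext cl; auto simp: s)
  qed (rule cl; assumption)+
qed

lemma direct_sum_inj_linear:
  assumes "i \<in> I"
  shows "linear_map K (V i) DS (direct_sum_inj I V i)"
proof (rule linear_mapI)
  have am: "abelian_monoid (V j)" if "j \<in> I" for j
    using V[OF that] by (simp add: module.axioms(2) abelian_group.axioms(1))
  fix x assume x: "x \<in> carrier (V i)"
  have "{j\<in>I. direct_sum_inj I V i x j \<noteq> \<zero>\<^bsub>V j\<^esub>} \<subseteq> {i}" by (auto simp: direct_sum_inj_def)
  then have "finite {j\<in>I. direct_sum_inj I V i x j \<noteq> \<zero>\<^bsub>V j\<^esub>}" using finite_subset by blast
  then show "direct_sum_inj I V i x \<in> carrier DS"
    using x by (auto simp: direct_sum_carrier direct_sum_inj_def abelian_monoid.zero_closed[OF am])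
next
  have am: "abelian_monoid (V j)" if "j \<in> I" for j
    using V[OF that] by (simp add: module.axioms(2) abelian_group.axioms(1))
  show "direct_sum_inj I V i (x \<oplus>\<^bsub>V i\<^esub> y) = direct_sum_inj I V i x \<oplus>\<^bsub>DS\<^esub> direct_sum_inj I V i y"
    if "x \<in> carrier (V i)" "y \<in> carrier (V i)" for x y
    using that
    by (auto simp: direct_sum_inj_def restrict_def abelian_monoid.l_zero[OF am]
        abelian_monoid.zero_closed[OF am])
  show "direct_sum_inj I V i (c \<odot>\<^bsub>V i\<^esub> x) = c \<odot>\<^bsub>DS\<^esub> direct_sum_inj I V i x"
    if "c \<in> carrier K" "x \<in> carrier (V i)" for c x
    using that by (auto simp: direct_sum_inj_def restrict_def module.smult_r_null[OF V])
qed

text \<open>The same induction as for free modules, with one summand split off at a time.\<close>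

lemma direct_sum_generated:
  assumes W: "submodule W K DS"
    and gen: "\<And>i x. \<lbrakk>i \<in> I; x \<in> carrier (V i)\<rbrakk> \<Longrightarrow> direct_sum_inj I V i x \<in> W"
    and f: "f \<in> carrier DS"
  shows "f \<in> W"
proof -
  interpret D: module K DS by (rule module_direct_sum)
  note W' = D.submoduleE[OF W] submodule_zero_closed[OF D.module_axioms W]
  have am: "abelian_monoid (V j)" if "j \<in> I" for j
    using V[OF that] by (simp add: module.axioms(2) abelian_group.axioms(1))
  have "\<forall>f\<in>carrier DS. {i\<in>I. f i \<noteq> \<zero>\<^bsub>V i\<^esub>} \<subseteq> B \<longrightarrow> f \<in> W" if "finite B" for B
    using that
  proof (induction B rule: finite_induct)
    case empty
    have "f \<in> W" if "f \<in> carrier DS" "{i\<in>I. f i \<noteq> \<zero>\<^bsub>V i\<^esub>} \<subseteq> {}" for f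
    proof -
      have "f = \<zero>\<^bsub>DS\<^esub>" using that by (intro direct_sum_ext direct_sum_closed) auto
      then show ?thesis using W'(7) by simp
    qed
    then show ?case by blast
  next
    case (insert b B)
    show ?case
    proof (intro ballI impI)
      fix f assume f: "f \<in> carrier DS" and s: "{i\<in>I. f i \<noteq> \<zero>\<^bsub>V i\<^esub>} \<subseteq> insert b B"
      show "f \<in> W"
      proof (cases "b \<in> I")
        case False
        then have "{i\<in>I. f i \<noteq> \<zero>\<^bsub>V i\<^esub>} \<subseteq> B" using s by auto
        then show ?thesis using insert.IH f by blast
      next
        case True
        define g where "g = (\<lambda>i\<in>I. if i = b then \<zero>\<^bsub>V i\<^esub> else f i)"
        have sg: "{i\<in>I. g i \<noteq> \<zero>\<^bsub>V i\<^esub>} \<subseteq> B" "{i\<in>I. g i \<noteq> \<zero>\<^bsub>V i\<^esub>} \<subseteq> {i\<in>I. f i \<noteq> \<zero>\<^bsub>V i\<^esub>}"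
          using s by (auto simp: g_def)
        have "finite {i\<in>I. g i \<noteq> \<zero>\<^bsub>V i\<^esub>}" using sg(1) insert.hyps(1) finite_subset by blast
        then have gc: "g \<in> carrier DS" using f
          by (auto simp: direct_sum_carrier g_def abelian_monoid.zero_closed[OF am])
        then have "g \<in> W" using insert.IH sg by blast
        moreover have fb: "f b \<in> carrier (V b)" using True f direct_sum_closed by blast
        then have "direct_sum_inj I V b (f b) \<in> W" using gen True by blast
        ultimately have "g \<oplus>\<^bsub>DS\<^esub> direct_sum_inj I V b (f b) \<in> W" by (rule W'(5))
        moreover have "f = g \<oplus>\<^bsub>DS\<^esub> direct_sum_inj I V b (f b)"
        proof (rule direct_sum_ext[OF f])
          show "g \<oplus>\<^bsub>DS\<^esub> direct_sum_inj I V b (f b) \<in> carrier DS"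
            using gc linear_map_closed[OF direct_sum_inj_linear[OF True] fb] by (rule direct_sum_closed(2))
          fix i assume i: "i \<in> I"
          then show "f i = (g \<oplus>\<^bsub>DS\<^esub> direct_sum_inj I V b (f b)) i"
            using f by (auto simp: g_def direct_sum_inj_def direct_sum_closed
                abelian_monoid.l_zero[OF am] abelian_monoid.r_zero[OF am])
        qed
        ultimately show ?thesis by argo
      qed
    qed
  qed
  then show ?thesis using f by (auto simp: direct_sum_carrier)
qed

lemma direct_sum_lift_exists:
  assumes U: "module K U" and F: "\<And>i. i \<in> I \<Longrightarrow> linear_map K (V i) U (F i)"
  shows "\<exists>G. linear_map K DS U G \<and>
    (\<forall>i\<in>I. \<forall>x\<in>carrier (V i). G (direct_sum_inj I V i x) = F i x)"
proof -
  interpret U: module K U by fact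
  define G where "G f = (\<Oplus>\<^bsub>U\<^esub> i\<in>{i\<in>I. f i \<noteq> \<zero>\<^bsub>V i\<^esub>}. F i (f i))" for f
  have Fc: "F i (f i) \<in> carrier U" if "f \<in> carrier DS" "i \<in> I" for f i
    using linear_map_closed[OF F[OF that(2)]] direct_sum_closed(1)[OF that] .
  have F0: "F i \<zero>\<^bsub>V i\<^esub> = \<zero>\<^bsub>U\<^esub>" if "i \<in> I" for i
    using linear_map_zero[OF V[OF that] U F[OF that]] .
  have super: "G f = (\<Oplus>\<^bsub>U\<^esub> i\<in>B. F i (f i))"
    if "f \<in> carrier DS" "finite B" "{i\<in>I. f i \<noteq> \<zero>\<^bsub>V i\<^esub>} \<subseteq> B" "B \<subseteq> I" for f B
    unfolding G_def
    by (rule U.add.finprod_mono_neutral_cong_left)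
      (use that Fc F0 in \<open>auto simp: subset_iff\<close>)
  have supp: "{i\<in>I. f i \<noteq> \<zero>\<^bsub>V i\<^esub>} \<subseteq> I" "finite {i\<in>I. f i \<noteq> \<zero>\<^bsub>V i\<^esub>}"
    if "f \<in> carrier DS" for f
    using that by (auto simp: direct_sum_carrier)
  have "linear_map K DS U G"
  proof (rule linear_mapI)
    fix f assume f: "f \<in> carrier DS"
    then show "G f \<in> carrier U"
      unfolding G_def using Fc by (intro U.finsum_closed) auto
  next
    fix f g assume fg: "f \<in> carrier DS" "g \<in> carrier DS"
    note fg' = direct_sum_closed(2)[OF fg]
    \<comment> \<open>The support of the sum is adjoined to the index set, so that its inclusion in
      the union of the two other supports does not have to be argued.\<close>
    let ?B = "{i\<in>I. f i \<noteq> \<zero>\<^bsub>V i\<^esub>} \<union> {i\<in>I. g i \<noteq> \<zero>\<^bsub>V i\<^esub>} \<union> {i\<in>I. (f \<oplus>\<^bsub>DS\<^esub> g) i \<noteq> \<zero>\<^bsub>V i\<^esub>}"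
    have B: "finite ?B" "?B \<subseteq> I"
      using supp[OF fg(1)] supp[OF fg(2)] supp[OF fg'] by (simp_all del: direct_sum_simps)
    have "G (f \<oplus>\<^bsub>DS\<^esub> g) = (\<Oplus>\<^bsub>U\<^esub> i\<in>?B. F i ((f \<oplus>\<^bsub>DS\<^esub> g) i))"
      by (rule super[OF fg' B(1) _ B(2)]) blast
    also have "\<dots> = (\<Oplus>\<^bsub>U\<^esub> i\<in>?B. F i (f i) \<oplus>\<^bsub>U\<^esub> F i (g i))"
      by (rule U.finsum_cong') (use fg Fc direct_sum_closed(1) in \<open>auto simp: linear_map_add[OF F]\<close>)
    also have "\<dots> = (\<Oplus>\<^bsub>U\<^esub> i\<in>?B. F i (f i)) \<oplus>\<^bsub>U\<^esub> (\<Oplus>\<^bsub>U\<^esub> i\<in>?B. F i (g i))"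
      by (rule U.finsum_addf) (use fg Fc in auto)
    also have "(\<Oplus>\<^bsub>U\<^esub> i\<in>?B. F i (f i)) = G f" by (rule super[OF fg(1) B(1) _ B(2), symmetric]) blast
    also have "(\<Oplus>\<^bsub>U\<^esub> i\<in>?B. F i (g i)) = G g" by (rule super[OF fg(2) B(1) _ B(2), symmetric]) blast
    finally show "G (f \<oplus>\<^bsub>DS\<^esub> g) = G f \<oplus>\<^bsub>U\<^esub> G g" .
  next
    fix c f assume cf: "c \<in> carrier K" "f \<in> carrier DS"
    note cf' = direct_sum_closed(3)[OF cf]
    let ?B = "{i\<in>I. f i \<noteq> \<zero>\<^bsub>V i\<^esub>} \<union> {i\<in>I. (c \<odot>\<^bsub>DS\<^esub> f) i \<noteq> \<zero>\<^bsub>V i\<^esub>}"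
    have B: "finite ?B" "?B \<subseteq> I"
      using supp[OF cf(2)] supp[OF cf'] by (simp_all del: direct_sum_simps)
    have "G (c \<odot>\<^bsub>DS\<^esub> f) = (\<Oplus>\<^bsub>U\<^esub> i\<in>?B. F i ((c \<odot>\<^bsub>DS\<^esub> f) i))"
      by (rule super[OF cf' B(1) _ B(2)]) blast
    also have "\<dots> = (\<Oplus>\<^bsub>U\<^esub> i\<in>?B. c \<odot>\<^bsub>U\<^esub> F i (f i))"
      by (rule U.finsum_cong') (use cf Fc direct_sum_closed(1) in \<open>auto simp: linear_map_smult[OF F]\<close>)
    also have "\<dots> = c \<odot>\<^bsub>U\<^esub> (\<Oplus>\<^bsub>U\<^esub> i\<in>?B. F i (f i))"
      by (rule U.finsum_smult_ldistr[symmetric]) (use B cf Fc in auto)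
    also have "(\<Oplus>\<^bsub>U\<^esub> i\<in>?B. F i (f i)) = G f" by (rule super[OF cf(2) B(1) _ B(2), symmetric]) blast
    finally show "G (c \<odot>\<^bsub>DS\<^esub> f) = c \<odot>\<^bsub>U\<^esub> G f" .
  qed
  moreover have "G (direct_sum_inj I V i x) = F i x" if i: "i \<in> I" and x: "x \<in> carrier (V i)" for i x
  proof -
    have "G (direct_sum_inj I V i x) = (\<Oplus>\<^bsub>U\<^esub> j\<in>{i}. F j (direct_sum_inj I V i x j))"
      by (rule super[OF linear_map_closed[OF direct_sum_inj_linear[OF i] x]])
        (use i in \<open>auto simp: direct_sum_inj_def\<close>)
    then show ?thesis using i linear_map_closed[OF F[OF i] x] by (simp add: direct_sum_inj_def)
  qed
  ultimately show ?thesis by blast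
qed

end

section \<open>The universal property of the tensor product\<close>

text \<open>Slots are given by splitting the list of factors, not by list update as in
  \<open>tensor_relations\<close>: tuples built with \<open>@\<close> and \<open>#\<close> then
  display their slot. \<open>multilinear_update\<close> translates back.\<close>

definition multilinear ::
  "('k, 'z) ring_scheme \<Rightarrow> ('k, 'v, 'y) module_scheme list \<Rightarrow> ('k, 'w, 'x) module_scheme
    \<Rightarrow> ('v list \<Rightarrow> 'w) \<Rightarrow> bool" where
  "multilinear K Vs W \<phi> \<longleftrightarrow> (\<forall>xs\<in>tuples Vs. \<phi> xs \<in> carrier W) \<and>
     (\<forall>As V Bs. Vs = As @ V # Bs \<longrightarrow> (\<forall>xs\<in>tuples As. \<forall>ys\<in>tuples Bs.
        linear_map K V W (\<lambda>x. \<phi> (xs @ x # ys))))"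

lemma multilinearI:
  assumes "\<And>xs. xs \<in> tuples Vs \<Longrightarrow> \<phi> xs \<in> carrier W"
    and "\<And>As V Bs xs ys. \<lbrakk>Vs = As @ V # Bs; xs \<in> tuples As; ys \<in> tuples Bs\<rbrakk>
      \<Longrightarrow> linear_map K V W (\<lambda>x. \<phi> (xs @ x # ys))"
  shows "multilinear K Vs W \<phi>"
  using assms unfolding multilinear_def by blast

lemma multilinear_closed: "\<lbrakk>multilinear K Vs W \<phi>; xs \<in> tuples Vs\<rbrakk> \<Longrightarrow> \<phi> xs \<in> carrier W"
  unfolding multilinear_def by blast

lemma multilinear_slot:
  "\<lbrakk>multilinear K (As @ V # Bs) W \<phi>; xs \<in> tuples As; ys \<in> tuples Bs\<rbrakk>
    \<Longrightarrow> linear_map K V W (\<lambda>x. \<phi> (xs @ x # ys))"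
  unfolding multilinear_def by blast

lemma tuples_Cons [simp]:
  "x # xs \<in> tuples (V # Vs) \<longleftrightarrow> x \<in> carrier V \<and> xs \<in> tuples Vs"
  by (simp add: tuples_def)

lemma tuples_length: "xs \<in> tuples Vs \<Longrightarrow> length xs = length Vs"
  by (auto simp: tuples_def list_all2_lengthD)

lemma tuples_append:
  "length xs = length As \<Longrightarrow> xs @ ys \<in> tuples (As @ Bs) \<longleftrightarrow> xs \<in> tuples As \<and> ys \<in> tuples Bs"
  by (simp add: tuples_def list_all2_append)

lemma tuples_nth: "\<lbrakk>xs \<in> tuples Vs; i < length Vs\<rbrakk> \<Longrightarrow> xs ! i \<in> carrier (Vs ! i)"
  by (auto simp: tuples_def list_all2_conv_all_nth)

lemma tuples_replicate:
  "xs \<in> tuples (replicate n V) \<longleftrightarrow> length xs = n \<and> set xs \<subseteq> carrier V"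
  by (auto simp: tuples_def list_all2_conv_all_nth set_conv_nth)

lemma tuples_update_conv:
  assumes "xs \<in> tuples Vs" "i < length Vs"
  shows "take i xs \<in> tuples (take i Vs)" "drop (Suc i) xs \<in> tuples (drop (Suc i) Vs)"
    "xs[i := x] = take i xs @ x # drop (Suc i) xs"
    "Vs = take i Vs @ Vs ! i # drop (Suc i) Vs"
proof -
  show "take i xs \<in> tuples (take i Vs)" "drop (Suc i) xs \<in> tuples (drop (Suc i) Vs)"
    using assms by (auto simp: tuples_def)
  show "xs[i := x] = take i xs @ x # drop (Suc i) xs"
    using assms by (simp add: tuples_length upd_conv_take_nth_drop)
  show "Vs = take i Vs @ Vs ! i # drop (Suc i) Vs"
    using assms by (simp add: id_take_nth_drop)
qed

lemma multilinear_update: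
  assumes "multilinear K Vs W \<phi>" "xs \<in> tuples Vs" "i < length Vs"
  shows "linear_map K (Vs ! i) W (\<lambda>x. \<phi> (xs[i := x]))"
proof -
  note u = tuples_update_conv[OF assms(2,3)]
  have "multilinear K (take i Vs @ Vs ! i # drop (Suc i) Vs) W \<phi>" using assms(1) u(4) by simp
  from multilinear_slot[OF this u(1,2)] show ?thesis by (simp add: u(3))
qed

lemma tuples_update:
  assumes "xs \<in> tuples Vs" "i < length Vs" "x \<in> carrier (Vs ! i)"
  shows "xs[i := x] \<in> tuples Vs"
  using assms by (auto simp: tuples_def list_all2_conv_all_nth nth_list_update)

lemma tensor_lift_cong:
  assumes "\<And>xs. xs \<in> tuples Vs \<Longrightarrow> \<phi> xs = \<psi> xs"
  shows "tensor_lift K Vs W \<phi> = tensor_lift K Vs W \<psi>"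
proof -
  have "(\<lambda>f. f \<in> carrier (hom_module K (tensor K Vs) W) \<and> (\<forall>xs\<in>tuples Vs. f (pure_tensor K Vs xs) = \<phi> xs))
    = (\<lambda>f. f \<in> carrier (hom_module K (tensor K Vs) W) \<and> (\<forall>xs\<in>tuples Vs. f (pure_tensor K Vs xs) = \<psi> xs))"
    using assms by (intro ext) auto
  then show ?thesis unfolding tensor_lift_def by simp
qed

context
  fixes K :: "('k, 'z) ring_scheme" and Vs :: "('k, 'v, 'y) module_scheme list"
  assumes cring: "cring K" and Vs: "\<And>V. V \<in> set Vs \<Longrightarrow> module K V"
begin

interpretation K: cring K by (fact cring)

interpretation F: module K "free_module K (tuples Vs)"
  by (rule module_free_module[OF cring])

lemma tensor_relations_closed: "tensor_relations K Vs \<subseteq> carrier (free_module K (tuples Vs))"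
proof -
  have m: "module K (Vs ! i)" if "i < length Vs" for i using Vs that by simp
  have am: "abelian_monoid (Vs ! i)" if "i < length Vs" for i
    using m[OF that] by (simp add: module.axioms(2) abelian_group.axioms(1))
  note c = abelian_monoid.a_closed[OF am] module.smult_closed[OF m]
  show ?thesis
    unfolding tensor_relations_def Let_def
    by (auto simp del: free_module_simps intro!: F.minus_closed F.a_closed F.smult_closed
        free_gen_closed[OF cring] tuples_update c)
qed

lemma tensor_span_submodule:
  "submodule (module_span K (free_module K (tuples Vs)) (tensor_relations K Vs)) K (free_module K (tuples Vs))"
  by (rule module_span_submodule[OF F.module_axioms tensor_relations_closed])

lemma module_tensor: "module K (tensor K Vs)"
  unfolding tensor_def Let_def
  by (rule module_quotient_module[OF F.module_axioms tensor_span_submodule])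

definition tensor_proj :: "('v list \<Rightarrow> 'k) \<Rightarrow> ('v list \<Rightarrow> 'k) set" where
  "tensor_proj f = module_span K (free_module K (tuples Vs)) (tensor_relations K Vs)
     +>\<^bsub>free_module K (tuples Vs)\<^esub> f"

lemma tensor_proj_linear: "linear_map K (free_module K (tuples Vs)) (tensor K Vs) tensor_proj"
  using linear_map_quotient[OF F.module_axioms tensor_span_submodule]
  unfolding tensor_def Let_def tensor_proj_def[abs_def] .

lemma pure_tensor_proj: "pure_tensor K Vs xs = tensor_proj (free_gen K xs)"
  by (simp add: pure_tensor_def tensor_proj_def Let_def)

lemma tensor_proj_surj: "carrier (tensor K Vs) = tensor_proj ` carrier (free_module K (tuples Vs))"
  using quotient_module_simps(1)[OF F.module_axioms tensor_span_submodule]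
  unfolding tensor_def Let_def tensor_proj_def[abs_def] .

lemma tensor_proj_relation:
  assumes "f \<in> carrier (free_module K (tuples Vs))" "g \<in> carrier (free_module K (tuples Vs))"
    "f \<ominus>\<^bsub>free_module K (tuples Vs)\<^esub> g \<in> tensor_relations K Vs"
  shows "tensor_proj f = tensor_proj g"
  unfolding tensor_proj_def
  by (rule iffD2[OF quotient_coset_eq_iff[OF F.module_axioms tensor_span_submodule assms(1,2)]
        subsetD[OF module_span_superset assms(3)]])

lemma pure_tensor_closed: "xs \<in> tuples Vs \<Longrightarrow> pure_tensor K Vs xs \<in> carrier (tensor K Vs)"
  unfolding pure_tensor_proj
  by (rule linear_map_closed[OF tensor_proj_linear free_gen_closed[OF cring]])

lemma pure_tensor_multilinear: "multilinear K Vs (tensor K Vs) (pure_tensor K Vs)"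
proof (rule multilinearI[OF pure_tensor_closed])
  fix As V Bs xs ys
  assume eq: "Vs = As @ V # Bs" and xs: "xs \<in> tuples As" and ys: "ys \<in> tuples Bs"
  let ?F = "free_module K (tuples Vs)" and ?i = "length As"
  interpret V: module K V using Vs eq by simp
  have len: "length xs = ?i" using xs by (rule tuples_length)
  \<comment> \<open>\<open>tensor_relations\<close> is phrased with list updates; a tuple with a
    zero placeholder in the slot brings \<open>xs @ x # ys\<close> into that form.\<close>
  have up: "xs @ x # ys = (xs @ \<zero>\<^bsub>V\<^esub> # ys)[?i := x]" for x
    using len list_update_length[of xs "\<zero>\<^bsub>V\<^esub>" ys x] by simp
  have nth: "Vs ! ?i = V" "?i < length Vs" using eq by simp_all
  have t: "xs @ x # ys \<in> tuples Vs" if "x \<in> carrier V" for x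
    using that xs ys len eq by (simp add: tuples_append)
  then have t0: "xs @ \<zero>\<^bsub>V\<^esub> # ys \<in> tuples Vs" by simp
  note g = free_gen_closed[OF cring t]
  show "linear_map K V (tensor K Vs) (\<lambda>x. pure_tensor K Vs (xs @ x # ys))"
  proof (rule linear_mapI)
    fix x assume "x \<in> carrier V"
    then show "pure_tensor K Vs (xs @ x # ys) \<in> carrier (tensor K Vs)"
      using pure_tensor_closed t by blast
  next
    fix x y assume xy: "x \<in> carrier V" "y \<in> carrier V"
    have "free_gen K (xs @ (x \<oplus>\<^bsub>V\<^esub> y) # ys) \<ominus>\<^bsub>?F\<^esub> (free_gen K (xs @ x # ys) \<oplus>\<^bsub>?F\<^esub> free_gen K (xs @ y # ys))
        \<in> tensor_relations K Vs"
      unfolding tensor_relations_def Let_def up[of x] up[of y] up[of "x \<oplus>\<^bsub>V\<^esub> y"]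
      using xy nth t0 by fastforce
    from tensor_proj_relation[OF _ _ this] xy
    have "tensor_proj (free_gen K (xs @ (x \<oplus>\<^bsub>V\<^esub> y) # ys))
        = tensor_proj (free_gen K (xs @ x # ys) \<oplus>\<^bsub>?F\<^esub> free_gen K (xs @ y # ys))"
      using g F.a_closed by (simp del: free_module_simps)
    then show "pure_tensor K Vs (xs @ (x \<oplus>\<^bsub>V\<^esub> y) # ys)
        = pure_tensor K Vs (xs @ x # ys) \<oplus>\<^bsub>tensor K Vs\<^esub> pure_tensor K Vs (xs @ y # ys)"
      unfolding pure_tensor_proj using linear_map_add[OF tensor_proj_linear] g xy by simp
  next
    fix c x assume cx: "c \<in> carrier K" "x \<in> carrier V"
    have "free_gen K (xs @ (c \<odot>\<^bsub>V\<^esub> x) # ys) \<ominus>\<^bsub>?F\<^esub> (c \<odot>\<^bsub>?F\<^esub> free_gen K (xs @ x # ys))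
        \<in> tensor_relations K Vs"
      unfolding tensor_relations_def Let_def up[of x] up[of "c \<odot>\<^bsub>V\<^esub> x"]
      using cx nth t0 by fastforce
    from tensor_proj_relation[OF _ _ this] cx
    have "tensor_proj (free_gen K (xs @ (c \<odot>\<^bsub>V\<^esub> x) # ys))
        = tensor_proj (c \<odot>\<^bsub>?F\<^esub> free_gen K (xs @ x # ys))"
      using g F.smult_closed by (simp del: free_module_simps)
    then show "pure_tensor K Vs (xs @ (c \<odot>\<^bsub>V\<^esub> x) # ys)
        = c \<odot>\<^bsub>tensor K Vs\<^esub> pure_tensor K Vs (xs @ x # ys)"
      unfolding pure_tensor_proj using linear_map_smult[OF tensor_proj_linear] g cx by simp
  qed
qed

text \<open>Pulled back along the projection from the free module, the equalizer of the two maps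
  contains all generators and is therefore everything; the projection is surjective.\<close>

lemma tensor_ext:
  assumes W: "module K W" and f: "linear_map K (tensor K Vs) W f" and g: "linear_map K (tensor K Vs) W g"
    and eq: "\<And>xs. xs \<in> tuples Vs \<Longrightarrow> f (pure_tensor K Vs xs) = g (pure_tensor K Vs xs)"
    and u: "u \<in> carrier (tensor K Vs)"
  shows "f u = g u"
proof -
  let ?F = "free_module K (tuples Vs)"
  obtain v where v: "v \<in> carrier ?F" "u = tensor_proj v" using u tensor_proj_surj by auto
  have "v \<in> {v \<in> carrier ?F. f (tensor_proj v) = g (tensor_proj v)}"
    by (rule free_module_generated[OF cring _ _ v(1)])
      (use eq free_gen_closed[OF cring] in \<open>auto simp: pure_tensor_proj intro!:
        submodule_equalizer[OF F.module_axioms W] linear_map_compose[OF f tensor_proj_linear]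
        linear_map_compose[OF g tensor_proj_linear]\<close>)
  then show ?thesis using v by simp
qed

text \<open>The universal property. Existence: the linear extension of \<open>\<phi>\<close> kills
  both kinds of relations and descends to the quotient. Uniqueness, which the definite description
  also needs: \<open>tensor_ext\<close> on the carrier, extensionality outside it.\<close>

lemma tensor_lift_in_hom:
  assumes W: "module K W" and \<phi>: "multilinear K Vs W \<phi>"
  shows "tensor_lift K Vs W \<phi> \<in> carrier (hom_module K (tensor K Vs) W) \<and>
     (\<forall>xs\<in>tuples Vs. tensor_lift K Vs W \<phi> (pure_tensor K Vs xs) = \<phi> xs)"
proof -
  interpret W: module K W by fact
  let ?F = "free_module K (tuples Vs)" and ?R = "module_span K (free_module K (tuples Vs)) (tensor_relations K Vs)"
  let ?L = "free_lift K W \<phi>"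
  have L: "linear_map K ?F W ?L"
    by (rule free_lift_linear[OF W multilinear_closed[OF \<phi>]])
  have Lg: "?L (free_gen K xs) = \<phi> xs" if "xs \<in> tuples Vs" for xs
    by (rule free_lift_gen[OF W multilinear_closed[OF \<phi>] that])
  have m: "module K (Vs ! i)" if "i < length Vs" for i using Vs that by simp
  have am: "abelian_monoid (Vs ! i)" if "i < length Vs" for i
    using m[OF that] by (simp add: module.axioms(2) abelian_group.axioms(1))
  note c = abelian_monoid.a_closed[OF am] module.smult_closed[OF m] tuples_update
  have Wz: "x \<ominus>\<^bsub>W\<^esub> x = \<zero>\<^bsub>W\<^esub>" if "x \<in> carrier W" for x
    using that by (simp add: a_minus_def W.r_neg)
  note fg = free_gen_closed[OF cring]
  have "?R \<subseteq> {v \<in> carrier ?F. ?L v = \<zero>\<^bsub>W\<^esub>}"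
  proof (rule module_span_minimal)
    show "submodule {v \<in> carrier ?F. ?L v = \<zero>\<^bsub>W\<^esub>} K ?F"
      by (rule submodule_equalizer[OF F.module_axioms W L linear_map_zero_fun[OF W]])
    have 1: "?L (free_gen K (xs[i := x \<oplus>\<^bsub>Vs ! i\<^esub> y]) \<ominus>\<^bsub>?F\<^esub>
        (free_gen K (xs[i := x]) \<oplus>\<^bsub>?F\<^esub> free_gen K (xs[i := y]))) = \<zero>\<^bsub>W\<^esub>"
      if "xs \<in> tuples Vs" "i < length Vs" "x \<in> carrier (Vs ! i)" "y \<in> carrier (Vs ! i)" for xs i x y
    proof -
      have "?L (free_gen K (xs[i := x \<oplus>\<^bsub>Vs ! i\<^esub> y]) \<ominus>\<^bsub>?F\<^esub>
          (free_gen K (xs[i := x]) \<oplus>\<^bsub>?F\<^esub> free_gen K (xs[i := y])))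
        = \<phi> (xs[i := x \<oplus>\<^bsub>Vs ! i\<^esub> y]) \<ominus>\<^bsub>W\<^esub> (\<phi> (xs[i := x]) \<oplus>\<^bsub>W\<^esub> \<phi> (xs[i := y]))"
      proof -
        have t: "xs[i := x \<oplus>\<^bsub>Vs ! i\<^esub> y] \<in> tuples Vs" "xs[i := x] \<in> tuples Vs" "xs[i := y] \<in> tuples Vs"
          using that(1,2) by (auto intro!: tuples_update c(1,2) that)
        show ?thesis
          unfolding linear_map_minus[OF F.module_axioms W L fg[OF t(1)] F.a_closed[OF fg[OF t(2)] fg[OF t(3)]]]
            linear_map_add[OF L fg[OF t(2)] fg[OF t(3)]] Lg[OF t(1)] Lg[OF t(2)] Lg[OF t(3)] ..
      qed
      also have "\<dots> = \<zero>\<^bsub>W\<^esub>"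
        unfolding linear_map_add[OF multilinear_update[OF \<phi> that(1,2)] that(3,4)]
        using multilinear_closed[OF \<phi> tuples_update[OF that(1,2)]] that by (intro Wz W.a_closed) auto
      finally show ?thesis .
    qed
    have 2: "?L (free_gen K (xs[i := a \<odot>\<^bsub>Vs ! i\<^esub> x]) \<ominus>\<^bsub>?F\<^esub>
        (a \<odot>\<^bsub>?F\<^esub> free_gen K (xs[i := x]))) = \<zero>\<^bsub>W\<^esub>"
      if "xs \<in> tuples Vs" "i < length Vs" "a \<in> carrier K" "x \<in> carrier (Vs ! i)" for xs i x a
    proof -
      have "?L (free_gen K (xs[i := a \<odot>\<^bsub>Vs ! i\<^esub> x]) \<ominus>\<^bsub>?F\<^esub>
          (a \<odot>\<^bsub>?F\<^esub> free_gen K (xs[i := x])))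
        = \<phi> (xs[i := a \<odot>\<^bsub>Vs ! i\<^esub> x]) \<ominus>\<^bsub>W\<^esub> (a \<odot>\<^bsub>W\<^esub> \<phi> (xs[i := x]))"
      proof -
        have t: "xs[i := a \<odot>\<^bsub>Vs ! i\<^esub> x] \<in> tuples Vs" "xs[i := x] \<in> tuples Vs"
          using that(1,2) by (auto intro!: tuples_update c(1,2) that)
        show ?thesis
          unfolding linear_map_minus[OF F.module_axioms W L fg[OF t(1)] F.smult_closed[OF that(3) fg[OF t(2)]]]
            linear_map_smult[OF L that(3) fg[OF t(2)]] Lg[OF t(1)] Lg[OF t(2)] ..
      qed
      also have "\<dots> = \<zero>\<^bsub>W\<^esub>"
        unfolding linear_map_smult[OF multilinear_update[OF \<phi> that(1,2)] that(3,4)]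
        using multilinear_closed[OF \<phi> tuples_update[OF that(1,2)]] that by (intro Wz W.smult_closed) auto
      finally show ?thesis .
    qed
    show "tensor_relations K Vs \<subseteq> {v \<in> carrier ?F. ?L v = \<zero>\<^bsub>W\<^esub>}"
    proof (intro subsetI CollectI conjI)
      fix r assume r: "r \<in> tensor_relations K Vs"
      then show "r \<in> carrier ?F" using tensor_relations_closed by blast
      show "?L r = \<zero>\<^bsub>W\<^esub>"
        using r 1 2 unfolding tensor_relations_def Let_def by (auto simp del: free_module_simps)
    qed
  qed
  then have "\<And>v. v \<in> ?R \<Longrightarrow> ?L v = \<zero>\<^bsub>W\<^esub>" by blast
  then have "\<exists>G. linear_map K (tensor K Vs) W G \<and> (\<forall>v\<in>carrier ?F. G (tensor_proj v) = ?L v)"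
    unfolding tensor_def Let_def tensor_proj_def
    by (rule quotient_lift_exists[OF F.module_axioms tensor_span_submodule W L])
  then obtain G where G: "linear_map K (tensor K Vs) W G"
    "\<And>v. v \<in> carrier ?F \<Longrightarrow> G (tensor_proj v) = ?L v"
    by blast
  \<comment> \<open>Restriction makes the descended map extensional, as membership in
    \<open>hom_module\<close> demands.\<close>
  let ?G = "restrict G (carrier (tensor K Vs))"
  let ?P = "\<lambda>f. f \<in> carrier (hom_module K (tensor K Vs) W) \<and> (\<forall>xs\<in>tuples Vs. f (pure_tensor K Vs xs) = \<phi> xs)"
  have P: "?P ?G"
  proof (intro conjI ballI)
    show "?G \<in> carrier (hom_module K (tensor K Vs) W)"
      by (rule restrict_in_hom_module[OF module_tensor G(1)])
    fix xs assume xs: "xs \<in> tuples Vs"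
    show "?G (pure_tensor K Vs xs) = \<phi> xs"
      using pure_tensor_closed[OF xs] G(2)[OF fg[OF xs]] Lg[OF xs] by (simp add: pure_tensor_proj)
  qed
  have "f = ?G" if "?P f" for f
  proof (rule extensionalityI)
    show "f \<in> extensional (carrier (tensor K Vs))" "?G \<in> extensional (carrier (tensor K Vs))"
      using conjunct1[OF that] unfolding hom_module_carrier by auto
    fix u assume u: "u \<in> carrier (tensor K Vs)"
    have lin: "linear_map K (tensor K Vs) W f" "linear_map K (tensor K Vs) W ?G"
      using that P unfolding hom_module_carrier by blast+
    have "f (pure_tensor K Vs xs) = ?G (pure_tensor K Vs xs)" if xs: "xs \<in> tuples Vs" for xs
      using bspec[OF conjunct2[OF \<open>?P f\<close>] xs] bspec[OF conjunct2[OF P] xs] by (rule trans[OF _ sym])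
    then show "f u = ?G u" by (rule tensor_ext[OF W lin _ u])
  qed
  then have "\<exists>!f. ?P f" using P by blast
  from theI'[OF this] show ?thesis unfolding tensor_lift_def .
qed

lemma tensor_lift_linear:
  "\<lbrakk>module K W; multilinear K Vs W \<phi>\<rbrakk> \<Longrightarrow> linear_map K (tensor K Vs) W (tensor_lift K Vs W \<phi>)"
  using tensor_lift_in_hom[of W \<phi>] by (simp add: hom_module_carrier)

lemma tensor_lift_pure:
  "\<lbrakk>module K W; multilinear K Vs W \<phi>; xs \<in> tuples Vs\<rbrakk>
    \<Longrightarrow> tensor_lift K Vs W \<phi> (pure_tensor K Vs xs) = \<phi> xs"
  using tensor_lift_in_hom by blast

lemma tensor_lift_eqI:
  assumes "module K W" "linear_map K (tensor K Vs) W f" "u \<in> carrier (tensor K Vs)"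
    "\<And>xs. xs \<in> tuples Vs \<Longrightarrow> f (pure_tensor K Vs xs) = \<phi> xs" "multilinear K Vs W \<phi>"
  shows "tensor_lift K Vs W \<phi> u = f u"
  by (rule tensor_ext[OF assms(1) tensor_lift_linear[OF assms(1,5)] assms(2) _ assms(3)])
    (simp add: assms tensor_lift_pure)

text \<open>In each linearity condition both sides are linear in \<open>u\<close> and agree on pure
  tensors. This supplies linearity in an outer parameter when lifts are nested, as in
  \<open>cat\<close>, \<open>hpow_mult\<close> and iterated Sweedler sums.\<close>

lemma tensor_lift_linear_param:
  assumes U: "module K U" and W: "module K W" and \<phi>: "\<And>p. p \<in> carrier U \<Longrightarrow> multilinear K Vs W (\<phi> p)"
    and lin: "\<And>xs. xs \<in> tuples Vs \<Longrightarrow> linear_map K U W (\<lambda>p. \<phi> p xs)"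
    and u: "u \<in> carrier (tensor K Vs)"
  shows "linear_map K U W (\<lambda>p. tensor_lift K Vs W (\<phi> p) u)"
proof -
  interpret U: module K U by fact
  interpret W: module K W by fact
  note l = tensor_lift_linear[OF W \<phi>]
  show ?thesis
  proof (rule linear_mapI)
    fix p assume "p \<in> carrier U"
    then show "tensor_lift K Vs W (\<phi> p) u \<in> carrier W" using linear_map_closed[OF l u] by blast
  next
    fix p q assume pq: "p \<in> carrier U" "q \<in> carrier U"
    show "tensor_lift K Vs W (\<phi> (p \<oplus>\<^bsub>U\<^esub> q)) u
        = tensor_lift K Vs W (\<phi> p) u \<oplus>\<^bsub>W\<^esub> tensor_lift K Vs W (\<phi> q) u"
      by (rule tensor_lift_eqI[OF W linear_map_add_fun[OF W l l] u])
        (use pq \<phi> in \<open>auto simp: tensor_lift_pure[OF W] linear_map_add[OF lin]\<close>)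
  next
    fix c p assume cp: "c \<in> carrier K" "p \<in> carrier U"
    show "tensor_lift K Vs W (\<phi> (c \<odot>\<^bsub>U\<^esub> p)) u = c \<odot>\<^bsub>W\<^esub> tensor_lift K Vs W (\<phi> p) u"
      by (rule tensor_lift_eqI[OF W linear_map_smult_fun[OF W l] u])
        (use cp \<phi> in \<open>auto simp: tensor_lift_pure[OF W] linear_map_smult[OF lin]\<close>)
  qed
qed

end

section \<open>Splitting lists at a position\<close>

lemma list_split_one:
  assumes "i < length xs"
  obtains A x B where "xs = A @ x # B" "length A = i"
proof -
  have "xs = take i xs @ xs ! i # drop (Suc i) xs"
    using assms by (simp add: Cons_nth_drop_Suc)
  then show ?thesis using that[of "take i xs"] assms by simp
qed

lemma list_split_two:
  assumes "Suc i < length ts"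
  obtains A s t B where "ts = A @ s # t # B" "length A = i"
proof -
  have "ts = take i ts @ ts ! i # ts ! Suc i # drop (Suc (Suc i)) ts"
    using assms by (simp add: Cons_nth_drop_Suc)
  then show ?thesis using that[of "take i ts"] assms by simp
qed

section \<open>The cyclic nerve\<close>

locale cring_category = linear_category K C + K: cring K
  for K :: "('k, 'z) ring_scheme" and C :: "('k, 'o, 'm, 'x) lin_cat_scheme"
begin

text \<open>A tuple of objects together with composable morphisms is stored as a list of arrows
  \<open>((source, target), morphism)\<close>, so that faces, degeneracies and the cyclic operator become
  local operations on lists.\<close>

abbreviation (input) "src t \<equiv> fst (fst t)"
abbreviation (input) "tgt t \<equiv> snd (fst t)"

text \<open>Arrows are listed as they are written in a composite, so the head is applied last. A
  nonempty chain leads from \<open>y\<close>, the source of its last entry, to \<open>x\<close>, the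
  target of its head.\<close>

fun chain :: "'o \<Rightarrow> (('o \<times> 'o) \<times> 'm) list \<Rightarrow> 'o \<Rightarrow> bool" where
  "chain y [] x \<longleftrightarrow> y = x \<and> x \<in> Ob C"
| "chain y (t # ts) x \<longleftrightarrow> tgt t = x \<and> x \<in> Ob C \<and> snd t \<in> carrier (Hom C (src t) (tgt t)) \<and> chain y ts (src t)"

text \<open>Degree \<open>n\<close> means \<open>n + 1\<close> arrows; the base point
  \<open>x\<close> is the object \<open>X\<^sub>0\<close>, target of the first arrow and source of
  the last.\<close>

definition cchains :: "nat \<Rightarrow> (('o \<times> 'o) \<times> 'm) list set" where
  "cchains n = {ts. length ts = Suc n \<and> (\<exists>x. chain x ts x)}"

definition npure :: "(('o \<times> 'o) \<times> 'm) list \<Rightarrow> 'o list \<Rightarrow> ('m list \<Rightarrow> 'k) set" where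
  "npure ts = nerve_pure K C (map (\<lambda>t. tgt t) ts) (map snd ts)"

lemma chain_append: "chain y (as @ bs) x \<longleftrightarrow> (\<exists>z. chain z as x \<and> chain y bs z)"
proof (induction as arbitrary: x)
  case Nil
  have "chain y bs x \<Longrightarrow> x \<in> Ob C" by (cases bs) auto
  then show ?case by auto
qed auto

lemma chain_Ob: "chain y ts x \<Longrightarrow> x \<in> Ob C \<and> y \<in> Ob C"
  by (induction ts arbitrary: x) auto

lemma chain_replace:
  "chain y (A @ ((b, a), f) # B) x \<longleftrightarrow> chain a A x \<and> chain y B b \<and> a \<in> Ob C \<and> f \<in> carrier (Hom C b a)"
  by (auto simp: chain_append dest: chain_Ob)

lemma cchains_replace:
  "\<lbrakk>A @ ((b, a), f) # B \<in> cchains n; g \<in> carrier (Hom C b a)\<rbrakk> \<Longrightarrow> A @ ((b, a), g) # B \<in> cchains n"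
  by (auto simp: cchains_def chain_replace)

lemma cchains_slot:
  "A @ ((b, a), f) # B \<in> cchains n \<Longrightarrow> a \<in> Ob C \<and> b \<in> Ob C \<and> f \<in> carrier (Hom C b a)"
  by (auto simp: cchains_def chain_replace dest: chain_Ob)

lemma chain_src:
  "\<lbrakk>chain y ts x; ts \<noteq> []\<rbrakk> \<Longrightarrow> map (\<lambda>t. src t) ts = tl (map (\<lambda>t. tgt t) ts) @ [y] \<and> hd (map (\<lambda>t. tgt t) ts) = x"
proof (induction ts arbitrary: x)
  case (Cons t ts)
  then show ?case by (cases ts) auto
qed simp

lemma chain_mem:
  "\<lbrakk>chain y ts x; t \<in> set ts\<rbrakk> \<Longrightarrow> snd t \<in> carrier (Hom C (src t) (tgt t)) \<and> tgt t \<in> Ob C \<and> src t \<in> Ob C"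
  by (induction ts arbitrary: x) (auto dest: chain_Ob)

text \<open>This is the cyclic convention \<open>X\<^sub>n\<^sub>+\<^sub>1 = X\<^sub>0\<close> of
  \<open>cnth\<close>: the source of an arrow is the target of the next one, and the last source
  closes up with the first target.\<close>

lemma cchains_src:
  assumes "ts \<in> cchains n"
  shows "map (\<lambda>t. src t) ts = rotate1 (map (\<lambda>t. tgt t) ts)"
proof -
  obtain x where x: "chain x ts x" using assms by (auto simp: cchains_def)
  have "ts \<noteq> []" using assms by (auto simp: cchains_def)
  note x = x this
  then show ?thesis using chain_src[OF x] by (cases ts) auto
qed

lemma cchains_src_nth:
  assumes "ts \<in> cchains n" "i \<le> n"
  shows "src (ts ! i) = cnth (map (\<lambda>t. tgt t) ts) (Suc i)"
    and "tgt (ts ! i) = cnth (map (\<lambda>t. tgt t) ts) i"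
proof -
  have l: "length ts = Suc n" using assms(1) by (simp add: cchains_def)
  have "src (ts ! i) = map (\<lambda>t. src t) ts ! i" using l assms(2) by simp
  also have "\<dots> = cnth (map (\<lambda>t. tgt t) ts) (Suc i)"
    using l assms(2) unfolding cchains_src[OF assms(1)] by (simp add: nth_rotate1 cnth_def)
  finally show "src (ts ! i) = cnth (map (\<lambda>t. tgt t) ts) (Suc i)" .
  show "tgt (ts ! i) = cnth (map (\<lambda>t. tgt t) ts) i"
    using l assms(2) by (simp add: cnth_def)
qed

lemma cyc_homs_chain:
  assumes "ts \<in> cchains n"
  shows "cyc_homs C (map (\<lambda>t. tgt t) ts) = map (\<lambda>t. Hom C (src t) (tgt t)) ts"
proof (rule nth_equalityI)
  fix i assume "i < length (cyc_homs C (map (\<lambda>t. tgt t) ts))"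
  then have i: "i < length ts" by (simp add: cyc_homs_def)
  then have "i \<le> n" using assms by (simp add: cchains_def)
  note s = cchains_src_nth[OF assms this]
  show "cyc_homs C (map (\<lambda>t. tgt t) ts) ! i = map (\<lambda>t. Hom C (src t) (tgt t)) ts ! i"
    using i s by (simp add: cyc_homs_def)
qed (simp add: cyc_homs_def)

lemma cchains_tuples:
  assumes "ts \<in> cchains n"
  shows "map (\<lambda>t. tgt t) ts \<in> ob_tuples C n" "map snd ts \<in> tuples (cyc_homs C (map (\<lambda>t. tgt t) ts))"
proof -
  obtain x where x: "chain x ts x" "length ts = Suc n" using assms by (auto simp: cchains_def)
  show "map (\<lambda>t. tgt t) ts \<in> ob_tuples C n" using x chain_mem[OF x(1)] by (auto simp: ob_tuples_def)
  show "map snd ts \<in> tuples (cyc_homs C (map (\<lambda>t. tgt t) ts))"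
    unfolding cyc_homs_chain[OF assms] tuples_def
    using chain_mem[OF x(1)] by (auto simp: list_all2_conv_all_nth)
qed

lemma chain_zip:
  "\<lbrakk>length fs = length Xs; set Xs \<subseteq> Ob C; y \<in> Ob C; Xs \<noteq> [];
    \<And>i. i < length Xs \<Longrightarrow> fs ! i \<in> carrier (Hom C ((tl Xs @ [y]) ! i) (Xs ! i))\<rbrakk>
   \<Longrightarrow> chain y (zip (zip (tl Xs @ [y]) Xs) fs) (hd Xs)"
proof (induction Xs arbitrary: fs)
  case (Cons X Xs)
  then obtain f fs' where fs: "fs = f # fs'" "length fs' = length Xs" by (cases fs) auto
  have f: "f \<in> carrier (Hom C ((Xs @ [y]) ! 0) X)" using Cons.prems(5)[of 0] fs by simp
  have fs': "fs' ! i \<in> carrier (Hom C ((Xs @ [y]) ! Suc i) (Xs ! i))" if "i < length Xs" for i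
    using Cons.prems(5)[of "Suc i"] fs that by simp
  show ?case
  proof (cases Xs)
    case Nil
    then show ?thesis using fs f Cons.prems by simp
  next
    case (Cons X' Xs')
    have "chain y (zip (zip (tl Xs @ [y]) Xs) fs') (hd Xs)"
      by (rule Cons.IH) (use fs fs' Cons Cons.prems in auto)
    then show ?thesis using fs f Cons.prems Cons by simp
  qed
qed simp

text \<open>Converse of \<open>cchains_tuples\<close>: every pair of an object tuple and a fitting
  morphism tuple comes from a chain, so statements about all \<open>nerve_pure\<close> elements may
  be checked on chains.\<close>

lemma cchains_exist:
  assumes "Xs \<in> ob_tuples C n" "fs \<in> tuples (cyc_homs C Xs)"
  obtains ts where "ts \<in> cchains n" "map (\<lambda>t. tgt t) ts = Xs" "map snd ts = fs"
proof -
  have Xs: "length Xs = Suc n" "set Xs \<subseteq> Ob C" "Xs \<noteq> []" using assms by (auto simp: ob_tuples_def)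
  have fs: "length fs = length Xs" using tuples_length[OF assms(2)] by (simp add: cyc_homs_def)
  have rot: "rotate1 Xs = tl Xs @ [hd Xs]" using Xs(3) by (cases Xs) auto
  have mem: "fs ! i \<in> carrier (Hom C ((tl Xs @ [hd Xs]) ! i) (Xs ! i))" if "i < length Xs" for i
  proof -
    have "fs ! i \<in> carrier (cyc_homs C Xs ! i)"
      using that by (intro tuples_nth[OF assms(2)]) (simp add: cyc_homs_def)
    also have "cyc_homs C Xs ! i = Hom C ((tl Xs @ [hd Xs]) ! i) (Xs ! i)"
      using that unfolding rot[symmetric] by (simp add: cyc_homs_def nth_rotate1 cnth_def)
    finally show ?thesis .
  qed
  let ?ts = "zip (zip (tl Xs @ [hd Xs]) Xs) fs"
  have "chain (hd Xs) ?ts (hd Xs)"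
    by (rule chain_zip[OF fs Xs(2) _ Xs(3) mem]) (use Xs in auto)
  then have c: "?ts \<in> cchains n" using fs Xs by (auto simp: cchains_def)
  have len: "length (tl Xs @ [hd Xs]) = length Xs" using Xs(1) by simp
  have m: "map snd ?ts = fs"
    using fs len by simp
  have "map (\<lambda>t. tgt t) ?ts = map snd (map fst ?ts)" by simp
  also have "\<dots> = Xs" unfolding map_fst_zip_take using fs len by (simp add: map_snd_zip_take)
  finally show ?thesis using that[OF c _ m] by blast
qed

text \<open>Multilinearity when the factors depend on the chain: the endpoints of the slot stay
  fixed while its morphism varies.\<close>

definition chain_linear ::
  "nat \<Rightarrow> ('k, 'w, 'y) module_scheme \<Rightarrow> ((('o \<times> 'o) \<times> 'm) list \<Rightarrow> 'w) \<Rightarrow> bool" where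
  "chain_linear n W \<Phi> \<longleftrightarrow> (\<forall>ts\<in>cchains n. \<Phi> ts \<in> carrier W) \<and>
     (\<forall>A b a f B. A @ ((b, a), f) # B \<in> cchains n \<longrightarrow>
        linear_map K (Hom C b a) W (\<lambda>f. \<Phi> (A @ ((b, a), f) # B)))"

lemma module_cyc_homs: "\<lbrakk>Xs \<in> ob_tuples C n; V \<in> set (cyc_homs C Xs)\<rbrakk> \<Longrightarrow> module K V"
  by (auto simp: cyc_homs_def ob_tuples_def cnth_def subset_iff intro!: Hom_module)

lemma module_nerve_tensor: "Xs \<in> ob_tuples C n \<Longrightarrow> module K (tensor K (cyc_homs C Xs))"
  by (rule module_tensor[OF K.is_cring module_cyc_homs])

lemma module_nerve: "module K (nerve K C n)"
  unfolding nerve_def by (rule module_direct_sum[OF K.is_cring module_nerve_tensor])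

lemma chain_linear_multilinear:
  assumes \<Phi>: "chain_linear n W \<Phi>" and Xs: "Xs \<in> ob_tuples C n"
    and eq: "\<And>ts. ts \<in> cchains n \<Longrightarrow> \<phi> (map (\<lambda>t. tgt t) ts) (map snd ts) = \<Phi> ts"
  shows "multilinear K (cyc_homs C Xs) W (\<phi> Xs)"
proof (rule multilinearI)
  fix fs assume "fs \<in> tuples (cyc_homs C Xs)"
  then obtain ts where "ts \<in> cchains n" "map (\<lambda>t. tgt t) ts = Xs" "map snd ts = fs"
    using cchains_exist[OF Xs] by blast
  then show "\<phi> Xs fs \<in> carrier W" using eq[of ts] \<Phi> by (auto simp: chain_linear_def)
next
  fix As V Bs fs gs assume V: "cyc_homs C Xs = As @ V # Bs" and fs: "fs \<in> tuples As" and gs: "gs \<in> tuples Bs"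
  interpret V: module K V using module_cyc_homs[OF Xs] V by simp
  have tup: "fs @ f # gs \<in> tuples (cyc_homs C Xs)" if "f \<in> carrier V" for f
    using fs gs that V tuples_length[OF fs] by (simp add: tuples_append)
  \<comment> \<open>The zero morphism occupies the slot only to produce a chain; the objects and the
    other arrows do not depend on it.\<close>
  obtain ts where ts: "ts \<in> cchains n" "map (\<lambda>t. tgt t) ts = Xs" "map snd ts = fs @ \<zero>\<^bsub>V\<^esub> # gs"
    using cchains_exist[OF Xs tup[OF V.zero_closed]] by blast
  then obtain A t B where AB: "ts = A @ t # B" "map snd A = fs" "map snd B = gs"
    by (auto simp: map_eq_append_conv map_eq_Cons_conv)
  obtain b a f0 where t: "t = ((b, a), f0)" by (metis prod.exhaust)
  have c: "A @ ((b, a), f0) # B \<in> cchains n" using ts AB t by simp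
  have "As @ V # Bs = map (\<lambda>t. Hom C (src t) (tgt t)) A @ Hom C b a # map (\<lambda>t. Hom C (src t) (tgt t)) B"
    using cyc_homs_chain[OF c] ts(2) V AB t by auto
  moreover have "length As = length A" using tuples_length[OF fs] AB by auto
  ultimately have Veq: "V = Hom C b a" by auto
  have "linear_map K V W (\<lambda>f. \<Phi> (A @ ((b, a), f) # B))"
    using \<Phi> c unfolding chain_linear_def Veq by blast
  moreover have "\<phi> Xs (fs @ f # gs) = \<Phi> (A @ ((b, a), f) # B)" if "f \<in> carrier V" for f
  proof -
    have "A @ ((b, a), f) # B \<in> cchains n" using cchains_replace[OF c] that Veq by simp
    from eq[OF this] show ?thesis using ts(2) AB t by auto
  qed
  ultimately show "linear_map K V W (\<lambda>f. \<phi> Xs (fs @ f # gs))"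
    by (subst linear_map_cong[OF V.module_axioms])
qed

lemma npure_eq:
  assumes "ts \<in> cchains n"
  shows "npure ts = direct_sum_inj (ob_tuples C n) (\<lambda>Ys. tensor K (cyc_homs C Ys)) (map (\<lambda>t. tgt t) ts)
    (pure_tensor K (cyc_homs C (map (\<lambda>t. tgt t) ts)) (map snd ts))"
  using assms by (simp add: npure_def nerve_pure_def cchains_def)

lemma nerve_inj_linear:
  assumes "Xs \<in> ob_tuples C n"
  shows "linear_map K (tensor K (cyc_homs C Xs)) (nerve K C n)
    (direct_sum_inj (ob_tuples C n) (\<lambda>Ys. tensor K (cyc_homs C Ys)) Xs)"
  unfolding nerve_def
  by (rule direct_sum_inj_linear[OF K.is_cring module_nerve_tensor assms])

lemma npure_chain_linear: "chain_linear n (nerve K C n) npure"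
  unfolding chain_linear_def
proof (intro conjI ballI allI impI)
  fix ts assume ts: "ts \<in> cchains n"
  note X = cchains_tuples[OF ts]
  show "npure ts \<in> carrier (nerve K C n)" unfolding npure_eq[OF ts]
    by (intro linear_map_closed[OF nerve_inj_linear[OF X(1)]]
        pure_tensor_closed[OF K.is_cring module_cyc_homs[OF X(1)]] X)
next
  fix A b a f B assume c: "A @ ((b, a), f) # B \<in> cchains n"
  let ?Xs = "map (\<lambda>t. tgt t) (A @ ((b, a), f) # B)"
  note X = cchains_tuples[OF c]
  interpret M: module K "Hom C b a" using cchains_slot[OF c] Hom_module by blast
  have hom: "cyc_homs C ?Xs = map (\<lambda>t. Hom C (src t) (tgt t)) A @ Hom C b a # map (\<lambda>t. Hom C (src t) (tgt t)) B"
    using cyc_homs_chain[OF c] by simp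
  have "map snd A \<in> tuples (map (\<lambda>t. Hom C (src t) (tgt t)) A)"
    "map snd B \<in> tuples (map (\<lambda>t. Hom C (src t) (tgt t)) B)"
    using X(2) unfolding hom by (simp_all add: tuples_append)
  from multilinear_slot[OF pure_tensor_multilinear[OF K.is_cring module_cyc_homs[OF X(1)], unfolded hom] this]
  have "linear_map K (Hom C b a) (tensor K (cyc_homs C ?Xs))
      (\<lambda>g. pure_tensor K (cyc_homs C ?Xs) (map snd A @ g # map snd B))"
    unfolding hom by simp
  from linear_map_compose[OF nerve_inj_linear[OF X(1)] this]
  show "linear_map K (Hom C b a) (nerve K C n) (\<lambda>f. npure (A @ ((b, a), f) # B))"
  proof (subst linear_map_cong[OF M.module_axioms])
    fix g assume "g \<in> carrier (Hom C b a)"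
    from npure_eq[OF cchains_replace[OF c this]]
    show "npure (A @ ((b, a), g) # B) = direct_sum_inj (ob_tuples C n) (\<lambda>Ys. tensor K (cyc_homs C Ys)) ?Xs
        (pure_tensor K (cyc_homs C ?Xs) (map snd A @ g # map snd B))" by simp
  qed
qed

lemma npure_closed: "ts \<in> cchains n \<Longrightarrow> npure ts \<in> carrier (nerve K C n)"
  using npure_chain_linear unfolding chain_linear_def by blast

text \<open>Two reductions: the summands generate the direct sum, and inside a summand the pure
  tensors suffice.\<close>

lemma nerve_ext:
  assumes W: "module K W" and F: "linear_map K (nerve K C n) W F" and G: "linear_map K (nerve K C n) W G"
    and eq: "\<And>ts. ts \<in> cchains n \<Longrightarrow> F (npure ts) = G (npure ts)"
    and u: "u \<in> carrier (nerve K C n)"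
  shows "F u = G u"
proof -
  let ?V = "\<lambda>Ys. tensor K (cyc_homs C Ys)"
  have "u \<in> {u \<in> carrier (nerve K C n). F u = G u}"
    unfolding nerve_def
  proof (rule direct_sum_generated[OF K.is_cring module_nerve_tensor])
    show "submodule {u \<in> carrier (direct_sum (ob_tuples C n) ?V). F u = G u} K (direct_sum (ob_tuples C n) ?V)"
      using submodule_equalizer[OF module_nerve W F G] unfolding nerve_def .
    show "u \<in> carrier (direct_sum (ob_tuples C n) ?V)" using u unfolding nerve_def .
  next
    fix Xs v assume Xs: "Xs \<in> ob_tuples C n" and v: "v \<in> carrier (?V Xs)"
    note i = nerve_inj_linear[OF Xs]
    have "F (direct_sum_inj (ob_tuples C n) ?V Xs v) = G (direct_sum_inj (ob_tuples C n) ?V Xs v)"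
    proof (rule tensor_ext[OF K.is_cring module_cyc_homs[OF Xs] W linear_map_compose[OF F i]
          linear_map_compose[OF G i] _ v])
      fix fs assume "fs \<in> tuples (cyc_homs C Xs)"
      then obtain ts where ts: "ts \<in> cchains n" "map (\<lambda>t. tgt t) ts = Xs" "map snd ts = fs"
        using cchains_exist[OF Xs] by blast
      from eq[OF ts(1)] show "F (direct_sum_inj (ob_tuples C n) ?V Xs (pure_tensor K (cyc_homs C Xs) fs))
          = G (direct_sum_inj (ob_tuples C n) ?V Xs (pure_tensor K (cyc_homs C Xs) fs))"
        unfolding npure_eq[OF ts(1)] ts(2,3) .
    qed
    then show "direct_sum_inj (ob_tuples C n) ?V Xs v
        \<in> {u \<in> carrier (direct_sum (ob_tuples C n) ?V). F u = G u}"
      using linear_map_closed[OF i v] unfolding nerve_def by blast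
  qed
  then show ?thesis by blast
qed

lemma nerve_lift_in_hom:
  assumes W: "module K W" and \<Phi>: "chain_linear n W \<Phi>"
    and eq: "\<And>ts. ts \<in> cchains n \<Longrightarrow> \<phi> (map (\<lambda>t. tgt t) ts) (map snd ts) = \<Phi> ts"
  shows "nerve_lift K C n W \<phi> \<in> carrier (hom_module K (nerve K C n) W) \<and>
    (\<forall>ts\<in>cchains n. nerve_lift K C n W \<phi> (npure ts) = \<Phi> ts)"
proof -
  let ?V = "\<lambda>Ys. tensor K (cyc_homs C Ys)"
  note ml = chain_linear_multilinear[OF \<Phi> _ eq]
  note mod = K.is_cring module_cyc_homs
  have "\<exists>G. linear_map K (direct_sum (ob_tuples C n) ?V) W G \<and>
    (\<forall>Xs\<in>ob_tuples C n. \<forall>x\<in>carrier (?V Xs). G (direct_sum_inj (ob_tuples C n) ?V Xs x)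
       = tensor_lift K (cyc_homs C Xs) W (\<phi> Xs) x)"
    by (rule direct_sum_lift_exists[OF K.is_cring module_nerve_tensor W tensor_lift_linear[OF mod W ml]])
  then obtain G where G: "linear_map K (nerve K C n) W G"
    "\<And>Xs x. \<lbrakk>Xs \<in> ob_tuples C n; x \<in> carrier (?V Xs)\<rbrakk> \<Longrightarrow> G (direct_sum_inj (ob_tuples C n) ?V Xs x)
       = tensor_lift K (cyc_homs C Xs) W (\<phi> Xs) x" unfolding nerve_def by blast
  have GP: "G (npure ts) = \<Phi> ts" if ts: "ts \<in> cchains n" for ts
  proof -
    note X = cchains_tuples[OF ts]
    have "G (npure ts) = tensor_lift K (cyc_homs C (map (\<lambda>t. tgt t) ts)) W (\<phi> (map (\<lambda>t. tgt t) ts))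
        (pure_tensor K (cyc_homs C (map (\<lambda>t. tgt t) ts)) (map snd ts))"
      unfolding npure_eq[OF ts]
      by (rule G(2)[OF X(1)]) (rule pure_tensor_closed[OF K.is_cring module_cyc_homs[OF X(1)] X(2)])
    also have "\<dots> = \<phi> (map (\<lambda>t. tgt t) ts) (map snd ts)"
      by (rule tensor_lift_pure[OF K.is_cring _ W ml[OF X(1)] X(2)]) (rule module_cyc_homs[OF X(1)])
    finally have "G (npure ts) = \<phi> (map (\<lambda>t. tgt t) ts) (map snd ts)" .
    then show ?thesis using eq[OF ts] by simp
  qed
  let ?G = "restrict G (carrier (nerve K C n))"
  let ?P = "\<lambda>F. F \<in> carrier (hom_module K (nerve K C n) W) \<and>
     (\<forall>Xs\<in>ob_tuples C n. \<forall>fs\<in>tuples (cyc_homs C Xs). F (nerve_pure K C Xs fs) = \<phi> Xs fs)"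
  \<comment> \<open>The predicate described by \<open>nerve_lift\<close> speaks of object and
    morphism tuples; in this form it speaks of chains, where \<open>\<Phi>\<close> is given.\<close>
  have P: "?P F \<longleftrightarrow> F \<in> carrier (hom_module K (nerve K C n) W) \<and> (\<forall>ts\<in>cchains n. F (npure ts) = \<Phi> ts)" for F
  proof (rule conj_cong[OF refl], rule iffI)
    assume *: "\<forall>Xs\<in>ob_tuples C n. \<forall>fs\<in>tuples (cyc_homs C Xs). F (nerve_pure K C Xs fs) = \<phi> Xs fs"
    show "\<forall>ts\<in>cchains n. F (npure ts) = \<Phi> ts"
    proof
      fix ts assume ts: "ts \<in> cchains n"
      note X = cchains_tuples[OF ts]
      show "F (npure ts) = \<Phi> ts" unfolding npure_def using *[rule_format, OF X] eq[OF ts] by (rule trans)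
    qed
  next
    assume *: "\<forall>ts\<in>cchains n. F (npure ts) = \<Phi> ts"
    show "\<forall>Xs\<in>ob_tuples C n. \<forall>fs\<in>tuples (cyc_homs C Xs). F (nerve_pure K C Xs fs) = \<phi> Xs fs"
    proof (intro ballI)
      fix Xs fs assume X: "Xs \<in> ob_tuples C n" "fs \<in> tuples (cyc_homs C Xs)"
      then obtain ts where ts: "ts \<in> cchains n" "map (\<lambda>t. tgt t) ts = Xs" "map snd ts = fs"
        using cchains_exist[OF X] by blast
      show "F (nerve_pure K C Xs fs) = \<phi> Xs fs"
        using *[rule_format, OF ts(1)] eq[OF ts(1)] unfolding npure_def ts(2,3) by simp
    qed
  qed
  have PG: "?P ?G" unfolding P
  proof (intro conjI ballI)
    show "?G \<in> carrier (hom_module K (nerve K C n) W)" by (rule restrict_in_hom_module[OF module_nerve G(1)])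
    show "?G (npure ts) = \<Phi> ts" if "ts \<in> cchains n" for ts
      using GP[OF that] npure_closed[OF that] by simp
  qed
  have "F = ?G" if F: "?P F" for F
  proof (rule extensionalityI)
    note F' = iffD1[OF P F, unfolded hom_module_carrier] and G' = iffD1[OF P PG, unfolded hom_module_carrier]
    show "F \<in> extensional (carrier (nerve K C n))" "?G \<in> extensional (carrier (nerve K C n))"
      using conjunct1[OF conjunct1[OF F']] by auto
    fix u assume u: "u \<in> carrier (nerve K C n)"
    show "F u = ?G u"
    proof (rule nerve_ext[OF W _ _ _ u])
      show "linear_map K (nerve K C n) W F" "linear_map K (nerve K C n) W ?G" using F' G' by blast+
      show "F (npure ts) = ?G (npure ts)" if "ts \<in> cchains n" for ts
        using bspec[OF conjunct2[OF F'] that] bspec[OF conjunct2[OF G'] that] by (rule trans[OF _ sym])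
    qed
  qed
  then have "\<exists>!F. ?P F" using PG by blast
  from theI'[OF this] have "?P (nerve_lift K C n W \<phi>)" unfolding nerve_lift_def .
  then show ?thesis unfolding P .
qed

lemma nerve_lift_linear:
  assumes "module K W" "chain_linear n W \<Phi>"
    and "\<And>ts. ts \<in> cchains n \<Longrightarrow> \<phi> (map (\<lambda>t. tgt t) ts) (map snd ts) = \<Phi> ts"
  shows "linear_map K (nerve K C n) W (nerve_lift K C n W \<phi>)"
  using nerve_lift_in_hom[OF assms] unfolding hom_module_carrier by blast

lemma nerve_lift_npure:
  assumes "module K W" "chain_linear n W \<Phi>"
    and "\<And>ts. ts \<in> cchains n \<Longrightarrow> \<phi> (map (\<lambda>t. tgt t) ts) (map snd ts) = \<Phi> ts" "ts \<in> cchains n"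
  shows "nerve_lift K C n W \<phi> (npure ts) = \<Phi> ts"
  using nerve_lift_in_hom[OF assms(1-3)] assms(4) by blast

end

section \<open>Faces, degeneracies and rotation as operations on chains\<close>

context cring_category begin

definition comp_arrow :: "('o \<times> 'o) \<times> 'm \<Rightarrow> ('o \<times> 'o) \<times> 'm \<Rightarrow> ('o \<times> 'o) \<times> 'm" where
  "comp_arrow s t = ((src t, tgt s), Comp C (src t) (src s) (tgt s) (snd s) (snd t))"

definition id_arrow :: "'o \<Rightarrow> ('o \<times> 'o) \<times> 'm" where
  "id_arrow x = ((x, x), Id C x)"

definition cface :: "nat \<Rightarrow> (('o \<times> 'o) \<times> 'm) list \<Rightarrow> (('o \<times> 'o) \<times> 'm) list" where
  "cface i ts = take i ts @ comp_arrow (ts ! i) (ts ! Suc i) # drop (i + 2) ts"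

text \<open>The identity is taken at the source of the \<open>i\<close>-th arrow. For
  \<open>i = n\<close> that source is \<open>X\<^sub>0\<close> and the identity lands at the end, so
  the last degeneracy needs no clause of its own.\<close>

definition cdeg :: "nat \<Rightarrow> (('o \<times> 'o) \<times> 'm) list \<Rightarrow> (('o \<times> 'o) \<times> 'm) list" where
  "cdeg i ts = take (Suc i) ts @ id_arrow (src (ts ! i)) # drop (Suc i) ts"

definition crot :: "'a list \<Rightarrow> 'a list" where
  "crot ts = last ts # butlast ts"

text \<open>The last face composes the last arrow with the first across the base point. One rotation
  makes these two adjacent at the front, so it is face 0 of the rotated chain.\<close>

definition cface' :: "nat \<Rightarrow> (('o \<times> 'o) \<times> 'm) list \<Rightarrow> (('o \<times> 'o) \<times> 'm) list" where
  "cface' i ts = (if Suc i < length ts then cface i ts else cface 0 (crot ts))"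

lemma cface_append: "length A = i \<Longrightarrow> cface i (A @ s # t # B) = A @ comp_arrow s t # B"
  by (auto simp: cface_def nth_append)

lemma cdeg_append: "length A = i \<Longrightarrow> cdeg i (A @ t # B) = A @ t # id_arrow (src t) # B"
  by (auto simp: cdeg_def nth_append)

lemma crot_snoc [simp]: "crot (ts @ [t]) = t # ts"
  by (simp add: crot_def)

lemma arrow_simps [simp]:
  "fst (comp_arrow s t) = (src t, tgt s)"
  "snd (comp_arrow s t) = Comp C (src t) (src s) (tgt s) (snd s) (snd t)"
  "fst (id_arrow x) = (x, x)" "snd (id_arrow x) = Id C x"
  by (simp_all add: comp_arrow_def id_arrow_def)

lemma Comp_closed:
  assumes "X \<in> Ob C" "Y \<in> Ob C" "Z \<in> Ob C" "f \<in> carrier (Hom C X Y)" "g \<in> carrier (Hom C Y Z)"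
  shows "Comp C X Y Z g f \<in> carrier (Hom C X Z)"
  using linear_map_closed[OF Comp_linear_right[OF assms(1-3,5)] assms(4)] .

lemma chain_comp:
  "chain y (A @ s # t # B) x \<Longrightarrow> chain y (A @ comp_arrow s t # B) x"
  by (auto simp: chain_append dest!: chain_Ob intro!: Comp_closed) 

lemma chain_id:
  "chain y (A @ t # B) x \<Longrightarrow> chain y (A @ t # id_arrow (src t) # B) x"
  by (auto simp: chain_append dest: chain_Ob intro!: Id_closed)

lemma cface_cchains:
  assumes "ts \<in> cchains (Suc n)" "i \<le> n"
  shows "cface i ts \<in> cchains n"
proof -
  have "Suc i < length ts" using assms by (simp add: cchains_def)
  then obtain A s t B where ts: "ts = A @ s # t # B" "length A = i" by (rule list_split_two)
  obtain x where "chain x ts x" using assms by (auto simp: cchains_def)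
  then have "chain x (A @ comp_arrow s t # B) x" unfolding ts(1) by (rule chain_comp)
  then show ?thesis using assms(1) unfolding ts(1) cface_append[OF ts(2)]
    by (auto simp: cchains_def)
qed

lemma cdeg_cchains:
  assumes "ts \<in> cchains n" "i \<le> n"
  shows "cdeg i ts \<in> cchains (Suc n)"
proof -
  have "i < length ts" using assms by (simp add: cchains_def)
  then obtain A t B where ts: "ts = A @ t # B" "length A = i" by (rule list_split_one)
  obtain x where "chain x ts x" using assms by (auto simp: cchains_def)
  then have "chain x (A @ t # id_arrow (src t) # B) x" unfolding ts(1) by (rule chain_id)
  then show ?thesis using assms(1) unfolding ts(1) cdeg_append[OF ts(2)]
    by (auto simp: cchains_def)
qed

lemma cchains_snoc:
  assumes "ts \<in> cchains n"
  obtains A t where "ts = A @ [t]" "length A = n" "crot ts = t # A"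
  using assms by (cases ts rule: rev_cases) (auto simp: cchains_def)

lemma crot_cchains:
  assumes "ts \<in> cchains n"
  shows "crot ts \<in> cchains n"
proof -
  obtain A t where ts: "ts = A @ [t]" "length A = n" "crot ts = t # A"
    using assms by (rule cchains_snoc)
  then obtain x where "chain x (A @ [t]) x" using assms by (auto simp: cchains_def)
  \<comment> \<open>Rotation moves the base point from \<open>x\<close> to the target of the former
    last arrow.\<close>
  then have "chain (tgt t) (t # A) (tgt t)" by (auto simp: chain_append)
  then show ?thesis using ts by (auto simp: cchains_def)
qed

lemma cface'_cchains:
  assumes "ts \<in> cchains (Suc n)"
  shows "cface' i ts \<in> cchains n"
  using assms cface_cchains[of ts n i] cface_cchains[OF crot_cchains[OF assms], of 0]
  unfolding cface'_def by (auto simp: cchains_def)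

text \<open>\<open>chain_op n m op\<close> says that \<open>op\<close> moves every slot of a chain to one slot of the result,
  acting linearly on it; this makes precomposition with \<open>op\<close> preserve multilinearity.\<close>

definition chain_op ::
  "nat \<Rightarrow> nat \<Rightarrow> ((('o \<times> 'o) \<times> 'm) list \<Rightarrow> (('o \<times> 'o) \<times> 'm) list) \<Rightarrow> bool" where
  "chain_op n m op \<longleftrightarrow> (\<forall>ts\<in>cchains n. op ts \<in> cchains m) \<and>
     (\<forall>A b a f B. A @ ((b, a), f) # B \<in> cchains n \<longrightarrow>
        (\<exists>A' b' a' B' g. linear_map K (Hom C b a) (Hom C b' a') g \<and>
          (\<forall>f\<in>carrier (Hom C b a). op (A @ ((b, a), f) # B) = A' @ ((b', a'), g f) # B')))"

lemma chain_linear_op: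
  assumes \<Phi>: "chain_linear m W \<Phi>" and op: "chain_op n m op"
  shows "chain_linear n W (\<lambda>ts. \<Phi> (op ts))"
  unfolding chain_linear_def
proof (intro conjI ballI allI impI)
  show "\<Phi> (op ts) \<in> carrier W" if "ts \<in> cchains n" for ts
    using assms that unfolding chain_linear_def chain_op_def by blast
next
  fix A b a f B assume c: "A @ ((b, a), f) # B \<in> cchains n"
  interpret M: module K "Hom C b a" using cchains_slot[OF c] Hom_module by blast
  obtain A' b' a' B' g where g: "linear_map K (Hom C b a) (Hom C b' a') g"
    "\<And>f. f \<in> carrier (Hom C b a) \<Longrightarrow> op (A @ ((b, a), f) # B) = A' @ ((b', a'), g f) # B'"
    using op c unfolding chain_op_def by blast
  have "A' @ ((b', a'), g f) # B' \<in> cchains m"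
    using op c cchains_slot[OF c] g(2) unfolding chain_op_def by metis
  then have "linear_map K (Hom C b' a') W (\<lambda>f. \<Phi> (A' @ ((b', a'), f) # B'))"
    using \<Phi> unfolding chain_linear_def by blast
  from linear_map_compose[OF this g(1)]
  show "linear_map K (Hom C b a) W (\<lambda>f. \<Phi> (op (A @ ((b, a), f) # B)))"
    by (subst linear_map_cong[OF M.module_axioms]) (simp_all add: g(2))
qed

lemma chain_op_compose:
  assumes "chain_op n m op" "chain_op m k op'"
  shows "chain_op n k (\<lambda>ts. op' (op ts))"
  unfolding chain_op_def
proof (intro conjI ballI allI impI)
  show "op' (op ts) \<in> cchains k" if "ts \<in> cchains n" for ts
    using assms that unfolding chain_op_def by blast
next
  fix A b a f B assume c: "A @ ((b, a), f) # B \<in> cchains n"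
  obtain A' b' a' B' g where g: "linear_map K (Hom C b a) (Hom C b' a') g"
    "\<And>f. f \<in> carrier (Hom C b a) \<Longrightarrow> op (A @ ((b, a), f) # B) = A' @ ((b', a'), g f) # B'"
    using assms(1) c unfolding chain_op_def by blast
  have "A' @ ((b', a'), g f) # B' \<in> cchains m"
    using assms(1) c cchains_slot[OF c] g(2) unfolding chain_op_def by metis
  then obtain A'' b'' a'' B'' g' where g': "linear_map K (Hom C b' a') (Hom C b'' a'') g'"
    "\<And>f. f \<in> carrier (Hom C b' a') \<Longrightarrow> op' (A' @ ((b', a'), f) # B') = A'' @ ((b'', a''), g' f) # B''"
    using assms(2) unfolding chain_op_def by blast
  show "\<exists>A' b' a' B' g. linear_map K (Hom C b a) (Hom C b' a') g \<and>
      (\<forall>f\<in>carrier (Hom C b a). op' (op (A @ ((b, a), f) # B)) = A' @ ((b', a'), g f) # B')"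
    by (rule exI[of _ A''], rule exI[of _ b''], rule exI[of _ a''], rule exI[of _ B''],
        rule exI[of _ "\<lambda>f. g' (g f)"])
      (simp add: g(2) g'(2) linear_map_closed[OF g(1)] linear_map_compose[OF g'(1) g(1)])
qed

lemma chain_op_slotI:
  assumes "linear_map K (Hom C b a) (Hom C b' a') g"
    "\<And>f. f \<in> carrier (Hom C b a) \<Longrightarrow> op (A @ ((b, a), f) # B) = A' @ ((b', a'), g f) # B'"
  shows "\<exists>A' b' a' B' g. linear_map K (Hom C b a) (Hom C b' a') g \<and>
      (\<forall>f\<in>carrier (Hom C b a). op (A @ ((b, a), f) # B) = A' @ ((b', a'), g f) # B')"
  using assms by blast

lemma chain_op_crot: "chain_op n n crot"
  unfolding chain_op_def
proof (intro conjI ballI allI impI)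
  fix A b a f B assume c: "A @ ((b, a), f) # B \<in> cchains n"
  show "\<exists>A' b' a' B' g. linear_map K (Hom C b a) (Hom C b' a') g \<and>
      (\<forall>f\<in>carrier (Hom C b a). crot (A @ ((b, a), f) # B) = A' @ ((b', a'), g f) # B')"
  proof (cases B rule: rev_cases)
    case Nil
    show ?thesis
      by (rule chain_op_slotI[where A' = "[]" and B' = A, OF linear_map_ident]) (simp add: Nil)
  next
    case (snoc B' t)
    show ?thesis
      by (rule chain_op_slotI[where A' = "t # A" and B' = B', OF linear_map_ident])
        (use crot_snoc[of "A @ ((b, a), _) # B'" t] snoc in simp)
  qed
qed (rule crot_cchains)

lemma append_Cons_eq_two:
  assumes "A @ x # B = P @ s # t # Q"
  shows "(\<exists>R. A @ x # R = P \<and> B = R @ s # t # Q) \<or> (A = P \<and> x = s \<and> B = t # Q) \<or>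
    (A = P @ [s] \<and> x = t \<and> B = Q) \<or> (\<exists>R. A = P @ s # t # R \<and> Q = R @ x # B)"
  using assms by (auto simp: append_eq_append_conv2 append_eq_Cons_conv Cons_eq_append_conv)

lemma append_Cons_eq_one:
  assumes "A @ x # B = P @ t # Q"
  shows "(\<exists>R. A @ x # R = P \<and> B = R @ t # Q) \<or> (A = P \<and> x = t \<and> B = Q) \<or>
    (\<exists>R. A = P @ t # R \<and> Q = R @ x # B)"
  using assms by (auto simp: append_eq_append_conv2 append_eq_Cons_conv Cons_eq_append_conv)

text \<open>The slot either lies outside the composed pair and is carried along unchanged, or is one
  of its two members, where linearity of composition in that argument applies.\<close>

lemma chain_op_cface:
  assumes "i \<le> n"
  shows "chain_op (Suc n) n (cface i)"
  unfolding chain_op_def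
proof (intro conjI ballI allI impI)
  show "cface i ts \<in> cchains n" if "ts \<in> cchains (Suc n)" for ts
    using cface_cchains[OF that assms] .
next
  fix A b a f B assume c: "A @ ((b, a), f) # B \<in> cchains (Suc n)"
  then have "Suc i < length (A @ ((b, a), f) # B)" using assms by (simp add: cchains_def)
  then obtain P s t Q where PQ: "A @ ((b, a), f) # B = P @ s # t # Q" "length P = i" by (rule list_split_two)
  note cs = cchains_slot[OF c]
  from append_Cons_eq_two[OF PQ(1)]
  consider R where "A @ ((b, a), f) # R = P" "B = R @ s # t # Q" | "A = P" "B = t # Q"
    | "A = P @ [s]" "B = Q" | R where "A = P @ s # t # R" by blast
  then show "\<exists>A' b' a' B' g. linear_map K (Hom C b a) (Hom C b' a') g \<and>
      (\<forall>f\<in>carrier (Hom C b a). cface i (A @ ((b, a), f) # B) = A' @ ((b', a'), g f) # B')"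
  proof cases
    case 1
    have l: "length (A @ ((b, a), h) # R) = i" for h using 1 PQ by auto
    show ?thesis
      by (rule chain_op_slotI[where A' = A and B' = "R @ comp_arrow s t # Q", OF linear_map_ident])
        (use cface_append[OF l, of _ s t Q] 1 in simp)
  next
    case 2
    obtain d e k where t: "t = ((d, e), k)" by (metis prod.exhaust)
    have "d \<in> Ob C" "e = b" "k \<in> carrier (Hom C d b)"
      using c by (auto simp: cchains_def 2 t chain_append dest: chain_Ob)
    then have "linear_map K (Hom C b a) (Hom C d a) (\<lambda>f. Comp C d b a f k)"
      using cs by (intro Comp_linear_left) auto
    then show ?thesis
      by (rule chain_op_slotI[where A' = P and B' = Q])
        (simp add: 2 cface_append[OF PQ(2)] comp_arrow_def t)
  next
    case 3
    obtain d e k where s: "s = ((d, e), k)" by (metis prod.exhaust)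
    have "e \<in> Ob C" "d = a" "k \<in> carrier (Hom C a e)"
      using c by (auto simp: cchains_def 3 s chain_append dest: chain_Ob)
    then have "linear_map K (Hom C b a) (Hom C b e) (Comp C b a e k)"
      using cs by (intro Comp_linear_right) auto
    then show ?thesis
      by (rule chain_op_slotI[where A' = P and B' = Q])
        (simp add: 3 cface_append[OF PQ(2)] comp_arrow_def s \<open>d = a\<close>)
  next
    case 4
    show ?thesis
      by (rule chain_op_slotI[where A' = "P @ comp_arrow s t # R" and B' = B, OF linear_map_ident])
        (simp add: 4 cface_append[OF PQ(2)])
  qed
qed

lemma chain_op_cdeg:
  assumes "i \<le> n"
  shows "chain_op n (Suc n) (cdeg i)"
  unfolding chain_op_def
proof (intro conjI ballI allI impI)
  show "cdeg i ts \<in> cchains (Suc n)" if "ts \<in> cchains n" for ts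
    using cdeg_cchains[OF that assms] .
next
  fix A b a f B assume c: "A @ ((b, a), f) # B \<in> cchains n"
  then have "i < length (A @ ((b, a), f) # B)" using assms by (simp add: cchains_def)
  then obtain P t Q where PQ: "A @ ((b, a), f) # B = P @ t # Q" "length P = i" by (rule list_split_one)
  from append_Cons_eq_one[OF PQ(1)]
  consider R where "A @ ((b, a), f) # R = P" "B = R @ t # Q" | "A = P" "B = Q"
    | R where "A = P @ t # R" by blast
  then show "\<exists>A' b' a' B' g. linear_map K (Hom C b a) (Hom C b' a') g \<and>
      (\<forall>f\<in>carrier (Hom C b a). cdeg i (A @ ((b, a), f) # B) = A' @ ((b', a'), g f) # B')"
  proof cases
    case 1
    have l: "length (A @ ((b, a), h) # R) = i" for h using 1 PQ by auto
    show ?thesis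
      by (rule chain_op_slotI[where A' = A and B' = "R @ t # id_arrow (src t) # Q", OF linear_map_ident])
        (use cdeg_append[OF l, of _ t Q] 1 in simp)
  next
    \<comment> \<open>The inserted identity depends only on the source \<open>b\<close>, which stays
      fixed while the morphism in the slot varies.\<close>
    case 2
    show ?thesis
      by (rule chain_op_slotI[where A' = A and B' = "id_arrow b # Q", OF linear_map_ident])
        (simp add: 2 cdeg_append[OF PQ(2)])
  next
    case 3
    show ?thesis
      by (rule chain_op_slotI[where A' = "P @ t # id_arrow (src t) # R" and B' = B, OF linear_map_ident])
        (simp add: 3 cdeg_append[OF PQ(2)])
  qed
qed

lemma chain_op_cong:
  assumes "chain_op n m op'" and eq: "\<And>ts. ts \<in> cchains n \<Longrightarrow> op ts = op' ts"
  shows "chain_op n m op"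
proof -
  have "op (A @ ((b, a), f) # B) = op' (A @ ((b, a), f) # B)"
    if "A @ ((b, a), f0) # B \<in> cchains n" "f \<in> carrier (Hom C b a)" for A b a f0 f B
    using eq[OF cchains_replace[OF that]] .
  then show ?thesis using assms unfolding chain_op_def by (simp cong: conj_cong)
qed

lemma chain_op_cface': "chain_op (Suc n) n (cface' i)"
proof (cases "i \<le> n")
  case True
  then show ?thesis
    by (intro chain_op_cong[OF chain_op_cface]) (auto simp: cface'_def cchains_def)
next
  case False
  show ?thesis
    by (rule chain_op_cong[OF chain_op_compose[OF chain_op_crot chain_op_cface]])
      (use False in \<open>auto simp: cface'_def cchains_def\<close>)
qed

end

section \<open>Simplicial and cyclic identities on chains\<close>

context cring_category begin

lemma cface'_append: "length A = i \<Longrightarrow> cface' i (A @ s # t # B) = A @ comp_arrow s t # B"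
  unfolding cface'_def by (simp add: cface_append)

lemma cface'_last: "i = Suc (length M) \<Longrightarrow> cface' i (s # M @ [t]) = comp_arrow t s # M"
  using crot_snoc[of "s # M" t] cface_append[of "[]" 0 t s M]
  unfolding cface'_def by simp

lemma comp_arrow_assoc:
  assumes "chain y [r, s, t] x"
  shows "comp_arrow (comp_arrow r s) t = comp_arrow r (comp_arrow s t)"
  using assms Comp_assoc by (auto simp: comp_arrow_def)

lemma comp_arrow_id:
  assumes "chain y [t] x"
  shows "comp_arrow t (id_arrow (src t)) = t" "comp_arrow (id_arrow (tgt t)) t = t"
  using assms Id_left Id_right by (auto simp: comp_arrow_def id_arrow_def prod_eq_iff dest: chain_Ob)

lemma chain_arrow: "\<lbrakk>chain y ts x; t \<in> set ts\<rbrakk> \<Longrightarrow> chain (src t) [t] (tgt t)"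
  using chain_mem by auto

text \<open>For neighbouring indices the identity is associativity; for distant ones the two
  compositions do not meet. The last face behaves in the same way, except that the triple of arrows
  may straddle the base point.\<close>

lemma cface'_cface':
  assumes ts: "ts \<in> cchains (Suc (Suc n))" and ij: "i < j" "j \<le> Suc (Suc n)"
  shows "cface' i (cface' j ts) = cface' (j - 1) (cface' i ts)"
proof -
  obtain x where x: "chain x ts x" and len: "length ts = n + 3" using ts by (auto simp: cchains_def)
  consider "j = Suc i" "j \<le> Suc n" | "Suc i < j" "j \<le> Suc n" | "j = Suc (Suc n)" using ij by linarith
  then show ?thesis
  proof cases
    case 1
    have "Suc i < length ts" using 1 len by simp
    then obtain A r s B where A: "ts = A @ r # s # B" "length A = i" by (rule list_split_two)
    with 1 len obtain t D where B: "B = t # D" by (cases B) auto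
    have "chain (src t) [r, s, t] (tgt r)" using x by (auto simp: A B chain_append dest: chain_Ob)
    from comp_arrow_assoc[OF this] show ?thesis
      using cface'_append[of A i r s "t # D"] cface'_append[of "A @ [r]" j s t D] A 1
        cface'_append[of A i r "comp_arrow s t" D] cface'_append[of A i "comp_arrow r s" t D]
      by (simp add: A B)
  next
    case 2
    have "Suc j < length ts" using 2 len by simp
    then obtain P t u D where P: "ts = P @ t # u # D" "length P = j" by (rule list_split_two)
    have "Suc i < length P" using 2 P by simp
    then obtain A r s B where A: "P = A @ r # s # B" "length A = i" by (rule list_split_two)
    show ?thesis
      using cface'_append[of "A @ r # s # B" j t u D] cface'_append[of A i r s "B @ t # u # D"]
        cface'_append[of A i r s "B @ comp_arrow t u # D"]
        cface'_append[of "A @ comp_arrow r s # B" "j - 1" t u D] P A by simp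
  next
    case 3
    obtain s M0 where "ts = s # M0" using len by (cases ts) auto
    moreover obtain M t where "M0 = M @ [t]" using len calculation by (cases M0 rule: rev_cases) auto
    ultimately have M: "ts = s # M @ [t]" "length M = Suc n" using len by auto
    have st: "src t = tgt s" using x by (auto simp: M chain_append)
    have j: "cface' j ts = comp_arrow t s # M" using 3 M cface'_last[of j M s t] by simp
    have vt: "chain (src t) [t] (tgt t)" "chain (src s) [s] (tgt s)" by (rule chain_arrow[OF x], simp add: M)+
    consider "i = 0" | "0 < i" "i \<le> n" | "i = Suc n" using ij 3 by linarith
    then show ?thesis
    proof cases
      \<comment> \<open>Face 0 meets the last face in the first arrow: the triple is last, first,
        second.\<close>
      case 1
      obtain r M' where M': "M = r # M'" using M(2) by (cases M) auto
      have "src s = tgt r" using x by (auto simp: M M')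
      moreover have "chain (src r) [r] (tgt r)" by (rule chain_arrow[OF x]) (simp add: M M')
      ultimately have "chain (src r) [t, s, r] (tgt t)" using vt st by simp
      from comp_arrow_assoc[OF this] show ?thesis
        using cface'_append[of "[]" 0 "comp_arrow t s" r M'] cface'_append[of "[]" 0 s r "M' @ [t]"]
          cface'_last[of "j - 1" M' "comp_arrow s r" t] j 1 3 M M' by simp
    next
      case 2
      then obtain k where k: "i = Suc k" by (cases i) auto
      have "Suc k < length M" using 2 M k by simp
      then obtain A r u B where A: "M = A @ r # u # B" "length A = k" by (rule list_split_two)
      show ?thesis
        using cface'_append[of "comp_arrow t s # A" i r u B] cface'_append[of "s # A" i r u "B @ [t]"]
          cface'_last[of "j - 1" "A @ comp_arrow r u # B" s t] j 3 M A k by simp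
    next
      \<comment> \<open>Here the two faces meet in the last arrow: the triple is last but one, last,
        first.\<close>
      case 3
      obtain M' r where M': "M = M' @ [r]" using M(2) by (cases M rule: rev_cases) auto
      have "src r = tgt t" using x by (auto simp: M M' chain_append)
      moreover have "chain (src r) [r] (tgt r)" by (rule chain_arrow[OF x]) (simp add: M M')
      ultimately have "chain (src s) [r, t, s] (tgt r)" using vt st by simp
      from comp_arrow_assoc[OF this] show ?thesis
        using cface'_append[of "s # M'" i r t "[]"] cface'_last[of i M' "comp_arrow t s" r]
          cface'_last[of "j - 1" M' s "comp_arrow r t"] j 3 \<open>j = Suc (Suc n)\<close> M M' by simp
    qed
  qed
qed

lemma cdeg_cdeg:
  assumes ts: "ts \<in> cchains n" and ij: "i \<le> j" "j \<le> n"
  shows "cdeg i (cdeg j ts) = cdeg (Suc j) (cdeg i ts)"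
proof -
  have "j < length ts" using ts ij by (simp add: cchains_def)
  then obtain P t Q where P: "ts = P @ t # Q" "length P = j" by (rule list_split_one)
  show ?thesis
  proof (cases "i = j")
    case True
    then show ?thesis
      using cdeg_append[of P i t Q] cdeg_append[of P i t "id_arrow (src t) # Q"]
        cdeg_append[of "P @ [t]" "Suc i" "id_arrow (src t)" Q] P by simp
  next
    case False
    then have "i < length P" using ij P by simp
    then obtain A s B where A: "P = A @ s # B" "length A = i" by (rule list_split_one)
    show ?thesis
      using cdeg_append[of "A @ s # B" j t Q] cdeg_append[of A i s "B @ t # id_arrow (src t) # Q"]
        cdeg_append[of A i s "B @ t # Q"] cdeg_append[of "A @ s # id_arrow (src s) # B" "Suc j" t Q] P A
      by simp
  qed
qed

lemma cface'_cdeg_same: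
  assumes ts: "ts \<in> cchains n" and ij: "j \<le> n" "i = j \<or> i = Suc j"
  shows "cface' i (cdeg j ts) = ts"
proof -
  obtain x where x: "chain x ts x" using ts by (auto simp: cchains_def)
  have l: "length ts = Suc n" using ts by (simp add: cchains_def)
  then have "j < length ts" using ij by simp
  then obtain P t Q where P: "ts = P @ t # Q" "length P = j" by (rule list_split_one)
  have t: "chain (src t) [t] (tgt t)" by (rule chain_arrow[OF x]) (simp add: P)
  from ij(2) show ?thesis
  proof
    assume "i = j"
    then show ?thesis
      using cdeg_append[of P j t Q] cface'_append[of P j t "id_arrow (src t)" Q] P comp_arrow_id[OF t] by simp
  next
    assume i: "i = Suc j"
    show ?thesis
    proof (cases Q)
      case (Cons u D)
      have u: "chain (src u) [u] (tgt u)" by (rule chain_arrow[OF x]) (simp add: P Cons)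
      have "src t = tgt u" using x by (auto simp: P Cons chain_append)
      then show ?thesis using comp_arrow_id[OF u] i P Cons cdeg_append[of P j t Q]
          cface'_append[of "P @ [t]" i "id_arrow (src t)" u D] by simp
    next
      \<comment> \<open>The identity was appended at the very end, so face \<open>Suc j\<close> is
        the last face and composes it with the first arrow \<open>s\<close> across the base
        point.\<close>
      case Nil
      obtain s M where M: "ts = s # M" using l by (cases ts) auto
      have s: "chain (src s) [s] (tgt s)" by (rule chain_arrow[OF x]) (simp add: M)
      have "src t = x" using x by (auto simp: P Nil chain_append)
      moreover have "tgt s = x" using x by (auto simp: M)
      ultimately have "src t = tgt s" by simp
      moreover have "cface' i (P @ [t, id_arrow (src t)]) = comp_arrow (id_arrow (src t)) s # M"
      proof -
        have "length M = n" using l unfolding M by simp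
        moreover have "j = n" using l P(2) unfolding P(1) Nil by simp
        ultimately have ij: "i = Suc (length M)" using i by simp
        have "P @ [t] = s # M" using M P Nil by simp
        then have "(P @ [t]) @ [id_arrow (src t)] = (s # M) @ [id_arrow (src t)]" by (simp only:)
        then have e: "P @ [t, id_arrow (src t)] = s # M @ [id_arrow (src t)]" by simp
        show ?thesis unfolding e by (rule cface'_last[OF ij])
      qed
      moreover have "cdeg j ts = P @ [t, id_arrow (src t)]"
        using cdeg_append[of P j t "[]"] P Nil by simp
      ultimately show ?thesis using comp_arrow_id(2)[OF s] M by simp
    qed
  qed
qed

lemma cface'_cdeg_less:
  assumes ts: "ts \<in> cchains (Suc n)" and ij: "i \<le> j" "j \<le> n"
  shows "cface' i (cdeg (Suc j) ts) = cdeg j (cface' i ts)"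
proof -
  have "Suc j < length ts" using ts ij by (simp add: cchains_def)
  then obtain P t Q where P: "ts = P @ t # Q" "length P = Suc j" by (rule list_split_one)
  show ?thesis
  proof (cases "i = j")
    case True
    obtain A s where A: "P = A @ [s]" using P by (cases P rule: rev_cases) auto
    show ?thesis
      using cdeg_append[of "A @ [s]" "Suc j" t Q] cface'_append[of A i s t "id_arrow (src t) # Q"]
        cface'_append[of A i s t Q] cdeg_append[of A j "comp_arrow s t" Q] P A True by simp
  next
    case False
    then have "Suc i < length P" using ij P by simp
    then obtain A r s B where A: "P = A @ r # s # B" "length A = i" by (rule list_split_two)
    show ?thesis
      using cdeg_append[of "A @ r # s # B" "Suc j" t Q] cface'_append[of A i r s "B @ t # id_arrow (src t) # Q"]
        cface'_append[of A i r s "B @ t # Q"] cdeg_append[of "A @ comp_arrow r s # B" j t Q] P A by simp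
  qed
qed

lemma cface'_cdeg_greater:
  assumes ts: "ts \<in> cchains (Suc n)" and ij: "Suc j < i" "i \<le> Suc (Suc n)"
  shows "cface' i (cdeg j ts) = cdeg j (cface' (i - 1) ts)"
proof -
  have l: "length ts = Suc (Suc n)" using ts by (simp add: cchains_def)
  show ?thesis
  proof (cases "i = Suc (Suc n)")
    case False
    then obtain k where k: "i = Suc k" "Suc k < length ts" using ij l by (cases i) auto
    then obtain P t u D where P: "ts = P @ t # u # D" "length P = k" by (metis list_split_two)
    have "j < length P" using ij P k by simp
    then obtain A s B where A: "P = A @ s # B" "length A = j" by (rule list_split_one)
    show ?thesis
      using cdeg_append[of A j s "B @ t # u # D"] cface'_append[of "A @ s # id_arrow (src s) # B" i t u D]
        cface'_append[of "A @ s # B" k t u D] cdeg_append[of A j s "B @ comp_arrow t u # D"] P A k by simp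
  next
    case True
    obtain s M0 where "ts = s # M0" using l by (cases ts) auto
    moreover obtain M t where "M0 = M @ [t]" using l calculation by (cases M0 rule: rev_cases) auto
    ultimately have M: "ts = s # M @ [t]" "length M = n" using l by auto
    show ?thesis
    proof (cases j)
      case 0
      then show ?thesis using cdeg_append[of "[]" 0 s "M @ [t]"] cface'_last[of i "id_arrow (src s) # M" s t]
          cface'_last[of "i - 1" M s t] cdeg_append[of "[]" 0 "comp_arrow t s" M] M True by simp
    next
      case (Suc k)
      then have "k < length M" using ij M True by simp
      then obtain A r B where A: "M = A @ r # B" "length A = k" by (rule list_split_one)
      show ?thesis
        using cdeg_append[of "s # A" j r "B @ [t]"] cface'_last[of i "A @ r # id_arrow (src r) # B" s t]
          cface'_last[of "i - 1" M s t] cdeg_append[of "comp_arrow t s # A" j r B] M A True Suc by simp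
    qed
  qed
qed

lemma cface'_crot:
  assumes ts: "ts \<in> cchains (Suc n)" and i: "1 \<le> i" "i \<le> Suc n"
  shows "cface' i (crot ts) = crot (cface' (i - 1) ts)"
proof -
  obtain k where k: "i = Suc k" using i by (cases i) auto
  have "Suc k < length ts" using ts i k by (simp add: cchains_def)
  then obtain P t u D where P: "ts = P @ t # u # D" "length P = k" by (rule list_split_two)
  show ?thesis
  proof (cases D rule: rev_cases)
    \<comment> \<open>The composed pair ends the chain; rotation tears it apart to the two ends, and
      the last face joins it again.\<close>
    case Nil
    have "k = n" using P Nil ts by (simp add: cchains_def)
    show ?thesis using P Nil k crot_snoc[of "P @ [t]" u] crot_snoc[of P "comp_arrow t u"]
        cface'_append[of P k t u "[]"] cface'_last[of i P u t] by simp
  next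
    case (snoc D' v)
    show ?thesis using P snoc k crot_snoc[of "P @ t # u # D'" v] crot_snoc[of "P @ comp_arrow t u # D'" v]
        cface'_append[of P k t u D] cface'_append[of "v # P" i t u D'] by simp
  qed
qed

lemma cdeg_crot:
  assumes ts: "ts \<in> cchains n" and i: "1 \<le> i" "i \<le> n"
  shows "cdeg i (crot ts) = crot (cdeg (i - 1) ts)"
proof -
  obtain k where k: "i = Suc k" using i by (cases i) auto
  have "Suc k < length ts" using ts i k by (simp add: cchains_def)
  then obtain P t u D where P: "ts = P @ t # u # D" "length P = k" by (rule list_split_two)
  obtain D' v where D: "u # D = D' @ [v]" by (metis append_butlast_last_id list.discI)
  show ?thesis using P D k crot_snoc[of "P @ t # D'" v] crot_snoc[of "P @ t # id_arrow (src t) # D'" v]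
      cdeg_append[of P k t "D' @ [v]"] cdeg_append[of "v # P" i t D'] by simp
qed

text \<open>\<open>cdeg n\<close> leaves the last arrow and the new identity at the end; two
  rotations carry this pair to the front in its order, which is what \<open>cdeg 0\<close> makes of
  the rotated chain.\<close>

lemma cdeg_0_crot:
  assumes ts: "ts \<in> cchains n"
  shows "cdeg 0 (crot ts) = crot (crot (cdeg n ts))"
proof -
  obtain A t where A: "ts = A @ [t]" "length A = n" using ts by (rule cchains_snoc)
  show ?thesis using A cdeg_append[of A n t "[]"] cdeg_append[of "[]" 0 t A]
      crot_snoc[of "A @ [t]" "id_arrow (src t)"] crot_snoc[of "id_arrow (src t) # A" t] by simp
qed

text \<open>A full turn is the case of empty \<open>as\<close>; it gives the periodicity in
  \<open>crot_power_length\<close>.\<close>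

lemma crot_power: "(crot ^^ length bs) (as @ bs) = bs @ as"
  for as bs :: "'a list"
proof (induction bs arbitrary: as rule: rev_induct)
  case (snoc b bs)
  have "(crot ^^ length (bs @ [b])) (as @ bs @ [b]) = (crot ^^ length bs) (crot ((as @ bs) @ [b]))"
    by (simp add: funpow_swap1)
  also have "\<dots> = bs @ b # as" unfolding crot_snoc using snoc[of "b # as"] by simp
  finally show ?case by simp
qed simp

lemma crot_power_length: "(crot ^^ length ts) ts = ts"
  for ts :: "'a list"
  using crot_power[of ts "[]"] by simp

section \<open>Operators of the nerve and the dual cocyclic module\<close>

lemma nerve_face:
  assumes "i \<le> Suc n"
  shows "linear_map K (nerve K C (Suc n)) (nerve K C n) (nerve_face K C n i)"
    and "ts \<in> cchains (Suc n) \<Longrightarrow> nerve_face K C n i (npure ts) = npure (cface' i ts)"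
proof -
  have eq: "(if i \<le> n then
       nerve_pure K C (take (Suc i) Xs @ drop (i + 2) Xs)
         (take i fs
          @ [Comp C (cnth Xs (i + 2)) (cnth Xs (i + 1)) (cnth Xs i) (fs ! i) (fs ! (i + 1))]
          @ drop (i + 2) fs)
     else
       nerve_pure K C (last Xs # tl (butlast Xs))
         (Comp C (cnth Xs 1) (cnth Xs 0) (last Xs) (last fs) (hd fs) # tl (butlast fs)))
     = npure (cface' i ts)"
    if ts: "ts \<in> cchains (Suc n)" and X: "Xs = map (\<lambda>t. tgt t) ts" "fs = map snd ts" for ts Xs fs
  proof -
    have l: "length ts = Suc (Suc n)" using ts by (simp add: cchains_def)
    show ?thesis
    proof (cases "i \<le> n")
      case True
      note s = cchains_src_nth[OF ts, of i] cchains_src_nth[OF ts, of "Suc i"]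
      show ?thesis using True l s
        by (simp add: cface'_def cface_def npure_def X take_Suc_conv_app_nth take_map drop_map)
    next
      case False
      then have i: "i = Suc n" using assms by simp
      obtain t0 M0 where "ts = t0 # M0" using l by (cases ts) auto
      moreover obtain M t where "M0 = M @ [t]" using l calculation by (cases M0 rule: rev_cases) auto
      ultimately have M: "ts = t0 # M @ [t]" "length M = n" using l by auto
      have t0: "src t0 = cnth Xs 1" "tgt t0 = cnth Xs 0"
        using cchains_src_nth[OF ts, of 0] by (simp_all add: X M(1))
      have t: "src t = cnth Xs 0"
        using cchains_src_nth(1)[OF ts, of "Suc n"] M by (simp add: X nth_append cnth_def)
      have ends: "last Xs = tgt t" "tl (butlast Xs) = map (\<lambda>t. tgt t) M"
        "last fs = snd t" "hd fs = snd t0" "tl (butlast fs) = map snd M"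
        by (simp_all add: X M(1))
      have "cface' i ts = comp_arrow t t0 # M"
        unfolding M(1) by (rule cface'_last) (simp add: i M(2))
      then show ?thesis using False
        by (simp only: if_False npure_def list.map arrow_simps fst_conv snd_conv t0 t[symmetric] ends)
    qed
  qed
  \<comment> \<open>The three facts that make \<open>nerve_lift\<close> computable: a module as
    target, chain linearity of the values, and agreement of the index formulas with the chain
    operation.\<close>
  note lift = module_nerve chain_linear_op[OF npure_chain_linear chain_op_cface'] eq[OF _ refl refl]
  show "linear_map K (nerve K C (Suc n)) (nerve K C n) (nerve_face K C n i)"
    unfolding nerve_face_def by (rule nerve_lift_linear[OF lift])
  show "ts \<in> cchains (Suc n) \<Longrightarrow> nerve_face K C n i (npure ts) = npure (cface' i ts)"
    unfolding nerve_face_def by (rule nerve_lift_npure[OF lift])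
qed

lemma nerve_degen:
  assumes "i \<le> n"
  shows "linear_map K (nerve K C n) (nerve K C (Suc n)) (nerve_degen K C n i)"
    and "ts \<in> cchains n \<Longrightarrow> nerve_degen K C n i (npure ts) = npure (cdeg i ts)"
proof -
  have eq: "nerve_pure K C (take (Suc i) Xs @ [cnth Xs (Suc i)] @ drop (Suc i) Xs)
       (take (Suc i) fs @ [Id C (cnth Xs (Suc i))] @ drop (Suc i) fs) = npure (cdeg i ts)"
    if ts: "ts \<in> cchains n" and X: "Xs = map (\<lambda>t. tgt t) ts" "fs = map snd ts" for ts Xs fs
    using cchains_src_nth(1)[OF ts assms]
    by (simp add: cdeg_def npure_def X take_map drop_map)
  note lift = module_nerve chain_linear_op[OF npure_chain_linear chain_op_cdeg[OF assms]] eq[OF _ refl refl]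
  show "linear_map K (nerve K C n) (nerve K C (Suc n)) (nerve_degen K C n i)"
    unfolding nerve_degen_def by (rule nerve_lift_linear[OF lift])
  show "ts \<in> cchains n \<Longrightarrow> nerve_degen K C n i (npure ts) = npure (cdeg i ts)"
    unfolding nerve_degen_def by (rule nerve_lift_npure[OF lift])
qed

lemma nerve_cyc:
  shows "linear_map K (nerve K C n) (nerve K C n) (nerve_cyc K C n)"
    and "ts \<in> cchains n \<Longrightarrow> nerve_cyc K C n (npure ts) = npure (crot ts)"
proof -
  have eq: "nerve_pure K C (last Xs # butlast Xs) (last fs # butlast fs) = npure (crot ts)"
    if ts: "ts \<in> cchains n" and X: "Xs = map (\<lambda>t. tgt t) ts" "fs = map snd ts" for ts Xs fs
  proof -
    obtain A t where "ts = A @ [t]" using ts by (rule cchains_snoc)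
    then show ?thesis by (simp add: npure_def X)
  qed
  note lift = module_nerve chain_linear_op[OF npure_chain_linear chain_op_crot] eq[OF _ refl refl]
  show "linear_map K (nerve K C n) (nerve K C n) (nerve_cyc K C n)"
    unfolding nerve_cyc_def by (rule nerve_lift_linear[OF lift])
  show "ts \<in> cchains n \<Longrightarrow> nerve_cyc K C n (npure ts) = npure (crot ts)"
    unfolding nerve_cyc_def by (rule nerve_lift_npure[OF lift])
qed

lemma nerve_cocyclic_simps [simp]:
  "cospace (nerve_cocyclic K C) n = dual_module K (nerve K C n)"
  "coface (nerve_cocyclic K C) n i = (\<lambda>\<phi>. \<lambda>x\<in>carrier (nerve K C (Suc n)). \<phi> (nerve_face K C n i x))"
  "codegen (nerve_cocyclic K C) n i = (\<lambda>\<phi>. \<lambda>x\<in>carrier (nerve K C n). \<phi> (nerve_degen K C n i x))"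
  "cocyc (nerve_cocyclic K C) n = (\<lambda>\<phi>. \<lambda>x\<in>carrier (nerve K C n). \<phi> (nerve_cyc K C n x))"
  by (simp_all add: nerve_cocyclic_def)

lemma module_self: "module K (self_module K)"
  by (rule module_self_module[OF K.is_cring])

lemma precompose_linear:
  assumes "module K V" "module K W" "linear_map K V W f"
  shows "linear_map K (dual_module K W) (dual_module K V) (\<lambda>\<phi>. \<lambda>x\<in>carrier V. \<phi> (f x))"
proof (rule linear_mapI)
  fix \<phi> assume "\<phi> \<in> carrier (dual_module K W)"
  then show "(\<lambda>x\<in>carrier V. \<phi> (f x)) \<in> carrier (dual_module K V)"
    by (intro restrict_in_hom_module[OF assms(1)] linear_map_compose[OF _ assms(3)])
      (simp add: hom_module_carrier)
qed (auto simp: linear_map_closed[OF assms(3)])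

lemma dual_ext:
  assumes "\<phi> \<in> carrier (dual_module K (nerve K C n))" "\<psi> \<in> carrier (dual_module K (nerve K C n))"
    "\<And>ts. ts \<in> cchains n \<Longrightarrow> \<phi> (npure ts) = \<psi> (npure ts)"
  shows "\<phi> = \<psi>"
  using assms unfolding hom_module_carrier
  by (auto intro: extensionalityI nerve_ext[OF module_self])

text \<open>Dual operators act by precomposition, which reverses their order. Evaluated on a chain
  by the rules \<open>ev\<close>, each cocyclic identity becomes one of the identities of chain
  operations, and \<open>ext\<close> says that such evaluations suffice.\<close>

theorem nerve_cocyclic_module: "cocyclic_module K (nerve_cocyclic K C)"
proof -
  let ?N = "nerve_cocyclic K C"
  have face: "coface ?N n i \<phi> \<in> carrier (cospace ?N (Suc n))"
    "ts \<in> cchains (Suc n) \<Longrightarrow> coface ?N n i \<phi> (npure ts) = \<phi> (npure (cface' i ts))"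
    if "i \<le> Suc n" "\<phi> \<in> carrier (cospace ?N n)" for i n \<phi> ts
    using linear_map_closed[OF precompose_linear[OF module_nerve module_nerve nerve_face(1)[OF that(1)]]]
      nerve_face(2)[OF that(1)] that(2) by (simp_all add: npure_closed)
  have degen: "codegen ?N n i \<phi> \<in> carrier (cospace ?N n)"
    "ts \<in> cchains n \<Longrightarrow> codegen ?N n i \<phi> (npure ts) = \<phi> (npure (cdeg i ts))"
    if "i \<le> n" "\<phi> \<in> carrier (cospace ?N (Suc n))" for i n \<phi> ts
    using linear_map_closed[OF precompose_linear[OF module_nerve module_nerve nerve_degen(1)[OF that(1)]]]
      nerve_degen(2)[OF that(1)] that(2) by (simp_all add: npure_closed)
  have cyc: "cocyc ?N n \<phi> \<in> carrier (cospace ?N n)"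
    "ts \<in> cchains n \<Longrightarrow> cocyc ?N n \<phi> (npure ts) = \<phi> (npure (crot ts))"
    if "\<phi> \<in> carrier (cospace ?N n)" for n \<phi> ts
    using linear_map_closed[OF precompose_linear[OF module_nerve module_nerve nerve_cyc(1)]]
      nerve_cyc(2) that by (simp_all add: npure_closed)
  have ext: "\<phi> = \<psi>" if "\<phi> \<in> carrier (cospace ?N n)" "\<psi> \<in> carrier (cospace ?N n)"
    "\<And>ts. ts \<in> cchains n \<Longrightarrow> \<phi> (npure ts) = \<psi> (npure ts)" for \<phi> \<psi> n
    using dual_ext that by simp
  note cl = face(1) degen(1) cyc(1)
  note ev = face(2) degen(2) cyc(2) face(1) degen(1) cyc(1) cface'_cchains cdeg_cchains crot_cchains
  show ?thesis
  proof (rule cocyclic_module.intro)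
    show "module K (cospace ?N n)" for n
      using module_hom_module[OF module_nerve module_self] by simp
    show "linear_map K (cospace ?N n) (cospace ?N (Suc n)) (coface ?N n i)" if "i \<le> Suc n" for n i
      using precompose_linear[OF module_nerve module_nerve nerve_face(1)[OF that]] by simp
    show "linear_map K (cospace ?N (Suc n)) (cospace ?N n) (codegen ?N n i)" if "i \<le> n" for n i
      using precompose_linear[OF module_nerve module_nerve nerve_degen(1)[OF that]] by simp
    show "linear_map K (cospace ?N n) (cospace ?N n) (cocyc ?N n)" for n
      using precompose_linear[OF module_nerve module_nerve nerve_cyc(1)] by simp
  next
    fix i j n x assume a: "i < j" "j \<le> Suc (Suc n)" "x \<in> carrier (cospace ?N n)"
    show "coface ?N (Suc n) j (coface ?N n i x) = coface ?N (Suc n) i (coface ?N n (j - 1) x)"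
      by (rule ext[of _ "Suc (Suc n)"])
        (use a in \<open>auto simp del: nerve_cocyclic_simps simp: ev cface'_cface' intro!: cl\<close>)
  next
    fix i j n x assume a: "i \<le> j" "j \<le> n" "x \<in> carrier (cospace ?N (Suc (Suc n)))"
    show "codegen ?N n j (codegen ?N (Suc n) i x) = codegen ?N n i (codegen ?N (Suc n) (Suc j) x)"
      by (rule ext[of _ n])
        (use a in \<open>auto simp del: nerve_cocyclic_simps simp: ev cdeg_cdeg intro!: cl\<close>)
  next
    fix i j n x assume a: "i \<le> j" "j \<le> n" "x \<in> carrier (cospace ?N (Suc n))"
    show "codegen ?N (Suc n) (Suc j) (coface ?N (Suc n) i x) = coface ?N n i (codegen ?N n j x)"
      by (rule ext[of _ "Suc n"])
        (use a in \<open>auto simp del: nerve_cocyclic_simps simp: ev cface'_cdeg_less intro!: cl\<close>)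
  next
    fix i j n x assume a: "j \<le> n" "i = j \<or> i = Suc j" "x \<in> carrier (cospace ?N n)"
    then have "i \<le> Suc n" by auto
    then show "codegen ?N n j (coface ?N n i x) = x"
      by (intro ext[of _ n])
        (use a in \<open>auto simp del: nerve_cocyclic_simps simp: ev cface'_cdeg_same intro!: cl\<close>)
  next
    fix i j n x assume a: "Suc j < i" "i \<le> Suc (Suc n)" "x \<in> carrier (cospace ?N (Suc n))"
    show "codegen ?N (Suc n) j (coface ?N (Suc n) i x) = coface ?N n (i - 1) (codegen ?N n j x)"
      by (rule ext[of _ "Suc n"])
        (use a in \<open>auto simp del: nerve_cocyclic_simps simp: ev cface'_cdeg_greater intro!: cl\<close>)
  next
    fix i n x assume a: "1 \<le> i" "i \<le> Suc n" "x \<in> carrier (cospace ?N n)"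
    show "cocyc ?N (Suc n) (coface ?N n i x) = coface ?N n (i - 1) (cocyc ?N n x)"
      by (rule ext[of _ "Suc n"])
        (use a in \<open>auto simp del: nerve_cocyclic_simps simp: ev cface'_crot intro!: cl\<close>)
  next
    fix n x assume a: "x \<in> carrier (cospace ?N n)"
    \<comment> \<open>Both sides are face 0 of the rotated chain, by the definition of the last
      face.\<close>
    have "cface' 0 (crot ts) = cface' (Suc n) ts" if "ts \<in> cchains (Suc n)" for ts
      using crot_cchains[OF that] that by (simp add: cface'_def cchains_def)
    then show "cocyc ?N (Suc n) (coface ?N n 0 x) = coface ?N n (Suc n) x"
      by (intro ext[of _ "Suc n"])
        (use a in \<open>auto simp del: nerve_cocyclic_simps simp: ev intro!: cl\<close>)
  next
    fix i n x assume a: "1 \<le> i" "i \<le> n" "x \<in> carrier (cospace ?N (Suc n))"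
    show "cocyc ?N n (codegen ?N n i x) = codegen ?N n (i - 1) (cocyc ?N (Suc n) x)"
      by (rule ext[of _ n])
        (use a in \<open>auto simp del: nerve_cocyclic_simps simp: ev cdeg_crot intro!: cl\<close>)
  next
    fix n x assume a: "x \<in> carrier (cospace ?N (Suc n))"
    show "cocyc ?N n (codegen ?N n 0 x) = codegen ?N n n (cocyc ?N (Suc n) (cocyc ?N (Suc n) x))"
      by (rule ext[of _ n])
        (use a in \<open>auto simp del: nerve_cocyclic_simps simp: ev cdeg_0_crot intro!: cl\<close>)
  next
    fix n x assume a: "x \<in> carrier (cospace ?N n)"
    \<comment> \<open>The \<open>k\<close>-th power of the dual operator is precomposition with the
      \<open>k\<close>-th power of the rotation; a full turn is then covered by
      \<open>crot_power_length\<close>.\<close>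
    have p: "(cocyc ?N n ^^ k) x \<in> carrier (cospace ?N n) \<and>
        (\<forall>ts\<in>cchains n. (cocyc ?N n ^^ k) x (npure ts) = x (npure ((crot ^^ k) ts)))" for k
    proof (induction k)
      case (Suc k)
      then show ?case by (simp add: ev funpow_swap1[of crot] del: nerve_cocyclic_simps)
    qed (use a in simp)
    show "(cocyc ?N n ^^ Suc n) x = x"
    proof (rule ext[OF conjunct1[OF p] a])
      fix ts assume ts: "ts \<in> cchains n"
      then have "(crot ^^ Suc n) ts = ts" using crot_power_length[of ts] by (simp only: cchains_def mem_Collect_eq) 
      then show "(cocyc ?N n ^^ Suc n) x (npure ts) = x (npure ts)"
        using p[of "Suc n"] ts by simp
    qed
  qed
qed

end

section \<open>Sweedler calculus\<close>

text \<open>Collects introduction rules for linearity, bilinearity and membership. The side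
  conditions of the Sweedler rules are built from these shapes, so \<open>intro lin\<close> breaks
  them down to elementary goals.\<close>

named_theorems lin

declare linear_map_ident [lin] linear_map_smult_fun [lin] linear_map_smult_scalar [lin]

context hopf_algebra
begin

text \<open>Only the number of factors is visible in \<open>tp\<close>, so rules can carry an
  equation between degrees as a premise and apply up to arithmetic.\<close>

definition tp :: "nat \<Rightarrow> ('k, ('h list \<Rightarrow> 'k) set) module" where
  "tp n = hpow K H n"

definition pt :: "'h list \<Rightarrow> ('h list \<Rightarrow> 'k) set" where
  "pt xs = hpure K H xs"

lemma module_K [simp]: "module K (self_module K)"
  by (rule module_self_module[OF R.is_cring])

lemma module_H [simp]: "module K H" ..

lemma module_tp [simp]: "module K (tp n)"
  unfolding tp_def by (rule module_tensor[OF R.is_cring]) auto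

lemma pt_closed [lin]: "\<lbrakk>set xs \<subseteq> carrier H; length xs = n\<rbrakk> \<Longrightarrow> pt xs \<in> carrier (tp n)"
  unfolding tp_def pt_def by (auto intro!: pure_tensor_closed[OF R.is_cring] simp: tuples_replicate)

lemma tp_ext:
  assumes "module K W" "linear_map K (tp n) W f" "linear_map K (tp n) W g"
    "\<And>xs. \<lbrakk>length xs = n; set xs \<subseteq> carrier H\<rbrakk> \<Longrightarrow> f (pt xs) = g (pt xs)" "u \<in> carrier (tp n)"
  shows "f u = g u"
  using assms unfolding tp_def pt_def
  by (intro tensor_ext[OF R.is_cring _ assms(1), of "replicate n H" f g u])
     (auto simp: tuples_replicate)

text \<open>A split of \<open>replicate n H\<close> has \<open>H\<close> in the slot and replicates
  on both sides, so of the factor lists only their lengths remain.\<close>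

lemma hmultilinearI:
  assumes "\<And>xs. \<lbrakk>length xs = n; set xs \<subseteq> carrier H\<rbrakk> \<Longrightarrow> \<phi> xs \<in> carrier W"
    and "\<And>xs ys. \<lbrakk>length xs + Suc (length ys) = n; set xs \<subseteq> carrier H; set ys \<subseteq> carrier H\<rbrakk>
      \<Longrightarrow> linear_map K H W (\<lambda>x. \<phi> (xs @ x # ys))"
  shows "multilinear K (replicate n H) W \<phi>"
proof (rule multilinearI)
  show "xs \<in> tuples (replicate n H) \<Longrightarrow> \<phi> xs \<in> carrier W" for xs
    using assms(1) by (simp add: tuples_replicate)
next
  fix As V Bs xs ys
  assume r: "replicate n H = As @ V # Bs" and xs: "xs \<in> tuples As" and ys: "ys \<in> tuples Bs"
  have "set (As @ V # Bs) \<subseteq> {H}" unfolding r[symmetric] by auto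
  then have "V = H" "As = replicate (length As) H" "Bs = replicate (length Bs) H"
    by (auto simp: replicate_length_same subset_iff intro!: replicate_eqI)
  moreover from this have "length xs = length As" "set xs \<subseteq> carrier H" "length ys = length Bs" "set ys \<subseteq> carrier H"
    using xs ys tuples_replicate by metis+
  moreover have "n = length As + Suc (length Bs)" using arg_cong[OF r, of length] by simp
  ultimately show "linear_map K V W (\<lambda>x. \<phi> (xs @ x # ys))" using assms(2)[of xs ys] by simp
qed

lemma hlift_linear:
  "\<lbrakk>module K W; multilinear K (replicate n H) W \<phi>\<rbrakk>
    \<Longrightarrow> linear_map K (tp n) W (tensor_lift K (replicate n H) W \<phi>)"
  unfolding tp_def by (rule tensor_lift_linear[OF R.is_cring]) auto

lemma hlift_pt:
  "\<lbrakk>module K W; multilinear K (replicate n H) W \<phi>; length xs = n; set xs \<subseteq> carrier H\<rbrakk>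
    \<Longrightarrow> tensor_lift K (replicate n H) W \<phi> (pt xs) = \<phi> xs"
  using tensor_lift_pure[OF R.is_cring, of "replicate n H" W \<phi> xs]
  unfolding pt_def by (auto simp: tuples_replicate)

lemma hlift_eqI:
  assumes "module K W" "linear_map K (tp n) W f" "multilinear K (replicate n H) W \<phi>"
    "\<And>xs. \<lbrakk>length xs = n; set xs \<subseteq> carrier H\<rbrakk> \<Longrightarrow> f (pt xs) = \<phi> xs" "u \<in> carrier (tp n)"
  shows "tensor_lift K (replicate n H) W \<phi> u = f u"
  by (rule tp_ext[OF assms(1) hlift_linear[OF assms(1,3)] assms(2) _ assms(5)])
    (simp add: assms hlift_pt)

lemma hlift_param:
  assumes "module K U" "module K W" "\<And>p. p \<in> carrier U \<Longrightarrow> multilinear K (replicate n H) W (\<phi> p)"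
    "\<And>xs. \<lbrakk>length xs = n; set xs \<subseteq> carrier H\<rbrakk> \<Longrightarrow> linear_map K U W (\<lambda>p. \<phi> p xs)" "u \<in> carrier (tp n)"
  shows "linear_map K U W (\<lambda>p. tensor_lift K (replicate n H) W (\<phi> p) u)"
  using assms(5) unfolding tp_def
  by (intro tensor_lift_linear_param[OF R.is_cring _ assms(1-3)])
    (auto simp: tuples_replicate assms(4))

lemma hlift_cong:
  assumes "\<And>xs. \<lbrakk>length xs = n; set xs \<subseteq> carrier H\<rbrakk> \<Longrightarrow> \<phi> xs = \<psi> xs"
  shows "tensor_lift K (replicate n H) W \<phi> = tensor_lift K (replicate n H) W \<psi>"
  by (rule tensor_lift_cong) (simp add: assms tuples_replicate)

lemma pt_slot:
  assumes "set xs \<subseteq> carrier H" "set ys \<subseteq> carrier H" "n = length xs + Suc (length ys)"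
  shows "linear_map K H (tp n) (\<lambda>x. pt (xs @ x # ys))"
proof -
  interpret M: module K H by simp
  have eq: "replicate n H = replicate (length xs) H @ H # replicate (length ys) H"
    using assms(3) by (simp add: replicate_add replicate_app_Cons_same)
  have "multilinear K (replicate n H) (tensor K (replicate n H)) (pure_tensor K (replicate n H))"
    by (rule pure_tensor_multilinear[OF R.is_cring]) auto
  then have "linear_map K H (tensor K (replicate n H)) (\<lambda>x. pure_tensor K (replicate n H) (xs @ x # ys))"
    by (rule multilinear_slot[of K "replicate (length xs) H" H "replicate (length ys) H", folded eq])
      (use assms in \<open>auto simp: tuples_replicate\<close>)
  then show ?thesis unfolding tp_def pt_def using assms(3) by simp
qed

text \<open>Concrete lists such as \<open>[a, b]\<close> do not syntactically match
  \<open>xs @ f x # ys\<close>; the first three positions are therefore stated separately for use by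
  \<open>intro\<close>.\<close>

lemma pt_slots [lin]:
  "\<lbrakk>linear_map K V H f; set ys \<subseteq> carrier H; n = Suc (length ys)\<rbrakk> \<Longrightarrow> linear_map K V (tp n) (\<lambda>x. pt (f x # ys))"
  "\<lbrakk>linear_map K V H f; a \<in> carrier H; set ys \<subseteq> carrier H; n = Suc (Suc (length ys))\<rbrakk>
    \<Longrightarrow> linear_map K V (tp n) (\<lambda>x. pt (a # f x # ys))"
  "\<lbrakk>linear_map K V H f; a \<in> carrier H; b \<in> carrier H; set ys \<subseteq> carrier H; n = Suc (Suc (Suc (length ys)))\<rbrakk>
    \<Longrightarrow> linear_map K V (tp n) (\<lambda>x. pt (a # b # f x # ys))"
  using linear_map_compose[OF pt_slot[of "[]" ys n], of V f]
    linear_map_compose[OF pt_slot[of "[a]" ys n], of V f]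
    linear_map_compose[OF pt_slot[of "[a, b]" ys n], of V f] by auto

text \<open>The isomorphism \<open>H\<^sup>\<otimes>\<^sup>p \<otimes> H\<^sup>\<otimes>\<^sup>q \<rightarrow> H\<^sup>\<otimes>\<^sup>p\<^sup>+\<^sup>q\<close>, as a bilinear map.\<close>

definition cat :: "nat \<Rightarrow> nat \<Rightarrow> ('h list \<Rightarrow> 'k) set \<Rightarrow> ('h list \<Rightarrow> 'k) set \<Rightarrow> ('h list \<Rightarrow> 'k) set" where
  "cat p q u v = tensor_lift K (replicate p H) (tp (p + q))
     (\<lambda>xs. tensor_lift K (replicate q H) (tp (p + q)) (\<lambda>ys. pt (xs @ ys)) v) u"

lemma cat_inner_multilinear:
  assumes "length xs = p" "set xs \<subseteq> carrier H"
  shows "multilinear K (replicate q H) (tp (p + q)) (\<lambda>ys. pt (xs @ ys))"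
proof (rule hmultilinearI)
  show "linear_map K H (tp (p + q)) (\<lambda>x. pt (xs @ ys @ x # zs))"
    if "length ys + Suc (length zs) = q" "set ys \<subseteq> carrier H" "set zs \<subseteq> carrier H" for ys zs
    using pt_slot[of "xs @ ys" zs "p + q"] assms that by simp
qed (use assms in \<open>auto intro!: pt_closed\<close>)

lemma cat_outer_multilinear:
  assumes "v \<in> carrier (tp q)"
  shows "multilinear K (replicate p H) (tp (p + q))
    (\<lambda>xs. tensor_lift K (replicate q H) (tp (p + q)) (\<lambda>ys. pt (xs @ ys)) v)"
proof (rule hmultilinearI)
  show "tensor_lift K (replicate q H) (tp (p + q)) (\<lambda>ys. pt (xs @ ys)) v \<in> carrier (tp (p + q))"
    if "length xs = p" "set xs \<subseteq> carrier H" for xs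
    using linear_map_closed[OF hlift_linear[OF _ cat_inner_multilinear[OF that]] assms] by simp
next
  fix xs ys assume *: "length xs + Suc (length ys) = p" "set xs \<subseteq> carrier H" "set ys \<subseteq> carrier H"
  show "linear_map K H (tp (p + q)) (\<lambda>x. tensor_lift K (replicate q H) (tp (p + q)) (\<lambda>zs. pt ((xs @ x # ys) @ zs)) v)"
  proof (rule hlift_param[OF _ _ _ _ assms])
    show "linear_map K H (tp (p + q)) (\<lambda>x. pt ((xs @ x # ys) @ zs))"
      if "length zs = q" "set zs \<subseteq> carrier H" for zs
      using pt_slot[of xs "ys @ zs" "p + q"] * that by simp
    show "multilinear K (replicate q H) (tp (p + q)) (\<lambda>zs. pt ((xs @ x # ys) @ zs))"
      if "x \<in> carrier H" for x
      by (rule cat_inner_multilinear) (use * that in auto)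
  qed simp_all
qed

lemma cat_linear_left:
  "v \<in> carrier (tp q) \<Longrightarrow> linear_map K (tp p) (tp (p + q)) (\<lambda>u. cat p q u v)"
  unfolding cat_def by (rule hlift_linear[OF _ cat_outer_multilinear]) simp_all

lemma cat_linear_right:
  assumes "u \<in> carrier (tp p)"
  shows "linear_map K (tp q) (tp (p + q)) (\<lambda>v. cat p q u v)"
  unfolding cat_def
  by (rule hlift_param[OF _ _ cat_outer_multilinear _ assms])
    (auto intro!: hlift_linear cat_inner_multilinear)

lemma cat_pt:
  assumes "length xs = p" "length ys = q" "set xs \<subseteq> carrier H" "set ys \<subseteq> carrier H"
  shows "cat p q (pt xs) (pt ys) = pt (xs @ ys)"
proof -
  have "pt ys \<in> carrier (tp q)" using assms by (intro pt_closed)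
  from hlift_pt[OF _ cat_outer_multilinear[OF this] assms(1,3)]
  show ?thesis unfolding cat_def
    using hlift_pt[OF _ cat_inner_multilinear[OF assms(1,3)] assms(2,4)] by simp
qed

lemma cat_closed [lin]:
  "\<lbrakk>u \<in> carrier (tp p); v \<in> carrier (tp q); r = p + q\<rbrakk> \<Longrightarrow> cat p q u v \<in> carrier (tp r)"
  using linear_map_closed[OF cat_linear_left] by blast

lemma cat_lin [lin]:
  "\<lbrakk>linear_map K V (tp p) f; v \<in> carrier (tp q); r = p + q\<rbrakk> \<Longrightarrow> linear_map K V (tp r) (\<lambda>x. cat p q (f x) v)"
  "\<lbrakk>linear_map K V (tp q) g; u \<in> carrier (tp p); r = p + q\<rbrakk> \<Longrightarrow> linear_map K V (tp r) (\<lambda>x. cat p q u (g x))"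
  using linear_map_compose[OF cat_linear_left] linear_map_compose[OF cat_linear_right] by auto

text \<open>Reduced to pure tensors one argument at a time, down to associativity of
  \<open>@\<close>.\<close>

lemma cat_assoc:
  assumes "u \<in> carrier (tp p)" "v \<in> carrier (tp q)" "w \<in> carrier (tp r)"
  shows "cat (p + q) r (cat p q u v) w = cat p (q + r) u (cat q r v w)"
proof -
  have 1: "cat (p + q) r (cat p q (pt xs) (pt ys)) w = cat p (q + r) (pt xs) (cat q r (pt ys) w)"
    if "length xs = p" "length ys = q" "set xs \<subseteq> carrier H" "set ys \<subseteq> carrier H" for xs ys
    by (rule tp_ext[where n = r and W = "tp (p + q + r)"]; (intro lin)?)
      (use that assms in \<open>auto simp: cat_pt\<close>)
  have 2: "cat (p + q) r (cat p q (pt xs) v) w = cat p (q + r) (pt xs) (cat q r v w)"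
    if "length xs = p" "set xs \<subseteq> carrier H" for xs
    by (rule tp_ext[where n = q and W = "tp (p + q + r)" and u = v]; (intro lin)?)
      (use that assms 1 in auto)
  show ?thesis
    by (rule tp_ext[where n = p and W = "tp (p + q + r)" and u = u]; (intro lin)?)
      (use assms 2 in auto)
qed

lemma cat_nil [simp]:
  assumes "v \<in> carrier (tp q)"
  shows "cat 0 q (pt []) v = v" "cat q 0 v (pt []) = v"
proof -
  have n: "pt [] \<in> carrier (tp 0)" by (rule pt_closed) auto
  show "cat 0 q (pt []) v = v"
    by (rule tp_ext[where n = q and W = "tp q" and u = v]; (intro lin)?) (use assms n in \<open>auto simp: cat_pt\<close>)
  show "cat q 0 v (pt []) = v"
    by (rule tp_ext[where n = q and W = "tp q" and u = v]; (intro lin)?) (use assms n in \<open>auto simp: cat_pt\<close>)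
qed

lemma pt_Cons:
  "\<lbrakk>x \<in> carrier H; set xs \<subseteq> carrier H; length xs = n\<rbrakk> \<Longrightarrow> pt (x # xs) = cat (Suc 0) n (pt [x]) (pt xs)"
  by (simp add: cat_pt)

section \<open>Sweedler sums of bilinear maps\<close>

abbreviation sw where "sw W \<phi> h \<equiv> sweedler K H W \<phi> h"

definition bil :: "('k, 'w, 'q) module_scheme \<Rightarrow> ('h \<Rightarrow> 'h \<Rightarrow> 'w) \<Rightarrow> bool" where
  "bil W \<phi> \<longleftrightarrow> (\<forall>b\<in>carrier H. linear_map K H W (\<lambda>a. \<phi> a b)) \<and> (\<forall>a\<in>carrier H. linear_map K H W (\<lambda>b. \<phi> a b))"

lemma bilI [lin]:
  "\<lbrakk>\<And>b. b \<in> carrier H \<Longrightarrow> linear_map K H W (\<lambda>a. \<phi> a b);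
    \<And>a. a \<in> carrier H \<Longrightarrow> linear_map K H W (\<lambda>b. \<phi> a b)\<rbrakk> \<Longrightarrow> bil W \<phi>"
  unfolding bil_def by blast

lemma bilD:
  "\<lbrakk>bil W \<phi>; b \<in> carrier H\<rbrakk> \<Longrightarrow> linear_map K H W (\<lambda>a. \<phi> a b)"
  "\<lbrakk>bil W \<phi>; a \<in> carrier H\<rbrakk> \<Longrightarrow> linear_map K H W (\<lambda>b. \<phi> a b)"
  unfolding bil_def by blast+

lemma length_2E:
  assumes "length xs = 2" obtains a b where "xs = [a, b]"
  using assms by (auto simp: numeral_2_eq_2 length_Suc_conv)

lemma bil_multilinear:
  assumes "bil W \<phi>"
  shows "multilinear K (replicate 2 H) W (\<lambda>xs. \<phi> (xs ! 0) (xs ! 1))"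
proof (rule hmultilinearI)
  show "\<phi> (xs ! 0) (xs ! 1) \<in> carrier W" if "length xs = 2" "set xs \<subseteq> carrier H" for xs
    using that linear_map_closed[OF bilD(1)[OF assms]] by (auto elim!: length_2E)
next
  fix xs ys assume *: "length xs + Suc (length ys) = 2" "set xs \<subseteq> carrier H" "set ys \<subseteq> carrier H"
  then consider b where "xs = []" "ys = [b]" | a where "xs = [a]" "ys = []"
    by (cases xs; cases ys) auto
  then show "linear_map K H W (\<lambda>x. \<phi> ((xs @ x # ys) ! 0) ((xs @ x # ys) ! 1))"
    using bilD[OF assms] * by cases auto
qed

lemma comult_closed [lin]: "h \<in> carrier H \<Longrightarrow> comult H h \<in> carrier (tp 2)"
  using linear_map_closed[OF comult_linear] unfolding tp_def .

lemma comult_lin [lin]: "linear_map K V H f \<Longrightarrow> linear_map K V (tp 2) (\<lambda>x. comult H (f x))"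
  using linear_map_compose[OF comult_linear] unfolding tp_def .

lemma sw_linear: "\<lbrakk>module K W; bil W \<phi>\<rbrakk> \<Longrightarrow> linear_map K H W (\<lambda>h. sw W \<phi> h)"
  unfolding sweedler_def
  by (rule linear_map_compose[OF hlift_linear[OF _ bil_multilinear] comult_linear[folded tp_def]])

lemma sw_lin [lin]:
  "\<lbrakk>linear_map K V H f; module K W; bil W \<phi>\<rbrakk> \<Longrightarrow> linear_map K V W (\<lambda>x. sw W \<phi> (f x))"
  by (rule linear_map_compose[OF sw_linear])

lemma sw_param [lin]:
  assumes "module K U" "module K W" "\<And>p. p \<in> carrier U \<Longrightarrow> bil W (\<phi> p)"
    "\<And>a b. \<lbrakk>a \<in> carrier H; b \<in> carrier H\<rbrakk> \<Longrightarrow> linear_map K U W (\<lambda>p. \<phi> p a b)" "h \<in> carrier H"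
  shows "linear_map K U W (\<lambda>p. sw W (\<phi> p) h)"
  unfolding sweedler_def
  by (rule hlift_param[OF assms(1,2) bil_multilinear[OF assms(3)] _ comult_closed[OF assms(5)]])
    (auto elim!: length_2E intro!: assms(4))

lemma sw_cong:
  assumes "\<And>a b. \<lbrakk>a \<in> carrier H; b \<in> carrier H\<rbrakk> \<Longrightarrow> \<phi> a b = \<psi> a b"
  shows "sw W \<phi> h = sw W \<psi> h"
  unfolding sweedler_def
  by (rule fun_cong[OF hlift_cong]) (use assms in \<open>auto elim!: length_2E\<close>)

text \<open>A linear map composed with a lift is the lift of the composed values. This is the rule
  by which linear operators pass under Sweedler sums.\<close>

lemma sw_map:
  assumes "module K W" "module K U" "linear_map K W U f" "bil W \<phi>" "h \<in> carrier H"
  shows "f (sw W \<phi> h) = sw U (\<lambda>a b. f (\<phi> a b)) h"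
proof -
  have b: "bil U (\<lambda>a b. f (\<phi> a b))"
    by (intro bilI linear_map_compose[OF assms(3)] bilD[OF assms(4)])
  show ?thesis unfolding sweedler_def
    by (rule hlift_eqI[symmetric, OF assms(2)
          linear_map_compose[OF assms(3) hlift_linear[OF assms(1) bil_multilinear[OF assms(4)]]] bil_multilinear[OF b]])
      (use assms in \<open>auto simp: hlift_pt bil_multilinear comult_closed simp del: One_nat_def\<close>)
qed

lemma comult_sw: "h \<in> carrier H \<Longrightarrow> comult H h = sw (tp 2) (\<lambda>a b. pt [a, b]) h"
proof -
  assume h: "h \<in> carrier H"
  have "bil (tp 2) (\<lambda>a b. pt [a, b])" by (intro lin) auto
  then show ?thesis unfolding sweedler_def
    by (intro hlift_eqI[symmetric, where f = "\<lambda>u. u", OF module_tp linear_map_ident bil_multilinear])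
      (use h in \<open>auto elim!: length_2E intro: comult_closed\<close>)
qed

lemma sw_comult_map:
  assumes "module K U" "linear_map K (tp 2) U f" "h \<in> carrier H"
  shows "f (comult H h) = sw U (\<lambda>a b. f (pt [a, b])) h"
  unfolding comult_sw[OF assms(3)]
  by (rule sw_map[OF _ assms(1,2) _ assms(3)]; (intro lin)?) auto

text \<open>The right-hand side makes sense with any tensor \<open>u\<close> in place of the
  coproduct of \<open>h\<close> and is linear in \<open>u\<close>; on a pure tensor the inner lift
  evaluates, and the integrand of the left-hand side appears.\<close>

lemma sw_swap:
  assumes W: "module K W" and 1: "\<And>a b. \<lbrakk>a \<in> carrier H; b \<in> carrier H\<rbrakk> \<Longrightarrow> bil W (\<lambda>c d. \<phi> a b c d)"
    and 2: "\<And>c d. \<lbrakk>c \<in> carrier H; d \<in> carrier H\<rbrakk> \<Longrightarrow> bil W (\<lambda>a b. \<phi> a b c d)"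
    and g: "g \<in> carrier H" and h: "h \<in> carrier H"
  shows "sw W (\<lambda>a b. sw W (\<lambda>c d. \<phi> a b c d) g) h = sw W (\<lambda>c d. sw W (\<lambda>a b. \<phi> a b c d) h) g"
proof -
  have b: "bil W (\<lambda>a b. sw W (\<lambda>c d. \<phi> a b c d) g)"
    by (rule bilI; rule sw_param[OF module_H W 1 _ g]) (auto intro: bilD[OF 2])
  have lin: "linear_map K (tp 2) W
      (\<lambda>u. sw W (\<lambda>c d. tensor_lift K (replicate 2 H) W (\<lambda>xs. \<phi> (xs ! 0) (xs ! 1) c d) u) g)"
  proof (rule sw_param[OF module_tp W _ _ g])
    show "bil W (\<lambda>c d. tensor_lift K (replicate 2 H) W (\<lambda>xs. \<phi> (xs ! 0) (xs ! 1) c d) u)"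
      if u: "u \<in> carrier (tp 2)" for u
      by (intro bilI hlift_param[OF _ W bil_multilinear[OF 2] _ u])
        (use bilD[OF 1] in \<open>auto elim!: length_2E\<close>)
    show "linear_map K (tp 2) W (tensor_lift K (replicate 2 H) W (\<lambda>xs. \<phi> (xs ! 0) (xs ! 1) c d))"
      if "c \<in> carrier H" "d \<in> carrier H" for c d
      by (rule hlift_linear[OF W bil_multilinear[OF 2[OF that]]])
  qed
  have "sw W (\<lambda>a b. sw W (\<lambda>c d. \<phi> a b c d) g) h =
      sw W (\<lambda>c d. tensor_lift K (replicate 2 H) W (\<lambda>xs. \<phi> (xs ! 0) (xs ! 1) c d) (comult H h)) g"
    unfolding sweedler_def[of K H W "\<lambda>a b. sw W (\<lambda>c d. \<phi> a b c d) g" h]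
  proof (rule hlift_eqI[OF W lin bil_multilinear[OF b] _ comult_closed[OF h]])
    fix xs :: "'h list" assume xs: "length xs = 2" "set xs \<subseteq> carrier H"
    show "sw W (\<lambda>c d. tensor_lift K (replicate 2 H) W (\<lambda>xs. \<phi> (xs ! 0) (xs ! 1) c d) (pt xs)) g
        = sw W (\<lambda>c d. \<phi> (xs ! 0) (xs ! 1) c d) g"
      by (rule sw_cong) (rule hlift_pt[OF W bil_multilinear[OF 2] xs])
  qed
  then show ?thesis unfolding sweedler_def[of K H W "\<lambda>a b. \<phi> a b _ _" h] by simp
qed

lemma counit_closed [lin]: "h \<in> carrier H \<Longrightarrow> counit H h \<in> carrier K"
  using linear_map_closed[OF counit_linear] by simp

lemma counit_lin [lin]: "linear_map K V H f \<Longrightarrow> linear_map K V (self_module K) (\<lambda>x. counit H (f x))"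
  by (rule linear_map_compose[OF counit_linear])

lemma antipode_closed [lin]: "h \<in> carrier H \<Longrightarrow> antipode H h \<in> carrier H"
  using linear_map_closed[OF antipode_linear] by simp

lemma antipode_lin [lin]: "linear_map K V H f \<Longrightarrow> linear_map K V H (\<lambda>x. antipode H (f x))"
  by (rule linear_map_compose[OF antipode_linear])

lemma mult_lin [lin]:
  assumes "b \<in> carrier H"
  shows "linear_map K V H f \<Longrightarrow> linear_map K V H (\<lambda>x. f x \<otimes>\<^bsub>H\<^esub> b)"
    and "linear_map K V H f \<Longrightarrow> linear_map K V H (\<lambda>x. b \<otimes>\<^bsub>H\<^esub> f x)"
proof -
  have "linear_map K H H (\<lambda>x. x \<otimes>\<^bsub>H\<^esub> b)" "linear_map K H H (\<lambda>x. b \<otimes>\<^bsub>H\<^esub> x)"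
    using assms by (auto intro!: linear_mapI simp: l_distr r_distr smult_mult_left smult_mult_right)
  then show "linear_map K V H f \<Longrightarrow> linear_map K V H (\<lambda>x. f x \<otimes>\<^bsub>H\<^esub> b)"
    "linear_map K V H f \<Longrightarrow> linear_map K V H (\<lambda>x. b \<otimes>\<^bsub>H\<^esub> f x)"
    using linear_map_compose by blast+
qed

declare m_closed [lin]

text \<open>The axiom has values in \<open>H\<close>; composing with \<open>f\<close> makes it
  available inside any linear expression. The three rules after it transport the other counit axiom
  and both antipode axioms in the same way.\<close>

lemma sw_counit_left:
  assumes W: "module K W" and f: "linear_map K H W f" and h: "h \<in> carrier H"
  shows "sw W (\<lambda>a b. counit H a \<odot>\<^bsub>W\<^esub> f b) h = f h"
proof -
  have "f (sw H (\<lambda>a b. counit H a \<odot>\<^bsub>H\<^esub> b) h) = sw W (\<lambda>a b. f (counit H a \<odot>\<^bsub>H\<^esub> b)) h"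
    by (rule sw_map[OF _ W f _ h]; (intro lin)?) auto
  also have "\<dots> = sw W (\<lambda>a b. counit H a \<odot>\<^bsub>W\<^esub> f b) h"
    by (rule sw_cong) (simp add: linear_map_smult[OF f] counit_closed)
  finally show ?thesis using counit_left[OF h] by simp
qed

lemma sw_counit_right:
  assumes W: "module K W" and f: "linear_map K H W f" and h: "h \<in> carrier H"
  shows "sw W (\<lambda>a b. counit H b \<odot>\<^bsub>W\<^esub> f a) h = f h"
proof -
  have "f (sw H (\<lambda>a b. counit H b \<odot>\<^bsub>H\<^esub> a) h) = sw W (\<lambda>a b. f (counit H b \<odot>\<^bsub>H\<^esub> a)) h"
    by (rule sw_map[OF _ W f _ h]; (intro lin)?) auto
  also have "\<dots> = sw W (\<lambda>a b. counit H b \<odot>\<^bsub>W\<^esub> f a) h"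
    by (rule sw_cong) (simp add: linear_map_smult[OF f] counit_closed)
  finally show ?thesis using counit_right[OF h] by simp
qed

lemma sw_antipode_right:
  assumes W: "module K W" and f: "linear_map K H W f" and h: "h \<in> carrier H"
  shows "sw W (\<lambda>a b. f (a \<otimes>\<^bsub>H\<^esub> antipode H b)) h = counit H h \<odot>\<^bsub>W\<^esub> f \<one>\<^bsub>H\<^esub>"
proof -
  have "f (sw H (\<lambda>a b. a \<otimes>\<^bsub>H\<^esub> antipode H b) h) = sw W (\<lambda>a b. f (a \<otimes>\<^bsub>H\<^esub> antipode H b)) h"
    by (rule sw_map[OF _ W f _ h]; (intro lin)?) auto
  then show ?thesis using antipode_right[OF h] linear_map_smult[OF f] counit_closed[OF h] by simp
qed

lemma sw_antipode_left:
  assumes W: "module K W" and f: "linear_map K H W f" and h: "h \<in> carrier H"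
  shows "sw W (\<lambda>a b. f (antipode H a \<otimes>\<^bsub>H\<^esub> b)) h = counit H h \<odot>\<^bsub>W\<^esub> f \<one>\<^bsub>H\<^esub>"
proof -
  have "f (sw H (\<lambda>a b. antipode H a \<otimes>\<^bsub>H\<^esub> b) h) = sw W (\<lambda>a b. f (antipode H a \<otimes>\<^bsub>H\<^esub> b)) h"
    by (rule sw_map[OF _ W f _ h]; (intro lin)?) auto
  then show ?thesis using antipode_left[OF h] linear_map_smult[OF f] counit_closed[OF h] by simp
qed

text \<open>The trilinear \<open>\<psi>\<close> factors through
  \<open>H\<^sup>\<otimes>\<^sup>3\<close> by a linear map \<open>?L\<close>; applied to both sides
  of the coassociativity axiom it gives the two nested sums.\<close>

lemma sw_coassoc:
  assumes W: "module K W"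
    and 1: "\<And>b c. \<lbrakk>b \<in> carrier H; c \<in> carrier H\<rbrakk> \<Longrightarrow> linear_map K H W (\<lambda>a. \<psi> a b c)"
    and 2: "\<And>a c. \<lbrakk>a \<in> carrier H; c \<in> carrier H\<rbrakk> \<Longrightarrow> linear_map K H W (\<lambda>b. \<psi> a b c)"
    and 3: "\<And>a b. \<lbrakk>a \<in> carrier H; b \<in> carrier H\<rbrakk> \<Longrightarrow> linear_map K H W (\<lambda>c. \<psi> a b c)"
    and h: "h \<in> carrier H"
  shows "sw W (\<lambda>x c. sw W (\<lambda>a b. \<psi> a b c) x) h = sw W (\<lambda>a x. sw W (\<lambda>b c. \<psi> a b c) x) h"
proof -
  let ?L = "tensor_lift K (replicate 3 H) W (\<lambda>xs. \<psi> (xs ! 0) (xs ! 1) (xs ! 2))"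
  have m: "multilinear K (replicate 3 H) W (\<lambda>xs. \<psi> (xs ! 0) (xs ! 1) (xs ! 2))"
  proof (rule hmultilinearI)
    fix xs :: "'h list" assume "length xs = 3" "set xs \<subseteq> carrier H"
    then show "\<psi> (xs ! 0) (xs ! 1) (xs ! 2) \<in> carrier W"
      using linear_map_closed[OF 1] by (auto simp: numeral_3_eq_3 length_Suc_conv)
  next
    fix xs ys :: "'h list" assume *: "length xs + Suc (length ys) = 3" "set xs \<subseteq> carrier H" "set ys \<subseteq> carrier H"
    then consider b c where "xs = []" "ys = [b, c]" | a c where "xs = [a]" "ys = [c]" | a b where "xs = [a, b]" "ys = []"
      by (cases xs; cases ys; cases "tl xs"; cases "tl ys") auto
    then show "linear_map K H W (\<lambda>x. \<psi> ((xs @ x # ys) ! 0) ((xs @ x # ys) ! 1) ((xs @ x # ys) ! 2))"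
      using 1 2 3 * by cases auto
  qed
  note L = hlift_linear[OF W m]
  have Lp: "?L (pt [a, b, c]) = \<psi> a b c" if "a \<in> carrier H" "b \<in> carrier H" "c \<in> carrier H" for a b c
    using hlift_pt[OF W m, of "[a, b, c]"] that by simp
  have b3: "bil (tp 3) (\<lambda>x c. sw (tp 3) (\<lambda>a b. pt [a, b, c]) x)" "bil (tp 3) (\<lambda>a x. sw (tp 3) (\<lambda>b c. pt [a, b, c]) x)"
    "c \<in> carrier H \<Longrightarrow> bil (tp 3) (\<lambda>a b. pt [a, b, c])" "a \<in> carrier H \<Longrightarrow> bil (tp 3) (\<lambda>b c. pt [a, b, c])" for a c
    by (intro lin; simp)+
  have "comult_at K H 2 0 (comult H h) = sw (tp 3) (\<lambda>x c. sw (tp 3) (\<lambda>a b. pt [a, b, c]) x) h"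
    unfolding comult_at_def sweedler_def[of K H _ "\<lambda>x c. sw (tp 3) (\<lambda>a b. pt [a, b, c]) x"]
      tp_def[symmetric] pt_def[symmetric]
    by (simp, rule fun_cong[OF hlift_cong]) (auto elim!: length_2E)
  moreover have "comult_at K H 2 1 (comult H h) = sw (tp 3) (\<lambda>a x. sw (tp 3) (\<lambda>b c. pt [a, b, c]) x) h"
    unfolding comult_at_def sweedler_def[of K H _ "\<lambda>a x. sw (tp 3) (\<lambda>b c. pt [a, b, c]) x"]
      tp_def[symmetric] pt_def[symmetric]
    by (simp, rule fun_cong[OF hlift_cong]) (auto elim!: length_2E)
  ultimately have "?L (sw (tp 3) (\<lambda>x c. sw (tp 3) (\<lambda>a b. pt [a, b, c]) x) h)
      = ?L (sw (tp 3) (\<lambda>a x. sw (tp 3) (\<lambda>b c. pt [a, b, c]) x) h)"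
    using coassoc[OF h] by simp
  moreover have "?L (sw (tp 3) (\<lambda>x c. sw (tp 3) (\<lambda>a b. pt [a, b, c]) x) h)
      = sw W (\<lambda>x c. sw W (\<lambda>a b. \<psi> a b c) x) h"
    unfolding sw_map[OF module_tp W L b3(1) h]
    by (rule sw_cong) (simp add: sw_map[OF module_tp W L b3(3)] Lp cong: sw_cong del: One_nat_def)
  moreover have "?L (sw (tp 3) (\<lambda>a x. sw (tp 3) (\<lambda>b c. pt [a, b, c]) x) h)
      = sw W (\<lambda>a x. sw W (\<lambda>b c. \<psi> a b c) x) h"
    unfolding sw_map[OF module_tp W L b3(2) h]
    by (rule sw_cong) (simp add: sw_map[OF module_tp W L b3(4)] Lp cong: sw_cong del: One_nat_def)
  ultimately show ?thesis by simp
qed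

text \<open>\<open>\<phi>\<close> is lifted to \<open>H\<^sup>\<otimes>\<^sup>2\<close> and applied
  to the coproduct of the product, which by axiom is the factorwise product of the two
  coproducts.\<close>

lemma sw_mult:
  assumes W: "module K W" and \<phi>: "bil W \<phi>" and g: "g \<in> carrier H" and h: "h \<in> carrier H"
  shows "sw W \<phi> (g \<otimes>\<^bsub>H\<^esub> h) = sw W (\<lambda>a b. sw W (\<lambda>c d. \<phi> (a \<otimes>\<^bsub>H\<^esub> c) (b \<otimes>\<^bsub>H\<^esub> d)) h) g"
proof -
  let ?L = "tensor_lift K (replicate 2 H) W (\<lambda>xs. \<phi> (xs ! 0) (xs ! 1))"
  note m = bil_multilinear[OF \<phi>]
  note L = hlift_linear[OF W m]
  have Lp: "?L (pt [a, b]) = \<phi> a b" if "a \<in> carrier H" "b \<in> carrier H" for a b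
    using hlift_pt[OF W m, of "[a, b]"] that by simp
  have b: "bil (tp 2) (\<lambda>a b. sw (tp 2) (\<lambda>c d. pt [a \<otimes>\<^bsub>H\<^esub> c, b \<otimes>\<^bsub>H\<^esub> d]) h)"
    "\<lbrakk>a \<in> carrier H; b \<in> carrier H\<rbrakk> \<Longrightarrow> bil (tp 2) (\<lambda>c d. pt [a \<otimes>\<^bsub>H\<^esub> c, b \<otimes>\<^bsub>H\<^esub> d])" for a b
    by (intro lin; simp add: h)+
  have "comult H (g \<otimes>\<^bsub>H\<^esub> h) = sw (tp 2) (\<lambda>a b. sw (tp 2) (\<lambda>c d. pt [a \<otimes>\<^bsub>H\<^esub> c, b \<otimes>\<^bsub>H\<^esub> d]) h) g"
    unfolding comult_mult[OF g h] hpow_mult_def sweedler_def tp_def[symmetric] pt_def[symmetric]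
    by (rule fun_cong[OF hlift_cong], rule fun_cong[OF hlift_cong]) (auto elim!: length_2E)
  then have "sw W \<phi> (g \<otimes>\<^bsub>H\<^esub> h) = ?L (sw (tp 2) (\<lambda>a b. sw (tp 2) (\<lambda>c d. pt [a \<otimes>\<^bsub>H\<^esub> c, b \<otimes>\<^bsub>H\<^esub> d]) h) g)"
    by (simp add: sweedler_def[of K H W \<phi>])
  also have "\<dots> = sw W (\<lambda>a b. sw W (\<lambda>c d. \<phi> (a \<otimes>\<^bsub>H\<^esub> c) (b \<otimes>\<^bsub>H\<^esub> d)) h) g"
    unfolding sw_map[OF module_tp W L b(1) g]
    by (rule sw_cong) (simp add: sw_map[OF module_tp W L b(2) h] Lp cong: sw_cong del: One_nat_def)
  finally show ?thesis .
qed

lemma sw_one: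
  assumes "module K W" "bil W \<phi>"
  shows "sw W \<phi> \<one>\<^bsub>H\<^esub> = \<phi> \<one>\<^bsub>H\<^esub> \<one>\<^bsub>H\<^esub>"
  using hlift_pt[OF assms(1) bil_multilinear[OF assms(2)], of "[\<one>\<^bsub>H\<^esub>, \<one>\<^bsub>H\<^esub>]"]
  unfolding sweedler_def comult_one pt_def by simp

lemma sw_group_like:
  assumes "module K W" "bil W \<phi>" "group_like K H s"
  shows "sw W \<phi> s = \<phi> s s"
  using hlift_pt[OF assms(1) bil_multilinear[OF assms(2)], of "[s, s]"] assms(3)
  unfolding sweedler_def group_like_def pt_def by simp

end

context hopf_algebra
begin

lemma pt_slot_lin [lin]:
  "\<lbrakk>linear_map K V H f; set xs \<subseteq> carrier H; set ys \<subseteq> carrier H; n = length xs + Suc (length ys)\<rbrakk>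
    \<Longrightarrow> linear_map K V (tp n) (\<lambda>x. pt (xs @ f x # ys))"
  by (rule linear_map_compose[OF pt_slot])

subsection \<open>Linear maps applied at one tensor position\<close>

text \<open>\<open>app p q m f\<close> is \<open>id\<^sup>\<otimes>\<^sup>p \<otimes> f \<otimes> id\<^sup>\<otimes>\<^sup>q\<close> for \<open>f : H \<rightarrow> H\<^sup>\<otimes>\<^sup>m\<close>; all inner cofaces and codegeneracies have this
  form.\<close>

definition app :: "nat \<Rightarrow> nat \<Rightarrow> nat \<Rightarrow> ('h \<Rightarrow> ('h list \<Rightarrow> 'k) set) \<Rightarrow> ('h list \<Rightarrow> 'k) set \<Rightarrow> ('h list \<Rightarrow> 'k) set" where
  "app p q m f = tensor_lift K (replicate (Suc (p + q)) H) (tp (p + (m + q)))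
     (\<lambda>xs. cat p (m + q) (pt (take p xs)) (cat m q (f (xs ! p)) (pt (drop (Suc p) xs))))"

lemma app_multilinear:
  assumes f: "linear_map K H (tp m) f"
  shows "multilinear K (replicate (Suc (p + q)) H) (tp (p + (m + q)))
     (\<lambda>xs. cat p (m + q) (pt (take p xs)) (cat m q (f (xs ! p)) (pt (drop (Suc p) xs))))"
proof (rule hmultilinearI)
  fix xs :: "'h list" assume xs: "length xs = Suc (p + q)" "set xs \<subseteq> carrier H"
  then have "p < length xs" by simp
  then obtain A x B where A: "xs = A @ x # B" "length A = p"
    by (rule list_split_one)
  show "cat p (m + q) (pt (take p xs)) (cat m q (f (xs ! p)) (pt (drop (Suc p) xs))) \<in> carrier (tp (p + (m + q)))"
    using xs A by (intro lin linear_map_closed[OF f]) (auto simp: nth_append)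
next
  fix xs ys :: "'h list"
  assume l: "length xs + Suc (length ys) = Suc (p + q)" and s: "set xs \<subseteq> carrier H" "set ys \<subseteq> carrier H"
  let ?g = "\<lambda>zs. cat p (m + q) (pt (take p zs)) (cat m q (f (zs ! p)) (pt (drop (Suc p) zs)))"
  \<comment> \<open>The varying slot is the one \<open>f\<close> acts on, or lies to the left or to
    the right of it; in the last two cases \<open>f\<close> is applied to a fixed element.\<close>
  consider "length xs = p" | "length xs < p" | "p < length xs" by linarith
  then show "linear_map K H (tp (p + (m + q))) (\<lambda>x. ?g (xs @ x # ys))"
  proof cases
    case 1
    have "linear_map K H (tp (p + (m + q))) (\<lambda>x. cat p (m + q) (pt xs) (cat m q (f x) (pt ys)))"
      by (intro lin f) (use 1 l s in auto)
    then show ?thesis using 1 by (simp add: nth_append)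
  next
    case 2
    then have "p - Suc (length xs) < length ys" using l by simp
    then obtain A y B where A: "ys = A @ y # B" "length A = p - Suc (length xs)"
      by (rule list_split_one)
    have p: "p = length xs + Suc (length A)" using A(2) 2 by simp
    then have "length B = q" using l unfolding A(1) by simp
    then have "linear_map K H (tp (p + (m + q))) (\<lambda>x. cat p (m + q) (pt (xs @ x # A)) (cat m q (f y) (pt B)))"
      by (intro lin linear_map_closed[OF f]) (use A(1) p s in auto)
    moreover have "take p (xs @ x # ys) = xs @ x # A" "(xs @ x # ys) ! p = y" "drop (Suc p) (xs @ x # ys) = B" for x
      unfolding p A(1) by (simp_all add: nth_append)
    ultimately show ?thesis by simp
  next
    case 3
    then have "p < length xs" using l by simp
    then obtain A y B where A: "xs = A @ y # B" "length A = p"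
      by (rule list_split_one)
    have "linear_map K H (tp (p + (m + q))) (\<lambda>x. cat p (m + q) (pt A) (cat m q (f y) (pt (B @ x # ys))))"
      by (intro lin linear_map_closed[OF f]) (use A l s in auto)
    then show ?thesis using A by (simp add: nth_append)
  qed
qed

lemma tp_ident_lin [lin]: "m = n \<Longrightarrow> linear_map K (tp m) (tp n) (\<lambda>x. x)"
  by (simp add: linear_map_ident)

lemma app_lin [lin]:
  assumes "linear_map K H (tp m) f" "linear_map K V (tp (Suc (p + q))) g" "r = p + (m + q)"
  shows "linear_map K V (tp r) (\<lambda>x. app p q m f (g x))"
  using linear_map_compose[OF hlift_linear[OF _ app_multilinear[OF assms(1)]]] assms(2-) unfolding app_def by auto

lemma app_closed [lin]:
  assumes "linear_map K H (tp m) f" "u \<in> carrier (tp (Suc (p + q)))" "r = p + (m + q)"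
  shows "app p q m f u \<in> carrier (tp r)"
  using linear_map_closed[OF app_lin[OF assms(1) linear_map_ident assms(3)] assms(2)] .

lemma app_pt:
  assumes "linear_map K H (tp m) f" "length xs = p" "length ys = q" "set xs \<subseteq> carrier H" "set ys \<subseteq> carrier H" "x \<in> carrier H"
  shows "app p q m f (pt (xs @ x # ys)) = cat p (m + q) (pt xs) (cat m q (f x) (pt ys))"
proof -
  have "app p q m f (pt (xs @ x # ys)) = cat p (m + q) (pt (take p (xs @ x # ys)))
      (cat m q (f ((xs @ x # ys) ! p)) (pt (drop (Suc p) (xs @ x # ys))))"
    unfolding app_def by (rule hlift_pt[OF _ app_multilinear[OF assms(1)]]) (use assms in auto)
  then show ?thesis using assms(2) by (simp add: nth_append)
qed

lemma app_single: "\<lbrakk>linear_map K H (tp m) f; x \<in> carrier H\<rbrakk> \<Longrightarrow> app 0 0 m f (pt [x]) = f x"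
  using app_pt[of m f "[]" 0 "[]" 0 x] linear_map_closed[of K H "tp m" f x] by simp

text \<open>With \<open>app_right\<close> this makes \<open>app\<close> local: tensoring with
  untouched factors on either side only changes the counts \<open>p\<close> and \<open>q\<close>. On
  pure tensors it is associativity of \<open>cat\<close>.\<close>

lemma app_left:
  assumes f: "linear_map K H (tp m) f" and u: "u \<in> carrier (tp r)" and w: "w \<in> carrier (tp (Suc (p + q)))"
  shows "app (r + p) q m f (cat r (Suc (p + q)) u w) = cat r (p + (m + q)) u (app p q m f w)"
proof -
  have 1: "app (r + p) q m f (cat r (Suc (p + q)) (pt us) (pt zs)) = cat r (p + (m + q)) (pt us) (app p q m f (pt zs))"
    if us: "length us = r" "set us \<subseteq> carrier H" and zs: "length zs = Suc (p + q)" "set zs \<subseteq> carrier H" for us zs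
  proof -
    have "p < length zs" using zs by simp
    then obtain A x B where A: "zs = A @ x # B" "length A = p"
      by (rule list_split_one)
    have "app (r + p) q m f (pt ((us @ A) @ x # B)) = cat (r + p) (m + q) (pt (us @ A)) (cat m q (f x) (pt B))"
      by (rule app_pt[OF f]) (use us zs A in auto)
    also have "\<dots> = cat (r + p) (m + q) (cat r p (pt us) (pt A)) (cat m q (f x) (pt B))"
      using us zs A by (simp add: cat_pt)
    also have "\<dots> = cat r (p + (m + q)) (pt us) (cat p (m + q) (pt A) (cat m q (f x) (pt B)))"
      by (rule cat_assoc; (intro lin linear_map_closed[OF f])?) (use us zs A in auto)
    also have "cat p (m + q) (pt A) (cat m q (f x) (pt B)) = app p q m f (pt zs)"
      unfolding A(1) by (rule app_pt[OF f, symmetric]) (use zs A in auto)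
    finally show ?thesis using us zs A by (simp add: cat_pt)
  qed
  have 2: "app (r + p) q m f (cat r (Suc (p + q)) (pt us) w) = cat r (p + (m + q)) (pt us) (app p q m f w)"
    if us: "length us = r" "set us \<subseteq> carrier H" for us
    by (rule tp_ext[where n = "Suc (p + q)" and W = "tp (r + p + (m + q))" and u = w]; (intro lin f)?)
      (use us 1 w in auto)
  show ?thesis
    by (rule tp_ext[where n = r and W = "tp (r + p + (m + q))" and u = u]; (intro lin f)?)
      (use u w 2 in auto)
qed

lemma app_right:
  assumes f: "linear_map K H (tp m) f" and v: "v \<in> carrier (tp s)" and w: "w \<in> carrier (tp (Suc (p + q)))"
  shows "app p (q + s) m f (cat (Suc (p + q)) s w v) = cat (p + (m + q)) s (app p q m f w) v"
proof -
  have 1: "app p (q + s) m f (cat (Suc (p + q)) s (pt zs) (pt vs)) = cat (p + (m + q)) s (app p q m f (pt zs)) (pt vs)"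
    if vs: "length vs = s" "set vs \<subseteq> carrier H" and zs: "length zs = Suc (p + q)" "set zs \<subseteq> carrier H" for vs zs
  proof -
    have "p < length zs" using zs by simp
    then obtain A x B where A: "zs = A @ x # B" "length A = p"
      by (rule list_split_one)
    have c: "f x \<in> carrier (tp m)" "pt A \<in> carrier (tp p)" "pt B \<in> carrier (tp q)" "pt vs \<in> carrier (tp s)"
      by (intro lin linear_map_closed[OF f]; use vs zs A in auto)+
    have "app p (q + s) m f (pt (A @ x # (B @ vs))) = cat p (m + (q + s)) (pt A) (cat m (q + s) (f x) (pt (B @ vs)))"
      by (rule app_pt[OF f]) (use vs zs A in auto)
    also have "pt (B @ vs) = cat q s (pt B) (pt vs)"
      using vs zs A by (simp add: cat_pt)
    also have "cat m (q + s) (f x) (cat q s (pt B) (pt vs)) = cat (m + q) s (cat m q (f x) (pt B)) (pt vs)"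
      by (rule cat_assoc[symmetric]) (rule c)+
    also have "cat p (m + (q + s)) (pt A) (cat (m + q) s (cat m q (f x) (pt B)) (pt vs))
        = cat (p + (m + q)) s (cat p (m + q) (pt A) (cat m q (f x) (pt B))) (pt vs)"
      unfolding add.assoc[symmetric, of m q s]
      by (rule cat_assoc[symmetric, OF c(2) cat_closed[OF c(1,3) refl] c(4)])
    also have "cat p (m + q) (pt A) (cat m q (f x) (pt B)) = app p q m f (pt zs)"
      unfolding A(1) by (rule app_pt[OF f, symmetric]) (use zs A in auto)
    finally show ?thesis using vs zs A by (simp add: cat_pt)
  qed
  have 2: "app p (q + s) m f (cat (Suc (p + q)) s (pt zs) v) = cat (p + (m + q)) s (app p q m f (pt zs)) v"
    if zs: "length zs = Suc (p + q)" "set zs \<subseteq> carrier H" for zs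
    by (rule tp_ext[where n = s and W = "tp (p + (m + q) + s)" and u = v]; (intro lin f)?)
      (use zs 1 v in auto)
  show ?thesis
    by (rule tp_ext[where n = "Suc (p + q)" and W = "tp (p + (m + q) + s)" and u = w]; (intro lin f)?)
      (use v w 2 in auto)
qed

lemma comult_linear_tp: "linear_map K H (tp 2) (comult H)"
  using comult_linear unfolding tp_def .

text \<open>\<open>comult_at\<close> inserts both legs into the list under a Sweedler sum; pulling
  \<open>cat\<close> out of that sum leaves the coproduct itself between the outer factors.\<close>

lemma comult_at_eq: "comult_at K H (Suc (i + q)) i = app i q 2 (comult H)"
proof -
  have r: "i + (2 + q) = Suc (Suc (i + q))" by simp
  show ?thesis
    unfolding comult_at_def app_def tp_def[symmetric] pt_def[symmetric] r
  proof (rule hlift_cong)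
    fix xs :: "'h list" assume xs: "length xs = Suc (i + q)" "set xs \<subseteq> carrier H"
    then have "i < length xs" by simp
    then obtain A x B where A: "xs = A @ x # B" "length A = i"
      by (rule list_split_one)
    have "cat i (2 + q) (pt A) (cat 2 q (comult H x) (pt B))
        = sw (tp (Suc (Suc (i + q)))) (\<lambda>a b. cat i (2 + q) (pt A) (cat 2 q (pt [a, b]) (pt B))) x"
      by (rule sw_comult_map; (intro lin)?) (use A xs in auto)
    also have "\<dots> = sw (tp (Suc (Suc (i + q)))) (\<lambda>a b. pt (A @ [a, b] @ B)) x"
      by (rule sw_cong) (use A xs in \<open>simp add: cat_pt\<close>)
    finally show "sw (tp (Suc (Suc (i + q)))) (\<lambda>a b. pt (take i xs @ [a, b] @ drop (Suc i) xs)) (xs ! i)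
        = cat i (2 + q) (pt (take i xs)) (cat 2 q (comult H (xs ! i)) (pt (drop (Suc i) xs)))"
      using A by (simp add: nth_append)
  qed
qed

text \<open>The counit with values in \<open>H\<^sup>\<otimes>\<^sup>0\<close>, so that it can be inserted by \<open>app\<close>.\<close>

definition eps :: "'h \<Rightarrow> ('h list \<Rightarrow> 'k) set" where
  "eps h = counit H h \<odot>\<^bsub>tp 0\<^esub> pt []"

lemma eps_lin [lin]: "linear_map K V H f \<Longrightarrow> linear_map K V (tp 0) (\<lambda>x. eps (f x))"
  unfolding eps_def by (intro lin) auto

lemma eps_linear: "linear_map K H (tp 0) eps"
  using eps_lin[OF linear_map_ident] .

lemma cat_smult:
  "\<lbrakk>c \<in> carrier K; u \<in> carrier (tp p); v \<in> carrier (tp q); r = p\<rbrakk> \<Longrightarrow> cat p q (c \<odot>\<^bsub>tp r\<^esub> u) v = c \<odot>\<^bsub>tp (p + q)\<^esub> cat p q u v"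
  "\<lbrakk>c \<in> carrier K; u \<in> carrier (tp p); v \<in> carrier (tp q); r = q\<rbrakk> \<Longrightarrow> cat p q u (c \<odot>\<^bsub>tp r\<^esub> v) = c \<odot>\<^bsub>tp (p + q)\<^esub> cat p q u v"
  using linear_map_smult[OF cat_linear_left] linear_map_smult[OF cat_linear_right] by auto

lemma cat_eps:
  assumes "h \<in> carrier H" "v \<in> carrier (tp q)"
  shows "cat 0 q (eps h) v = counit H h \<odot>\<^bsub>tp q\<^esub> v" "cat q 0 v (eps h) = counit H h \<odot>\<^bsub>tp q\<^esub> v"
proof -
  have "pt [] \<in> carrier (tp 0)" by (rule pt_closed) auto
  then show "cat 0 q (eps h) v = counit H h \<odot>\<^bsub>tp q\<^esub> v" "cat q 0 v (eps h) = counit H h \<odot>\<^bsub>tp q\<^esub> v"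
    unfolding eps_def using assms by (simp_all add: cat_smult counit_closed)
qed

text \<open>Applying \<open>eps\<close> leaves no factor at its position; the counit sits there as a
  scalar in \<open>H\<^sup>\<otimes>\<^sup>0\<close>, and \<open>cat_eps\<close> pulls it
  out.\<close>

lemma codegen_eq: "hopf_codegen K H (i + q) i = app i q 0 eps"
  unfolding hopf_codegen_def app_def tp_def[symmetric] pt_def[symmetric] add_0
proof (rule hlift_cong)
  fix xs :: "'h list" assume xs: "length xs = Suc (i + q)" "set xs \<subseteq> carrier H"
  then have "i < length xs" by simp
  then obtain A x B where A: "xs = A @ x # B" "length A = i"
    by (rule list_split_one)
  have "cat i q (pt A) (cat 0 q (eps x) (pt B)) = counit H x \<odot>\<^bsub>tp (i + q)\<^esub> pt (A @ B)"
    using A xs by (simp add: cat_eps cat_smult cat_pt counit_closed pt_closed)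
  then show "counit H (xs ! i) \<odot>\<^bsub>tp (i + q)\<^esub> pt (take i xs @ drop (Suc i) xs)
      = cat i q (pt (take i xs)) (cat 0 q (eps (xs ! i)) (pt (drop (Suc i) xs)))"
    using A by (simp add: nth_append)
qed


subsection \<open>The diagonal action\<close>

lemma zip_mult_closed:
  "\<lbrakk>(a, b) \<in> set (zip xs ys); set xs \<subseteq> carrier H; set ys \<subseteq> carrier H\<rbrakk> \<Longrightarrow> a \<otimes>\<^bsub>H\<^esub> b \<in> carrier H"
  by (auto dest: set_zip_leftD set_zip_rightD)

lemma hm_inner_multilinear:
  assumes "length xs = n" "set xs \<subseteq> carrier H"
  shows "multilinear K (replicate n H) (tp n) (\<lambda>ys. pt (map2 (mult H) xs ys))"
proof (rule hmultilinearI)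
  fix ys zs assume *: "length ys + Suc (length zs) = n" "set ys \<subseteq> carrier H" "set zs \<subseteq> carrier H"
  have "length ys < length xs" using assms * by simp
  then obtain A x B where A: "xs = A @ x # B" "length A = length ys"
    by (rule list_split_one)
  have "linear_map K H (tp n) (\<lambda>y. pt (map2 (mult H) A ys @ (x \<otimes>\<^bsub>H\<^esub> y) # map2 (mult H) B zs))"
    by (intro lin) (use A * assms in \<open>auto intro: zip_mult_closed\<close>)
  then show "linear_map K H (tp n) (\<lambda>y. pt (map2 (mult H) xs (ys @ y # zs)))"
    using A by simp
qed (use assms in \<open>auto intro!: pt_closed intro: zip_mult_closed\<close>)

lemma hm_outer_multilinear:
  assumes v: "v \<in> carrier (tp n)"
  shows "multilinear K (replicate n H) (tp n)
    (\<lambda>xs. tensor_lift K (replicate n H) (tp n) (\<lambda>ys. pt (map2 (mult H) xs ys)) v)"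
proof (rule hmultilinearI)
  show "tensor_lift K (replicate n H) (tp n) (\<lambda>ys. pt (map2 (mult H) xs ys)) v \<in> carrier (tp n)"
    if "length xs = n" "set xs \<subseteq> carrier H" for xs
    using linear_map_closed[OF hlift_linear[OF _ hm_inner_multilinear[OF that]] v] by simp
next
  fix xs ys assume *: "length xs + Suc (length ys) = n" "set xs \<subseteq> carrier H" "set ys \<subseteq> carrier H"
  show "linear_map K H (tp n) (\<lambda>x. tensor_lift K (replicate n H) (tp n) (\<lambda>zs. pt (map2 (mult H) (xs @ x # ys) zs)) v)"
  proof (rule hlift_param[OF _ _ _ _ v])
    fix zs :: "'h list" assume zs: "length zs = n" "set zs \<subseteq> carrier H"
    have "length xs < length zs" using zs * by simp
    then obtain A z B where A: "zs = A @ z # B" "length A = length xs"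
      by (rule list_split_one)
    have "linear_map K H (tp n) (\<lambda>x. pt (map2 (mult H) xs A @ (x \<otimes>\<^bsub>H\<^esub> z) # map2 (mult H) ys B))"
      by (intro lin) (use A * zs in \<open>auto intro: zip_mult_closed\<close>)
    then show "linear_map K H (tp n) (\<lambda>x. pt (map2 (mult H) (xs @ x # ys) zs))"
      using A by simp
  next
    show "multilinear K (replicate n H) (tp n) (\<lambda>zs. pt (map2 (mult H) (xs @ x # ys) zs))"
      if "x \<in> carrier H" for x
      by (rule hm_inner_multilinear) (use * that in auto)
  qed simp_all
qed

lemma hm_def: "hpow_mult K H n u v = tensor_lift K (replicate n H) (tp n)
    (\<lambda>xs. tensor_lift K (replicate n H) (tp n) (\<lambda>ys. pt (map2 (mult H) xs ys)) v) u"
  unfolding hpow_mult_def tp_def pt_def ..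

lemma hm_lin [lin]:
  "\<lbrakk>linear_map K V (tp n) f; v \<in> carrier (tp n)\<rbrakk> \<Longrightarrow> linear_map K V (tp n) (\<lambda>x. hpow_mult K H n (f x) v)"
  "\<lbrakk>linear_map K V (tp n) g; u \<in> carrier (tp n)\<rbrakk> \<Longrightarrow> linear_map K V (tp n) (\<lambda>x. hpow_mult K H n u (g x))"
proof -
  assume "linear_map K V (tp n) f" "v \<in> carrier (tp n)"
  then show "linear_map K V (tp n) (\<lambda>x. hpow_mult K H n (f x) v)"
    unfolding hm_def
    by (intro linear_map_compose[OF hlift_linear[OF _ hm_outer_multilinear]]) auto
next
  assume g: "linear_map K V (tp n) g" and u: "u \<in> carrier (tp n)"
  have "linear_map K (tp n) (tp n) (\<lambda>v. hpow_mult K H n u v)"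
    unfolding hm_def
    by (rule hlift_param[OF _ _ hm_outer_multilinear _ u])
      (auto intro!: hlift_linear hm_inner_multilinear)
  from linear_map_compose[OF this g] show "linear_map K V (tp n) (\<lambda>x. hpow_mult K H n u (g x))" .
qed

lemma hm_pt:
  assumes "length xs = n" "length ys = n" "set xs \<subseteq> carrier H" "set ys \<subseteq> carrier H"
  shows "hpow_mult K H n (pt xs) (pt ys) = pt (map2 (mult H) xs ys)"
proof -
  have "pt ys \<in> carrier (tp n)" using assms by (intro lin)
  from hlift_pt[OF _ hm_outer_multilinear[OF this] assms(1,3)]
  show ?thesis unfolding hm_def
    using hlift_pt[OF _ hm_inner_multilinear[OF assms(1,3)] assms(2,4)] by simp
qed

text \<open>Computes the factorwise product by recursion with arbitrary tensors as tails; iterated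
  coproducts are not pure, so \<open>hm_pt\<close> alone would not reach them.\<close>

lemma hm_Cons:
  assumes x: "x \<in> carrier H" and y: "y \<in> carrier H" and u: "u \<in> carrier (tp n)" and v: "v \<in> carrier (tp n)"
  shows "hpow_mult K H (Suc n) (cat (Suc 0) n (pt [x]) u) (cat (Suc 0) n (pt [y]) v)
    = cat (Suc 0) n (pt [x \<otimes>\<^bsub>H\<^esub> y]) (hpow_mult K H n u v)"
proof -
  have 1: "hpow_mult K H (Suc n) (cat (Suc 0) n (pt [x]) (pt us)) (cat (Suc 0) n (pt [y]) (pt vs))
    = cat (Suc 0) n (pt [x \<otimes>\<^bsub>H\<^esub> y]) (hpow_mult K H n (pt us) (pt vs))"
    if "length us = n" "set us \<subseteq> carrier H" "length vs = n" "set vs \<subseteq> carrier H" for us vs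
  proof -
    have "set (map2 (mult H) us vs) \<subseteq> carrier H" using that by (auto intro: zip_mult_closed)
    then show ?thesis using that x y by (simp add: cat_pt hm_pt)
  qed
  have 2: "hpow_mult K H (Suc n) (cat (Suc 0) n (pt [x]) (pt us)) (cat (Suc 0) n (pt [y]) v)
    = cat (Suc 0) n (pt [x \<otimes>\<^bsub>H\<^esub> y]) (hpow_mult K H n (pt us) v)"
    if us: "length us = n" "set us \<subseteq> carrier H" for us
    by (rule tp_ext[where n = n and W = "tp (Suc n)" and u = v]; (intro lin)?)
      (use us 1 v x y in auto)
  show ?thesis
    by (rule tp_ext[where n = n and W = "tp (Suc n)" and u = u]; (intro lin)?)
      (use u v x y 2 in auto)
qed

lemma pt_Nil_closed [simp]: "pt [] \<in> carrier (tp 0)"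
  by (rule pt_closed) auto

lemma iter_comult_0: "iter_comult K H 0 h = eps h"
  by (simp add: eps_def tp_def pt_def)

text \<open>\<open>iter_comult\<close> keeps splitting the first leg, whereas recursion on a list
  needs the form \<open>h\<^sub>1\<close> followed by the iterated coproduct of
  \<open>h\<^sub>2\<close>. Linearity belongs to the same induction because bilinearity of that
  expression rests on it.\<close>

lemma iter_comult_Suc_linear:
  "linear_map K H (tp n) (iter_comult K H n) \<and> (\<forall>h\<in>carrier H.
    iter_comult K H (Suc n) h = sw (tp (Suc n)) (\<lambda>a b. cat (Suc 0) n (pt [a]) (iter_comult K H n b)) h)"
proof (induction n)
  case 0
  have e: "iter_comult K H 0 = eps" by (rule ext) (rule iter_comult_0)
  \<comment> \<open>\<open>h\<^sub>1\<close> times the counit of \<open>h\<^sub>2\<close> is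
    \<open>h\<close>: the clauses of \<open>iter_comult\<close> for zero factors and one factor fit
    the same recursion.\<close>
  have "sw (tp (Suc 0)) (\<lambda>a b. cat (Suc 0) 0 (pt [a]) (eps b)) h = pt [h]" if h: "h \<in> carrier H" for h
  proof -
    have "sw (tp (Suc 0)) (\<lambda>a b. cat (Suc 0) 0 (pt [a]) (eps b)) h
      = sw (tp (Suc 0)) (\<lambda>a b. counit H b \<odot>\<^bsub>tp (Suc 0)\<^esub> pt [a]) h"
      by (rule sw_cong) (simp add: cat_eps pt_closed)
    also have "\<dots> = pt [h]"
      by (rule sw_counit_right[OF _ _ h]; (intro lin)?) auto
    finally show ?thesis .
  qed
  then show ?case unfolding e using eps_linear by (simp add: pt_def)
next
  case (Suc n)
  let ?it = "iter_comult K H"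
  have L: "linear_map K H (tp n) (?it n)" and rec: "\<And>h. h \<in> carrier H \<Longrightarrow>
      ?it (Suc n) h = sw (tp (Suc n)) (\<lambda>a b. cat (Suc 0) n (pt [a]) (?it n b)) h" using Suc by auto
  have Ln: "linear_map K V (tp n) (\<lambda>x. ?it n (f x))" if "linear_map K V H f" for V :: "('k, 'v, 'q) module_scheme" and f
    by (rule linear_map_compose[OF L that])
  note Lc = linear_map_closed[OF L]
  interpret HM: module K H by simp
  have b: "bil (tp (Suc n)) (\<lambda>a b. cat (Suc 0) n (pt [a]) (?it n b))"
    by (intro lin Lc linear_map_compose[OF L]) auto
  have LS: "linear_map K H (tp (Suc n)) (?it (Suc n))"
    using sw_linear[OF module_tp b] by (subst linear_map_cong[OF module_H rec]) simp_all
  have "?it (Suc (Suc n)) h = sw (tp (Suc (Suc n))) (\<lambda>a b. cat (Suc 0) (Suc n) (pt [a]) (?it (Suc n) b)) h"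
    if h: "h \<in> carrier H" for h
  proof -
    let ?W = "tp (Suc (Suc n))"
    have "?it (Suc (Suc n)) h = app 0 n 2 (comult H) (?it (Suc n) h)"
      using comult_at_eq[of 0 n] by simp
    also have "\<dots> = app 0 n 2 (comult H) (sw (tp (Suc n)) (\<lambda>a b. cat (Suc 0) n (pt [a]) (?it n b)) h)"
      by (simp only: rec[OF h])
    also have "\<dots> = sw ?W (\<lambda>a b. app 0 n 2 (comult H) (cat (Suc 0) n (pt [a]) (?it n b))) h"
      by (rule sw_map[OF _ _ _ b h]; (intro lin comult_linear_tp)?) auto
    also have "\<dots> = sw ?W (\<lambda>x b. sw ?W (\<lambda>c d. cat (Suc 0) (Suc n) (pt [c]) (cat (Suc 0) n (pt [d]) (?it n b))) x) h"
    proof (rule sw_cong)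
      fix x b assume xb: "x \<in> carrier H" "b \<in> carrier H"
      have "app 0 n 2 (comult H) (cat (Suc 0) n (pt [x]) (?it n b)) = cat 2 n (comult H x) (?it n b)"
        using app_right[OF comult_linear_tp Lc[OF xb(2)], of "pt [x]" 0 0] xb
          app_single[OF comult_linear_tp xb(1)]
        by (simp add: pt_closed numeral_2_eq_2)
      also have "\<dots> = sw ?W (\<lambda>c d. cat 2 n (pt [c, d]) (?it n b)) x"
        by (rule sw_comult_map; (intro lin Lc)?) (use xb in auto)
      also have "\<dots> = sw ?W (\<lambda>c d. cat (Suc 0) (Suc n) (pt [c]) (cat (Suc 0) n (pt [d]) (?it n b))) x"
      proof (rule sw_cong)
        fix c d assume cd: "c \<in> carrier H" "d \<in> carrier H"
        have "cat (Suc 0 + Suc 0) n (cat (Suc 0) (Suc 0) (pt [c]) (pt [d])) (?it n b)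
            = cat (Suc 0) (Suc 0 + n) (pt [c]) (cat (Suc 0) n (pt [d]) (?it n b))"
          by (rule cat_assoc) (use cd xb Lc in \<open>auto intro!: pt_closed\<close>)
        then show "cat 2 n (pt [c, d]) (?it n b) = cat (Suc 0) (Suc n) (pt [c]) (cat (Suc 0) n (pt [d]) (?it n b))"
          using cd by (simp add: cat_pt numeral_2_eq_2)
      qed
      finally show "app 0 n 2 (comult H) (cat (Suc 0) n (pt [x]) (?it n b))
          = sw ?W (\<lambda>c d. cat (Suc 0) (Suc n) (pt [c]) (cat (Suc 0) n (pt [d]) (?it n b))) x" .
    qed
    \<comment> \<open>Coassociativity trades the split of the first leg for a split of the second,
      which \<open>rec\<close> then reassembles.\<close>
    also have "\<dots> = sw ?W (\<lambda>c x. sw ?W (\<lambda>d b. cat (Suc 0) (Suc n) (pt [c]) (cat (Suc 0) n (pt [d]) (?it n b))) x) h"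
      by (rule sw_coassoc[OF _ _ _ _ h]; (intro lin Lc linear_map_compose[OF L])?) auto
    also have "\<dots> = sw ?W (\<lambda>a b. cat (Suc 0) (Suc n) (pt [a]) (?it (Suc n) b)) h"
    proof (rule sw_cong)
      fix c x assume cx: "c \<in> carrier H" "x \<in> carrier H"
      show "sw ?W (\<lambda>d b. cat (Suc 0) (Suc n) (pt [c]) (cat (Suc 0) n (pt [d]) (?it n b))) x
        = cat (Suc 0) (Suc n) (pt [c]) (?it (Suc n) x)"
        unfolding rec[OF cx(2)]
        by (rule sw_map[OF _ _ _ b cx(2), symmetric]; (intro lin)?) (use cx in auto)
    qed
    finally show ?thesis .
  qed
  then show ?case using LS by blast
qed

definition act where "act n h u = diag_act K H n h u"

lemma iter_comult_lin [lin]: "linear_map K V H f \<Longrightarrow> linear_map K V (tp n) (\<lambda>x. iter_comult K H n (f x))"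
  using linear_map_compose iter_comult_Suc_linear by blast

lemma iter_comult_closed [lin]: "h \<in> carrier H \<Longrightarrow> iter_comult K H n h \<in> carrier (tp n)"
  using linear_map_closed[OF iter_comult_lin[OF linear_map_ident]] .

lemma act_lin [lin]:
  "\<lbrakk>linear_map K V H f; u \<in> carrier (tp n)\<rbrakk> \<Longrightarrow> linear_map K V (tp n) (\<lambda>x. act n (f x) u)"
  "\<lbrakk>linear_map K V (tp n) g; h \<in> carrier H\<rbrakk> \<Longrightarrow> linear_map K V (tp n) (\<lambda>x. act n h (g x))"
  unfolding act_def diag_act_def by (intro lin; assumption)+

lemma act_closed [lin]: "\<lbrakk>h \<in> carrier H; u \<in> carrier (tp n)\<rbrakk> \<Longrightarrow> act n h u \<in> carrier (tp n)"
  using linear_map_closed[OF act_lin(2)[OF linear_map_ident]] .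

text \<open>The recursion behind the structural laws of the action that follow:
  \<open>h\<^sub>1\<close> multiplies the first entry and \<open>h\<^sub>2\<close> acts on the
  rest.\<close>

lemma act_Cons:
  assumes h: "h \<in> carrier H" and x: "x \<in> carrier H" and u: "u \<in> carrier (tp n)"
  shows "act (Suc n) h (cat (Suc 0) n (pt [x]) u)
    = sw (tp (Suc n)) (\<lambda>a b. cat (Suc 0) n (pt [a \<otimes>\<^bsub>H\<^esub> x]) (act n b u)) h"
proof -
  let ?it = "iter_comult K H"
  have "act (Suc n) h (cat (Suc 0) n (pt [x]) u)
    = hpow_mult K H (Suc n) (sw (tp (Suc n)) (\<lambda>a b. cat (Suc 0) n (pt [a]) (?it n b)) h) (cat (Suc 0) n (pt [x]) u)"
    unfolding act_def diag_act_def using iter_comult_Suc_linear[of n] h by simp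
  also have "\<dots> = sw (tp (Suc n)) (\<lambda>a b. hpow_mult K H (Suc n) (cat (Suc 0) n (pt [a]) (?it n b)) (cat (Suc 0) n (pt [x]) u)) h"
    by (rule sw_map[where f = "\<lambda>w. hpow_mult K H (Suc n) w (cat (Suc 0) n (pt [x]) u)", OF _ _ _ _ h]; (intro lin)?)
      (use x u in auto)
  also have "\<dots> = sw (tp (Suc n)) (\<lambda>a b. cat (Suc 0) n (pt [a \<otimes>\<^bsub>H\<^esub> x]) (act n b u)) h"
    unfolding act_def diag_act_def
    by (rule sw_cong) (use x u in \<open>simp add: hm_Cons iter_comult_closed\<close>)
  finally show ?thesis .
qed

lemma act_Nil:
  assumes "h \<in> carrier H"
  shows "act 0 h (pt []) = eps h"
proof -
  have "act 0 h (pt []) = hpow_mult K H 0 (counit H h \<odot>\<^bsub>tp 0\<^esub> pt []) (pt [])"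
    unfolding act_def diag_act_def iter_comult_0 eps_def ..
  also have "\<dots> = counit H h \<odot>\<^bsub>tp 0\<^esub> hpow_mult K H 0 (pt []) (pt [])"
    by (rule linear_map_smult[OF hm_lin(1)[OF linear_map_ident]]) (use assms in \<open>auto intro: counit_closed\<close>)
  finally show ?thesis by (simp add: hm_pt eps_def)
qed

lemma act_smult:
  "\<lbrakk>c \<in> carrier K; h \<in> carrier H; u \<in> carrier (tp n)\<rbrakk> \<Longrightarrow> act n (c \<odot>\<^bsub>H\<^esub> h) u = c \<odot>\<^bsub>tp n\<^esub> act n h u"
  "\<lbrakk>c \<in> carrier K; h \<in> carrier H; u \<in> carrier (tp n)\<rbrakk> \<Longrightarrow> act n h (c \<odot>\<^bsub>tp n\<^esub> u) = c \<odot>\<^bsub>tp n\<^esub> act n h u"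
  using linear_map_smult[OF act_lin(1)[OF linear_map_ident]] linear_map_smult[OF act_lin(2)[OF linear_map_ident]] by auto

text \<open>Induction on the entries of a pure first factor. The empty factor absorbs its leg
  through the counit; in the step coassociativity groups the leg for the new entry with the one for
  the remaining entries.\<close>

lemma act_cat:
  assumes h: "h \<in> carrier H" and u: "u \<in> carrier (tp p)" and v: "v \<in> carrier (tp q)"
  shows "act (p + q) h (cat p q u v) = sw (tp (p + q)) (\<lambda>a b. cat p q (act p a u) (act q b v)) h"
proof -
  have pure: "act (length xs + q) h (cat (length xs) q (pt xs) v)
      = sw (tp (length xs + q)) (\<lambda>a b. cat (length xs) q (act (length xs) a (pt xs)) (act q b v)) h"
    if "set xs \<subseteq> carrier H" "h \<in> carrier H" for xs h
    using that
  proof (induction xs arbitrary: h)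
    case Nil
    have "sw (tp q) (\<lambda>a b. cat 0 q (act 0 a (pt [])) (act q b v)) h
        = sw (tp q) (\<lambda>a b. counit H a \<odot>\<^bsub>tp q\<^esub> act q b v) h"
      by (rule sw_cong) (use v in \<open>simp add: act_Nil cat_eps act_closed\<close>)
    also have "\<dots> = act q h v"
      by (rule sw_counit_left; (intro lin)?) (use v Nil in auto)
    finally show ?case using v by simp
  next
    case (Cons x xs)
    let ?n = "length xs" and ?W = "tp (Suc (length xs + q))"
    have x: "x \<in> carrier H" "set xs \<subseteq> carrier H" using Cons.prems by auto
    have xs: "pt xs \<in> carrier (tp ?n)" by (rule pt_closed) (use x in auto)
    have split: "cat (Suc ?n) q (cat (Suc 0) ?n z w) v' = cat (Suc 0) (?n + q) z (cat ?n q w v')"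
      if "z \<in> carrier (tp (Suc 0))" "w \<in> carrier (tp ?n)" "v' \<in> carrier (tp q)" for z w v'
      using cat_assoc[OF that] by simp
    have "act (Suc (?n + q)) h (cat (Suc ?n) q (pt (x # xs)) v)
        = act (Suc (?n + q)) h (cat (Suc 0) (?n + q) (pt [x]) (cat ?n q (pt xs) v))"
      using split[of "pt [x]" "pt xs" v] x xs v by (simp add: pt_Cons[of x xs] pt_closed)
    also have "\<dots> = sw ?W (\<lambda>a b. cat (Suc 0) (?n + q) (pt [a \<otimes>\<^bsub>H\<^esub> x]) (act (?n + q) b (cat ?n q (pt xs) v))) h"
      by (rule act_Cons; (intro lin)?) (use x v Cons.prems in auto)
    also have "\<dots> = sw ?W (\<lambda>a b. sw ?W (\<lambda>c d. cat (Suc 0) (?n + q) (pt [a \<otimes>\<^bsub>H\<^esub> x]) (cat ?n q (act ?n c (pt xs)) (act q d v))) b) h"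
    proof (rule sw_cong)
      fix a b assume ab: "a \<in> carrier H" "b \<in> carrier H"
      show "cat (Suc 0) (?n + q) (pt [a \<otimes>\<^bsub>H\<^esub> x]) (act (?n + q) b (cat ?n q (pt xs) v))
        = sw ?W (\<lambda>c d. cat (Suc 0) (?n + q) (pt [a \<otimes>\<^bsub>H\<^esub> x]) (cat ?n q (act ?n c (pt xs)) (act q d v))) b"
        unfolding Cons.IH[OF x(2) ab(2)]
        by (rule sw_map[OF _ _ _ _ ab(2)]; (intro lin)?) (use ab x v in auto)
    qed
    also have "\<dots> = sw ?W (\<lambda>b d. sw ?W (\<lambda>a c. cat (Suc 0) (?n + q) (pt [a \<otimes>\<^bsub>H\<^esub> x]) (cat ?n q (act ?n c (pt xs)) (act q d v))) b) h"
      by (rule sw_coassoc[symmetric]; (intro lin)?) (use x v Cons.prems in auto)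
    also have "\<dots> = sw ?W (\<lambda>b d. cat (Suc ?n) q (act (Suc ?n) b (pt (x # xs))) (act q d v)) h"
    proof (rule sw_cong)
      fix b d assume bd: "b \<in> carrier H" "d \<in> carrier H"
      have "cat (Suc ?n) q (act (Suc ?n) b (pt (x # xs))) (act q d v)
          = cat (Suc ?n) q (sw (tp (Suc ?n)) (\<lambda>a c. cat (Suc 0) ?n (pt [a \<otimes>\<^bsub>H\<^esub> x]) (act ?n c (pt xs))) b) (act q d v)"
        using act_Cons[OF bd(1) x(1) xs] x by (simp add: pt_Cons[of x xs])
      also have "\<dots> = sw ?W (\<lambda>a c. cat (Suc ?n) q (cat (Suc 0) ?n (pt [a \<otimes>\<^bsub>H\<^esub> x]) (act ?n c (pt xs))) (act q d v)) b"
        by (rule sw_map[where f = "\<lambda>w. cat (Suc ?n) q w (act q d v)", OF _ _ _ _ bd(1)]; (intro lin)?) (use bd x v in auto)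
      also have "\<dots> = sw ?W (\<lambda>a c. cat (Suc 0) (?n + q) (pt [a \<otimes>\<^bsub>H\<^esub> x]) (cat ?n q (act ?n c (pt xs)) (act q d v))) b"
        by (rule sw_cong) (use bd x v xs in \<open>simp add: split act_closed pt_closed\<close>)
      finally show "sw ?W (\<lambda>a c. cat (Suc 0) (?n + q) (pt [a \<otimes>\<^bsub>H\<^esub> x]) (cat ?n q (act ?n c (pt xs)) (act q d v))) b
          = cat (Suc ?n) q (act (Suc ?n) b (pt (x # xs))) (act q d v)" by simp
    qed
    finally show ?case by simp
  qed
  show ?thesis
    by (rule tp_ext[where n = p and W = "tp (p + q)" and u = u]; (intro lin)?) (use u v h pure in auto)
qed

text \<open>Induction on the entries: the coproduct is multiplicative, and the Sweedler sums over
  \<open>g\<close> and \<open>h\<close> commute, so the two actions can be carried out one after the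
  other.\<close>

lemma act_mult:
  assumes g: "g \<in> carrier H" and h: "h \<in> carrier H" and u: "u \<in> carrier (tp n)"
  shows "act n (g \<otimes>\<^bsub>H\<^esub> h) u = act n g (act n h u)"
proof -
  have pure: "act (length xs) (g \<otimes>\<^bsub>H\<^esub> h) (pt xs) = act (length xs) g (act (length xs) h (pt xs))"
    if "set xs \<subseteq> carrier H" "g \<in> carrier H" "h \<in> carrier H" for xs g h
    using that
  proof (induction xs arbitrary: g h)
    case Nil
    then show ?case
      using ring_hom_mult[OF counit_ring_hom]
      by (simp add: act_Nil eps_def act_smult counit_closed R.m_comm module.smult_assoc1[OF module_tp, symmetric])
  next
    case (Cons x xs)
    let ?n = "length xs" and ?W = "tp (Suc (length xs))"
    have x: "x \<in> carrier H" "set xs \<subseteq> carrier H" using Cons.prems by auto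
    have xs: "pt xs \<in> carrier (tp ?n)" by (rule pt_closed) (use x in auto)
    note gh = Cons.prems(2,3)
    note px = pt_Cons[OF x(1,2) refl]
    have "act (Suc ?n) (g \<otimes>\<^bsub>H\<^esub> h) (pt (x # xs))
        = sw ?W (\<lambda>a b. cat (Suc 0) ?n (pt [a \<otimes>\<^bsub>H\<^esub> x]) (act ?n b (pt xs))) (g \<otimes>\<^bsub>H\<^esub> h)"
      unfolding px by (rule act_Cons) (use gh x xs in auto)
    also have "\<dots> = sw ?W (\<lambda>a b. sw ?W (\<lambda>c d. cat (Suc 0) ?n (pt [a \<otimes>\<^bsub>H\<^esub> c \<otimes>\<^bsub>H\<^esub> x]) (act ?n (b \<otimes>\<^bsub>H\<^esub> d) (pt xs))) h) g"
      by (rule sw_mult[OF _ _ gh]; (intro lin)?) (use x in auto)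
    also have "\<dots> = sw ?W (\<lambda>c d. sw ?W (\<lambda>a b. cat (Suc 0) ?n (pt [a \<otimes>\<^bsub>H\<^esub> c \<otimes>\<^bsub>H\<^esub> x]) (act ?n (b \<otimes>\<^bsub>H\<^esub> d) (pt xs))) g) h"
      by (rule sw_swap[OF _ _ _ gh(2,1)]; (intro lin)?) (use x in auto)
    also have "\<dots> = sw ?W (\<lambda>c d. act (Suc ?n) g (cat (Suc 0) ?n (pt [c \<otimes>\<^bsub>H\<^esub> x]) (act ?n d (pt xs)))) h"
    proof (rule sw_cong)
      fix c d assume cd: "c \<in> carrier H" "d \<in> carrier H"
      have "act (Suc ?n) g (cat (Suc 0) ?n (pt [c \<otimes>\<^bsub>H\<^esub> x]) (act ?n d (pt xs)))
          = sw ?W (\<lambda>a b. cat (Suc 0) ?n (pt [a \<otimes>\<^bsub>H\<^esub> (c \<otimes>\<^bsub>H\<^esub> x)]) (act ?n b (act ?n d (pt xs)))) g"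
        by (rule act_Cons; (intro lin)?) (use gh cd x in auto)
      also have "\<dots> = sw ?W (\<lambda>a b. cat (Suc 0) ?n (pt [a \<otimes>\<^bsub>H\<^esub> c \<otimes>\<^bsub>H\<^esub> x]) (act ?n (b \<otimes>\<^bsub>H\<^esub> d) (pt xs))) g"
        by (rule sw_cong) (use cd x Cons.IH in \<open>simp add: m_assoc\<close>)
      finally show "sw ?W (\<lambda>a b. cat (Suc 0) ?n (pt [a \<otimes>\<^bsub>H\<^esub> c \<otimes>\<^bsub>H\<^esub> x]) (act ?n (b \<otimes>\<^bsub>H\<^esub> d) (pt xs))) g
          = act (Suc ?n) g (cat (Suc 0) ?n (pt [c \<otimes>\<^bsub>H\<^esub> x]) (act ?n d (pt xs)))" by simp
    qed
    also have "\<dots> = act (Suc ?n) g (sw ?W (\<lambda>c d. cat (Suc 0) ?n (pt [c \<otimes>\<^bsub>H\<^esub> x]) (act ?n d (pt xs))) h)"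
      by (rule sw_map[symmetric, OF _ _ _ _ gh(2)]; (intro lin)?) (use x gh in auto)
    also have "\<dots> = act (Suc ?n) g (act (Suc ?n) h (pt (x # xs)))"
      unfolding px using act_Cons[OF gh(2) x(1) xs] by simp
    finally show ?case by simp
  qed
  show ?thesis
    by (rule tp_ext[where n = n and W = "tp n" and u = u]; (intro lin)?) (use u g h pure in auto)
qed

text \<open>All legs of the iterated coproduct of a group-like element equal that element. For
  \<open>\<sigma>\<close> this describes the effect of a full turn; for the unit it gives
  \<open>act_one\<close>.\<close>

lemma act_group_like:
  assumes s: "group_like K H s" and xs: "set xs \<subseteq> carrier H"
  shows "act (length xs) s (pt xs) = pt (map (\<lambda>x. s \<otimes>\<^bsub>H\<^esub> x) xs)"
  using xs
proof (induction xs)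
  case Nil
  then show ?case using s by (simp add: act_Nil eps_def group_like_def module.smult_one[OF module_tp])
next
  case (Cons x xs)
  let ?n = "length xs"
  have sc: "s \<in> carrier H" using s by (simp add: group_like_def)
  have x: "x \<in> carrier H" "set xs \<subseteq> carrier H" using Cons.prems by auto
  have xs: "pt xs \<in> carrier (tp ?n)" by (rule pt_closed) (use x in auto)
  have "act (Suc ?n) s (pt (x # xs)) = sw (tp (Suc ?n)) (\<lambda>a b. cat (Suc 0) ?n (pt [a \<otimes>\<^bsub>H\<^esub> x]) (act ?n b (pt xs))) s"
    unfolding pt_Cons[OF x(1,2) refl] by (rule act_Cons[OF sc x(1) xs])
  also have "\<dots> = cat (Suc 0) ?n (pt [s \<otimes>\<^bsub>H\<^esub> x]) (act ?n s (pt xs))"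
    by (rule sw_group_like[OF _ _ s]; (intro lin)?) (use x in auto)
  also have "\<dots> = pt (map (\<lambda>x. s \<otimes>\<^bsub>H\<^esub> x) (x # xs))"
  proof -
    have "set (map (\<lambda>x. s \<otimes>\<^bsub>H\<^esub> x) xs) \<subseteq> carrier H" using x sc by auto
    then show ?thesis using Cons.IH x sc by (simp add: cat_pt)
  qed
  finally show ?case by simp
qed

lemma group_like_one: "group_like K H \<one>\<^bsub>H\<^esub>"
  using comult_one ring_hom_one[OF counit_ring_hom] by (simp add: group_like_def)

lemma act_one:
  assumes "u \<in> carrier (tp n)"
  shows "act n \<one>\<^bsub>H\<^esub> u = u"
proof -
  have "act n \<one>\<^bsub>H\<^esub> (pt xs) = pt xs" if "length xs = n" "set xs \<subseteq> carrier H" for xs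
  proof -
    have "map (\<lambda>x. \<one>\<^bsub>H\<^esub> \<otimes>\<^bsub>H\<^esub> x) xs = xs" using that by (auto intro!: map_idI)
    then show ?thesis using act_group_like[OF group_like_one that(2)] that by simp
  qed
  then show ?thesis
    by (intro tp_ext[where n = n and W = "tp n" and u = u and f = "\<lambda>u. act n \<one>\<^bsub>H\<^esub> u" and g = "\<lambda>u. u"] lin)
      (use assms in auto)
qed

end

section \<open>Maps at a position: evaluation, commutation, compatibility with the diagonal
  action\<close>

context hopf_algebra
begin

lemma act_single: "\<lbrakk>h \<in> carrier H; x \<in> carrier H\<rbrakk> \<Longrightarrow> act (Suc 0) h (pt [x]) = pt [h \<otimes>\<^bsub>H\<^esub> x]"
proof -
  assume h: "h \<in> carrier H" and x: "x \<in> carrier H"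
  have "act (Suc 0) h (pt [x]) = act (Suc 0) h (cat (Suc 0) 0 (pt [x]) (pt []))"
    using x by (simp add: pt_closed)
  also have "\<dots> = sw (tp (Suc 0)) (\<lambda>a b. cat (Suc 0) 0 (pt [a \<otimes>\<^bsub>H\<^esub> x]) (act 0 b (pt []))) h"
    by (rule act_Cons[OF h x]) simp
  also have "\<dots> = sw (tp (Suc 0)) (\<lambda>a b. counit H b \<odot>\<^bsub>tp (Suc 0)\<^esub> pt [a \<otimes>\<^bsub>H\<^esub> x]) h"
    by (rule sw_cong) (use x in \<open>simp add: act_Nil cat_eps pt_closed\<close>)
  also have "\<dots> = pt [h \<otimes>\<^bsub>H\<^esub> x]"
    by (rule sw_counit_right[OF _ _ h]; (intro lin)?) (use x in auto)
  finally show ?thesis .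
qed

text \<open>Evaluation of \<open>app\<close> with arbitrary tensors around the position;
  \<open>app_pt\<close> does not apply once a diagonal action has been carried out.\<close>

lemma app_cat:
  assumes f: "linear_map K H (tp m) f" and X: "X \<in> carrier (tp p)" and Y: "Y \<in> carrier (tp q)" and x: "x \<in> carrier H"
  shows "app p q m f (cat p (Suc q) X (cat (Suc 0) q (pt [x]) Y)) = cat p (m + q) X (cat m q (f x) Y)"
proof -
  have x1: "pt [x] \<in> carrier (tp (Suc 0))" using x by (intro pt_closed) auto
  have "app (p + 0) q m f (cat p (Suc (0 + q)) X (cat (Suc 0) q (pt [x]) Y))
      = cat p (0 + (m + q)) X (app 0 q m f (cat (Suc 0) q (pt [x]) Y))"
    by (rule app_left[OF f X]) (use x1 Y in \<open>auto intro: cat_closed\<close>)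
  moreover have "app 0 (0 + q) m f (cat (Suc (0 + 0)) q (pt [x]) Y) = cat (0 + (m + 0)) q (app 0 0 m f (pt [x])) Y"
    by (rule app_right[OF f Y]) (use x1 in simp)
  ultimately show ?thesis using app_single[OF f x] by simp
qed

lemma app_0_cat:
  assumes "linear_map K H (tp m) f" "Y \<in> carrier (tp q)" "x \<in> carrier H"
  shows "app 0 q m f (cat (Suc 0) q (pt [x]) Y) = cat m q (f x) Y"
  using app_cat[OF assms(1) pt_Nil_closed assms(2,3)] linear_map_closed[OF assms(1,3)] assms
  by (simp add: cat_closed pt_closed)

lemma app_end_cat:
  assumes "linear_map K H (tp m) f" "X \<in> carrier (tp p)" "x \<in> carrier H"
  shows "app p 0 m f (cat p (Suc 0) X (pt [x])) = cat p m X (f x)"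
  using app_cat[OF assms(1,2) pt_Nil_closed assms(3)] linear_map_closed[OF assms(1,3)] assms
  by (simp add: cat_closed pt_closed)

text \<open>Isolates the factor at position \<open>p\<close> and leaves its surroundings
  \<open>X\<close> and \<open>Y\<close> as general tensors, which is the form in which
  \<open>app_cat\<close> and \<open>act_cat\<close> compute.\<close>

lemma tp_split_ext:
  assumes W: "module K W" and F: "linear_map K (tp n) W F" and G: "linear_map K (tp n) W G"
    and n: "n = p + Suc q"
    and eq: "\<And>X x Y. \<lbrakk>X \<in> carrier (tp p); x \<in> carrier H; Y \<in> carrier (tp q)\<rbrakk>
      \<Longrightarrow> F (cat p (Suc q) X (cat (Suc 0) q (pt [x]) Y)) = G (cat p (Suc q) X (cat (Suc 0) q (pt [x]) Y))"
    and w: "w \<in> carrier (tp n)"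
  shows "F w = G w"
proof (rule tp_ext[OF W F G _ w])
  fix xs :: "'h list" assume xs: "length xs = n" "set xs \<subseteq> carrier H"
  then have "p < length xs" using n by simp
  then obtain A x B where A: "xs = A @ x # B" "length A = p" by (rule list_split_one)
  have "cat p (Suc q) (pt A) (cat (Suc 0) q (pt [x]) (pt B)) = pt xs"
    using A xs n by (simp add: cat_pt)
  then show "F (pt xs) = G (pt xs)" using eq[of "pt A" x "pt B"] A xs n by (simp add: pt_closed)
qed

lemma tp_Suc_ext:
  assumes W: "module K W" and F: "linear_map K (tp (Suc q)) W F" and G: "linear_map K (tp (Suc q)) W G"
    and eq: "\<And>x Y. \<lbrakk>x \<in> carrier H; Y \<in> carrier (tp q)\<rbrakk>
      \<Longrightarrow> F (cat (Suc 0) q (pt [x]) Y) = G (cat (Suc 0) q (pt [x]) Y)"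
    and w: "w \<in> carrier (tp (Suc q))"
  shows "F w = G w"
proof (rule tp_ext[OF W F G _ w])
  fix xs :: "'h list" assume xs: "length xs = Suc q" "set xs \<subseteq> carrier H"
  then obtain x ys where x: "xs = x # ys" by (cases xs) auto
  then show "F (pt xs) = G (pt xs)"
    using eq[of x "pt ys"] pt_Cons[of x ys q] xs by (simp add: pt_closed)
qed

text \<open>Maps at different positions commute. Since \<open>f\<close> replaces one factor by
  \<open>m\<close>, the later position moves from \<open>Suc (p + s)\<close> to
  \<open>p + m + s\<close>. The identities between non-adjacent inner cofaces and codegeneracies are
  instances, with \<open>m\<close> and \<open>l\<close> equal to 2 or 0.\<close>

lemma app_app:
  assumes f: "linear_map K H (tp m) f" and g: "linear_map K H (tp l) g"
    and w: "w \<in> carrier (tp (Suc (p + Suc (s + t))))"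
  shows "app (p + m + s) t l g (app p (Suc (s + t)) m f w) = app p (s + (l + t)) m f (app (Suc (p + s)) t l g w)"
proof (rule tp_split_ext[where W = "tp (p + (m + (s + (l + t))))" and p = p and q = "Suc (s + t)", OF _ _ _ _ _ w])
  fix X x Y assume X: "X \<in> carrier (tp p)" and x: "x \<in> carrier H" and Y: "Y \<in> carrier (tp (Suc (s + t)))"
  note fx = linear_map_closed[OF f x]
  have x1: "pt [x] \<in> carrier (tp (Suc 0))" using x by (intro pt_closed) auto
  have c1: "cat (p + m) (Suc (s + t)) (cat p m X (f x)) Y = cat p (m + Suc (s + t)) X (cat m (Suc (s + t)) (f x) Y)"
    by (rule cat_assoc[OF X fx Y])
  have gY: "app s t l g Y \<in> carrier (tp (s + (l + t)))"
    by (rule app_closed[OF g Y]) simp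
  have "app (p + m + s) t l g (app p (Suc (s + t)) m f (cat p (Suc (Suc (s + t))) X (cat (Suc 0) (Suc (s + t)) (pt [x]) Y)))
      = app (p + m + s) t l g (cat (p + m) (Suc (s + t)) (cat p m X (f x)) Y)"
    unfolding app_cat[OF f X Y x] c1 ..
  also have "\<dots> = cat (p + m) (s + (l + t)) (cat p m X (f x)) (app s t l g Y)"
    by (rule app_left[OF g _ Y]) (use X fx in \<open>auto intro: cat_closed\<close>)
  also have "\<dots> = cat p (m + (s + (l + t))) X (cat m (s + (l + t)) (f x) (app s t l g Y))"
    by (rule cat_assoc[OF X fx gY])
  also have "\<dots> = app p (s + (l + t)) m f (cat p (Suc (s + (l + t))) X (cat (Suc 0) (s + (l + t)) (pt [x]) (app s t l g Y)))"
    by (rule app_cat[OF f X gY x, symmetric])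
  also have "cat p (Suc (s + (l + t))) X (cat (Suc 0) (s + (l + t)) (pt [x]) (app s t l g Y))
      = cat (Suc p) (s + (l + t)) (cat p (Suc 0) X (pt [x])) (app s t l g Y)"
    using cat_assoc[OF X x1 gY] by simp
  also have "\<dots> = app (Suc p + s) t l g (cat (Suc p) (Suc (s + t)) (cat p (Suc 0) X (pt [x])) Y)"
    by (rule app_left[OF g _ Y, symmetric]) (use X x1 in \<open>auto intro: cat_closed\<close>)
  also have "cat (Suc p) (Suc (s + t)) (cat p (Suc 0) X (pt [x])) Y
      = cat p (Suc (Suc (s + t))) X (cat (Suc 0) (Suc (s + t)) (pt [x]) Y)"
    using cat_assoc[OF X x1 Y] by simp
  finally show "app (p + m + s) t l g (app p (Suc (s + t)) m f (cat p (Suc (Suc (s + t))) X (cat (Suc 0) (Suc (s + t)) (pt [x]) Y)))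
    = app p (s + (l + t)) m f (app (Suc (p + s)) t l g (cat p (Suc (Suc (s + t))) X (cat (Suc 0) (Suc (s + t)) (pt [x]) Y)))"
    by simp
qed ((intro lin f g)?; simp)+

text \<open>Here \<open>g\<close> acts on one of the factors that \<open>f\<close> has produced, so
  an identity between maps on \<open>H\<close> holds at every position. Coassociativity and the
  counit axioms are spread over \<open>H\<^sup>\<otimes>\<^sup>n\<close> in this way.\<close>

lemma app_inside:
  assumes f: "linear_map K H (tp m) f" and g: "linear_map K H (tp l) g"
    and m: "m = Suc (r + s)" and w: "w \<in> carrier (tp (Suc (p + q)))"
    and h: "linear_map K H (tp (r + (l + s))) h" and eq: "\<And>x. x \<in> carrier H \<Longrightarrow> app r s l g (f x) = h x"
  shows "app (p + r) (s + q) l g (app p q m f w) = app p q (r + (l + s)) h w"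
proof (rule tp_split_ext[where W = "tp (p + (r + (l + s) + q))" and p = p and q = q, OF _ _ _ _ _ w])
  fix X x Y assume X: "X \<in> carrier (tp p)" and x: "x \<in> carrier H" and Y: "Y \<in> carrier (tp q)"
  have fx: "f x \<in> carrier (tp (Suc (r + s)))" using linear_map_closed[OF f x] m by simp
  have "app (p + r) (s + q) l g (app p q m f (cat p (Suc q) X (cat (Suc 0) q (pt [x]) Y)))
      = app (p + r) (s + q) l g (cat p (Suc (r + (s + q))) X (cat (Suc (r + s)) q (f x) Y))"
    using app_cat[OF f X Y x] by (simp add: m add.assoc)
  also have "\<dots> = cat p (r + (l + (s + q))) X (app r (s + q) l g (cat (Suc (r + s)) q (f x) Y))"
    by (rule app_left[OF g X]) (use fx Y in \<open>auto intro: cat_closed\<close>)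
  also have "app r (s + q) l g (cat (Suc (r + s)) q (f x) Y) = cat (r + (l + s)) q (app r s l g (f x)) Y"
    by (rule app_right[OF g Y fx])
  finally show "app (p + r) (s + q) l g (app p q m f (cat p (Suc q) X (cat (Suc 0) q (pt [x]) Y)))
    = app p q (r + (l + s)) h (cat p (Suc q) X (cat (Suc 0) q (pt [x]) Y))"
    unfolding app_cat[OF h X Y x] eq[OF x] by (simp add: add.assoc)
qed ((intro lin f g h)?; simp add: m)+

text \<open>A left \<open>H\<close>-linear map from \<open>H\<close> to
  \<open>H\<^sup>\<otimes>\<^sup>m\<close> remains linear for the diagonal action when applied at
  one position: by \<open>act_cat\<close> only the leg falling on that position matters. The
  instances are \<open>comult\<close> and \<open>eps\<close>.\<close>

lemma app_act:
  assumes f: "linear_map K H (tp m) f"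
    and eq: "\<And>a x. \<lbrakk>a \<in> carrier H; x \<in> carrier H\<rbrakk> \<Longrightarrow> f (a \<otimes>\<^bsub>H\<^esub> x) = act m a (f x)"
    and h: "h \<in> carrier H" and w: "w \<in> carrier (tp (Suc (p + q)))"
  shows "app p q m f (act (Suc (p + q)) h w) = act (p + (m + q)) h (app p q m f w)"
proof (rule tp_split_ext[where W = "tp (p + (m + q))" and p = p and q = q, OF _ _ _ _ _ w])
  fix X x Y assume X: "X \<in> carrier (tp p)" and x: "x \<in> carrier H" and Y: "Y \<in> carrier (tp q)"
  note fx = linear_map_closed[OF f x]
  let ?W = "tp (p + (m + q))"
  have x1: "pt [x] \<in> carrier (tp (Suc 0))" using x by (intro pt_closed) auto
  have xY: "cat (Suc 0) q (pt [x]) Y \<in> carrier (tp (Suc q))" using x1 Y by (intro cat_closed) auto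
  have "act (Suc (p + q)) h (cat p (Suc q) X (cat (Suc 0) q (pt [x]) Y))
      = sw (tp (Suc (p + q))) (\<lambda>a b. cat p (Suc q) (act p a X) (act (Suc q) b (cat (Suc 0) q (pt [x]) Y))) h"
    using act_cat[OF h X xY] by simp
  then have "app p q m f (act (Suc (p + q)) h (cat p (Suc q) X (cat (Suc 0) q (pt [x]) Y)))
      = app p q m f (sw (tp (Suc (p + q))) (\<lambda>a b. cat p (Suc q) (act p a X) (act (Suc q) b (cat (Suc 0) q (pt [x]) Y))) h)"
    by simp
  also have "\<dots> = sw ?W (\<lambda>a b. app p q m f (cat p (Suc q) (act p a X) (act (Suc q) b (cat (Suc 0) q (pt [x]) Y)))) h"
    by (rule sw_map[OF _ _ _ _ h]; (intro lin f)?) (use X Y x in auto)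
  also have "\<dots> = sw ?W (\<lambda>a b. cat p (m + q) (act p a X) (act (m + q) b (cat m q (f x) Y))) h"
  proof (rule sw_cong)
    fix a b assume ab: "a \<in> carrier H" "b \<in> carrier H"
    have aX: "act p a X \<in> carrier (tp p)" using ab X by (intro lin)
    have "app p q m f (cat p (Suc q) (act p a X) (act (Suc q) b (cat (Suc 0) q (pt [x]) Y)))
      = app p q m f (cat p (Suc q) (act p a X) (sw (tp (Suc q)) (\<lambda>c d. cat (Suc 0) q (pt [c \<otimes>\<^bsub>H\<^esub> x]) (act q d Y)) b))"
      using act_Cons[OF ab(2) x Y] by simp
    also have "\<dots> = sw ?W (\<lambda>c d. app p q m f (cat p (Suc q) (act p a X) (cat (Suc 0) q (pt [c \<otimes>\<^bsub>H\<^esub> x]) (act q d Y)))) b"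
      by (rule sw_map[where f = "\<lambda>w. app p q m f (cat p (Suc q) (act p a X) w)", OF _ _ _ _ ab(2)]; (intro lin f)?)
        (use X Y x ab in auto)
    also have "\<dots> = sw ?W (\<lambda>c d. cat p (m + q) (act p a X) (cat m q (act m c (f x)) (act q d Y))) b"
    proof (rule sw_cong)
      fix c d assume cd: "c \<in> carrier H" "d \<in> carrier H"
      then have "act q d Y \<in> carrier (tp q)" using Y by (intro lin)
      from app_cat[OF f aX this, of "c \<otimes>\<^bsub>H\<^esub> x"] cd x
      show "app p q m f (cat p (Suc q) (act p a X) (cat (Suc 0) q (pt [c \<otimes>\<^bsub>H\<^esub> x]) (act q d Y)))
          = cat p (m + q) (act p a X) (cat m q (act m c (f x)) (act q d Y))"
        by (simp add: eq)
    qed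
    also have "\<dots> = cat p (m + q) (act p a X) (sw (tp (m + q)) (\<lambda>c d. cat m q (act m c (f x)) (act q d Y)) b)"
      by (rule sw_map[symmetric, OF _ _ _ _ ab(2)]; (intro lin f)?) (use X Y x ab fx in auto)
    also have "\<dots> = cat p (m + q) (act p a X) (act (m + q) b (cat m q (f x) Y))"
      using act_cat[OF ab(2) fx Y] by simp
    finally show "app p q m f (cat p (Suc q) (act p a X) (act (Suc q) b (cat (Suc 0) q (pt [x]) Y)))
        = cat p (m + q) (act p a X) (act (m + q) b (cat m q (f x) Y))" .
  qed
  also have "\<dots> = act (p + (m + q)) h (cat p (m + q) X (cat m q (f x) Y))"
    by (rule act_cat[OF h X, symmetric]) (use fx Y in \<open>auto intro: cat_closed\<close>)
  finally show "app p q m f (act (Suc (p + q)) h (cat p (Suc q) X (cat (Suc 0) q (pt [x]) Y)))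
    = act (p + (m + q)) h (app p q m f (cat p (Suc q) X (cat (Suc 0) q (pt [x]) Y)))"
    unfolding app_cat[OF f X Y x] .
qed ((intro lin f)?; simp add: h)+

lemma eps_mult: "\<lbrakk>a \<in> carrier H; x \<in> carrier H\<rbrakk> \<Longrightarrow> eps (a \<otimes>\<^bsub>H\<^esub> x) = act 0 a (eps x)"
  using ring_hom_mult[OF counit_ring_hom]
  by (simp add: eps_def act_smult act_Nil counit_closed R.m_comm module.smult_assoc1[OF module_tp, symmetric])

text \<open>Multiplicativity of the coproduct, read as left \<open>H\<close>-linearity.\<close>

lemma comult_act:
  assumes a: "a \<in> carrier H" and x: "x \<in> carrier H"
  shows "comult H (a \<otimes>\<^bsub>H\<^esub> x) = act 2 a (comult H x)"
proof -
  have pt2: "act 2 a (pt [c, d]) = sw (tp 2) (\<lambda>u v. pt [u \<otimes>\<^bsub>H\<^esub> c, v \<otimes>\<^bsub>H\<^esub> d]) a"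
    if "c \<in> carrier H" "d \<in> carrier H" for c d
  proof -
    have d1: "pt [d] \<in> carrier (tp (Suc 0))" using that by (intro pt_closed) auto
    have "act (Suc (Suc 0)) a (pt [c, d]) = act (Suc (Suc 0)) a (cat (Suc 0) (Suc 0) (pt [c]) (pt [d]))"
      using that by (simp add: cat_pt)
    also have "\<dots> = sw (tp (Suc (Suc 0))) (\<lambda>u v. cat (Suc 0) (Suc 0) (pt [u \<otimes>\<^bsub>H\<^esub> c]) (act (Suc 0) v (pt [d]))) a"
      by (rule act_Cons[OF a that(1) d1])
    also have "\<dots> = sw (tp (Suc (Suc 0))) (\<lambda>u v. pt [u \<otimes>\<^bsub>H\<^esub> c, v \<otimes>\<^bsub>H\<^esub> d]) a"
      by (rule sw_cong) (use that in \<open>simp add: act_single cat_pt\<close>)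
    finally show ?thesis by (simp add: numeral_2_eq_2)
  qed
  have "comult H (a \<otimes>\<^bsub>H\<^esub> x) = sw (tp 2) (\<lambda>u v. pt [u, v]) (a \<otimes>\<^bsub>H\<^esub> x)"
    using a x by (intro comult_sw) simp
  also have "\<dots> = sw (tp 2) (\<lambda>u v. sw (tp 2) (\<lambda>c d. pt [u \<otimes>\<^bsub>H\<^esub> c, v \<otimes>\<^bsub>H\<^esub> d]) x) a"
    by (rule sw_mult[OF _ _ a x]; (intro lin)?) auto
  also have "\<dots> = sw (tp 2) (\<lambda>c d. sw (tp 2) (\<lambda>u v. pt [u \<otimes>\<^bsub>H\<^esub> c, v \<otimes>\<^bsub>H\<^esub> d]) a) x"
    by (rule sw_swap[OF _ _ _ x a]; (intro lin)?) auto
  also have "\<dots> = sw (tp 2) (\<lambda>c d. act 2 a (pt [c, d])) x"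
    by (rule sw_cong) (simp add: pt2)
  also have "\<dots> = act 2 a (comult H x)"
    by (rule sw_comult_map[symmetric, OF _ _ x]; (intro lin)?) (use a in auto)
  finally show ?thesis .
qed

lemma comult_coassoc: "h \<in> carrier H \<Longrightarrow> app 0 1 2 (comult H) (comult H h) = app 1 0 2 (comult H) (comult H h)"
  using coassoc[of h] comult_at_eq[of 0 1] comult_at_eq[of 1 0] by (simp add: numeral_2_eq_2)

lemma comult_counit:
  assumes h: "h \<in> carrier H"
  shows "app 0 1 0 eps (comult H h) = pt [h]" "app 1 0 0 eps (comult H h) = pt [h]"
proof -
  have "app 0 1 0 eps (comult H h) = sw (tp (Suc 0)) (\<lambda>a b. app 0 1 0 eps (pt [a, b])) h"
    by (rule sw_comult_map[OF _ _ h]; (intro lin)?) auto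
  also have "\<dots> = sw (tp (Suc 0)) (\<lambda>a b. counit H a \<odot>\<^bsub>tp (Suc 0)\<^esub> pt [b]) h"
  proof (rule sw_cong)
    fix a b assume ab: "a \<in> carrier H" "b \<in> carrier H"
    then show "app 0 1 0 eps (pt [a, b]) = counit H a \<odot>\<^bsub>tp (Suc 0)\<^esub> pt [b]"
      using app_0_cat[OF eps_linear, of "pt [b]" "Suc 0" a] by (simp add: cat_pt pt_closed cat_eps)
  qed
  also have "\<dots> = pt [h]"
    by (rule sw_counit_left[OF _ _ h]; (intro lin)?) auto
  finally show "app 0 1 0 eps (comult H h) = pt [h]" .
  have "app 1 0 0 eps (comult H h) = sw (tp (Suc 0)) (\<lambda>a b. app 1 0 0 eps (pt [a, b])) h"
    by (rule sw_comult_map[OF _ _ h]; (intro lin)?) auto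
  also have "\<dots> = sw (tp (Suc 0)) (\<lambda>a b. counit H b \<odot>\<^bsub>tp (Suc 0)\<^esub> pt [a]) h"
  proof (rule sw_cong)
    fix a b assume ab: "a \<in> carrier H" "b \<in> carrier H"
    then show "app 1 0 0 eps (pt [a, b]) = counit H b \<odot>\<^bsub>tp (Suc 0)\<^esub> pt [a]"
      using app_end_cat[OF eps_linear, of "pt [a]" "Suc 0" b] by (simp add: cat_pt pt_closed cat_eps)
  qed
  also have "\<dots> = pt [h]"
    by (rule sw_counit_right[OF _ _ h]; (intro lin)?) auto
  finally show "app 1 0 0 eps (comult H h) = pt [h]" .
qed

lemma app_pt_id:
  assumes w: "w \<in> carrier (tp (Suc (p + q)))"
  shows "app p q 1 (\<lambda>x. pt [x]) w = w"
proof (rule tp_split_ext[where W = "tp (Suc (p + q))" and p = p and q = q, OF _ _ _ _ _ w])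
  fix X x Y assume X: "X \<in> carrier (tp p)" and x: "x \<in> carrier H" and Y: "Y \<in> carrier (tp q)"
  have "linear_map K H (tp 1) (\<lambda>x. pt [x])" by (intro lin) auto
  from app_cat[OF this X Y x]
  show "app p q 1 (\<lambda>x. pt [x]) (cat p (Suc q) X (cat (Suc 0) q (pt [x]) Y)) = cat p (Suc q) X (cat (Suc 0) q (pt [x]) Y)"
    by simp
qed ((intro lin)?; simp)+

lemma comult_coassoc_at:
  assumes "w \<in> carrier (tp (Suc (p + q)))"
  shows "app (Suc p) q 2 (comult H) (app p q 2 (comult H) w) = app p (Suc q) 2 (comult H) (app p q 2 (comult H) w)"
proof -
  note L = comult_linear_tp
  have l: "linear_map K H (tp (0 + (2 + 1))) (\<lambda>x. app 0 1 2 (comult H) (comult H x))"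
    by (intro lin) (use L in \<open>simp_all add: numeral_2_eq_2\<close>)
  have "app (p + 0) (1 + q) 2 (comult H) (app p q 2 (comult H) w) = app p q (0 + (2 + 1)) (\<lambda>x. app 0 1 2 (comult H) (comult H x)) w"
    by (rule app_inside[OF L L _ assms l]) simp_all
  moreover have "app (p + 1) (0 + q) 2 (comult H) (app p q 2 (comult H) w) = app p q (1 + (2 + 0)) (\<lambda>x. app 0 1 2 (comult H) (comult H x)) w"
    by (rule app_inside[OF L L _ assms]) (use l comult_coassoc in \<open>simp_all add: numeral_3_eq_3\<close>)
  ultimately show ?thesis by (simp add: numeral_3_eq_3)
qed

lemma comult_counit_at:
  assumes "w \<in> carrier (tp (Suc (p + q)))"
  shows "app p (Suc q) 0 eps (app p q 2 (comult H) w) = w" "app (Suc p) q 0 eps (app p q 2 (comult H) w) = w"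
proof -
  have l: "linear_map K H (tp (Suc 0)) (\<lambda>x. pt [x])" by (intro lin) auto
  have "app (p + 0) (1 + q) 0 eps (app p q 2 (comult H) w) = app p q (0 + (0 + 1)) (\<lambda>x. pt [x]) w"
    by (rule app_inside[OF comult_linear_tp eps_linear _ assms]) (use l comult_counit in auto)
  then show "app p (Suc q) 0 eps (app p q 2 (comult H) w) = w" using app_pt_id[OF assms] by simp
  have "app (p + 1) (0 + q) 0 eps (app p q 2 (comult H) w) = app p q (1 + (0 + 0)) (\<lambda>x. pt [x]) w"
    by (rule app_inside[OF comult_linear_tp eps_linear _ assms]) (use l comult_counit in auto)
  then show "app (Suc p) q 0 eps (app p q 2 (comult H) w) = w" using app_pt_id[OF assms] by simp
qed

end

section \<open>The twisted antipode\<close>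

locale hopf_modular = hopf_algebra K H
  for K :: "('k, 'z) ring_scheme" and H :: "('k, 'h, 'y) hopf_scheme" +
  fixes \<delta> :: "'h \<Rightarrow> 'k" and \<sigma> :: 'h
  assumes mpi: "modular_pair_in_involution K H \<delta> \<sigma>"
begin

lemma delta_linear: "linear_map K H (self_module K) \<delta>" and delta_hom: "\<delta> \<in> ring_hom H K"
  and sigma_group_like: "group_like K H \<sigma>" and delta_sigma: "\<delta> \<sigma> = \<one>\<^bsub>K\<^esub>"
  using mpi by (auto simp: modular_pair_in_involution_def hopf_character_def)

lemma sigma_closed [simp, lin]: "\<sigma> \<in> carrier H"
  using sigma_group_like by (simp add: group_like_def)

lemma delta_lin [lin]: "linear_map K V H f \<Longrightarrow> linear_map K V (self_module K) (\<lambda>x. \<delta> (f x))"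
  by (rule linear_map_compose[OF delta_linear])

lemma delta_closed [lin]: "h \<in> carrier H \<Longrightarrow> \<delta> h \<in> carrier K"
  using linear_map_closed[OF delta_linear] by simp

definition Sd :: "'h \<Rightarrow> 'h" where
  "Sd h = twisted_antipode K H \<delta> h"

lemma Sd_eq: "Sd h = sw H (\<lambda>a b. \<delta> a \<odot>\<^bsub>H\<^esub> antipode H b) h"
  by (simp add: Sd_def twisted_antipode_def)

lemma Sd_lin [lin]: "linear_map K V H f \<Longrightarrow> linear_map K V H (\<lambda>x. Sd (f x))"
  unfolding Sd_eq by (intro lin; assumption?) auto

lemma Sd_closed [lin]: "h \<in> carrier H \<Longrightarrow> Sd h \<in> carrier H"
  using linear_map_closed[OF Sd_lin[OF linear_map_ident]] .

lemma Sd_apply: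
  assumes W: "module K W" and f: "linear_map K H W f" and h: "h \<in> carrier H"
  shows "f (Sd h) = sw W (\<lambda>a b. \<delta> a \<odot>\<^bsub>W\<^esub> f (antipode H b)) h"
proof -
  have "f (Sd h) = sw W (\<lambda>a b. f (\<delta> a \<odot>\<^bsub>H\<^esub> antipode H b)) h"
    unfolding Sd_eq by (rule sw_map[OF _ W f _ h]; (intro lin)?) auto
  also have "\<dots> = sw W (\<lambda>a b. \<delta> a \<odot>\<^bsub>W\<^esub> f (antipode H b)) h"
    by (rule sw_cong) (simp add: linear_map_smult[OF f] delta_closed antipode_closed)
  finally show ?thesis .
qed

text \<open>Expanding the definition gives \<open>\<delta>(h\<^sub>1)S(h\<^sub>2)h\<^sub>3\<close>,
  and the antipode axiom removes the last two legs.\<close>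

lemma Sd_left:
  assumes W: "module K W" and f: "linear_map K H W f" and h: "h \<in> carrier H"
  shows "sw W (\<lambda>a b. f (Sd a \<otimes>\<^bsub>H\<^esub> b)) h = \<delta> h \<odot>\<^bsub>W\<^esub> f \<one>\<^bsub>H\<^esub>"
proof -
  have fl: "linear_map K V W (\<lambda>x. f (g x))" if "linear_map K V H g" for g and V :: "('k, 'h, 'y) hopf_scheme"
    by (rule linear_map_compose[OF f that])
  have "sw W (\<lambda>a b. f (Sd a \<otimes>\<^bsub>H\<^esub> b)) h
      = sw W (\<lambda>x b. sw W (\<lambda>c d. \<delta> c \<odot>\<^bsub>W\<^esub> f (antipode H d \<otimes>\<^bsub>H\<^esub> b)) x) h"
    by (rule sw_cong) (rule Sd_apply[OF W]; (intro lin fl)?; simp)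
  also have "\<dots> = sw W (\<lambda>c x. sw W (\<lambda>d b. \<delta> c \<odot>\<^bsub>W\<^esub> f (antipode H d \<otimes>\<^bsub>H\<^esub> b)) x) h"
    by (rule sw_coassoc[OF W _ _ _ h]; (intro lin fl linear_map_closed[OF f])?) (use W in auto)
  also have "\<dots> = sw W (\<lambda>c x. counit H x \<odot>\<^bsub>W\<^esub> (\<delta> c \<odot>\<^bsub>W\<^esub> f \<one>\<^bsub>H\<^esub>)) h"
  proof (rule sw_cong)
    fix c x assume cx: "c \<in> carrier H" "x \<in> carrier H"
    have "sw W (\<lambda>d b. \<delta> c \<odot>\<^bsub>W\<^esub> f (antipode H d \<otimes>\<^bsub>H\<^esub> b)) x = counit H x \<odot>\<^bsub>W\<^esub> (\<delta> c \<odot>\<^bsub>W\<^esub> f \<one>\<^bsub>H\<^esub>)"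
      by (rule sw_antipode_left[OF W _ cx(2), where f = "\<lambda>y. \<delta> c \<odot>\<^bsub>W\<^esub> f y"]; (intro lin f)?)
        (use W cx in auto)
    then show "sw W (\<lambda>d b. \<delta> c \<odot>\<^bsub>W\<^esub> f (antipode H d \<otimes>\<^bsub>H\<^esub> b)) x = counit H x \<odot>\<^bsub>W\<^esub> (\<delta> c \<odot>\<^bsub>W\<^esub> f \<one>\<^bsub>H\<^esub>)" .
  qed
  also have "\<dots> = \<delta> h \<odot>\<^bsub>W\<^esub> f \<one>\<^bsub>H\<^esub>"
    by (rule sw_counit_right[OF W _ h]; (intro lin linear_map_closed[OF f])?) (use W in auto)
  finally show ?thesis .
qed

text \<open>Because the antipode is the convolution inverse of the identity.\<close>

lemma convolution_cancel:
  assumes G: "linear_map K H H G" and P: "linear_map K H H P"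
    and eq: "\<And>x. x \<in> carrier H \<Longrightarrow> sw H (\<lambda>c d. G c \<otimes>\<^bsub>H\<^esub> d) x = P x" and h: "h \<in> carrier H"
  shows "G h = sw H (\<lambda>c d. P c \<otimes>\<^bsub>H\<^esub> antipode H d) h"
proof -
  have Gl: "linear_map K H H (\<lambda>x. G (g x))" if "linear_map K H H g" for g
    by (rule linear_map_compose[OF G that])
  note Gc = linear_map_closed[OF G]
  have "sw H (\<lambda>c d. P c \<otimes>\<^bsub>H\<^esub> antipode H d) h
      = sw H (\<lambda>x d. sw H (\<lambda>a b. G a \<otimes>\<^bsub>H\<^esub> b \<otimes>\<^bsub>H\<^esub> antipode H d) x) h"
  proof (rule sw_cong)
    fix x d assume xd: "x \<in> carrier H" "d \<in> carrier H"
    show "P x \<otimes>\<^bsub>H\<^esub> antipode H d = sw H (\<lambda>a b. G a \<otimes>\<^bsub>H\<^esub> b \<otimes>\<^bsub>H\<^esub> antipode H d) x"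
      unfolding eq[OF xd(1), symmetric]
      by (rule sw_map[where f = "\<lambda>y. y \<otimes>\<^bsub>H\<^esub> antipode H d", OF _ _ _ _ xd(1)]; (intro lin Gl Gc)?)
        (use xd in auto)
  qed
  also have "\<dots> = sw H (\<lambda>a x. sw H (\<lambda>b d. G a \<otimes>\<^bsub>H\<^esub> b \<otimes>\<^bsub>H\<^esub> antipode H d) x) h"
    by (rule sw_coassoc[OF _ _ _ _ h]; (intro lin Gl Gc)?) auto
  also have "\<dots> = sw H (\<lambda>a x. counit H x \<odot>\<^bsub>H\<^esub> G a) h"
  proof (rule sw_cong)
    fix a x assume ax: "a \<in> carrier H" "x \<in> carrier H"
    have "sw H (\<lambda>b d. G a \<otimes>\<^bsub>H\<^esub> b \<otimes>\<^bsub>H\<^esub> antipode H d) x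
        = sw H (\<lambda>b d. G a \<otimes>\<^bsub>H\<^esub> (b \<otimes>\<^bsub>H\<^esub> antipode H d)) x"
      by (rule sw_cong) (use ax in \<open>simp add: m_assoc Gc antipode_closed\<close>)
    also have "\<dots> = counit H x \<odot>\<^bsub>H\<^esub> (G a \<otimes>\<^bsub>H\<^esub> \<one>\<^bsub>H\<^esub>)"
      by (rule sw_antipode_right[OF _ _ ax(2)]; (intro lin Gc)?) (use ax in auto)
    finally show "sw H (\<lambda>b d. G a \<otimes>\<^bsub>H\<^esub> b \<otimes>\<^bsub>H\<^esub> antipode H d) x = counit H x \<odot>\<^bsub>H\<^esub> G a"
      using Gc[OF ax(1)] by simp
  qed
  also have "\<dots> = G h"
    by (rule sw_counit_right[OF _ G h]) simp
  finally show ?thesis by simp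
qed

text \<open>\<open>Sd_left\<close> for a product says
  \<open>S\<^sub>\<delta>(g\<^sub>1x\<^sub>1)g\<^sub>2x\<^sub>2 = \<delta>(gx)1\<close>. Cancelling
  the convolution in \<open>x\<close> gives \<open>S\<^sub>\<delta>(g\<^sub>1h)g\<^sub>2 =
  \<delta>(g)S\<^sub>\<delta>(h)\<close>, and cancelling the one in \<open>g\<close> gives the
  claim.\<close>

lemma Sd_mult:
  assumes g: "g \<in> carrier H" and h: "h \<in> carrier H"
  shows "Sd (g \<otimes>\<^bsub>H\<^esub> h) = Sd h \<otimes>\<^bsub>H\<^esub> Sd g"
proof -
  have 1: "sw H (\<lambda>a b. Sd (a \<otimes>\<^bsub>H\<^esub> h) \<otimes>\<^bsub>H\<^esub> b) g = \<delta> g \<odot>\<^bsub>H\<^esub> Sd h"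
    if g: "g \<in> carrier H" and h: "h \<in> carrier H" for g h
  proof -
    have "sw H (\<lambda>c d. sw H (\<lambda>a b. Sd (a \<otimes>\<^bsub>H\<^esub> c) \<otimes>\<^bsub>H\<^esub> b) g \<otimes>\<^bsub>H\<^esub> d) x = \<delta> g \<odot>\<^bsub>H\<^esub> (\<delta> x \<odot>\<^bsub>H\<^esub> \<one>\<^bsub>H\<^esub>)"
      if x: "x \<in> carrier H" for x
    proof -
      have "sw H (\<lambda>c d. sw H (\<lambda>a b. Sd (a \<otimes>\<^bsub>H\<^esub> c) \<otimes>\<^bsub>H\<^esub> b) g \<otimes>\<^bsub>H\<^esub> d) x
          = sw H (\<lambda>c d. sw H (\<lambda>a b. Sd (a \<otimes>\<^bsub>H\<^esub> c) \<otimes>\<^bsub>H\<^esub> (b \<otimes>\<^bsub>H\<^esub> d)) g) x"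
      proof (rule sw_cong)
        fix c d assume cd: "c \<in> carrier H" "d \<in> carrier H"
        have "sw H (\<lambda>a b. Sd (a \<otimes>\<^bsub>H\<^esub> c) \<otimes>\<^bsub>H\<^esub> b) g \<otimes>\<^bsub>H\<^esub> d = sw H (\<lambda>a b. Sd (a \<otimes>\<^bsub>H\<^esub> c) \<otimes>\<^bsub>H\<^esub> b \<otimes>\<^bsub>H\<^esub> d) g"
          by (rule sw_map[where f = "\<lambda>y. y \<otimes>\<^bsub>H\<^esub> d", OF _ _ _ _ g]; (intro lin)?) (use cd in auto)
        also have "\<dots> = sw H (\<lambda>a b. Sd (a \<otimes>\<^bsub>H\<^esub> c) \<otimes>\<^bsub>H\<^esub> (b \<otimes>\<^bsub>H\<^esub> d)) g"
          by (rule sw_cong) (use cd in \<open>simp add: m_assoc Sd_closed\<close>)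
        finally show "sw H (\<lambda>a b. Sd (a \<otimes>\<^bsub>H\<^esub> c) \<otimes>\<^bsub>H\<^esub> b) g \<otimes>\<^bsub>H\<^esub> d
            = sw H (\<lambda>a b. Sd (a \<otimes>\<^bsub>H\<^esub> c) \<otimes>\<^bsub>H\<^esub> (b \<otimes>\<^bsub>H\<^esub> d)) g" .
      qed
      also have "\<dots> = sw H (\<lambda>a b. sw H (\<lambda>c d. Sd (a \<otimes>\<^bsub>H\<^esub> c) \<otimes>\<^bsub>H\<^esub> (b \<otimes>\<^bsub>H\<^esub> d)) x) g"
        by (rule sw_swap[OF _ _ _ g x]; (intro lin)?) auto
      also have "\<dots> = sw H (\<lambda>a b. Sd a \<otimes>\<^bsub>H\<^esub> b) (g \<otimes>\<^bsub>H\<^esub> x)"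
        by (rule sw_mult[symmetric, OF _ _ g x]; (intro lin)?) auto
      also have "\<dots> = \<delta> (g \<otimes>\<^bsub>H\<^esub> x) \<odot>\<^bsub>H\<^esub> \<one>\<^bsub>H\<^esub>"
        by (rule Sd_left[where f = "\<lambda>y. y"]; (intro lin)?) (use g x in auto)
      finally show ?thesis
        using g x ring_hom_mult[OF delta_hom] by (simp add: module.smult_assoc1[OF module_H] delta_closed)
    qed
    from convolution_cancel[OF _ _ this h]
    have "sw H (\<lambda>a b. Sd (a \<otimes>\<^bsub>H\<^esub> h) \<otimes>\<^bsub>H\<^esub> b) g
        = sw H (\<lambda>c d. (\<delta> g \<odot>\<^bsub>H\<^esub> (\<delta> c \<odot>\<^bsub>H\<^esub> \<one>\<^bsub>H\<^esub>)) \<otimes>\<^bsub>H\<^esub> antipode H d) h"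
      by this (intro lin; use g in auto)+
    also have "\<dots> = sw H (\<lambda>c d. \<delta> g \<odot>\<^bsub>H\<^esub> (\<delta> c \<odot>\<^bsub>H\<^esub> antipode H d)) h"
      by (rule sw_cong) (use g in \<open>simp add: smult_mult_left delta_closed antipode_closed\<close>)
    also have "\<dots> = \<delta> g \<odot>\<^bsub>H\<^esub> Sd h" unfolding Sd_eq
      by (rule sw_map[symmetric, OF _ _ _ _ h]; (intro lin)?) (use g in auto)
    finally show ?thesis .
  qed
  have "Sd (g \<otimes>\<^bsub>H\<^esub> h) = sw H (\<lambda>a b. (\<delta> a \<odot>\<^bsub>H\<^esub> Sd h) \<otimes>\<^bsub>H\<^esub> antipode H b) g"
    by (rule convolution_cancel[where G = "\<lambda>g. Sd (g \<otimes>\<^bsub>H\<^esub> h)", OF _ _ 1[OF _ h] g]) (intro lin; use h in auto)+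
  also have "\<dots> = sw H (\<lambda>a b. Sd h \<otimes>\<^bsub>H\<^esub> (\<delta> a \<odot>\<^bsub>H\<^esub> antipode H b)) g"
    by (rule sw_cong) (use h in \<open>simp add: smult_mult_left smult_mult_right delta_closed antipode_closed Sd_closed\<close>)
  also have "\<dots> = Sd h \<otimes>\<^bsub>H\<^esub> Sd g" unfolding Sd_eq[of g]
    by (rule sw_map[symmetric, OF _ _ _ _ g]; (intro lin)?) (use h in auto)
  finally show ?thesis .
qed

lemma Sd_one: "Sd \<one>\<^bsub>H\<^esub> = \<one>\<^bsub>H\<^esub>"
proof -
  have "Sd \<one>\<^bsub>H\<^esub> \<otimes>\<^bsub>H\<^esub> \<one>\<^bsub>H\<^esub> = sw H (\<lambda>a b. Sd a \<otimes>\<^bsub>H\<^esub> b) \<one>\<^bsub>H\<^esub>"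
    by (rule sw_one[symmetric]; (intro lin)?) auto
  also have "\<dots> = \<delta> \<one>\<^bsub>H\<^esub> \<odot>\<^bsub>H\<^esub> \<one>\<^bsub>H\<^esub>"
    by (rule Sd_left[where f = "\<lambda>y. y"]; (intro lin)?) auto
  finally show ?thesis
    using ring_hom_one[OF delta_hom] by (simp add: Sd_closed module.smult_one[OF module_H])
qed

text \<open>\<open>Sd_left\<close> at a group-like element yields
  \<open>\<delta>(\<sigma>)1\<close>, and \<open>\<delta>(\<sigma>) = 1\<close>.\<close>

lemma Sd_sigma: "Sd \<sigma> \<otimes>\<^bsub>H\<^esub> \<sigma> = \<one>\<^bsub>H\<^esub>"
proof -
  have "Sd \<sigma> \<otimes>\<^bsub>H\<^esub> \<sigma> = sw H (\<lambda>a b. Sd a \<otimes>\<^bsub>H\<^esub> b) \<sigma>"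
    by (rule sw_group_like[symmetric, OF _ _ sigma_group_like]; (intro lin)?) auto
  also have "\<dots> = \<delta> \<sigma> \<odot>\<^bsub>H\<^esub> \<one>\<^bsub>H\<^esub>"
    by (rule Sd_left[where f = "\<lambda>y. y"]; (intro lin)?) auto
  finally show ?thesis by (simp add: delta_sigma module.smult_one[OF module_H])
qed

lemma sigma_Sd: "\<sigma> \<otimes>\<^bsub>H\<^esub> antipode H \<sigma> = \<one>\<^bsub>H\<^esub>"
proof -
  have "\<sigma> \<otimes>\<^bsub>H\<^esub> antipode H \<sigma> = sw H (\<lambda>a b. a \<otimes>\<^bsub>H\<^esub> antipode H b) \<sigma>"
    by (rule sw_group_like[symmetric, OF _ _ sigma_group_like]; (intro lin)?) auto
  also have "\<dots> = counit H \<sigma> \<odot>\<^bsub>H\<^esub> \<one>\<^bsub>H\<^esub>" by (rule antipode_right) simp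
  finally show ?thesis using sigma_group_like by (simp add: group_like_def module.smult_one[OF module_H])
qed

lemma Sd_Sd_sigma:
  assumes "h \<in> carrier H"
  shows "Sd (Sd h) \<otimes>\<^bsub>H\<^esub> \<sigma> = \<sigma> \<otimes>\<^bsub>H\<^esub> h"
proof -
  \<comment> \<open>The left inverse \<open>Sd \<sigma>\<close> and the right inverse
    \<open>antipode H \<sigma>\<close> coincide. So \<open>\<sigma>\<close> is a unit, and
    \<open>inv\<close> in the involution property denotes its inverse.\<close>
  have "Sd \<sigma> = Sd \<sigma> \<otimes>\<^bsub>H\<^esub> (\<sigma> \<otimes>\<^bsub>H\<^esub> antipode H \<sigma>)"
    using sigma_Sd by (simp add: Sd_closed)
  also have "\<dots> = antipode H \<sigma>"
    using Sd_sigma by (simp add: m_assoc[symmetric] Sd_closed antipode_closed)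
  finally have u: "\<sigma> \<in> Units H"
    unfolding Units_def using Sd_sigma sigma_Sd Sd_closed[of \<sigma>] by auto
  have "Sd (Sd h) = \<sigma> \<otimes>\<^bsub>H\<^esub> h \<otimes>\<^bsub>H\<^esub> inv\<^bsub>H\<^esub> \<sigma>"
    using mpi assms unfolding modular_pair_in_involution_def Sd_def by blast
  then show ?thesis using u assms by (simp add: m_assoc)
qed

end

section \<open>The cocyclic module of a modular pair in involution\<close>

context hopf_modular
begin

text \<open>On the second factor the legs meet as \<open>h\<^sub>2S(h\<^sub>3)\<close> and cancel;
  only the action of \<open>h\<close> on the first factor survives.\<close>

lemma act_antipode:
  assumes h: "h \<in> carrier H" and u: "u \<in> carrier (tp p)" and v: "v \<in> carrier (tp q)"
  shows "sw (tp (p + q)) (\<lambda>a b. act (p + q) a (cat p q u (act q (antipode H b) v))) h = cat p q (act p h u) v"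
proof -
  let ?W = "tp (p + q)"
  have "sw ?W (\<lambda>a b. act (p + q) a (cat p q u (act q (antipode H b) v))) h
      = sw ?W (\<lambda>x b. sw ?W (\<lambda>c d. cat p q (act p c u) (act q (d \<otimes>\<^bsub>H\<^esub> antipode H b) v)) x) h"
  proof (rule sw_cong)
    fix x b assume xb: "x \<in> carrier H" "b \<in> carrier H"
    have "act (p + q) x (cat p q u (act q (antipode H b) v))
        = sw ?W (\<lambda>c d. cat p q (act p c u) (act q d (act q (antipode H b) v))) x"
      by (rule act_cat[OF xb(1) u]) (use xb v in \<open>auto intro!: act_closed antipode_closed\<close>)
    also have "\<dots> = sw ?W (\<lambda>c d. cat p q (act p c u) (act q (d \<otimes>\<^bsub>H\<^esub> antipode H b) v)) x"
      by (rule sw_cong) (use xb v in \<open>simp add: act_mult antipode_closed\<close>)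
    finally show "act (p + q) x (cat p q u (act q (antipode H b) v))
        = sw ?W (\<lambda>c d. cat p q (act p c u) (act q (d \<otimes>\<^bsub>H\<^esub> antipode H b) v)) x" .
  qed
  also have "\<dots> = sw ?W (\<lambda>c x. sw ?W (\<lambda>d b. cat p q (act p c u) (act q (d \<otimes>\<^bsub>H\<^esub> antipode H b) v)) x) h"
    by (rule sw_coassoc[OF _ _ _ _ h]; (intro lin)?) (use u v in auto)
  also have "\<dots> = sw ?W (\<lambda>c x. counit H x \<odot>\<^bsub>?W\<^esub> cat p q (act p c u) v) h"
  proof (rule sw_cong)
    fix c x assume cx: "c \<in> carrier H" "x \<in> carrier H"
    have "sw ?W (\<lambda>d b. cat p q (act p c u) (act q (d \<otimes>\<^bsub>H\<^esub> antipode H b) v)) x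
        = counit H x \<odot>\<^bsub>?W\<^esub> cat p q (act p c u) (act q \<one>\<^bsub>H\<^esub> v)"
      by (rule sw_antipode_right[where f = "\<lambda>y. cat p q (act p c u) (act q y v)", OF _ _ cx(2)]; (intro lin)?)
        (use u v cx in auto)
    then show "sw ?W (\<lambda>d b. cat p q (act p c u) (act q (d \<otimes>\<^bsub>H\<^esub> antipode H b) v)) x
        = counit H x \<odot>\<^bsub>?W\<^esub> cat p q (act p c u) v" by (simp add: act_one[OF v])
  qed
  also have "\<dots> = cat p q (act p h u) v"
    by (rule sw_counit_right[OF _ _ h]; (intro lin)?) (use u v in auto)
  finally show ?thesis .
qed

text \<open>Integration by parts for the diagonal action. \<open>act_antipode\<close> rewrites the
  argument as a diagonal action of \<open>h\<^sub>2\<close>, which together with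
  \<open>S\<^sub>\<delta>(h\<^sub>1)\<close> collapses to a scalar; the remaining
  \<open>\<delta>(h\<^sub>1)S(h\<^sub>2)\<close> on \<open>v\<close> is
  \<open>S\<^sub>\<delta>(h)\<close>.\<close>

lemma act_Sd:
  assumes h: "h \<in> carrier H" and u: "u \<in> carrier (tp p)" and v: "v \<in> carrier (tp q)"
  shows "sw (tp (p + q)) (\<lambda>a b. act (p + q) (Sd a) (cat p q (act p b u) v)) h = cat p q u (act q (Sd h) v)"
proof -
  let ?W = "tp (p + q)"
  have cl: "cat p q u (act q (antipode H d) v) \<in> carrier ?W" if "d \<in> carrier H" for d
    by (intro lin) (use that u v in auto)
  have "sw ?W (\<lambda>a b. act (p + q) (Sd a) (cat p q (act p b u) v)) h
      = sw ?W (\<lambda>a x. sw ?W (\<lambda>c d. act (p + q) (Sd a \<otimes>\<^bsub>H\<^esub> c) (cat p q u (act q (antipode H d) v))) x) h"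
  proof (rule sw_cong)
    fix a x assume ax: "a \<in> carrier H" "x \<in> carrier H"
    have "act (p + q) (Sd a) (cat p q (act p x u) v)
        = sw ?W (\<lambda>c d. act (p + q) (Sd a) (act (p + q) c (cat p q u (act q (antipode H d) v)))) x"
      unfolding act_antipode[OF ax(2) u v, symmetric]
      by (rule sw_map[OF _ _ _ _ ax(2)]; (intro lin)?) (use ax u v in auto)
    also have "\<dots> = sw ?W (\<lambda>c d. act (p + q) (Sd a \<otimes>\<^bsub>H\<^esub> c) (cat p q u (act q (antipode H d) v))) x"
      by (rule sw_cong) (use ax cl in \<open>simp add: act_mult Sd_closed\<close>)
    finally show "act (p + q) (Sd a) (cat p q (act p x u) v)
        = sw ?W (\<lambda>c d. act (p + q) (Sd a \<otimes>\<^bsub>H\<^esub> c) (cat p q u (act q (antipode H d) v))) x" .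
  qed
  also have "\<dots> = sw ?W (\<lambda>x d. sw ?W (\<lambda>a c. act (p + q) (Sd a \<otimes>\<^bsub>H\<^esub> c) (cat p q u (act q (antipode H d) v))) x) h"
    by (rule sw_coassoc[symmetric, OF _ _ _ _ h]; (intro lin)?) (use u v in auto)
  also have "\<dots> = sw ?W (\<lambda>x d. \<delta> x \<odot>\<^bsub>?W\<^esub> cat p q u (act q (antipode H d) v)) h"
  proof (rule sw_cong)
    fix x d assume xd: "x \<in> carrier H" "d \<in> carrier H"
    have "sw ?W (\<lambda>a c. act (p + q) (Sd a \<otimes>\<^bsub>H\<^esub> c) (cat p q u (act q (antipode H d) v))) x
        = \<delta> x \<odot>\<^bsub>?W\<^esub> act (p + q) \<one>\<^bsub>H\<^esub> (cat p q u (act q (antipode H d) v))"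
      by (rule Sd_left[where f = "\<lambda>y. act (p + q) y (cat p q u (act q (antipode H d) v))", OF _ _ xd(1)]; (intro lin)?)
        (use u v xd in auto)
    then show "sw ?W (\<lambda>a c. act (p + q) (Sd a \<otimes>\<^bsub>H\<^esub> c) (cat p q u (act q (antipode H d) v))) x
        = \<delta> x \<odot>\<^bsub>?W\<^esub> cat p q u (act q (antipode H d) v)"
      by (simp add: act_one[OF cl[OF xd(2)]])
  qed
  also have "\<dots> = cat p q u (act q (Sd h) v)"
    by (rule Sd_apply[where f = "\<lambda>y. cat p q u (act q y v)", OF _ _ h, symmetric]; (intro lin)?) (use u v in auto)
  finally show ?thesis .
qed

definition tau :: "nat \<Rightarrow> ('h list \<Rightarrow> 'k) set \<Rightarrow> ('h list \<Rightarrow> 'k) set" where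
  "tau n = hopf_cocyc K H \<delta> \<sigma> n"

lemma tau_Suc: "tau (Suc n) = tensor_lift K (replicate (Suc n) H) (tp (Suc n))
  (\<lambda>hs. act (Suc n) (Sd (hd hs)) (pt (tl hs @ [\<sigma>])))"
  unfolding tau_def hopf_cocyc_def tp_def pt_def act_def Sd_def by simp

lemma tau_multilinear: "multilinear K (replicate (Suc n) H) (tp (Suc n))
  (\<lambda>hs. act (Suc n) (Sd (hd hs)) (pt (tl hs @ [\<sigma>])))"
proof (rule hmultilinearI)
  fix xs :: "'h list" assume "length xs = Suc n" "set xs \<subseteq> carrier H"
  then show "act (Suc n) (Sd (hd xs)) (pt (tl xs @ [\<sigma>])) \<in> carrier (tp (Suc n))"
    by (cases xs) (auto intro!: act_closed Sd_closed pt_closed)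
next
  fix xs ys :: "'h list"
  assume *: "length xs + Suc (length ys) = Suc n" "set xs \<subseteq> carrier H" "set ys \<subseteq> carrier H"
  show "linear_map K H (tp (Suc n)) (\<lambda>x. act (Suc n) (Sd (hd (xs @ x # ys))) (pt (tl (xs @ x # ys) @ [\<sigma>])))"
  proof (cases xs)
    case Nil
    have "linear_map K H (tp (Suc n)) (\<lambda>x. act (Suc n) (Sd x) (pt (ys @ [\<sigma>])))"
      by (intro lin) (use * Nil in auto)
    then show ?thesis using Nil by simp
  next
    case (Cons a zs)
    have "linear_map K H (tp (Suc n)) (\<lambda>x. act (Suc n) (Sd a) (pt (zs @ x # (ys @ [\<sigma>]))))"
      by (intro lin) (use * Cons in auto)
    then show ?thesis using Cons by simp
  qed
qed

lemma tau_lin [lin]: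
  "\<lbrakk>linear_map K V (tp n) f\<rbrakk> \<Longrightarrow> linear_map K V (tp n) (\<lambda>x. tau n (f x))"
proof (cases n)
  case 0
  then show "linear_map K V (tp n) f \<Longrightarrow> ?thesis" by (simp add: tau_def hopf_cocyc_def)
next
  case (Suc k)
  then show "linear_map K V (tp n) f \<Longrightarrow> ?thesis"
    using linear_map_compose[OF hlift_linear[OF module_tp tau_multilinear]] by (simp only: tau_Suc)
qed

lemma tau_closed [lin]: "u \<in> carrier (tp n) \<Longrightarrow> tau n u \<in> carrier (tp n)"
  using linear_map_closed[OF tau_lin[OF linear_map_ident]] .

lemma sigma_pt: "pt [\<sigma>] \<in> carrier (tp (Suc 0))"
  by (rule pt_closed) auto

text \<open>Frees the defining formula from pure tensors in all entries but the first, so that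
  \<open>tau\<close> can be applied to the result of an action.\<close>

lemma tau_cat:
  assumes x: "x \<in> carrier H" and u: "u \<in> carrier (tp n)"
  shows "tau (Suc n) (cat (Suc 0) n (pt [x]) u) = act (Suc n) (Sd x) (cat n (Suc 0) u (pt [\<sigma>]))"
proof (rule tp_ext[where n = n and W = "tp (Suc n)" and u = u, OF _ _ _ _ u])
  fix xs assume xs: "length xs = n" "set xs \<subseteq> carrier H"
  have "tau (Suc n) (pt (x # xs)) = act (Suc n) (Sd (hd (x # xs))) (pt (tl (x # xs) @ [\<sigma>]))"
    unfolding tau_Suc by (rule hlift_pt[OF _ tau_multilinear]) (use x xs in auto)
  then show "tau (Suc n) (cat (Suc 0) n (pt [x]) (pt xs)) = act (Suc n) (Sd x) (cat n (Suc 0) (pt xs) (pt [\<sigma>]))"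
    using x xs by (simp add: cat_pt)
qed ((intro lin)?; use x in simp)+

text \<open>\<open>act_Sd\<close> with a single entry as second factor, on which the action is left
  multiplication.\<close>

lemma act_cat_sigma:
  assumes h: "h \<in> carrier H" and u: "u \<in> carrier (tp n)" and y: "y \<in> carrier H"
  shows "sw (tp (Suc n)) (\<lambda>a b. act (Suc n) (Sd a) (cat n (Suc 0) (act n b u) (pt [y]))) h
    = cat n (Suc 0) u (pt [Sd h \<otimes>\<^bsub>H\<^esub> y])"
proof -
  have "pt [y] \<in> carrier (tp (Suc 0))" using y by (intro pt_closed) auto
  from act_Sd[OF h u this] show ?thesis using h y by (simp add: act_single Sd_closed)
qed

text \<open>The cyclic operator is conjugate to the rotation of \<open>H\<^sup>\<otimes>\<^sup>n\<^sup>+\<^sup>1\<close> under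
  \<open>h\<^sub>0 \<otimes> u \<mapsto> S\<^sub>\<delta>(h\<^sub>0) u\<close>; this is the only place where the involution property is used.\<close>

lemma tau_rotate:
  assumes x: "x \<in> carrier H" and y: "y \<in> carrier H" and u: "u \<in> carrier (tp n)"
  shows "tau (Suc n) (act (Suc n) (Sd x) (cat (Suc 0) n (pt [y]) u))
    = act (Suc n) (Sd y) (cat n (Suc 0) u (pt [\<sigma> \<otimes>\<^bsub>H\<^esub> x]))"
proof -
  let ?W = "tp (Suc n)"
  have g: "Sd x \<in> carrier H" using x by (rule Sd_closed)
  have "tau (Suc n) (act (Suc n) (Sd x) (cat (Suc 0) n (pt [y]) u))
      = tau (Suc n) (sw ?W (\<lambda>a b. cat (Suc 0) n (pt [a \<otimes>\<^bsub>H\<^esub> y]) (act n b u)) (Sd x))"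
    using act_Cons[OF g y u] by simp
  also have "\<dots> = sw ?W (\<lambda>a b. tau (Suc n) (cat (Suc 0) n (pt [a \<otimes>\<^bsub>H\<^esub> y]) (act n b u))) (Sd x)"
    by (rule sw_map[OF _ _ _ _ g]; (intro lin)?) (use y u in auto)
  \<comment> \<open>Antimultiplicativity, \<open>S\<^sub>\<delta>(ay) =
    S\<^sub>\<delta>(y)S\<^sub>\<delta>(a)\<close>, separates \<open>y\<close> from the Sweedler
    sum.\<close>
  also have "\<dots> = sw ?W (\<lambda>a b. act (Suc n) (Sd y) (act (Suc n) (Sd a) (cat n (Suc 0) (act n b u) (pt [\<sigma>])))) (Sd x)"
  proof (rule sw_cong)
    fix a b assume ab: "a \<in> carrier H" "b \<in> carrier H"
    have "act n b u \<in> carrier (tp n)" using ab u by (intro act_closed)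
    moreover from this have "cat n (Suc 0) (act n b u) (pt [\<sigma>]) \<in> carrier ?W"
      using sigma_pt by (intro cat_closed) auto
    ultimately show "tau (Suc n) (cat (Suc 0) n (pt [a \<otimes>\<^bsub>H\<^esub> y]) (act n b u))
        = act (Suc n) (Sd y) (act (Suc n) (Sd a) (cat n (Suc 0) (act n b u) (pt [\<sigma>])))"
      using ab y by (simp add: tau_cat Sd_mult act_mult Sd_closed)
  qed
  also have "\<dots> = act (Suc n) (Sd y) (sw ?W (\<lambda>a b. act (Suc n) (Sd a) (cat n (Suc 0) (act n b u) (pt [\<sigma>]))) (Sd x))"
    by (rule sw_map[symmetric, OF _ _ _ _ g]; (intro lin)?) (use y u in auto)
  \<comment> \<open>\<open>act_cat_sigma\<close> for the element \<open>S\<^sub>\<delta>(x)\<close>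
    leaves \<open>S\<^sub>\<delta>\<^sup>2(x)\<sigma>\<close> in the last place, and this is
    \<open>\<sigma>x\<close>.\<close>
  also have "\<dots> = act (Suc n) (Sd y) (cat n (Suc 0) u (pt [\<sigma> \<otimes>\<^bsub>H\<^esub> x]))"
    using act_cat_sigma[OF g u sigma_closed] Sd_Sd_sigma[OF x] by simp
  finally show ?thesis .
qed

lemma tau_rotate_list:
  assumes "x \<in> carrier H" "y \<in> carrier H" "set xs \<subseteq> carrier H" "length xs = n"
  shows "tau (Suc n) (act (Suc n) (Sd x) (pt (y # xs))) = act (Suc n) (Sd y) (pt (xs @ [\<sigma> \<otimes>\<^bsub>H\<^esub> x]))"
  using tau_rotate[OF assms(1,2), of "pt xs" n] assms by (simp add: cat_pt pt_closed)

text \<open>Each application of \<open>tau_rotate_list\<close> sends the current head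
  \<open>a\<close> to the end as \<open>\<sigma>a\<close>; the split into \<open>as\<close> and
  \<open>bs\<close> records how many entries are still to be moved.\<close>

lemma tau_rotate_power:
  assumes "length (as @ bs) = Suc (Suc n)" "set (as @ bs) \<subseteq> carrier H"
  shows "(tau (Suc n) ^^ length as) (act (Suc n) (Sd (hd (as @ bs))) (pt (tl (as @ bs))))
    = act (Suc n) (Sd (hd (bs @ map (\<lambda>x. \<sigma> \<otimes>\<^bsub>H\<^esub> x) as))) (pt (tl (bs @ map (\<lambda>x. \<sigma> \<otimes>\<^bsub>H\<^esub> x) as)))"
  using assms
proof (induction as arbitrary: bs)
  case (Cons a as)
  obtain y zs where yz: "as @ bs = y # zs" using Cons.prems(1) by (cases "as @ bs") auto
  have c: "a \<in> carrier H" "y \<in> carrier H" "set zs \<subseteq> carrier H" "length zs = n"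
    using Cons.prems yz by (auto simp flip: set_append)
  have "(tau (Suc n) ^^ length (a # as)) (act (Suc n) (Sd (hd ((a # as) @ bs))) (pt (tl ((a # as) @ bs))))
      = (tau (Suc n) ^^ length as) (tau (Suc n) (act (Suc n) (Sd a) (pt (y # zs))))"
    using yz by (simp add: funpow_swap1)
  also have "\<dots> = (tau (Suc n) ^^ length as) (act (Suc n) (Sd (hd (as @ (bs @ [\<sigma> \<otimes>\<^bsub>H\<^esub> a])))) (pt (tl (as @ (bs @ [\<sigma> \<otimes>\<^bsub>H\<^esub> a])))))"
  proof -
    have e: "as @ (bs @ [\<sigma> \<otimes>\<^bsub>H\<^esub> a]) = y # zs @ [\<sigma> \<otimes>\<^bsub>H\<^esub> a]" using yz by (simp flip: append_assoc)
    show ?thesis unfolding e using tau_rotate_list[OF c] by simp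
  qed
  also have "\<dots> = act (Suc n) (Sd (hd ((bs @ [\<sigma> \<otimes>\<^bsub>H\<^esub> a]) @ map (\<lambda>x. \<sigma> \<otimes>\<^bsub>H\<^esub> x) as)))
      (pt (tl ((bs @ [\<sigma> \<otimes>\<^bsub>H\<^esub> a]) @ map (\<lambda>x. \<sigma> \<otimes>\<^bsub>H\<^esub> x) as)))"
    by (rule Cons.IH) (use Cons.prems in auto)
  finally show ?case by simp
qed simp

lemma tau_power:
  assumes "u \<in> carrier (tp n)"
  shows "(tau n ^^ Suc n) u = u"
proof (cases n)
  case 0
  then show ?thesis by (simp add: tau_def hopf_cocyc_def)
next
  case (Suc k)
  have pw: "linear_map K (tp n) (tp n) (\<lambda>u. (tau n ^^ j) u)" for j
    by (induction j) (auto intro!: lin simp: linear_map_ident)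
  show ?thesis
  proof (rule tp_ext[where n = n and W = "tp n", OF _ pw linear_map_ident _ assms])
    fix xs :: "'h list" assume xs: "length xs = n" "set xs \<subseteq> carrier H"
    let ?s = "\<lambda>x. \<sigma> \<otimes>\<^bsub>H\<^esub> x"
    have xc: "pt xs \<in> carrier (tp n)" by (rule pt_closed) (use xs in auto)
    \<comment> \<open>The unit is prepended because \<open>S\<^sub>\<delta>(1) = 1\<close>: the
      given tensor is the image of the list with \<open>n + 1\<close> entries, and a full turn of
      that list takes \<open>n + 1\<close> steps.\<close>
    have "(tau (Suc k) ^^ length (\<one>\<^bsub>H\<^esub> # xs)) (act (Suc k) (Sd (hd ((\<one>\<^bsub>H\<^esub> # xs) @ []))) (pt (tl ((\<one>\<^bsub>H\<^esub> # xs) @ []))))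
        = act (Suc k) (Sd (hd ([] @ map ?s (\<one>\<^bsub>H\<^esub> # xs)))) (pt (tl ([] @ map ?s (\<one>\<^bsub>H\<^esub> # xs))))"
      by (rule tau_rotate_power) (use xs Suc in auto)
    then have "(tau n ^^ Suc n) (act n (Sd \<one>\<^bsub>H\<^esub>) (pt xs)) = act n (Sd \<sigma>) (pt (map ?s xs))"
      using xs Suc by simp
    also have "pt (map ?s xs) = act n \<sigma> (pt xs)"
      using act_group_like[OF sigma_group_like xs(2)] xs by simp
    also have "act n (Sd \<sigma>) (act n \<sigma> (pt xs)) = act n (Sd \<sigma> \<otimes>\<^bsub>H\<^esub> \<sigma>) (pt xs)"
      by (rule act_mult[symmetric]) (use xc in \<open>auto intro: Sd_closed\<close>)
    also have "\<dots> = pt xs" using Sd_sigma act_one[OF xc] by simp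
    finally show "(tau n ^^ Suc n) (pt xs) = pt xs" using Sd_one act_one[OF xc] by simp
  qed simp
qed

section \<open>Cosimplicial and cyclic identities of the Hopf cocyclic module\<close>

definition dd :: "nat \<Rightarrow> nat \<Rightarrow> ('h list \<Rightarrow> 'k) set \<Rightarrow> ('h list \<Rightarrow> 'k) set" where
  "dd n i = hopf_coface K H \<sigma> n i"

definition ss :: "nat \<Rightarrow> nat \<Rightarrow> ('h list \<Rightarrow> 'k) set \<Rightarrow> ('h list \<Rightarrow> 'k) set" where
  "ss n i = hopf_codegen K H n i"

lemma one_pt: "pt [\<one>\<^bsub>H\<^esub>] \<in> carrier (tp (Suc 0))"
  by (rule pt_closed) auto

lemma dd_0:
  assumes "u \<in> carrier (tp n)"
  shows "dd n 0 u = cat (Suc 0) n (pt [\<one>\<^bsub>H\<^esub>]) u"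
proof -
  have 1: "multilinear K (replicate n H) (tp (Suc n)) (\<lambda>hs. pt (\<one>\<^bsub>H\<^esub> # hs))"
  proof (rule hmultilinearI)
    show "linear_map K H (tp (Suc n)) (\<lambda>x. pt (\<one>\<^bsub>H\<^esub> # xs @ x # ys))"
      if "length xs + Suc (length ys) = n" "set xs \<subseteq> carrier H" "set ys \<subseteq> carrier H" for xs ys
      using pt_slot[of "\<one>\<^bsub>H\<^esub> # xs" ys "Suc n"] that by simp
  qed (auto intro!: pt_closed)
  show ?thesis unfolding dd_def hopf_coface_def tp_def[symmetric] pt_def[symmetric]
    by (simp, rule hlift_eqI[OF _ _ 1 _ assms]; (intro lin)?) (auto simp: cat_pt)
qed

lemma dd_last:
  assumes "u \<in> carrier (tp n)"
  shows "dd n (Suc n) u = cat n (Suc 0) u (pt [\<sigma>])"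
proof -
  have 1: "multilinear K (replicate n H) (tp (Suc n)) (\<lambda>hs. pt (hs @ [\<sigma>]))"
  proof (rule hmultilinearI)
    show "linear_map K H (tp (Suc n)) (\<lambda>x. pt ((xs @ x # ys) @ [\<sigma>]))"
      if "length xs + Suc (length ys) = n" "set xs \<subseteq> carrier H" "set ys \<subseteq> carrier H" for xs ys
      using pt_slot[of xs "ys @ [\<sigma>]" "Suc n"] that by simp
  qed (auto intro!: pt_closed)
  show ?thesis unfolding dd_def hopf_coface_def tp_def[symmetric] pt_def[symmetric]
    by (simp, rule hlift_eqI[OF _ _ 1 _ assms]; (intro lin)?) (auto simp: cat_pt)
qed

lemma dd_inner: "n = Suc (p + q) \<Longrightarrow> dd n (Suc p) = app p q 2 (comult H)"
  unfolding dd_def hopf_coface_def using comult_at_eq[of p q] by simp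

lemma ss_eq: "n = p + q \<Longrightarrow> ss n p = app p q 0 eps"
  unfolding ss_def by (simp add: codegen_eq)

text \<open>In the inner case \<open>p\<close> factors precede the position and \<open>q\<close>
  follow it. For \<open>n = 0\<close> only the two outer cofaces occur, which is why that case has
  \<open>n = Suc (p + q)\<close>.\<close>

lemma coface_cases:
  assumes "i \<le> Suc n"
  obtains "i = 0" | "i = Suc n" | p q where "i = Suc p" "n = Suc (p + q)"
proof (cases i)
  case (Suc p)
  show ?thesis
  proof (cases "p = n")
    case False
    then have "n = Suc (p + (n - Suc p))" using assms Suc by simp
    then show ?thesis using that(3) Suc by blast
  qed (use Suc that in simp)
qed (use that in simp)

lemma dd_linear:
  assumes "i \<le> Suc n"
  shows "linear_map K (tp n) (tp (Suc n)) (dd n i)"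
  using assms
proof (cases rule: coface_cases)
  case 1
  have "linear_map K (tp n) (tp (Suc n)) (\<lambda>u. cat (Suc 0) n (pt [\<one>\<^bsub>H\<^esub>]) u)"
    by (intro lin) auto
  then show ?thesis using 1 by (subst linear_map_cong[OF module_tp]) (simp_all add: dd_0)
next
  case 2
  have "linear_map K (tp n) (tp (Suc n)) (\<lambda>u. cat n (Suc 0) u (pt [\<sigma>]))"
    by (intro lin) auto
  then show ?thesis using 2 by (subst linear_map_cong[OF module_tp]) (simp_all add: dd_last)
next
  case (3 p q)
  have "linear_map K (tp n) (tp (Suc n)) (\<lambda>u. app p q 2 (comult H) u)"
    by (intro lin comult_linear_tp) (use 3 in auto)
  then show ?thesis using 3 dd_inner[OF 3(2)] by simp
qed

lemma ss_linear:
  assumes "i \<le> n"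
  shows "linear_map K (tp (Suc n)) (tp n) (ss n i)"
proof -
  have n: "n = i + (n - i)" using assms by simp
  have "linear_map K (tp (Suc n)) (tp n) (\<lambda>u. app i (n - i) 0 eps u)"
    by (intro lin eps_linear) (use n in auto)
  then show ?thesis using ss_eq[OF n] by simp
qed

lemma comult_one_pt: "comult H \<one>\<^bsub>H\<^esub> = cat (Suc 0) (Suc 0) (pt [\<one>\<^bsub>H\<^esub>]) (pt [\<one>\<^bsub>H\<^esub>])"
  using comult_one by (simp add: cat_pt) (simp add: pt_def)

lemma comult_sigma_pt: "comult H \<sigma> = cat (Suc 0) (Suc 0) (pt [\<sigma>]) (pt [\<sigma>])"
  using sigma_group_like by (simp add: cat_pt) (simp add: pt_def group_like_def)

text \<open>Group-likeness of the unit and of \<open>\<sigma>\<close> settles an outer coface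
  against its neighbour, coassociativity settles two adjacent inner ones, and the remaining pairs
  act on disjoint factors.\<close>

lemma dd_dd:
  assumes ij: "i < j" "j \<le> Suc (Suc n)" and x: "x \<in> carrier (tp n)"
  shows "dd (Suc n) j (dd n i x) = dd (Suc n) i (dd n (j - 1) x)"
proof -
  note L = comult_linear_tp
  have i: "i \<le> Suc n" using ij by simp
  have dx: "dd n k x \<in> carrier (tp (Suc n))" if "k \<le> Suc n" for k
    using linear_map_closed[OF dd_linear[OF that] x] .
  have xs: "cat n (Suc 0) x (pt [\<sigma>]) \<in> carrier (tp (Suc n))" "cat (Suc 0) n (pt [\<one>\<^bsub>H\<^esub>]) x \<in> carrier (tp (Suc n))"
    using x sigma_pt one_pt by (auto intro!: cat_closed)
  from i show ?thesis
  proof (cases rule: coface_cases)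
    case 1
    from ij(2) show ?thesis
    proof (cases rule: coface_cases)
      case 2
      show ?thesis using 1 2 x xs cat_assoc[OF one_pt x sigma_pt] by (simp add: dd_0 dd_last)
    next
      case (3 p q)
      show ?thesis
      proof (cases p)
        case 0
        have "app 0 n 2 (comult H) (cat (Suc 0) n (pt [\<one>\<^bsub>H\<^esub>]) x) = cat 2 n (comult H \<one>\<^bsub>H\<^esub>) x"
          by (rule app_0_cat[OF L x]) simp
        also have "\<dots> = cat (Suc 0) (Suc n) (pt [\<one>\<^bsub>H\<^esub>]) (cat (Suc 0) n (pt [\<one>\<^bsub>H\<^esub>]) x)"
          using cat_assoc[OF one_pt one_pt x] by (simp add: comult_one_pt numeral_2_eq_2)
        finally show ?thesis using 0 1 3 x xs dd_inner[of "Suc n" 0 n] by (simp add: dd_0)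
      next
        case (Suc p')
        have n: "n = Suc (p' + q)" using Suc 3 by simp
        have "app (Suc 0 + p') q 2 (comult H) (cat (Suc 0) (Suc (p' + q)) (pt [\<one>\<^bsub>H\<^esub>]) x)
            = cat (Suc 0) (p' + (2 + q)) (pt [\<one>\<^bsub>H\<^esub>]) (app p' q 2 (comult H) x)"
          by (rule app_left[OF L one_pt]) (use x n in simp)
        then show ?thesis
          using 1 3 Suc x xs dd_inner[of "Suc n" p q] dd_inner[OF n] dx[of "Suc p'"] n by (simp add: dd_0)
      qed
    qed (use 1 ij in simp)
  next
    case 2
    then have j: "j = Suc (Suc n)" using ij by simp
    have "app n 0 2 (comult H) (cat n (Suc 0) x (pt [\<sigma>])) = cat n 2 x (comult H \<sigma>)"
      by (rule app_end_cat[OF L x]) simp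
    also have "\<dots> = cat (Suc n) (Suc 0) (cat n (Suc 0) x (pt [\<sigma>])) (pt [\<sigma>])"
      using cat_assoc[OF x sigma_pt sigma_pt] by (simp add: comult_sigma_pt numeral_2_eq_2)
    finally show ?thesis using 2 j x xs dd_inner[of "Suc n" n 0] by (simp add: dd_last)
  next
    case (3 p q)
    note p = 3
    note di = dd_inner[OF p(2)] dd_inner[of "Suc n" p "Suc q"]
    from ij(2) show ?thesis
    proof (cases rule: coface_cases)
      case 2
      have "app p (q + Suc 0) 2 (comult H) (cat (Suc (p + q)) (Suc 0) x (pt [\<sigma>]))
          = cat (p + (2 + q)) (Suc 0) (app p q 2 (comult H) x) (pt [\<sigma>])"
        by (rule app_right[OF L sigma_pt]) (use x p in simp)
      then show ?thesis using 2 p di x xs dx[of i] i by (simp add: dd_last)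
    next
      case (3 r t)
      show ?thesis
      proof (cases "r = Suc p")
        case True
        then have t: "t = q" using 3 p by simp
        have "app (Suc p) q 2 (comult H) (app p q 2 (comult H) x) = app p (Suc q) 2 (comult H) (app p q 2 (comult H) x)"
          by (rule comult_coassoc_at) (use x p in simp)
        then show ?thesis using 3 p di True t dd_inner[of "Suc n" "Suc p" q] by simp
      next
        case False
        \<comment> \<open>\<open>s\<close> counts the factors strictly between the two positions;
          the earlier coproduct has doubled its own factor, whence the 2.\<close>
        then obtain s where s: "r = p + 2 + s" using ij 3 p by (metis Suc_lessI add_2_eq_Suc' less_iff_Suc_add not_less_eq add_Suc)
        have n: "n = Suc (p + Suc (s + t))" "q = Suc (s + t)" using s 3 p by simp_all
        have "app (p + 2 + s) t 2 (comult H) (app p (Suc (s + t)) 2 (comult H) x)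
            = app p (s + (2 + t)) 2 (comult H) (app (Suc (p + s)) t 2 (comult H) x)"
          by (rule app_app[OF L L]) (use x n in simp)
        then show ?thesis
          using 3 p di s n dd_inner[of "Suc n" r t] dd_inner[of n "Suc (p + s)" t] by simp
      qed
    qed (use ij in simp)
  qed
qed

lemma ss_ss:
  assumes ij: "i \<le> j" "j \<le> n" and x: "x \<in> carrier (tp (Suc (Suc n)))"
  shows "ss n j (ss (Suc n) i x) = ss n i (ss (Suc n) (Suc j) x)"
proof -
  obtain s t where s: "j = i + s" "n = i + s + t" using ij by (metis le_Suc_ex)
  have "app (i + 0 + s) t 0 eps (app i (Suc (s + t)) 0 eps x) = app i (s + (0 + t)) 0 eps (app (Suc (i + s)) t 0 eps x)"
    by (rule app_app[OF eps_linear eps_linear]) (use x s in \<open>simp add: add.assoc\<close>)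
  then show ?thesis
    using s ss_eq[of n j t] ss_eq[of "Suc n" i "Suc (s + t)"] ss_eq[of n i "s + t"] ss_eq[of "Suc n" "Suc j" t] by (simp add: add.assoc)
qed

lemma ss_dd_less:
  assumes ij: "i \<le> j" "j \<le> n" and x: "x \<in> carrier (tp (Suc n))"
  shows "ss (Suc n) (Suc j) (dd (Suc n) i x) = dd n i (ss n j x)"
proof -
  obtain t where n: "n = j + t" using ij by (metis le_Suc_ex)
  have sx: "ss n j x \<in> carrier (tp n)" using linear_map_closed[OF ss_linear[OF ij(2)] x] .
  show ?thesis
  proof (cases i)
    case 0
    have "app (Suc 0 + j) t 0 eps (cat (Suc 0) (Suc (j + t)) (pt [\<one>\<^bsub>H\<^esub>]) x)
        = cat (Suc 0) (j + (0 + t)) (pt [\<one>\<^bsub>H\<^esub>]) (app j t 0 eps x)"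
      by (rule app_left[OF eps_linear one_pt]) (use x n in simp)
    then show ?thesis
      using 0 n x sx ss_eq[of "Suc n" "Suc j" t] ss_eq[OF n] by (simp add: dd_0)
  next
    case (Suc p)
    then obtain s where s: "j = Suc p + s" using ij by (metis le_Suc_ex)
    have "app (p + 2 + s) t 0 eps (app p (Suc (s + t)) 2 (comult H) x)
        = app p (s + (0 + t)) 2 (comult H) (app (Suc (p + s)) t 0 eps x)"
      by (rule app_app[OF comult_linear_tp eps_linear]) (use x n s in \<open>simp add: add.assoc\<close>)
    then show ?thesis
      using Suc s n ss_eq[of "Suc n" "Suc j" t] ss_eq[OF n] dd_inner[of "Suc n" p "Suc (s + t)"] dd_inner[of n p "s + t"]
      by (simp add: add.assoc)
  qed
qed

text \<open>For an outer coface the inserted entry is the unit or \<open>\<sigma>\<close>, both of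
  counit 1; for an inner one this is the counit axiom at that position.\<close>

lemma ss_dd_same:
  assumes j: "j \<le> n" "i = j \<or> i = Suc j" and x: "x \<in> carrier (tp n)"
  shows "ss n j (dd n i x) = x"
proof -
  obtain q where n: "n = j + q" using j by (metis le_Suc_ex)
  have e1: "counit H \<one>\<^bsub>H\<^esub> = \<one>\<^bsub>K\<^esub>" "counit H \<sigma> = \<one>\<^bsub>K\<^esub>"
    using ring_hom_one[OF counit_ring_hom] sigma_group_like by (auto simp: group_like_def)
  from j(2) show ?thesis
  proof
    assume i: "i = j"
    show ?thesis
    proof (cases j)
      case 0
      have "app 0 n 0 eps (cat (Suc 0) n (pt [\<one>\<^bsub>H\<^esub>]) x) = cat 0 n (eps \<one>\<^bsub>H\<^esub>) x"
        by (rule app_0_cat[OF eps_linear x]) simp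
      then show ?thesis using i 0 x ss_eq[of n 0 n] by (simp add: dd_0 cat_eps e1 module.smult_one[OF module_tp])
    next
      case (Suc p)
      then show ?thesis using i n x ss_eq[OF n] dd_inner[of n p q] comult_counit_at(2)[of x p q] by simp
    qed
  next
    assume i: "i = Suc j"
    show ?thesis
    proof (cases q)
      case 0
      have "app n 0 0 eps (cat n (Suc 0) x (pt [\<sigma>])) = cat n 0 x (eps \<sigma>)"
        by (rule app_end_cat[OF eps_linear x]) simp
      then show ?thesis using i 0 n x ss_eq[of n n 0] by (simp add: dd_last cat_eps e1 module.smult_one[OF module_tp])
    next
      case (Suc t)
      then show ?thesis using i n x ss_eq[OF n] dd_inner[of n j t] comult_counit_at(1)[of x j t] by simp
    qed
  qed
qed

lemma ss_dd_greater:
  assumes ij: "Suc j < i" "i \<le> Suc (Suc n)" and x: "x \<in> carrier (tp (Suc n))"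
  shows "ss (Suc n) j (dd (Suc n) i x) = dd n (i - 1) (ss n j x)"
proof -
  have jn: "j \<le> n" using ij by simp
  then obtain t where n: "n = j + t" by (metis le_Suc_ex)
  have sx: "ss n j x \<in> carrier (tp n)" using linear_map_closed[OF ss_linear[OF jn] x] .
  from ij(2) show ?thesis
  proof (cases rule: coface_cases)
    case 2
    have "app j (t + Suc 0) 0 eps (cat (Suc (j + t)) (Suc 0) x (pt [\<sigma>])) = cat (j + (0 + t)) (Suc 0) (app j t 0 eps x) (pt [\<sigma>])"
      by (rule app_right[OF eps_linear sigma_pt]) (use x n in simp)
    then show ?thesis using 2 n x sx ss_eq[OF n] ss_eq[of "Suc n" j "Suc t"] by (simp add: dd_last)
  next
    case (3 r q)
    then obtain s where s: "r = Suc (j + s)" using ij by (metis Suc_less_eq less_iff_Suc_add)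
    have "app (j + 0 + s) q 2 (comult H) (app j (Suc (s + q)) 0 eps x)
        = app j (s + (2 + q)) 0 eps (app (Suc (j + s)) q 2 (comult H) x)"
      by (rule app_app[OF eps_linear comult_linear_tp]) (use x 3 s in \<open>simp add: add.assoc\<close>)
    then show ?thesis
      using 3 s n ss_eq[of n j "Suc (s + q)"] ss_eq[of "Suc n" j "s + (2 + q)"] dd_inner[OF 3(2)]
        dd_inner[of n "j + s" q] by (simp add: add.assoc)
  qed (use ij in simp)
qed

text \<open>\<open>tau\<close> removes the first factor, which shifts the position of
  \<open>f\<close> by one to the left, and then acts diagonally, which commutes with
  \<open>f\<close> by \<open>app_act\<close>.\<close>

lemma tau_app:
  assumes f: "linear_map K H (tp m) f"
    and eq: "\<And>a x. \<lbrakk>a \<in> carrier H; x \<in> carrier H\<rbrakk> \<Longrightarrow> f (a \<otimes>\<^bsub>H\<^esub> x) = act m a (f x)"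
    and w: "w \<in> carrier (tp (Suc (Suc (p + q))))"
  shows "tau (Suc (p + (m + q))) (app (Suc p) q m f w) = app p (Suc q) m f (tau (Suc (Suc (p + q))) w)"
proof (rule tp_Suc_ext[where W = "tp (Suc (p + (m + q)))", OF _ _ _ _ w])
  fix x Y assume x: "x \<in> carrier H" and Y: "Y \<in> carrier (tp (Suc (p + q)))"
  have x1: "pt [x] \<in> carrier (tp (Suc 0))" using x by (intro pt_closed) auto
  have fY: "app p q m f Y \<in> carrier (tp (p + (m + q)))" by (rule app_closed[OF f Y]) simp
  have l: "app (Suc 0 + p) q m f (cat (Suc 0) (Suc (p + q)) (pt [x]) Y) = cat (Suc 0) (p + (m + q)) (pt [x]) (app p q m f Y)"
    by (rule app_left[OF f x1 Y])
  have r: "app p (q + Suc 0) m f (cat (Suc (p + q)) (Suc 0) Y (pt [\<sigma>])) = cat (p + (m + q)) (Suc 0) (app p q m f Y) (pt [\<sigma>])"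
    by (rule app_right[OF f sigma_pt Y])
  have Ys: "cat (Suc (p + q)) (Suc 0) Y (pt [\<sigma>]) \<in> carrier (tp (Suc (p + Suc q)))"
    using Y sigma_pt by (intro cat_closed) auto
  have a: "app p (Suc q) m f (act (Suc (p + Suc q)) (Sd x) (cat (Suc (p + q)) (Suc 0) Y (pt [\<sigma>])))
      = act (p + (m + Suc q)) (Sd x) (app p (Suc q) m f (cat (Suc (p + q)) (Suc 0) Y (pt [\<sigma>])))"
    by (rule app_act[OF f eq _ Ys]) (use x in \<open>auto intro: Sd_closed\<close>)
  show "tau (Suc (p + (m + q))) (app (Suc p) q m f (cat (Suc 0) (Suc (p + q)) (pt [x]) Y))
      = app p (Suc q) m f (tau (Suc (Suc (p + q))) (cat (Suc 0) (Suc (p + q)) (pt [x]) Y))"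
    using l r a tau_cat[OF x fY] tau_cat[OF x Y] by simp
qed ((intro lin f)?; simp)+

text \<open>Only \<open>i = 1\<close> and \<open>i = n + 1\<close> touch the ends. For
  \<open>i = 1\<close> both legs of the first entry are involved and \<open>act_Sd\<close> applies;
  for \<open>i = n + 1\<close> the appended \<open>\<sigma>\<close> meets the one that
  \<open>tau\<close> supplies. Otherwise \<open>tau_app\<close> applies.\<close>

lemma tau_dd:
  assumes i: "1 \<le> i" "i \<le> Suc n" and x: "x \<in> carrier (tp n)"
  shows "tau (Suc n) (dd n i x) = dd n (i - 1) (tau n x)"
  using i(2)
proof (cases rule: coface_cases)
  case 2
  show ?thesis
  proof (cases n)
    \<comment> \<open>With no entry present the claim comes down to
      \<open>S\<^sub>\<delta>(\<sigma>)\<sigma> = 1\<close>.\<close>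
    case 0
    have "tau (Suc 0) (cat 0 (Suc 0) (pt []) (pt [\<sigma>])) = cat (Suc 0) 0 (pt [\<one>\<^bsub>H\<^esub>]) (pt [])"
      using tau_cat[OF sigma_closed pt_Nil_closed] Sd_sigma by (simp add: sigma_pt one_pt act_single Sd_closed)
    then have "tau (Suc 0) (dd 0 (Suc 0) (pt [])) = dd 0 0 (pt [])" by (simp add: dd_0 dd_last)
    then have pure: "tau (Suc 0) (dd 0 (Suc 0) (pt xs)) = dd 0 0 (pt xs)" if "length xs = 0" for xs
      using that by simp
    have l1: "linear_map K (tp 0) (tp (Suc 0)) (\<lambda>x. tau (Suc 0) (dd 0 (Suc 0) x))"
      by (intro tau_lin dd_linear) simp
    have l2: "linear_map K (tp 0) (tp (Suc 0)) (dd 0 0)" by (rule dd_linear) simp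
    have "tau (Suc 0) (dd 0 (Suc 0) x) = dd 0 0 x"
      by (rule tp_ext[OF module_tp l1 l2 pure]) (use x 0 in simp_all)
    then show ?thesis using 0 2 by (simp add: tau_def hopf_cocyc_def)
  next
    case (Suc k)
    have "tau (Suc n) (dd n (Suc n) x) = dd n n (tau n x)"
    proof (rule tp_Suc_ext[where q = k and W = "tp (Suc n)" and w = x])
      fix y w assume y: "y \<in> carrier H" and w: "w \<in> carrier (tp k)"
      have y1: "pt [y] \<in> carrier (tp (Suc 0))" using y by (intro pt_closed) auto
      have ws: "cat k (Suc 0) w (pt [\<sigma>]) \<in> carrier (tp (Suc k))" using w sigma_pt by (intro cat_closed) auto
      have yw: "cat (Suc 0) k (pt [y]) w \<in> carrier (tp (Suc k))" using w y1 by (intro cat_closed) auto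
      have ten: "tau n (cat (Suc 0) k (pt [y]) w) \<in> carrier (tp (Suc k))" using yw Suc by (simp add: tau_closed)
      have "tau (Suc n) (dd n (Suc n) (cat (Suc 0) k (pt [y]) w))
          = tau (Suc n) (cat (Suc 0) (Suc k) (pt [y]) (cat k (Suc 0) w (pt [\<sigma>])))"
        using yw Suc cat_assoc[OF y1 w sigma_pt] by (simp add: dd_last)
      also have "\<dots> = act (Suc n) (Sd y) (cat (Suc k) (Suc 0) (cat k (Suc 0) w (pt [\<sigma>])) (pt [\<sigma>]))"
        using tau_cat[OF y ws] Suc by simp
      \<comment> \<open>The two trailing copies of \<open>\<sigma>\<close> form its coproduct, so
        the last coface turns into the inner coface at the end, which commutes with the
        action.\<close>
      also have "cat (Suc k) (Suc 0) (cat k (Suc 0) w (pt [\<sigma>])) (pt [\<sigma>]) = cat k 2 w (comult H \<sigma>)"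
        using cat_assoc[OF w sigma_pt sigma_pt] by (simp add: comult_sigma_pt numeral_2_eq_2)
      also have "\<dots> = app k 0 2 (comult H) (cat k (Suc 0) w (pt [\<sigma>]))"
        by (rule app_end_cat[OF comult_linear_tp w, symmetric]) simp
      also have "act (Suc n) (Sd y) \<dots> = app k 0 2 (comult H) (act (Suc k) (Sd y) (cat k (Suc 0) w (pt [\<sigma>])))"
        using app_act[OF comult_linear_tp comult_act Sd_closed[OF y], of "cat k (Suc 0) w (pt [\<sigma>])" k 0] ws Suc by simp
      also have "\<dots> = dd n n (tau n (cat (Suc 0) k (pt [y]) w))"
        using tau_cat[OF y w] Suc dd_inner[of n k 0] by simp
      finally show "tau (Suc n) (dd n (Suc n) (cat (Suc 0) k (pt [y]) w)) = dd n n (tau n (cat (Suc 0) k (pt [y]) w))" .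
    next
      show "linear_map K (tp (Suc k)) (tp (Suc n)) (\<lambda>x. tau (Suc n) (dd n (Suc n) x))"
        by (intro tau_lin) (use Suc dd_linear in simp)
      show "linear_map K (tp (Suc k)) (tp (Suc n)) (\<lambda>x. dd n n (tau n x))"
        using linear_map_compose[OF dd_linear[of n n] tau_lin[OF linear_map_ident]] Suc by simp
    qed (use x Suc in simp_all)
    then show ?thesis using 2 by simp
  qed
next
  case (3 p q)
  show ?thesis
  proof (cases p)
    case (Suc p')
    then have n: "n = Suc (Suc (p' + q))" using 3 by simp
    have "tau (Suc (p' + (2 + q))) (app (Suc p') q 2 (comult H) x) = app p' (Suc q) 2 (comult H) (tau (Suc (Suc (p' + q))) x)"
      by (rule tau_app[OF comult_linear_tp comult_act]) (use x n in simp_all)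
    then show ?thesis using 3 Suc n dd_inner[of n "Suc p'" q] dd_inner[of n p' "Suc q"] by simp
  next
    case 0
    then have n: "n = Suc q" and i1: "i = Suc 0" using 3 by simp_all
    have "tau (Suc (Suc q)) (dd n i x) = dd n 0 (tau n x)"
    proof (rule tp_Suc_ext[where q = q and W = "tp (Suc (Suc q))" and w = x])
      fix y w assume y: "y \<in> carrier H" and w: "w \<in> carrier (tp q)"
      let ?W = "tp (Suc (Suc q))"
      have ws: "cat q (Suc 0) w (pt [\<sigma>]) \<in> carrier (tp (Suc q))" using w sigma_pt by (intro cat_closed) auto
      have y1: "pt [y] \<in> carrier (tp (Suc 0))" using y by (intro pt_closed) auto
      have tw: "tau (Suc q) (cat (Suc 0) q (pt [y]) w) \<in> carrier (tp (Suc q))"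
        using w y1 by (intro tau_closed cat_closed) auto
      have "tau (Suc (Suc q)) (dd n i (cat (Suc 0) q (pt [y]) w)) = tau (Suc (Suc q)) (cat 2 q (comult H y) w)"
        using app_0_cat[OF comult_linear_tp w y] dd_inner[of n 0 q] n i1 by simp
      also have "\<dots> = sw ?W (\<lambda>a b. tau (Suc (Suc q)) (cat 2 q (pt [a, b]) w)) y"
        by (rule sw_comult_map[OF _ _ y]; (intro lin)?) (use w in auto)
      \<comment> \<open>The second leg \<open>b\<close> is written as \<open>b\<close> acting on the
        unit, so that \<open>act_Sd\<close> applies with \<open>u = 1\<close>; this unit is the
        entry that coface 0 inserts.\<close>
      also have "\<dots> = sw ?W (\<lambda>a b. act (Suc (Suc q)) (Sd a) (cat (Suc 0) (Suc q) (act (Suc 0) b (pt [\<one>\<^bsub>H\<^esub>])) (cat q (Suc 0) w (pt [\<sigma>])))) y"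
      proof (rule sw_cong)
        fix a b assume ab: "a \<in> carrier H" "b \<in> carrier H"
        have p: "pt [a] \<in> carrier (tp (Suc 0))" "pt [b] \<in> carrier (tp (Suc 0))" using ab by (auto intro!: pt_closed)
        have bw: "cat (Suc 0) q (pt [b]) w \<in> carrier (tp (Suc q))" using p w by (intro cat_closed) auto
        have "cat 2 q (pt [a, b]) w = cat (Suc 0) (Suc q) (pt [a]) (cat (Suc 0) q (pt [b]) w)"
          using cat_assoc[OF p w] ab by (simp add: cat_pt numeral_2_eq_2)
        then have "tau (Suc (Suc q)) (cat 2 q (pt [a, b]) w)
            = act (Suc (Suc q)) (Sd a) (cat (Suc q) (Suc 0) (cat (Suc 0) q (pt [b]) w) (pt [\<sigma>]))"
          using tau_cat[OF ab(1) bw] by simp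
        also have "cat (Suc q) (Suc 0) (cat (Suc 0) q (pt [b]) w) (pt [\<sigma>]) = cat (Suc 0) (Suc q) (pt [b]) (cat q (Suc 0) w (pt [\<sigma>]))"
          using cat_assoc[OF p(2) w sigma_pt] by simp
        finally show "tau (Suc (Suc q)) (cat 2 q (pt [a, b]) w)
            = act (Suc (Suc q)) (Sd a) (cat (Suc 0) (Suc q) (act (Suc 0) b (pt [\<one>\<^bsub>H\<^esub>])) (cat q (Suc 0) w (pt [\<sigma>])))"
          using ab by (simp add: act_single)
      qed
      also have "\<dots> = cat (Suc 0) (Suc q) (pt [\<one>\<^bsub>H\<^esub>]) (act (Suc q) (Sd y) (cat q (Suc 0) w (pt [\<sigma>])))"
        using act_Sd[OF y one_pt ws] by simp
      also have "\<dots> = dd n 0 (tau n (cat (Suc 0) q (pt [y]) w))"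
        using tau_cat[OF y w] tw n by (simp add: dd_0)
      finally show "tau (Suc (Suc q)) (dd n i (cat (Suc 0) q (pt [y]) w)) = dd n 0 (tau n (cat (Suc 0) q (pt [y]) w))" .
    next
      show "linear_map K (tp (Suc q)) (tp (Suc (Suc q))) (\<lambda>x. tau (Suc (Suc q)) (dd n i x))"
        by (intro tau_lin) (use dd_linear[OF i(2)] n in simp)
      show "linear_map K (tp (Suc q)) (tp (Suc (Suc q))) (\<lambda>x. dd n 0 (tau n x))"
        using linear_map_compose[OF dd_linear[of 0 n] tau_lin[OF linear_map_ident]] n by simp
    qed (use x n in simp_all)
    then show ?thesis using i1 n by simp
  qed
qed (use i in simp)

lemma tau_dd_0:
  assumes x: "x \<in> carrier (tp n)"
  shows "tau (Suc n) (dd n 0 x) = dd n (Suc n) x"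
proof -
  have "cat n (Suc 0) x (pt [\<sigma>]) \<in> carrier (tp (Suc n))" using x sigma_pt by (intro cat_closed) auto
  then show ?thesis using x tau_cat[OF one_closed x] by (simp add: dd_0 dd_last Sd_one act_one)
qed

lemma tau_ss:
  assumes i: "1 \<le> i" "i \<le> n" and x: "x \<in> carrier (tp (Suc n))"
  shows "tau n (ss n i x) = ss n (i - 1) (tau (Suc n) x)"
proof -
  obtain p where p: "i = Suc p" using i by (cases i) auto
  then obtain q where n: "n = Suc (p + q)" using i by (metis add_Suc le_Suc_ex)
  have "tau (Suc (p + (0 + q))) (app (Suc p) q 0 eps x) = app p (Suc q) 0 eps (tau (Suc (Suc (p + q))) x)"
    by (rule tau_app[OF eps_linear eps_mult]) (use x n in simp_all)
  then show ?thesis using p n ss_eq[of n "Suc p" q] ss_eq[of n p "Suc q"] by simp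
qed

text \<open>The second application of \<open>tau\<close> is computed by \<open>tau_rotate\<close>,
  which leaves \<open>\<sigma>y\<close> in the last place. Its counit is that of \<open>y\<close>,
  the scalar produced on the left-hand side.\<close>

lemma tau_ss_0:
  assumes x: "x \<in> carrier (tp (Suc n))"
  shows "tau n (ss n 0 x) = ss n n (tau (Suc n) (tau (Suc n) x))"
proof (rule tp_Suc_ext[where W = "tp n", OF _ _ _ _ x])
  fix y Y assume y: "y \<in> carrier H" and Y: "Y \<in> carrier (tp n)"
  have e: "counit H (\<sigma> \<otimes>\<^bsub>H\<^esub> y) = counit H y"
    using ring_hom_mult[OF counit_ring_hom sigma_closed y] sigma_group_like y by (simp add: group_like_def counit_closed)
  have L: "ss n 0 (cat (Suc 0) n (pt [y]) Y) = counit H y \<odot>\<^bsub>tp n\<^esub> Y"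
    using app_0_cat[OF eps_linear Y y] ss_eq[of n 0 n] y Y by (simp add: cat_eps)
  have n0: "act n (Sd z) (app n 0 0 eps (cat n (Suc 0) w (pt [\<sigma> \<otimes>\<^bsub>H\<^esub> y]))) = counit H y \<odot>\<^bsub>tp n\<^esub> act n (Sd z) w"
    if "z \<in> carrier H" "w \<in> carrier (tp n)" for z w
    using app_end_cat[OF eps_linear that(2), of "\<sigma> \<otimes>\<^bsub>H\<^esub> y"] that y e
    by (simp add: cat_eps act_smult counit_closed Sd_closed)
  have R: "app n 0 0 eps (act (Suc n) (Sd z) (cat n (Suc 0) w (pt [\<sigma> \<otimes>\<^bsub>H\<^esub> y]))) = counit H y \<odot>\<^bsub>tp n\<^esub> act n (Sd z) w"
    if z: "z \<in> carrier H" and w: "w \<in> carrier (tp n)" for z w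
  proof -
    have "cat n (Suc 0) w (pt [\<sigma> \<otimes>\<^bsub>H\<^esub> y]) \<in> carrier (tp (Suc n))"
      using w y by (intro cat_closed pt_closed) auto
    then show ?thesis
      using app_act[OF eps_linear eps_mult Sd_closed[OF z], of "cat n (Suc 0) w (pt [\<sigma> \<otimes>\<^bsub>H\<^esub> y])" n 0] n0[OF z w] by simp
  qed
  have c: "linear_map K (tp n) (tp (Suc n)) (\<lambda>Y. cat (Suc 0) n (pt [y]) Y)"
    by (intro lin) (use y in auto)
  have lin1: "linear_map K (tp n) (tp n) (\<lambda>Y. tau n (ss n 0 (cat (Suc 0) n (pt [y]) Y)))"
    by (intro tau_lin linear_map_compose[OF ss_linear c]) simp
  have lin2: "linear_map K (tp n) (tp n) (\<lambda>Y. ss n n (tau (Suc n) (tau (Suc n) (cat (Suc 0) n (pt [y]) Y))))"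
    by (intro linear_map_compose[OF ss_linear] tau_lin c) simp
  show "tau n (ss n 0 (cat (Suc 0) n (pt [y]) Y)) = ss n n (tau (Suc n) (tau (Suc n) (cat (Suc 0) n (pt [y]) Y)))"
  proof (cases n)
    \<comment> \<open>The entry rotated second is the \<open>\<sigma>\<close> that the first
      application appended; its remaining action on the ground field is trivial because
      \<open>S\<^sub>\<delta>(\<sigma>)\<sigma> = 1\<close>.\<close>
    case 0
    have "tau (Suc 0) (act (Suc 0) (Sd y) (cat 0 (Suc 0) (pt []) (pt [\<sigma>])))
        = act (Suc 0) (Sd \<sigma>) (cat 0 (Suc 0) (pt []) (pt [\<sigma> \<otimes>\<^bsub>H\<^esub> y]))"
      using tau_rotate[OF y sigma_closed pt_Nil_closed] y by (simp add: sigma_pt pt_closed)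
    then have "ss n n (tau (Suc n) (tau (Suc n) (cat (Suc 0) n (pt [y]) (pt [])))) = counit H y \<odot>\<^bsub>tp 0\<^esub> act 0 (Sd \<sigma>) (pt [])"
      using 0 tau_cat[OF y pt_Nil_closed] R[OF sigma_closed, of "pt []"] ss_eq[of 0 0 0] by simp
    also have "act 0 (Sd \<sigma>) (pt []) = act 0 (Sd \<sigma>) (act 0 \<sigma> (pt []))"
      using act_group_like[OF sigma_group_like, of "[]"] by simp
    also have "\<dots> = pt []"
      using act_mult[OF Sd_closed[OF sigma_closed] sigma_closed pt_Nil_closed] Sd_sigma by (simp add: act_one)
    finally have "tau n (ss n 0 (cat (Suc 0) n (pt [y]) (pt []))) = ss n n (tau (Suc n) (tau (Suc n) (cat (Suc 0) n (pt [y]) (pt []))))"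
      using app_0_cat[OF eps_linear pt_Nil_closed y] ss_eq[of 0 0 0] y 0
      by (simp add: cat_eps tau_def hopf_cocyc_def)
    then have pure: "tau n (ss n 0 (cat (Suc 0) n (pt [y]) (pt xs)))
        = ss n n (tau (Suc n) (tau (Suc n) (cat (Suc 0) n (pt [y]) (pt xs))))" if "length xs = n" for xs
      using that 0 by simp
    show ?thesis by (rule tp_ext[OF module_tp lin1 lin2 pure Y])
  next
    case (Suc k)
    have y1: "pt [y] \<in> carrier (tp (Suc 0))" using y by (intro pt_closed) auto
    show ?thesis
    proof (rule tp_Suc_ext[where q = k and W = "tp n" and w = Y])
      fix z w assume z: "z \<in> carrier H" and w: "w \<in> carrier (tp k)"
      have z1: "pt [z] \<in> carrier (tp (Suc 0))" using z by (intro pt_closed) auto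
      have ws: "cat k (Suc 0) w (pt [\<sigma>]) \<in> carrier (tp (Suc k))" using w sigma_pt by (intro cat_closed) auto
      have zw: "cat (Suc 0) k (pt [z]) w \<in> carrier (tp n)" using z1 w Suc by (intro cat_closed) auto
      have "tau (Suc n) (tau (Suc n) (cat (Suc 0) n (pt [y]) (cat (Suc 0) k (pt [z]) w)))
          = tau (Suc n) (act (Suc n) (Sd y) (cat (Suc 0) (Suc k) (pt [z]) (cat k (Suc 0) w (pt [\<sigma>]))))"
        using tau_cat[OF y zw] cat_assoc[OF z1 w sigma_pt] Suc by simp
      also have "\<dots> = act (Suc n) (Sd z) (cat n (Suc 0) (cat k (Suc 0) w (pt [\<sigma>])) (pt [\<sigma> \<otimes>\<^bsub>H\<^esub> y]))"
        using tau_rotate[OF y z ws] Suc by simp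
      finally have "ss n n (tau (Suc n) (tau (Suc n) (cat (Suc 0) n (pt [y]) (cat (Suc 0) k (pt [z]) w))))
          = counit H y \<odot>\<^bsub>tp n\<^esub> act n (Sd z) (cat k (Suc 0) w (pt [\<sigma>]))"
        using R[OF z, of "cat k (Suc 0) w (pt [\<sigma>])"] ws Suc ss_eq[of n n 0] by simp
      also have "\<dots> = tau n (ss n 0 (cat (Suc 0) n (pt [y]) (cat (Suc 0) k (pt [z]) w)))"
        using app_0_cat[OF eps_linear zw y] ss_eq[of n 0 n] y zw tau_cat[OF z w] Suc
          linear_map_smult[OF tau_lin[OF linear_map_ident] counit_closed[OF y] zw]
        by (simp add: cat_eps)
      finally show "tau n (ss n 0 (cat (Suc 0) n (pt [y]) (cat (Suc 0) k (pt [z]) w)))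
          = ss n n (tau (Suc n) (tau (Suc n) (cat (Suc 0) n (pt [y]) (cat (Suc 0) k (pt [z]) w))))" by simp
    qed (use lin1 lin2 Y Suc in simp_all)
  qed
next
  show "linear_map K (tp (Suc n)) (tp n) (\<lambda>x. tau n (ss n 0 x))"
    by (intro tau_lin ss_linear) simp
  show "linear_map K (tp (Suc n)) (tp n) (\<lambda>x. ss n n (tau (Suc n) (tau (Suc n) x)))"
    by (intro linear_map_compose[OF ss_linear] tau_lin linear_map_ident) simp
qed simp

lemma hopf_cocyclic_simps:
  "cospace (hopf_cocyclic K H \<delta> \<sigma>) n = tp n" "coface (hopf_cocyclic K H \<delta> \<sigma>) n i = dd n i"
  "codegen (hopf_cocyclic K H \<delta> \<sigma>) n i = ss n i" "cocyc (hopf_cocyclic K H \<delta> \<sigma>) n = tau n"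
  by (simp_all add: hopf_cocyclic_def tp_def dd_def ss_def tau_def)

theorem hopf_cocyclic_module: "cocyclic_module K (hopf_cocyclic K H \<delta> \<sigma>)"
  apply (rule cocyclic_module.intro; unfold hopf_cocyclic_simps)
               apply (rule module_tp)
              apply (rule dd_linear, assumption)
             apply (rule ss_linear, assumption)
            apply (rule tau_lin[OF linear_map_ident])
           apply (rule dd_dd; assumption)
          apply (rule ss_ss; assumption)
         apply (rule ss_dd_less; assumption)
        apply (rule ss_dd_same; assumption)
       apply (rule ss_dd_greater; assumption)
      apply (rule tau_dd; assumption)
     apply (rule tau_dd_0; assumption)
    apply (rule tau_ss; assumption)
   apply (rule tau_ss_0; assumption)
  apply (rule tau_power; assumption)
  done

end

section \<open>Functoriality of cyclic cohomology\<close>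

lemma linear_map_finsum_fun:
  assumes V: "module K V" and W: "module K W" and "finite A" "\<And>i. i \<in> A \<Longrightarrow> linear_map K V W (f i)"
  shows "linear_map K V W (\<lambda>x. \<Oplus>\<^bsub>W\<^esub> i\<in>A. f i x)"
  using assms(3,4)
proof (induction A rule: finite_induct)
  case empty
  interpret W: module K W by fact
  show ?case using linear_map_zero_fun[OF W] by simp
next
  case (insert i A)
  interpret W: module K W by fact
  have "linear_map K V W (\<lambda>x. f i x \<oplus>\<^bsub>W\<^esub> (\<Oplus>\<^bsub>W\<^esub> i\<in>A. f i x))"
    using insert by (intro linear_map_add_fun[OF W]) auto
  moreover have "(\<Oplus>\<^bsub>W\<^esub> i\<in>insert i A. f i x) = f i x \<oplus>\<^bsub>W\<^esub> (\<Oplus>\<^bsub>W\<^esub> i\<in>A. f i x)" if "x \<in> carrier V" for x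
    using insert linear_map_closed[OF insert.prems that] by (intro W.finsum_insert) auto
  ultimately show ?case by (subst linear_map_cong[OF V]) auto
qed

lemma linear_map_minus_fun:
  assumes "module K V" "module K W" "linear_map K V W f" "linear_map K V W g"
  shows "linear_map K V W (\<lambda>x. f x \<ominus>\<^bsub>W\<^esub> g x)"
proof -
  interpret W: module K W by fact
  have "linear_map K V W (\<lambda>x. f x \<oplus>\<^bsub>W\<^esub> (\<ominus>\<^bsub>K\<^esub> \<one>\<^bsub>K\<^esub>) \<odot>\<^bsub>W\<^esub> g x)"
    by (intro linear_map_add_fun linear_map_smult_fun assms) simp
  moreover have "f x \<ominus>\<^bsub>W\<^esub> g x = f x \<oplus>\<^bsub>W\<^esub> (\<ominus>\<^bsub>K\<^esub> \<one>\<^bsub>K\<^esub>) \<odot>\<^bsub>W\<^esub> g x" if "x \<in> carrier V" for x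
    using linear_map_closed[OF assms(4) that] by (simp add: a_minus_def W.smult_l_minus)
  ultimately show ?thesis by (subst linear_map_cong[OF assms(1)])
qed

lemma submodule_image:
  assumes V: "module K V" and W: "module K W" and f: "linear_map K V W f" and A: "submodule A K V"
  shows "submodule (f ` A) K W"
proof -
  interpret V: module K V by fact
  interpret W: module K W by fact
  note A' = V.submoduleE[OF A] submodule_zero_closed[OF V A]
  note c = subsetD[OF A'(1)]
  show ?thesis
  proof (rule W.submoduleI)
    show "f ` A \<subseteq> carrier W" using linear_map_closed[OF f] c by auto
    show "\<zero>\<^bsub>W\<^esub> \<in> f ` A"
      unfolding linear_map_zero[OF V W f, symmetric] using A'(7) by (rule imageI)
    show "\<ominus>\<^bsub>W\<^esub> a \<in> f ` A" if "a \<in> f ` A" for a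
      using that A'(3) c by (auto simp: linear_map_a_inv[OF V W f, symmetric])
    show "a \<oplus>\<^bsub>W\<^esub> b \<in> f ` A" if "a \<in> f ` A" "b \<in> f ` A" for a b
      using that A'(5) c by (auto simp: linear_map_add[OF f, symmetric])
    show "k \<odot>\<^bsub>W\<^esub> x \<in> f ` A" if "k \<in> carrier K" "x \<in> f ` A" for k x
      using that A'(4) c by (auto simp: linear_map_smult[OF f, symmetric])
  qed
qed

context cocyclic_module
begin

lemma cring: "cring K"
  using module.axioms(1)[OF cospace_module] .

lemma alt_sign_closed: "alt_sign K n \<in> carrier K"
proof -
  interpret K: cring K by (rule cring)
  show ?thesis by (simp add: alt_sign_def)
qed

lemma hochschild_b_linear: "linear_map K (cospace C n) (cospace C (Suc n)) (hochschild_b K C n)"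
  unfolding hochschild_b_def[abs_def]
  by (intro linear_map_finsum_fun linear_map_smult_fun cospace_module coface_linear alt_sign_closed) auto

lemma cyclic_cochains_submodule: "submodule (cyclic_cochains K C n) K (cospace C n)"
  unfolding cyclic_cochains_def
  by (intro submodule_equalizer[where W = "cospace C n"] cospace_module linear_map_minus_fun
      linear_map_ident linear_map_smult_fun cocyc_linear alt_sign_closed linear_map_zero_fun)

lemma cyclic_coboundaries_submodule: "submodule (cyclic_coboundaries K C n) K (cospace C n)"
proof (cases n)
  case 0
  interpret M: module K "cospace C 0" by (rule cospace_module)
  show ?thesis using 0 by (auto intro!: M.submoduleI)
next
  case (Suc k)
  show ?thesis unfolding Suc cyclic_coboundaries.simps
    by (rule submodule_image[OF cospace_module cospace_module hochschild_b_linear cyclic_cochains_submodule])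
qed

lemma cyclic_cocycles_closed: "x \<in> cyclic_cocycles K C n \<Longrightarrow> x \<in> carrier (cospace C n)"
  by (simp add: cyclic_cocycles_def cyclic_cochains_def)

lemma cyclic_cohomology_carrier:
  "carrier (cyclic_cohomology K C n) = cyclic_class K C n ` cyclic_cocycles K C n"
  by (auto simp: cyclic_cohomology_def quotient_module_def A_RCOSETS_def' a_r_coset_def' cyclic_class_def)

text \<open>The cohomology is the quotient of a record whose carrier was cut down to the cocycles.
  Addition of cosets ignores that carrier, so the rule for the quotient of the whole
  \<open>cospace\<close> applies.\<close>

lemma cyclic_cohomology_add:
  assumes "x \<in> carrier (cospace C n)" "y \<in> carrier (cospace C n)"
  shows "cyclic_class K C n x \<oplus>\<^bsub>cyclic_cohomology K C n\<^esub> cyclic_class K C n y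
    = cyclic_class K C n (x \<oplus>\<^bsub>cospace C n\<^esub> y)"
proof -
  have "add (cyclic_cohomology K C n) = add (quotient_module (cospace C n) (cyclic_coboundaries K C n))"
    by (intro ext) (simp add: cyclic_cohomology_def quotient_module_def set_add_def')
  then show ?thesis unfolding cyclic_class_def
    using quotient_module_simps(3)[OF cospace_module cyclic_coboundaries_submodule assms] by simp
qed

lemma cyclic_cohomology_smult:
  assumes "c \<in> carrier K" "x \<in> carrier (cospace C n)"
  shows "c \<odot>\<^bsub>cyclic_cohomology K C n\<^esub> cyclic_class K C n x = cyclic_class K C n (c \<odot>\<^bsub>cospace C n\<^esub> x)"
proof -
  have "smult (cyclic_cohomology K C n) = smult (quotient_module (cospace C n) (cyclic_coboundaries K C n))"
    by (intro ext) (simp add: cyclic_cohomology_def quotient_module_def a_r_coset_def')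
  then show ?thesis unfolding cyclic_class_def
    using quotient_module_smult[OF cospace_module cyclic_coboundaries_submodule assms] by simp
qed

end

context cocyclic_morphism
begin

lemma hochschild_b_commutes:
  assumes x: "x \<in> carrier (cospace C n)"
  shows "\<gamma> (Suc n) (hochschild_b K C n x) = hochschild_b K D n (\<gamma> n x)"
proof -
  interpret MD: module K "cospace D (Suc n)" by (rule D.cospace_module)
  interpret MC: module K "cospace C (Suc n)" by (rule C.cospace_module)
  have cf: "coface C n i x \<in> carrier (cospace C (Suc n))" if "i \<le> Suc n" for i
    using linear_map_closed[OF C.coface_linear[OF that] x] .
  have "\<gamma> (Suc n) (hochschild_b K C n x)
      = (\<Oplus>\<^bsub>cospace D (Suc n)\<^esub> i\<in>{..Suc n}. \<gamma> (Suc n) (alt_sign K i \<odot>\<^bsub>cospace C (Suc n)\<^esub> coface C n i x))"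
    unfolding hochschild_b_def
    by (rule linear_map_finsum[OF C.cospace_module D.cospace_module linear])
      (use cf C.alt_sign_closed in auto)
  also have "\<dots> = hochschild_b K D n (\<gamma> n x)"
    unfolding hochschild_b_def
  proof (rule MD.finsum_cong')
    fix i assume "i \<in> {..Suc n}"
    then have i: "i \<le> Suc n" by simp
    show "\<gamma> (Suc n) (alt_sign K i \<odot>\<^bsub>cospace C (Suc n)\<^esub> coface C n i x)
        = alt_sign K i \<odot>\<^bsub>cospace D (Suc n)\<^esub> coface D n i (\<gamma> n x)"
      unfolding linear_map_smult[OF linear C.alt_sign_closed cf[OF i]] commutes_coface[OF i x] ..
  qed (use linear_map_closed[OF D.coface_linear linear_map_closed[OF linear x]] C.alt_sign_closed in auto)
  finally show ?thesis .
qed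

lemma cyclic_cochains_map:
  assumes x: "x \<in> cyclic_cochains K C n"
  shows "\<gamma> n x \<in> cyclic_cochains K D n"
proof -
  have xc: "x \<in> carrier (cospace C n)"
    and eq: "x \<ominus>\<^bsub>cospace C n\<^esub> (alt_sign K n \<odot>\<^bsub>cospace C n\<^esub> cocyc C n x) = \<zero>\<^bsub>cospace C n\<^esub>"
    using x by (auto simp: cyclic_cochains_def)
  interpret MC: module K "cospace C n" by (rule C.cospace_module)
  have tc: "cocyc C n x \<in> carrier (cospace C n)" using linear_map_closed[OF C.cocyc_linear xc] .
  have "\<gamma> n x \<ominus>\<^bsub>cospace D n\<^esub> (alt_sign K n \<odot>\<^bsub>cospace D n\<^esub> cocyc D n (\<gamma> n x))
      = \<gamma> n (x \<ominus>\<^bsub>cospace C n\<^esub> (alt_sign K n \<odot>\<^bsub>cospace C n\<^esub> cocyc C n x))"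
    unfolding linear_map_minus[OF C.cospace_module D.cospace_module linear xc MC.smult_closed[OF C.alt_sign_closed tc]]
      linear_map_smult[OF linear C.alt_sign_closed tc] commutes_cocyc[OF xc] ..
  also have "\<dots> = \<zero>\<^bsub>cospace D n\<^esub>"
    unfolding eq by (rule linear_map_zero[OF C.cospace_module D.cospace_module linear])
  finally show ?thesis using linear_map_closed[OF linear xc] by (simp add: cyclic_cochains_def)
qed

lemma cyclic_cocycles_map:
  assumes x: "x \<in> cyclic_cocycles K C n"
  shows "\<gamma> n x \<in> cyclic_cocycles K D n"
proof -
  have xc: "x \<in> carrier (cospace C n)" using x by (rule C.cyclic_cocycles_closed)
  have "hochschild_b K D n (\<gamma> n x) = \<gamma> (Suc n) \<zero>\<^bsub>cospace C (Suc n)\<^esub>"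
    using hochschild_b_commutes[OF xc] x by (simp add: cyclic_cocycles_def)
  also have "\<dots> = \<zero>\<^bsub>cospace D (Suc n)\<^esub>"
    by (rule linear_map_zero[OF C.cospace_module D.cospace_module linear])
  finally show ?thesis using x cyclic_cochains_map by (simp add: cyclic_cocycles_def)
qed

lemma cyclic_coboundaries_map:
  assumes x: "x \<in> cyclic_coboundaries K C n"
  shows "\<gamma> n x \<in> cyclic_coboundaries K D n"
proof (cases n)
  case 0
  then show ?thesis using x linear_map_zero[OF C.cospace_module D.cospace_module linear[of 0]] by simp
next
  case (Suc k)
  then obtain y where y: "y \<in> cyclic_cochains K C k" "x = hochschild_b K C k y" using x by auto
  have "y \<in> carrier (cospace C k)" using y by (simp add: cyclic_cochains_def)
  then show ?thesis using hochschild_b_commutes cyclic_cochains_map[OF y(1)] y(2) Suc by simp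
qed

text \<open>\<open>\<gamma>\<close> maps coboundaries to coboundaries and so descends to the
  quotient of the whole \<open>cospace\<close>; its values on classes of cocycles give the induced
  map.\<close>

theorem induced_map:
  "\<exists>\<Gamma>. \<forall>n. linear_map K (cyclic_cohomology K C n) (cyclic_cohomology K D n) (\<Gamma> n)
    \<and> (\<forall>x\<in>cyclic_cocycles K C n. \<gamma> n x \<in> cyclic_cocycles K D n
         \<and> \<Gamma> n (cyclic_class K C n x) = cyclic_class K D n (\<gamma> n x))"
proof (rule choice, rule allI)
  fix n
  let ?B = "cyclic_coboundaries K C n" and ?B' = "cyclic_coboundaries K D n"
  let ?Q' = "quotient_module (cospace D n) ?B'"
  interpret MC: module K "cospace C n" by (rule C.cospace_module)
  note DB = D.cospace_module[of n] D.cyclic_coboundaries_submodule[of n]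
  interpret Q: module K ?Q' by (rule module_quotient_module[OF DB])
  have f: "linear_map K (cospace C n) ?Q' (\<lambda>x. cyclic_class K D n (\<gamma> n x))"
    unfolding cyclic_class_def by (rule linear_map_compose[OF linear_map_quotient[OF DB] linear])
  have ker: "cyclic_class K D n (\<gamma> n w) = \<zero>\<^bsub>?Q'\<^esub>" if "w \<in> ?B" for w
  proof -
    interpret MD: module K "cospace D n" by (rule D.cospace_module)
    have "\<gamma> n w \<in> ?B'" using that by (rule cyclic_coboundaries_map)
    moreover have "w \<in> carrier (cospace C n)"
      using that MC.submoduleE(1)[OF C.cyclic_coboundaries_submodule] by blast
    then have "\<gamma> n w \<in> carrier (cospace D n)" using linear_map_closed[OF linear] by blast
    moreover have "\<gamma> n w \<ominus>\<^bsub>cospace D n\<^esub> \<zero>\<^bsub>cospace D n\<^esub> = \<gamma> n w" if "\<gamma> n w \<in> carrier (cospace D n)"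
      using that MD.minus_equality[of "\<zero>\<^bsub>cospace D n\<^esub>" "\<zero>\<^bsub>cospace D n\<^esub>"] unfolding a_minus_def by simp
    ultimately have "?B' +>\<^bsub>cospace D n\<^esub> \<gamma> n w = ?B' +>\<^bsub>cospace D n\<^esub> \<zero>\<^bsub>cospace D n\<^esub>"
      by (subst quotient_coset_eq_iff[OF DB]) simp_all
    also have "\<dots> = ?B'" using MD.a_coset_add_zero MD.submoduleE(1)[OF DB(2)] by blast
    finally show ?thesis unfolding cyclic_class_def quotient_module_simps(2)[OF DB] .
  qed
  obtain F where F: "linear_map K (quotient_module (cospace C n) ?B) ?Q' F"
    "\<And>x. x \<in> carrier (cospace C n) \<Longrightarrow> F (cyclic_class K C n x) = cyclic_class K D n (\<gamma> n x)"
    using quotient_lift_exists[OF C.cospace_module C.cyclic_coboundaries_submodule Q.module_axioms f ker]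
    unfolding cyclic_class_def by blast
  note cC = C.cyclic_cocycles_closed and cD = D.cyclic_cocycles_closed[OF cyclic_cocycles_map]
  have "linear_map K (cyclic_cohomology K C n) (cyclic_cohomology K D n) F"
  proof (rule linear_mapI; unfold C.cyclic_cohomology_carrier; elim imageE; hypsubst)
    fix x assume x: "x \<in> cyclic_cocycles K C n"
    show "F (cyclic_class K C n x) \<in> carrier (cyclic_cohomology K D n)"
      using F(2)[OF cC[OF x]] cyclic_cocycles_map[OF x] unfolding D.cyclic_cohomology_carrier by simp
    fix y assume y: "y \<in> cyclic_cocycles K C n"
    show "F (cyclic_class K C n x \<oplus>\<^bsub>cyclic_cohomology K C n\<^esub> cyclic_class K C n y)
        = F (cyclic_class K C n x) \<oplus>\<^bsub>cyclic_cohomology K D n\<^esub> F (cyclic_class K C n y)"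
      using cC[OF x] cC[OF y] cD[OF x] cD[OF y]
      by (simp add: C.cyclic_cohomology_add D.cyclic_cohomology_add F(2) linear_map_add[OF linear])
  next
    fix c x assume c: "c \<in> carrier K" and x: "x \<in> cyclic_cocycles K C n"
    show "F (c \<odot>\<^bsub>cyclic_cohomology K C n\<^esub> cyclic_class K C n x)
        = c \<odot>\<^bsub>cyclic_cohomology K D n\<^esub> F (cyclic_class K C n x)"
      using c cC[OF x] cD[OF x]
      by (simp add: C.cyclic_cohomology_smult D.cyclic_cohomology_smult F(2) linear_map_smult[OF linear])
  qed
  then show "\<exists>F. linear_map K (cyclic_cohomology K C n) (cyclic_cohomology K D n) F
    \<and> (\<forall>x\<in>cyclic_cocycles K C n. \<gamma> n x \<in> cyclic_cocycles K D n
         \<and> F (cyclic_class K C n x) = cyclic_class K D n (\<gamma> n x))"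
    using cyclic_cocycles_map F(2) cC by blast
qed

end

section \<open>The characteristic map\<close>

locale hopf_trace = hopf_modular K H \<delta> \<sigma> + left_hopf_category K H D
  for K :: "('k, 'z) ring_scheme" and H :: "('k, 'h, 'y) hopf_scheme" and \<delta> \<sigma>
    and D :: "('k, 'h, 'o, 'm, 'x) hopf_cat_scheme" +
  fixes T :: "'o \<Rightarrow> 'm \<Rightarrow> 'k"
  assumes trace: "sigma_trace K D \<sigma> T" and invariant: "delta_invariant K H D \<delta> T"

sublocale hopf_trace \<subseteq> cring_category K D ..

context hopf_trace
begin

definition act_arrow :: "'h \<Rightarrow> ('o \<times> 'o) \<times> 'm \<Rightarrow> ('o \<times> 'o) \<times> 'm" where
  "act_arrow h t = (fst t, Act D (src t) (tgt t) h (snd t))"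

abbreviation acts where "acts hs ts \<equiv> map2 act_arrow hs ts"

text \<open>The product is right-nested and ends in an identity, so that empty chains are allowed
  and concatenation behaves well. The argument \<open>y\<close> is needed because an empty chain
  does not determine its object.\<close>

fun cmp :: "'o \<Rightarrow> (('o \<times> 'o) \<times> 'm) list \<Rightarrow> 'm" where
  "cmp y [] = Id D y"
| "cmp y (t # ts) = Comp D y (src t) (tgt t) (snd t) (cmp y ts)"

lemma act_arrow_simps [simp]:
  "fst (act_arrow h t) = fst t" "snd (act_arrow h t) = Act D (src t) (tgt t) h (snd t)"
  by (simp_all add: act_arrow_def)

lemma Act_lin [lin]:
  "\<lbrakk>X \<in> Ob D; Y \<in> Ob D; f \<in> carrier (Hom D X Y); linear_map K V H g\<rbrakk>
    \<Longrightarrow> linear_map K V (Hom D X Y) (\<lambda>x. Act D X Y (g x) f)"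
  "\<lbrakk>X \<in> Ob D; Y \<in> Ob D; h \<in> carrier H; linear_map K V (Hom D X Y) k\<rbrakk>
    \<Longrightarrow> linear_map K V (Hom D X Y) (\<lambda>x. Act D X Y h (k x))"
  using linear_map_compose[OF left_hopf_module.act_linear_left[OF Act_module]]
    linear_map_compose[OF left_hopf_module.act_linear_right[OF Act_module]] by blast+

lemma Act_closed [lin]:
  "\<lbrakk>X \<in> Ob D; Y \<in> Ob D; h \<in> carrier H; f \<in> carrier (Hom D X Y)\<rbrakk> \<Longrightarrow> Act D X Y h f \<in> carrier (Hom D X Y)"
  using linear_map_closed[OF Act_lin(2)[OF _ _ _ linear_map_ident]] .

lemma Comp_lin [lin]:
  "\<lbrakk>X \<in> Ob D; Y \<in> Ob D; Z \<in> Ob D; f \<in> carrier (Hom D X Y); linear_map K V (Hom D Y Z) g\<rbrakk>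
    \<Longrightarrow> linear_map K V (Hom D X Z) (\<lambda>x. Comp D X Y Z (g x) f)"
  "\<lbrakk>X \<in> Ob D; Y \<in> Ob D; Z \<in> Ob D; e \<in> carrier (Hom D Y Z); linear_map K V (Hom D X Y) k\<rbrakk>
    \<Longrightarrow> linear_map K V (Hom D X Z) (\<lambda>x. Comp D X Y Z e (k x))"
  using linear_map_compose[OF Comp_linear_left] linear_map_compose[OF Comp_linear_right] by blast+

declare Comp_closed [lin] Hom_module [lin]

lemma T_lin [lin]:
  "\<lbrakk>X \<in> Ob D; linear_map K V (Hom D X X) f\<rbrakk> \<Longrightarrow> linear_map K V (self_module K) (\<lambda>x. T X (f x))"
  using trace linear_map_compose unfolding sigma_trace_def by blast

lemma T_linear: "X \<in> Ob D \<Longrightarrow> linear_map K (Hom D X X) (self_module K) (T X)"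
  using trace unfolding sigma_trace_def by blast

lemma T_closed: "\<lbrakk>X \<in> Ob D; f \<in> carrier (Hom D X X)\<rbrakk> \<Longrightarrow> T X f \<in> carrier K"
  using linear_map_closed[OF T_linear] by simp

lemma cmp_closed: "chain y ts x \<Longrightarrow> cmp y ts \<in> carrier (Hom D y x)"
  by (induction ts arbitrary: x) (auto intro: Id_closed intro!: Comp_closed dest: chain_Ob)

text \<open>Associativity regroups the right-nested product at an arbitrary point of the
  chain.\<close>

lemma cmp_append:
  "\<lbrakk>chain z A x; chain y B z\<rbrakk> \<Longrightarrow> cmp y (A @ B) = Comp D y z x (cmp z A) (cmp y B)"
proof (induction A arbitrary: x)
  case Nil
  then show ?case using Id_left cmp_closed[OF Nil(2)] chain_Ob[OF Nil(2)] by auto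
next
  case (Cons t A)
  then have c: "chain z A (src t)" "tgt t = x" "snd t \<in> carrier (Hom D (src t) x)" by auto
  have ob: "y \<in> Ob D" "z \<in> Ob D" "src t \<in> Ob D" "x \<in> Ob D"
    using chain_Ob[OF Cons.prems(1)] chain_Ob[OF Cons.prems(2)] chain_Ob[OF c(1)] by auto
  show ?case
    using Cons.IH[OF c(1) Cons.prems(2)] Comp_assoc[OF ob(1,2,3,4) cmp_closed[OF Cons.prems(2)] cmp_closed[OF c(1)] c(3)] c(2)
    by simp
qed

lemma chain_acts:
  "\<lbrakk>chain y ts x; length hs = length ts; set hs \<subseteq> carrier H\<rbrakk> \<Longrightarrow> chain y (acts hs ts) x"
proof (induction ts arbitrary: x hs)
  case (Cons t ts)
  then obtain h hs' where "hs = h # hs'" by (cases hs) auto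
  then show ?case using Cons by (auto intro!: Act_closed dest: chain_Ob)
qed simp

lemma cmp_single: "\<lbrakk>chain y [t] x\<rbrakk> \<Longrightarrow> cmp y [t] = snd t"
  using Id_right by auto

lemma cmp_slot:
  assumes "chain a A x" "chain y B b" "f \<in> carrier (Hom D b a)"
  shows "cmp y (A @ ((b, a), f) # B) = Comp D y a x (cmp a A) (Comp D y b a f (cmp y B))"
proof -
  have "chain y (((b, a), f) # B) a" using assms chain_Ob[OF assms(1)] by auto
  from cmp_append[OF assms(1) this] show ?thesis by simp
qed

lemma cmp_slot_linear:
  assumes A: "chain a A x" and B: "chain y B b"
  shows "linear_map K (Hom D b a) (Hom D y x) (\<lambda>f. cmp y (A @ ((b, a), f) # B))"
proof -
  have ob: "a \<in> Ob D" "x \<in> Ob D" "y \<in> Ob D" "b \<in> Ob D" using chain_Ob[OF A] chain_Ob[OF B] by auto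
  have "linear_map K (Hom D b a) (Hom D y x) (\<lambda>f. Comp D y a x (cmp a A) (Comp D y b a f (cmp y B)))"
    by (intro lin ob cmp_closed A B)
  then show ?thesis
    by (subst linear_map_cong[OF Hom_module[OF ob(4,1)]]) (simp_all add: cmp_slot[OF A B])
qed

text \<open>Associativity again: composing two neighbours leaves the product unchanged. Face
  operators on chains thereby become invisible to the trace.\<close>

lemma cmp_comp:
  assumes "chain y (A @ s # t # B) x"
  shows "cmp y (A @ comp_arrow s t # B) = cmp y (A @ s # t # B)"
proof -
  obtain z where A: "chain z A x" and B: "chain y (s # t # B) z" using assms by (auto simp only: chain_append)
  then have tB: "chain y B (src t)" and st: "src s = tgt t" "tgt s = z" "snd s \<in> carrier (Hom D (src s) z)"
    "snd t \<in> carrier (Hom D (src t) (src s))" "z \<in> Ob D" "src s \<in> Ob D" by auto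
  have tO: "src t \<in> Ob D" "y \<in> Ob D" using chain_Ob[OF tB] by auto
  have c: "chain y (comp_arrow s t # B) z" using st tO tB by (auto intro!: Comp_closed)
  have "cmp y (comp_arrow s t # B) = cmp y (s # t # B)"
    using Comp_assoc[OF tO(2,1) st(6,5) cmp_closed[OF tB] st(4,3)] st by simp
  then show ?thesis unfolding cmp_append[OF A B] cmp_append[OF A c] by simp
qed

text \<open>The \<open>\<sigma>\<close>-trace identity read from right to left, with
  \<open>g\<close> the last arrow and \<open>f\<close> the product of \<open>M\<close>.\<close>

lemma trace_rotate:
  assumes "chain x (M @ [t]) x"
  shows "T x (cmp x (M @ [act_arrow \<sigma> t])) = T (tgt t) (cmp (tgt t) (t # M))"
proof -
  from assms have M: "chain (tgt t) M x" and t: "src t = x" "snd t \<in> carrier (Hom D x (tgt t))" "tgt t \<in> Ob D" "x \<in> Ob D"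
    by (auto simp: chain_append dest: chain_Ob)
  have st: "chain x [act_arrow \<sigma> t] (tgt t)" using t by (auto intro!: Act_closed)
  have "T x (cmp x (M @ [act_arrow \<sigma> t])) = T x (Comp D x (tgt t) x (cmp (tgt t) M) (Act D x (tgt t) \<sigma> (snd t)))"
    using cmp_append[OF M st] cmp_single[OF st] t by simp
  also have "\<dots> = T (tgt t) (Comp D (tgt t) x (tgt t) (snd t) (cmp (tgt t) M))"
    using trace t cmp_closed[OF M] unfolding sigma_trace_def by metis
  finally show ?thesis using t by simp
qed

text \<open>Apply invariance to \<open>h\<^sub>1(f \<cdot> S(h\<^sub>2)g) = (h\<^sub>1f) \<cdot> (h\<^sub>2S(h\<^sub>3)g)\<close>.\<close>

lemma trace_by_parts:
  assumes X: "X \<in> Ob D" and Y: "Y \<in> Ob D" and f: "f \<in> carrier (Hom D Y X)" and g: "g \<in> carrier (Hom D X Y)"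
    and h: "h \<in> carrier H"
  shows "T X (Comp D X Y X f (Act D X Y (Sd h) g)) = T X (Comp D X Y X (Act D Y X h f) g)"
proof -
  let ?K = "self_module K"
  note ob = X Y
  have Ag: "Act D X Y k g \<in> carrier (Hom D X Y)" if "k \<in> carrier H" for k using that g ob by (intro Act_closed)
  have inv: "T X (Act D X X k u) = \<delta> k \<otimes>\<^bsub>K\<^esub> T X u" if "k \<in> carrier H" "u \<in> carrier (Hom D X X)" for k u
    using invariant that X unfolding delta_invariant_def by blast
  \<comment> \<open>The calculation starts from the right-hand side: splitting off the counit of the
    second leg makes room for \<open>h\<^sub>2S(h\<^sub>3)\<close> acting on
    \<open>g\<close>.\<close>
  have "Comp D X Y X (Act D Y X h f) g
      = sw (Hom D X X) (\<lambda>c x. counit H x \<odot>\<^bsub>Hom D X X\<^esub> Comp D X Y X (Act D Y X c f) g) h"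
    by (rule sw_counit_right[OF _ _ h, symmetric]; (intro lin ob f g)?)
  also have "\<dots> = sw (Hom D X X) (\<lambda>c x. sw (Hom D X X) (\<lambda>d b. Comp D X Y X (Act D Y X c f) (Act D X Y (d \<otimes>\<^bsub>H\<^esub> antipode H b) g)) x) h"
  proof (rule sw_cong)
    fix c x assume cx: "c \<in> carrier H" "x \<in> carrier H"
    have "sw (Hom D X X) (\<lambda>d b. Comp D X Y X (Act D Y X c f) (Act D X Y (d \<otimes>\<^bsub>H\<^esub> antipode H b) g)) x
        = counit H x \<odot>\<^bsub>Hom D X X\<^esub> Comp D X Y X (Act D Y X c f) (Act D X Y \<one>\<^bsub>H\<^esub> g)"
      by (rule sw_antipode_right[where f = "\<lambda>y. Comp D X Y X (Act D Y X c f) (Act D X Y y g)", OF _ _ cx(2)];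
          (intro lin ob f g cx)?)
    then show "counit H x \<odot>\<^bsub>Hom D X X\<^esub> Comp D X Y X (Act D Y X c f) g
        = sw (Hom D X X) (\<lambda>d b. Comp D X Y X (Act D Y X c f) (Act D X Y (d \<otimes>\<^bsub>H\<^esub> antipode H b) g)) x"
      using left_hopf_module.act_one[OF Act_module[OF ob] g] by simp
  qed
  also have "\<dots> = sw (Hom D X X) (\<lambda>x b. sw (Hom D X X) (\<lambda>c d. Comp D X Y X (Act D Y X c f) (Act D X Y (d \<otimes>\<^bsub>H\<^esub> antipode H b) g)) x) h"
    by (rule sw_coassoc[symmetric, OF _ _ _ _ h]; (intro lin ob f g)?; assumption?)
  also have "\<dots> = sw (Hom D X X) (\<lambda>x b. Act D X X x (Comp D X Y X f (Act D X Y (antipode H b) g))) h"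
  proof (rule sw_cong)
    fix x b assume xb: "x \<in> carrier H" "b \<in> carrier H"
    have Sb: "Act D X Y (antipode H b) g \<in> carrier (Hom D X Y)" using xb Ag antipode_closed by blast
    have "Act D X X x (Comp D X Y X f (Act D X Y (antipode H b) g))
        = sw (Hom D X X) (\<lambda>c d. Comp D X Y X (Act D Y X c f) (Act D X Y d (Act D X Y (antipode H b) g))) x"
      by (rule Act_Comp[OF X Y X xb(1) Sb f])
    also have "\<dots> = sw (Hom D X X) (\<lambda>c d. Comp D X Y X (Act D Y X c f) (Act D X Y (d \<otimes>\<^bsub>H\<^esub> antipode H b) g)) x"
      by (rule sw_cong) (use xb g in \<open>simp add: left_hopf_module.act_mult[OF Act_module[OF ob]] antipode_closed\<close>)
    finally show "sw (Hom D X X) (\<lambda>c d. Comp D X Y X (Act D Y X c f) (Act D X Y (d \<otimes>\<^bsub>H\<^esub> antipode H b) g)) x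
        = Act D X X x (Comp D X Y X f (Act D X Y (antipode H b) g))" by simp
  qed
  finally have "T X (Comp D X Y X (Act D Y X h f) g)
      = T X (sw (Hom D X X) (\<lambda>x b. Act D X X x (Comp D X Y X f (Act D X Y (antipode H b) g))) h)" by simp
  also have "\<dots> = sw ?K (\<lambda>x b. T X (Act D X X x (Comp D X Y X f (Act D X Y (antipode H b) g)))) h"
    by (rule sw_map[OF _ _ T_linear[OF X] _ h]; (intro lin ob f g module_K)?; assumption?)
  \<comment> \<open>Invariance turns the outer action into the scalar
    \<open>\<delta>(h\<^sub>1)\<close>; with the antipode of \<open>h\<^sub>2\<close> on
    \<open>g\<close> this is the definition of \<open>S\<^sub>\<delta>\<close>.\<close>
  also have "\<dots> = sw ?K (\<lambda>x b. \<delta> x \<odot>\<^bsub>?K\<^esub> T X (Comp D X Y X f (Act D X Y (antipode H b) g))) h"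
    by (rule sw_cong) (use inv Ag ob f in \<open>simp add: Comp_closed antipode_closed\<close>)
  also have "\<dots> = T X (Comp D X Y X f (Act D X Y (Sd h) g))"
    by (rule Sd_apply[where f = "\<lambda>y. T X (Comp D X Y X f (Act D X Y y g))", OF _ _ h, symmetric]; (intro lin ob f g module_K)?)
  finally show ?thesis by simp
qed

text \<open>The head of \<open>ts\<close> is \<open>f\<^sup>0\<close>, on which nothing acts; hence
  \<open>hs\<close> is paired with the tail, and the base point is the target of the head.\<close>

definition val :: "'h list \<Rightarrow> (('o \<times> 'o) \<times> 'm) list \<Rightarrow> 'k" where
  "val hs ts = T (tgt (hd ts)) (cmp (tgt (hd ts)) (hd ts # acts hs (tl ts)))"

lemma cchains_ConsE:
  assumes "ts \<in> cchains n"
  obtains t ts' where "ts = t # ts'" "length ts' = n" "chain (tgt t) (t # ts') (tgt t)"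
proof -
  obtain x where x: "chain x ts x" "length ts = Suc n" using assms by (auto simp: cchains_def)
  then obtain t ts' where "ts = t # ts'" by (cases ts) auto
  moreover from this have "x = tgt t" using x by simp
  ultimately show ?thesis using that x by simp
qed

lemma chain_Cons_acts:
  "\<lbrakk>chain y (t # ts) x; length hs = length ts; set hs \<subseteq> carrier H\<rbrakk> \<Longrightarrow> chain y (t # acts hs ts) x"
  using chain_acts by auto

text \<open>\<open>twisted_product\<close> is nested to the left and \<open>cmp\<close> to the
  right; \<open>cmp_append\<close> reconciles them. The chain condition is carried through the
  induction because \<open>cmp_append\<close> requires it.\<close>

lemma twisted_product_cmp:
  assumes ts: "ts \<in> cchains n" and hs: "length hs = n" "set hs \<subseteq> carrier H" and j: "j \<le> n"
  shows "twisted_product D (map (\<lambda>t. tgt t) ts) hs (map snd ts) j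
    = cmp (cnth (map (\<lambda>t. tgt t) ts) (Suc j)) (hd ts # acts (take j hs) (take j (tl ts)))
    \<and> chain (cnth (map (\<lambda>t. tgt t) ts) (Suc j)) (hd ts # acts (take j hs) (take j (tl ts))) (cnth (map (\<lambda>t. tgt t) ts) 0)"
  using j
proof (induction j)
  case 0
  obtain t ts' where t: "ts = t # ts'" "chain (tgt t) (t # ts') (tgt t)" using cchains_ConsE[OF ts] by metis
  have s: "src t = cnth (map (\<lambda>t. tgt t) ts) (Suc 0)" "tgt t = cnth (map (\<lambda>t. tgt t) ts) 0"
    using cchains_src_nth[OF ts, of 0] t by simp_all
  have c: "chain (src t) [t] (tgt t)" using chain_arrow[OF t(2)] by simp
  have "cmp (src t) [t] = snd t" by (rule cmp_single[OF c])
  then show ?case unfolding s[symmetric] using t(1) c by (simp del: cmp.simps chain.simps)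
next
  case (Suc j)
  let ?Xs = "map (\<lambda>t. tgt t) ts"
  have l: "length ts = Suc n" using ts by (simp add: cchains_def)
  obtain x where x: "chain x ts x" using ts by (auto simp: cchains_def)
  let ?t = "ts ! Suc j"
  have t: "tl ts ! j = ?t" using Suc.prems l by (simp add: nth_tl)
  have s: "src ?t = cnth ?Xs (Suc (Suc j))" "tgt ?t = cnth ?Xs (Suc j)"
    using cchains_src_nth[OF ts, of "Suc j"] Suc.prems by simp_all
  have hj: "hs ! j \<in> carrier H" using hs Suc.prems by auto
  have c: "chain (src ?t) [act_arrow (hs ! j) ?t] (tgt ?t)"
    using chain_mem[OF x, of ?t] l Suc.prems hj by (auto intro!: Act_closed)
  have tk: "acts (take (Suc j) hs) (take (Suc j) (tl ts)) = acts (take j hs) (take j (tl ts)) @ [act_arrow (hs ! j) ?t]"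
    using Suc.prems hs l t by (simp add: take_Suc_conv_app_nth)
  have IH: "twisted_product D ?Xs hs (map snd ts) j = cmp (tgt ?t) (hd ts # acts (take j hs) (take j (tl ts)))"
    "chain (tgt ?t) (hd ts # acts (take j hs) (take j (tl ts))) (cnth ?Xs 0)"
    using Suc.IH[OF Suc_leD[OF Suc.prems]] unfolding s(2)[symmetric] by blast+
  have "chain (src ?t) ((hd ts # acts (take j hs) (take j (tl ts))) @ [act_arrow (hs ! j) ?t]) (cnth ?Xs 0)"
    unfolding chain_append using IH(2) c by blast
  moreover have "twisted_product D ?Xs hs (map snd ts) (Suc j)
      = cmp (src ?t) ((hd ts # acts (take j hs) (take j (tl ts))) @ [act_arrow (hs ! j) ?t])"
    unfolding cmp_append[OF IH(2) c] cmp_single[OF c] using IH(1) s Suc.prems l by simp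
  ultimately show ?case unfolding tk s(1) append_Cons by blast
qed

lemma twisted_product_val:
  assumes ts: "ts \<in> cchains n" and hs: "length hs = n" "set hs \<subseteq> carrier H"
  shows "T (map (\<lambda>t. tgt t) ts ! 0) (twisted_product D (map (\<lambda>t. tgt t) ts) hs (map snd ts) n) = val hs ts"
proof -
  obtain t ts' where t: "ts = t # ts'" "length ts' = n" using cchains_ConsE[OF ts] by metis
  have "cnth (map (\<lambda>t. tgt t) ts) (Suc n) = tgt t" using t by (simp add: cnth_def)
  then show ?thesis using twisted_product_cmp[OF ts hs le_refl] t hs(1) by (simp add: val_def)
qed

lemma val_slot:
  assumes t: "chain x (t0 # A @ ((b, a), f) # B) x" and hs: "length hs = length A" "length ks = length B"
    "set hs \<subseteq> carrier H" "set ks \<subseteq> carrier H"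
  shows "chain a (t0 # acts hs A) x" "chain x (acts ks B) b"
    and "val (hs @ h # ks) (t0 # A @ ((b, a), f) # B) = T x (cmp x ((t0 # acts hs A) @ ((b, a), Act D b a h f) # acts ks B))"
proof -
  have "chain a (t0 # A) x" "chain x B b" using t by (auto simp: chain_append chain_replace)
  then show "chain a (t0 # acts hs A) x" "chain x (acts ks B) b"
    using chain_Cons_acts chain_acts hs by blast+
  have "tgt t0 = x" using t by simp
  then show "val (hs @ h # ks) (t0 # A @ ((b, a), f) # B) = T x (cmp x ((t0 # acts hs A) @ ((b, a), Act D b a h f) # acts ks B))"
    using hs by (simp add: val_def act_arrow_def)
qed

lemma val_chain_linear:
  assumes hs: "length hs = n" "set hs \<subseteq> carrier H"
  shows "chain_linear n (self_module K) (val hs)"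
  unfolding chain_linear_def
proof (intro conjI ballI allI impI)
  fix ts assume "ts \<in> cchains n"
  then obtain t ts' where t: "ts = t # ts'" "length ts' = n" "chain (tgt t) (t # ts') (tgt t)" by (rule cchains_ConsE)
  have "chain (tgt t) (t # acts hs ts') (tgt t)" by (rule chain_Cons_acts[OF t(3)]) (use t hs in auto)
  from cmp_closed[OF this] show "val hs ts \<in> carrier (self_module K)"
    using T_closed chain_Ob[OF t(3)] t(1) by (simp add: val_def del: cmp.simps)
next
  fix A b a f B assume c: "A @ ((b, a), f) # B \<in> cchains n"
  have s: "a \<in> Ob D" "b \<in> Ob D" using cchains_slot[OF c] by auto
  interpret M: module K "Hom D b a" by (rule Hom_module[OF s(2,1)])
  show "linear_map K (Hom D b a) (self_module K) (\<lambda>f. val hs (A @ ((b, a), f) # B))"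
  proof (cases A)
    \<comment> \<open>The slot is \<open>f\<^sup>0\<close>, the one arrow that no element of
      \<open>H\<close> acts on.\<close>
    case Nil
    obtain x where x: "chain x (((b, a), f) # B) x" using c Nil by (auto simp: cchains_def)
    then have xa: "x = a" "chain a B b" by auto
    have B: "chain a (acts hs B) b" by (rule chain_acts[OF xa(2)]) (use hs c Nil in \<open>auto simp: cchains_def\<close>)
    have "linear_map K (Hom D b a) (self_module K) (\<lambda>f. T a (Comp D a b a f (cmp a (acts hs B))))"
      by (intro lin s cmp_closed B)
    then show ?thesis using Nil by (simp add: val_def)
  next
    case (Cons t0 A')
    obtain x where x: "chain x (t0 # A' @ ((b, a), f) # B) x" using c Cons by (auto simp: cchains_def)
    have "length A' < length hs" using c Cons hs by (auto simp: cchains_def)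
    then obtain hs1 h hs2 where h: "hs = hs1 @ h # hs2" "length hs1 = length A'" by (rule list_split_one)
    have l: "length hs2 = length B" using h hs c Cons by (auto simp: cchains_def)
    have sub: "set hs1 \<subseteq> carrier H" "set hs2 \<subseteq> carrier H" "h \<in> carrier H" using hs h by auto
    note v = val_slot[OF x h(2) l sub(1,2)]
    have "linear_map K (Hom D b a) (self_module K) (\<lambda>f. T x (cmp x ((t0 # acts hs1 A') @ ((b, a), Act D b a h f) # acts hs2 B)))"
      by (intro linear_map_compose[OF linear_map_compose[OF T_linear cmp_slot_linear[OF v(1,2)]]] lin s sub)
        (use chain_Ob[OF x] in auto)
    moreover have "val hs (A @ ((b, a), g) # B) = T x (cmp x ((t0 # acts hs1 A') @ ((b, a), Act D b a h g) # acts hs2 B))"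
      if "g \<in> carrier (Hom D b a)" for g
    proof -
      have "chain x ((t0 # A') @ ((b, a), f) # B) x" using x by (simp only: append_Cons)
      then have "chain x ((t0 # A') @ ((b, a), g) # B) x" unfolding chain_replace using that by blast
      then have "chain x (t0 # A' @ ((b, a), g) # B) x" by (simp only: append_Cons)
      from val_slot(3)[OF this h(2) l sub(1,2)] show ?thesis using Cons h by simp
    qed
    ultimately show ?thesis by (subst linear_map_cong[OF M.module_axioms]) auto
  qed
qed

definition gam_pure :: "nat \<Rightarrow> 'h list \<Rightarrow> ('o list \<Rightarrow> ('m list \<Rightarrow> 'k) set) \<Rightarrow> 'k" where
  "gam_pure n hs = nerve_lift K D n (self_module K) (\<lambda>Xs fs. T (Xs ! 0) (twisted_product D Xs hs fs n))"

lemma gam_pure: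
  assumes "length hs = n" "set hs \<subseteq> carrier H"
  shows "gam_pure n hs \<in> carrier (dual_module K (nerve K D n))"
    and "ts \<in> cchains n \<Longrightarrow> gam_pure n hs (npure ts) = val hs ts"
  using nerve_lift_in_hom[OF module_K val_chain_linear[OF assms] twisted_product_val[OF _ assms]]
  unfolding gam_pure_def by blast+

text \<open>Linearity in an entry from \<open>H\<close>, whereas \<open>val_chain_linear\<close>
  concerns the morphisms. Together they give the two nested lifts in
  \<open>hopf_gamma\<close>.\<close>

lemma val_linear:
  assumes ts: "ts \<in> cchains n" and hs: "length hs + Suc (length ks) = n" "set hs \<subseteq> carrier H" "set ks \<subseteq> carrier H"
  shows "linear_map K H (self_module K) (\<lambda>h. val (hs @ h # ks) ts)"
proof -
  obtain t0 ts' where t: "ts = t0 # ts'" "length ts' = n" "chain (tgt t0) (t0 # ts') (tgt t0)" using ts by (rule cchains_ConsE)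
  have "length hs < length ts'" using t hs by simp
  then obtain A t B where A: "ts' = A @ t # B" "length A = length hs" by (rule list_split_one)
  obtain b a f where f: "t = ((b, a), f)" by (metis prod.exhaust)
  have c: "chain (tgt t0) (t0 # A @ ((b, a), f) # B) (tgt t0)" using t(3) A f by simp
  have l: "length hs = length A" "length ks = length B" using A t hs by auto
  note v = val_slot[OF c l hs(2,3)]
  have "chain (tgt t0) ((t0 # A) @ ((b, a), f) # B) (tgt t0)" using c by simp
  then have s: "a \<in> Ob D" "b \<in> Ob D" "f \<in> carrier (Hom D b a)"
    unfolding chain_replace by (auto dest: chain_Ob)
  show ?thesis unfolding t(1) A(1) f v(3)
    by (intro linear_map_compose[OF linear_map_compose[OF T_linear cmp_slot_linear[OF v(1,2)]]] lin s)
      (use chain_Ob[OF c] in auto)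
qed

text \<open>An equation in the dual of the nerve is tested on chains, where it reduces to linearity
  of \<open>val\<close> in one entry.\<close>

lemma gam_multilinear: "multilinear K (replicate n H) (dual_module K (nerve K D n)) (gam_pure n)"
proof (rule hmultilinearI)
  interpret HM: module K H by simp
  fix hs ks assume h: "length hs + Suc (length ks) = n" "set hs \<subseteq> carrier H" "set ks \<subseteq> carrier H"
  have g: "gam_pure n (hs @ x # ks) \<in> carrier (dual_module K (nerve K D n))"
    "ts \<in> cchains n \<Longrightarrow> gam_pure n (hs @ x # ks) (npure ts) = val (hs @ x # ks) ts" if "x \<in> carrier H" for x ts
    using gam_pure[of "hs @ x # ks" n] h that by auto
  interpret Dm: module K "dual_module K (nerve K D n)"
    by (rule module_hom_module[OF module_nerve module_K])
  show "linear_map K H (dual_module K (nerve K D n)) (\<lambda>x. gam_pure n (hs @ x # ks))"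
  proof (rule linear_mapI)
    fix x y assume xy: "x \<in> carrier H" "y \<in> carrier H"
    show "gam_pure n (hs @ (x \<oplus>\<^bsub>H\<^esub> y) # ks)
        = gam_pure n (hs @ x # ks) \<oplus>\<^bsub>dual_module K (nerve K D n)\<^esub> gam_pure n (hs @ y # ks)"
    proof (rule dual_ext)
      show "gam_pure n (hs @ x # ks) \<oplus>\<^bsub>dual_module K (nerve K D n)\<^esub> gam_pure n (hs @ y # ks)
          \<in> carrier (dual_module K (nerve K D n))" using xy by (intro Dm.a_closed g)
    qed (use xy g linear_map_add[OF val_linear[OF _ h]] in \<open>simp_all add: npure_closed\<close>)
  next
    fix c x assume cx: "c \<in> carrier K" "x \<in> carrier H"
    show "gam_pure n (hs @ (c \<odot>\<^bsub>H\<^esub> x) # ks)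
        = c \<odot>\<^bsub>dual_module K (nerve K D n)\<^esub> gam_pure n (hs @ x # ks)"
    proof (rule dual_ext)
      show "c \<odot>\<^bsub>dual_module K (nerve K D n)\<^esub> gam_pure n (hs @ x # ks)
          \<in> carrier (dual_module K (nerve K D n))" using cx by (intro Dm.smult_closed g)
    qed (use cx g linear_map_smult[OF val_linear[OF _ h]] in \<open>simp_all add: npure_closed\<close>)
  qed (rule g)
qed (rule gam_pure)

abbreviation gam where "gam \<equiv> hopf_gamma K H D T"

lemma gam_def: "gam n = tensor_lift K (replicate n H) (dual_module K (nerve K D n)) (gam_pure n)"
  unfolding hopf_gamma_def gam_pure_def[abs_def] ..

lemma module_dual: "module K (dual_module K (nerve K D n))"
  by (rule module_hom_module[OF module_nerve module_K])

lemma gam_linear: "linear_map K (tp n) (dual_module K (nerve K D n)) (gam n)"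
  unfolding gam_def by (rule hlift_linear[OF module_dual gam_multilinear])

lemma gam_pt:
  "\<lbrakk>length hs = n; set hs \<subseteq> carrier H; ts \<in> cchains n\<rbrakk> \<Longrightarrow> gam n (pt hs) (npure ts) = val hs ts"
  unfolding gam_def using hlift_pt[OF module_dual gam_multilinear, of hs n] gam_pure(2)[of hs n ts] by simp

lemma gam_lin [lin]:
  assumes "linear_map K V (tp n) f" "ts \<in> cchains n"
  shows "linear_map K V (self_module K) (\<lambda>x. gam n (f x) (npure ts))"
  by (rule linear_map_compose[OF linear_map_eval[OF npure_closed[OF assms(2)]] linear_map_compose[OF gam_linear assms(1)]])

section \<open>Compatibility of the characteristic map with the cocyclic operators\<close>

lemma gam_dd:
  assumes i: "i \<le> Suc n" and hs: "length hs = n" "set hs \<subseteq> carrier H" and ts: "ts \<in> cchains (Suc n)"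
  shows "gam (Suc n) (dd n i (pt hs)) (npure ts) = val hs (cface' i ts)"
proof -
  have ptc: "pt hs \<in> carrier (tp n)" using hs by (intro pt_closed)
  obtain t0 ts' where t: "ts = t0 # ts'" "length ts' = Suc n" "chain (tgt t0) (t0 # ts') (tgt t0)" using ts by (rule cchains_ConsE)
  let ?x = "tgt t0"
  from i show ?thesis
  proof (cases rule: coface_cases)
    \<comment> \<open>The inserted unit acts trivially on \<open>f\<^sup>1\<close>, so the product
      contains the plain composite of \<open>f\<^sup>0\<close> and \<open>f\<^sup>1\<close>.\<close>
    case 1
    obtain t1 us where t1: "ts' = t1 # us" using t by (cases ts') auto
    have c: "chain ?x ([] @ t0 # t1 # acts hs us) ?x"
      using chain_acts[of ?x us "src t1" hs] t t1 hs by auto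
    have "act_arrow \<one>\<^bsub>H\<^esub> t1 = t1"
      using left_hopf_module.act_one[OF Act_module] c by (auto simp: act_arrow_def prod_eq_iff dest: chain_Ob)
    moreover have "gam (Suc n) (dd n i (pt hs)) (npure ts) = val (\<one>\<^bsub>H\<^esub> # hs) ts"
      using 1 ptc hs gam_pt[of "\<one>\<^bsub>H\<^esub> # hs" "Suc n" ts] ts by (simp add: dd_0 cat_pt)
    ultimately show ?thesis using cmp_comp[OF c] cface'_append[of "[]" 0 t0 t1 us] 1 t t1
      by (simp add: val_def del: cmp.simps)
  next
    \<comment> \<open>The appended \<open>\<sigma>\<close> acts on the last arrow. The trace
      property moves that arrow, now without \<open>\<sigma>\<close>, in front of
      \<open>f\<^sup>0\<close>, which is the pair the last face composes.\<close>
    case 2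
    obtain M t2 where M: "ts' = M @ [t2]" "length M = n" using t(2) by (cases ts' rule: rev_cases) auto
    have cM: "chain ?x ((t0 # M) @ [t2]) ?x" using t M by simp
    have c: "chain ?x ((t0 # acts hs M) @ [t2]) ?x"
    proof -
      obtain z where z: "chain z (t0 # M) ?x" "chain ?x [t2] z" using cM unfolding chain_append by blast
      have "chain z (t0 # acts hs M) ?x" by (rule chain_Cons_acts[OF z(1)]) (use M hs in auto)
      then show ?thesis unfolding chain_append using z(2) by blast
    qed
    have st: "src t2 = ?x" using cM by (auto simp: chain_append)
    have c2: "chain (tgt t2) ([] @ t2 # t0 # acts hs M) (tgt t2)"
      using c by (auto simp: chain_append dest: chain_Ob)
    have "gam (Suc n) (dd n i (pt hs)) (npure ts) = val (hs @ [\<sigma>]) ts"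
      using 2 ptc hs gam_pt[of "hs @ [\<sigma>]" "Suc n" ts] ts by (simp add: dd_last cat_pt)
    also have "\<dots> = T ?x (cmp ?x ((t0 # acts hs M) @ [act_arrow \<sigma> t2]))"
      using t M hs by (simp add: val_def)
    also have "\<dots> = T (tgt t2) (cmp (tgt t2) (t2 # t0 # acts hs M))"
      by (rule trace_rotate[OF c])
    also have "\<dots> = T (tgt t2) (cmp (tgt t2) (comp_arrow t2 t0 # acts hs M))"
      using cmp_comp[OF c2] by simp
    also have "\<dots> = val hs (cface' i ts)"
      using cface'_last[of i M t0 t2] 2 t M by (simp add: val_def del: cmp.simps)
    finally show ?thesis .
  next
    case (3 p q)
    have "p < length hs" using hs 3 by simp
    then obtain A h B where A: "hs = A @ h # B" "length A = p" by (rule list_split_one)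
    have sub: "set A \<subseteq> carrier H" "set B \<subseteq> carrier H" "h \<in> carrier H" "length B = q" using hs A 3 by auto
    have "Suc p < length ts'" using t 3 by simp
    then obtain M s u N where M: "ts' = M @ s # u # N" "length M = p" by (rule list_split_two)
    have lN: "length N = q" using t M 3 by simp
    obtain z where z: "chain z (t0 # M) ?x" "chain ?x (s # u # N) z"
      using t(3) M by (metis append_Cons chain_append)
    let ?P = "t0 # acts A M" and ?Q = "acts B N"
    have P: "chain z ?P ?x" by (rule chain_Cons_acts[OF z(1)]) (use sub A M in auto)
    have su: "tgt s = z" "z \<in> Ob D" "snd s \<in> carrier (Hom D (src s) z)" "src s = tgt u" "src s \<in> Ob D"
      "snd u \<in> carrier (Hom D (src u) (src s))" "chain ?x N (src u)" using z(2) by auto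
    have uO: "src u \<in> Ob D" "?x \<in> Ob D" using chain_Ob[OF su(7)] by auto
    have Q: "chain ?x ?Q (src u)" by (rule chain_acts[OF su(7)]) (use sub lN in auto)
    \<comment> \<open>The trace as a linear function of a single slot: in this form it can be pulled
      out of the Sweedler sum, which leaves \<open>Act_Comp\<close> inside.\<close>
    let ?F = "\<lambda>m. T ?x (cmp ?x (?P @ ((src u, z), m) # ?Q))"
    have F: "linear_map K (Hom D (src u) z) (self_module K) ?F"
      by (rule linear_map_compose[OF T_linear cmp_slot_linear[OF P Q]]) (use uO in auto)
    have "gam (Suc n) (dd n i (pt hs)) (npure ts)
        = gam (Suc n) (cat p (2 + q) (pt A) (cat 2 q (comult H h) (pt B))) (npure ts)"
      using app_pt[OF comult_linear_tp A(2) sub(4) sub(1,2,3)] A dd_inner[OF 3(2)] 3 by simp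
    also have "\<dots> = sw (self_module K) (\<lambda>a b. gam (Suc n) (cat p (2 + q) (pt A) (cat 2 q (pt [a, b]) (pt B))) (npure ts)) h"
      by (rule sw_comult_map[where f = "\<lambda>w. gam (Suc n) (cat p (2 + q) (pt A) (cat 2 q w (pt B))) (npure ts)", OF _ _ sub(3)];
          (intro lin)?) (use sub A ts 3 in auto)
    also have "\<dots> = sw (self_module K) (\<lambda>a b. ?F (Comp D (src u) (src s) z (Act D (src s) z a (snd s)) (Act D (src u) (src s) b (snd u)))) h"
    proof (rule sw_cong)
      fix a b assume ab: "a \<in> carrier H" "b \<in> carrier H"
      have c: "chain ?x (?P @ act_arrow a s # act_arrow b u # ?Q) ?x"
        using P Q su uO ab by (auto simp: chain_append intro!: Act_closed)
      have "gam (Suc n) (cat p (2 + q) (pt A) (cat 2 q (pt [a, b]) (pt B))) (npure ts) = val (A @ [a, b] @ B) ts"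
        using gam_pt[of "A @ [a, b] @ B" "Suc n" ts] ts sub A 3 ab by (simp add: cat_pt)
      also have "\<dots> = T ?x (cmp ?x (?P @ act_arrow a s # act_arrow b u # ?Q))"
        using t M A sub lN by (simp add: val_def)
      also have "\<dots> = T ?x (cmp ?x (?P @ comp_arrow (act_arrow a s) (act_arrow b u) # ?Q))"
        by (simp only: cmp_comp[OF c])
      also have "comp_arrow (act_arrow a s) (act_arrow b u)
          = ((src u, z), Comp D (src u) (src s) z (Act D (src s) z a (snd s)) (Act D (src u) (src s) b (snd u)))"
        using su by (simp add: comp_arrow_def)
      finally show "gam (Suc n) (cat p (2 + q) (pt A) (cat 2 q (pt [a, b]) (pt B))) (npure ts)
          = ?F (Comp D (src u) (src s) z (Act D (src s) z a (snd s)) (Act D (src u) (src s) b (snd u)))" .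
    qed
    also have "\<dots> = ?F (sw (Hom D (src u) z) (\<lambda>a b. Comp D (src u) (src s) z (Act D (src s) z a (snd s)) (Act D (src u) (src s) b (snd u))) h)"
      by (rule sw_map[symmetric, OF _ _ F _ sub(3)]; (intro lin su uO)?; simp?)
    also have "\<dots> = ?F (Act D (src u) z h (Comp D (src u) (src s) z (snd s) (snd u)))"
      using Act_Comp[OF uO(1) su(5,2) sub(3) su(6,3)] by simp
    also have "((src u, z), Act D (src u) z h (Comp D (src u) (src s) z (snd s) (snd u))) = act_arrow h (comp_arrow s u)"
      using su by (simp add: act_arrow_def comp_arrow_def)
    also have "T ?x (cmp ?x (?P @ act_arrow h (comp_arrow s u) # ?Q)) = val hs (cface' i ts)"
      using cface'_append[of "t0 # M" i s u N] t M A 3 sub lN by (simp add: val_def)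
    finally show ?thesis .
  qed
qed

lemma gam_ss:
  assumes i: "i \<le> n" and hs: "length hs = Suc n" "set hs \<subseteq> carrier H" and ts: "ts \<in> cchains n"
  shows "gam n (ss n i (pt hs)) (npure ts) = val hs (cdeg i ts)"
proof -
  obtain q where n: "n = i + q" using i by (metis le_Suc_ex)
  have "i < length hs" using hs i by simp
  then obtain A h B where A: "hs = A @ h # B" "length A = i" by (rule list_split_one)
  have sub: "set A \<subseteq> carrier H" "set B \<subseteq> carrier H" "h \<in> carrier H" "length B = q" using hs A n by auto
  obtain t0 ts' where t: "ts = t0 # ts'" "length ts' = n" "chain (tgt t0) (t0 # ts') (tgt t0)" using ts by (rule cchains_ConsE)
  let ?x = "tgt t0"
  obtain M N where M: "ts' = M @ N" "length M = i" "length N = q"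
    using t(2) n by (metis append_take_drop_id length_take length_drop min.absorb2 diff_add_inverse i)
  obtain z where z: "chain z (t0 # M) ?x" "chain ?x N z" using t(3) M by (metis append_Cons chain_append)
  have zO: "z \<in> Ob D" "?x \<in> Ob D" using chain_Ob[OF z(1)] by auto
  \<comment> \<open>\<open>cdeg\<close> splits the chain at an arrow, so the last arrow of the
    prefix is named. Since \<open>f\<^sup>0\<close> is arrow number 0, the prefix
    \<open>t0 # M\<close> has \<open>i + 1\<close> entries.\<close>
  obtain P' s where P': "t0 # M = P' @ [s]" "length P' = i" using M by (metis length_Cons length_append_singleton list.discI append_butlast_last_id nat.inject)
  have sz: "src s = z" using z(1) unfolding P'(1) by (auto simp: chain_append)
  have cd: "cdeg i ts = t0 # M @ id_arrow z # N"
  proof -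
    have e: "ts = P' @ s # N" using t(1) M(1) P'(1) by (metis append_Cons append_assoc append_Nil)
    have "cdeg i ts = (P' @ [s]) @ id_arrow z # N" unfolding e cdeg_append[OF P'(2)] sz by simp
    then show ?thesis unfolding P'(1)[symmetric] by simp
  qed
  let ?P = "t0 # acts A M" and ?Q = "acts B N"
  have P: "chain z ?P ?x" by (rule chain_Cons_acts[OF z(1)]) (use sub A M in auto)
  have Q: "chain ?x ?Q z" by (rule chain_acts[OF z(2)]) (use sub M in auto)
  have "gam n (ss n i (pt hs)) (npure ts) = gam n (counit H h \<odot>\<^bsub>tp n\<^esub> pt (A @ B)) (npure ts)"
    using app_pt[OF eps_linear A(2) sub(4) sub(1,2,3)] A ss_eq[OF n] n sub
    by (simp add: cat_eps cat_smult counit_closed pt_closed cat_pt)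
  also have "\<dots> = counit H h \<otimes>\<^bsub>K\<^esub> gam n (pt (A @ B)) (npure ts)"
    using linear_map_smult[OF gam_lin[OF linear_map_ident ts] counit_closed[OF sub(3)], of "pt (A @ B)"] sub A n
    by (simp add: pt_closed)
  also have "gam n (pt (A @ B)) (npure ts) = T ?x (cmp ?x (?P @ ?Q))"
    using gam_pt[of "A @ B" n ts] ts sub A n t M by (simp add: val_def)
  \<comment> \<open>The identity arrow is one slot of the product; there \<open>h\<close> acts on it
    by its counit, and linearity in the slot extracts the scalar.\<close>
  also have "counit H h \<otimes>\<^bsub>K\<^esub> T ?x (cmp ?x (?P @ ?Q)) = T ?x (cmp ?x (?P @ act_arrow h (id_arrow z) # ?Q))"
  proof -
    have L: "linear_map K (Hom D z z) (self_module K) (\<lambda>f. T ?x (cmp ?x (?P @ ((z, z), f) # ?Q)))"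
      by (rule linear_map_compose[OF T_linear[OF zO(2)] cmp_slot_linear[OF P Q]])
    have Idz: "Id D z \<in> carrier (Hom D z z)" by (rule Id_closed[OF zO(1)])
    have "cmp ?x (?P @ ((z, z), Id D z) # ?Q) = cmp ?x (?P @ ?Q)"
      unfolding cmp_slot[OF P Q Idz] cmp_append[OF P Q]
      using Id_left[OF zO(2,1) cmp_closed[OF Q]] by simp
    then show ?thesis
      using linear_map_smult[OF L counit_closed[OF sub(3)] Idz] Act_Id[OF zO(1) sub(3)]
      by (simp add: act_arrow_def id_arrow_def)
  qed
  also have "\<dots> = val hs (cdeg i ts)" unfolding cd using A M sub by (simp add: val_def)
  finally show ?thesis .
qed

text \<open>The product \<open>(h\<^sup>1f\<^sup>1) \<dots> (h\<^sup>nf\<^sup>n)\<close> as a linear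
  function of the tensor. It is needed because \<open>tau\<close> returns a diagonal action, hence a
  tensor that is not pure and cannot be evaluated entry by entry.\<close>

definition ev :: "'o \<Rightarrow> 'o \<Rightarrow> (('o \<times> 'o) \<times> 'm) list \<Rightarrow> ('h list \<Rightarrow> 'k) set \<Rightarrow> 'm" where
  "ev y x ts = tensor_lift K (replicate (length ts) H) (Hom D y x) (\<lambda>hs. cmp y (acts hs ts))"

lemma ev_multilinear:
  assumes ts: "chain y ts x"
  shows "multilinear K (replicate (length ts) H) (Hom D y x) (\<lambda>hs. cmp y (acts hs ts))"
proof (rule hmultilinearI)
  show "cmp y (acts hs ts) \<in> carrier (Hom D y x)" if "length hs = length ts" "set hs \<subseteq> carrier H" for hs
    by (rule cmp_closed[OF chain_acts[OF ts that]])
next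
  fix hs ks assume h: "length hs + Suc (length ks) = length ts" "set hs \<subseteq> carrier H" "set ks \<subseteq> carrier H"
  then have "length hs < length ts" by simp
  then obtain A t B where A: "ts = A @ t # B" "length A = length hs" by (rule list_split_one)
  obtain b a f where f: "t = ((b, a), f)" by (metis prod.exhaust)
  have c: "chain a A x" "chain y B b" "a \<in> Ob D" "f \<in> carrier (Hom D b a)"
    using ts unfolding A(1) f chain_replace by auto
  have b: "b \<in> Ob D" using chain_Ob[OF c(2)] by simp
  have A': "chain a (acts hs A) x" "chain y (acts ks B) b"
    by (rule chain_acts[OF c(1)], use A h in auto) (rule chain_acts[OF c(2)], use A h in auto)
  have "linear_map K H (Hom D y x) (\<lambda>h. cmp y (acts hs A @ ((b, a), Act D b a h f) # acts ks B))"
    by (intro linear_map_compose[OF cmp_slot_linear[OF A']] lin b c)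
  then show "linear_map K H (Hom D y x) (\<lambda>h. cmp y (acts (hs @ h # ks) ts))"
    using A f by (simp add: act_arrow_def)
qed

lemma ev_linear: "chain y ts x \<Longrightarrow> linear_map K (tp (length ts)) (Hom D y x) (ev y x ts)"
  unfolding ev_def using chain_Ob by (intro hlift_linear ev_multilinear Hom_module) auto

lemma ev_pt:
  "\<lbrakk>chain y ts x; length hs = length ts; set hs \<subseteq> carrier H\<rbrakk> \<Longrightarrow> ev y x ts (pt hs) = cmp y (acts hs ts)"
  unfolding ev_def using chain_Ob by (intro hlift_pt ev_multilinear Hom_module) auto

lemma ev_Cons:
  assumes c: "chain y (t # ts) x" and h: "h \<in> carrier H" and u: "u \<in> carrier (tp (length ts))"
  shows "ev y x (t # ts) (cat (Suc 0) (length ts) (pt [h]) u)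
    = Comp D y (src t) x (Act D (src t) x h (snd t)) (ev y (src t) ts u)"
proof -
  have c': "chain y ts (src t)" "tgt t = x" "x \<in> Ob D" "snd t \<in> carrier (Hom D (src t) x)" using c by auto
  have ob: "y \<in> Ob D" "src t \<in> Ob D" using chain_Ob[OF c'(1)] by auto
  have l1: "linear_map K (tp (length ts)) (Hom D y x) (\<lambda>u. ev y x (t # ts) (cat (Suc 0) (length ts) (pt [h]) u))"
    by (rule linear_map_compose[OF ev_linear[OF c]]; intro lin) (use h in auto)
  have l2: "linear_map K (tp (length ts)) (Hom D y x) (\<lambda>u. Comp D y (src t) x (Act D (src t) x h (snd t)) (ev y (src t) ts u))"
    by (intro lin ev_linear ob c' h)
  show ?thesis
  proof (rule tp_ext[OF Hom_module[OF ob(1) c'(3)] l1 l2 _ u])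
    fix hs assume hs: "length hs = length ts" "set hs \<subseteq> carrier H"
    have "ev y x (t # ts) (pt (h # hs)) = cmp y (acts (h # hs) (t # ts))"
      by (rule ev_pt[OF c]) (use hs h in auto)
    then show "ev y x (t # ts) (cat (Suc 0) (length ts) (pt [h]) (pt hs))
        = Comp D y (src t) x (Act D (src t) x h (snd t)) (ev y (src t) ts (pt hs))"
      using ev_pt[OF c'(1) hs] hs h c'(2) by (simp add: cat_pt)
  qed
qed

text \<open>\<open>Act_Comp\<close> iterated along the chain: \<open>ev\<close> carries the diagonal
  action on tensors to the action on morphisms. The empty chain corresponds to
  \<open>Act_Id\<close>.\<close>

lemma ev_act:
  assumes "chain y ts x" "h \<in> carrier H" "u \<in> carrier (tp (length ts))"
  shows "ev y x ts (act (length ts) h u) = Act D y x h (ev y x ts u)"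
proof -
  have pure: "ev y x ts (act (length ts) h (pt hs)) = Act D y x h (ev y x ts (pt hs))"
    if "chain y ts x" "h \<in> carrier H" "length hs = length ts" "set hs \<subseteq> carrier H" for ts x h hs
    using that
  proof (induction ts arbitrary: x h hs)
    case Nil
    then have x: "y = x" "x \<in> Ob D" by auto
    have "ev y x [] (act 0 h (pt [])) = counit H h \<odot>\<^bsub>Hom D y x\<^esub> ev y x [] (pt [])"
      unfolding act_Nil[OF Nil(2)] eps_def
      using linear_map_smult[OF ev_linear[OF Nil(1)] counit_closed[OF Nil(2)]] by simp
    then show ?case using ev_pt[OF Nil(1), of "[]"] Act_Id[OF x(2) Nil(2)] x Nil by simp
  next
    case (Cons t ts)
    obtain k ks where k: "hs = k # ks" using Cons.prems(3) by (cases hs) auto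
    have kk: "k \<in> carrier H" "set ks \<subseteq> carrier H" "length ks = length ts" using Cons.prems k by auto
    note c = Cons.prems(1) and h = Cons.prems(2)
    have c': "chain y ts (src t)" "tgt t = x" "x \<in> Ob D" "snd t \<in> carrier (Hom D (src t) x)" using c by auto
    have ob: "y \<in> Ob D" "src t \<in> Ob D" using chain_Ob[OF c'(1)] by auto
    have pks: "pt ks \<in> carrier (tp (length ts))" using kk by (intro pt_closed)
    have px: "pt hs = cat (Suc 0) (length ts) (pt [k]) (pt ks)" unfolding k by (rule pt_Cons[OF kk])
    let ?n = "length ts" and ?W = "Hom D y x"
    have evc: "ev y (src t) ts (pt ks) \<in> carrier (Hom D y (src t))"
      by (rule linear_map_closed[OF ev_linear[OF c'(1)] pks])
    have "ev y x (t # ts) (act (Suc ?n) h (pt hs))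
        = ev y x (t # ts) (sw (tp (Suc ?n)) (\<lambda>a b. cat (Suc 0) ?n (pt [a \<otimes>\<^bsub>H\<^esub> k]) (act ?n b (pt ks))) h)"
      unfolding px act_Cons[OF h kk(1) pks] ..
    also have "\<dots> = sw ?W (\<lambda>a b. ev y x (t # ts) (cat (Suc 0) ?n (pt [a \<otimes>\<^bsub>H\<^esub> k]) (act ?n b (pt ks)))) h"
      by (rule sw_map[OF _ _ ev_linear[OF c, simplified] _ h]; (intro lin ob c'(3))?) (use kk in auto)
    also have "\<dots> = sw ?W (\<lambda>a b. Comp D y (src t) x (Act D (src t) x a (Act D (src t) x k (snd t))) (Act D y (src t) b (ev y (src t) ts (pt ks)))) h"
    proof (rule sw_cong)
      fix a b assume ab: "a \<in> carrier H" "b \<in> carrier H"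
      have ak: "a \<otimes>\<^bsub>H\<^esub> k \<in> carrier H" using ab kk by simp
      show "ev y x (t # ts) (cat (Suc 0) ?n (pt [a \<otimes>\<^bsub>H\<^esub> k]) (act ?n b (pt ks)))
          = Comp D y (src t) x (Act D (src t) x a (Act D (src t) x k (snd t))) (Act D y (src t) b (ev y (src t) ts (pt ks)))"
        unfolding ev_Cons[OF c ak act_closed[OF ab(2) pks]] Cons.IH[OF c'(1) ab(2) kk(3,2)]
          left_hopf_module.act_mult[OF Act_module[OF ob(2) c'(3)] ab(1) kk(1) c'(4)] ..
    qed
    also have "\<dots> = Act D y x h (Comp D y (src t) x (Act D (src t) x k (snd t)) (ev y (src t) ts (pt ks)))"
      by (rule Act_Comp[symmetric, OF ob c'(3) h evc]) (intro Act_closed ob c' kk)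
    also have "Comp D y (src t) x (Act D (src t) x k (snd t)) (ev y (src t) ts (pt ks)) = ev y x (t # ts) (pt hs)"
      unfolding px ev_Cons[OF c kk(1) pks] ..
    finally show ?case by simp
  qed
  have ob: "y \<in> Ob D" "x \<in> Ob D" using chain_Ob[OF assms(1)] by auto
  show ?thesis
    by (rule tp_ext[OF Hom_module[OF ob] linear_map_compose[OF ev_linear[OF assms(1)] act_lin(2)[OF linear_map_ident assms(2)]]
          Act_lin(2)[OF ob assms(2) ev_linear[OF assms(1)]] _ assms(3)])
      (use pure assms in auto)
qed

text \<open>Extends the value of \<open>gam\<close> from pure tensors to arbitrary \<open>u\<close>;
  \<open>f\<^sup>0\<close> is kept apart because nothing acts on it.\<close>

lemma gam_ev:
  assumes ts: "t # ts \<in> cchains n" and u: "u \<in> carrier (tp n)"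
  shows "gam n u (npure (t # ts)) = T (tgt t) (Comp D (tgt t) (src t) (tgt t) (snd t) (ev (tgt t) (src t) ts u))"
proof -
  have l: "length ts = n" and c: "chain (tgt t) (t # ts) (tgt t)" using ts by (auto elim: cchains_ConsE)
  have c': "chain (tgt t) ts (src t)" "tgt t \<in> Ob D" "src t \<in> Ob D" "snd t \<in> carrier (Hom D (src t) (tgt t))"
    using c by (auto dest: chain_Ob)
  have l2: "linear_map K (tp n) (self_module K) (\<lambda>u. T (tgt t) (Comp D (tgt t) (src t) (tgt t) (snd t) (ev (tgt t) (src t) ts u)))"
    by (intro lin c' ev_linear[OF c'(1), unfolded l])
  show ?thesis
  proof (rule tp_ext[OF module_K gam_lin[OF linear_map_ident ts] l2 _ u])
    fix hs assume hs: "length hs = n" "set hs \<subseteq> carrier H"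
    show "gam n (pt hs) (npure (t # ts)) = T (tgt t) (Comp D (tgt t) (src t) (tgt t) (snd t) (ev (tgt t) (src t) ts (pt hs)))"
      using gam_pt[OF hs ts] ev_pt[OF c'(1), of hs] hs l by (simp add: val_def)
  qed
qed

lemma gam_tau:
  assumes hs: "length hs = n" "set hs \<subseteq> carrier H" and ts: "ts \<in> cchains n"
  shows "gam n (tau n (pt hs)) (npure ts) = val hs (crot ts)"
proof (cases n)
  \<comment> \<open>A single arrow is fixed by rotation, and \<open>tau\<close> is the identity in
    degree 0.\<close>
  case 0
  then obtain t where "ts = [t]" using ts by (auto simp: cchains_def length_Suc_conv)
  then show ?thesis using 0 hs gam_pt[OF hs ts] by (simp add: tau_def hopf_cocyc_def crot_def)
next
  case (Suc k)
  obtain h hs' where h: "hs = h # hs'" "length hs' = k" using hs Suc by (cases hs) auto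
  have hc: "h \<in> carrier H" "set hs' \<subseteq> carrier H" using hs h by auto
  obtain t ts' where t: "ts = t # ts'" "length ts' = n" "chain (tgt t) (t # ts') (tgt t)" using ts by (rule cchains_ConsE)
  obtain B l where B: "ts' = B @ [l]" "length B = k" using t Suc by (cases ts' rule: rev_cases) auto
  let ?x = "tgt t" and ?y = "src t"
  have c: "chain ?x ts' ?y" "?x \<in> Ob D" "?y \<in> Ob D" "snd t \<in> carrier (Hom D ?y ?x)"
    using t(3) by (auto dest: chain_Ob)
  have us: "pt (hs' @ [\<sigma>]) \<in> carrier (tp n)" using h hc Suc by (intro pt_closed) auto
  have tau: "tau n (pt hs) = act n (Sd h) (pt (hs' @ [\<sigma>]))"
    using tau_cat[OF hc(1) pt_closed[OF hc(2) h(2)]] h hc Suc by (simp add: cat_pt)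
  obtain z where z: "chain z B ?y" "chain ?x [l] z" using c(1) unfolding B(1) chain_append by blast
  have Bc: "chain z (acts hs' B) ?y" by (rule chain_acts[OF z(1)]) (use B h hc in auto)
  have lz: "tgt l = z" using z(2) by simp
  have rot: "chain ?x ((act_arrow h t # acts hs' B) @ [l]) ?x"
    using Bc z(2) c hc by (auto simp: chain_append intro!: Act_closed)
  have evc: "ev ?x ?y ts' (pt (hs' @ [\<sigma>])) = cmp ?x (acts hs' B @ [act_arrow \<sigma> l])"
    using ev_pt[OF c(1), of "hs' @ [\<sigma>]"] B h hc by simp
  have evcl: "cmp ?x (acts hs' B @ [act_arrow \<sigma> l]) \<in> carrier (Hom D ?x ?y)"
    using chain_acts[OF c(1), of "hs' @ [\<sigma>]"] B h hc cmp_closed by simp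
  have "gam n (tau n (pt hs)) (npure ts) = T ?x (Comp D ?x ?y ?x (snd t) (ev ?x ?y ts' (act n (Sd h) (pt (hs' @ [\<sigma>])))))"
    unfolding tau t(1) by (rule gam_ev[OF ts[unfolded t(1)]]) (use us hc in \<open>auto intro: act_closed Sd_closed\<close>)
  also have "ev ?x ?y ts' (act n (Sd h) (pt (hs' @ [\<sigma>]))) = Act D ?x ?y (Sd h) (cmp ?x (acts hs' B @ [act_arrow \<sigma> l]))"
    using ev_act[OF c(1) Sd_closed[OF hc(1)], of "pt (hs' @ [\<sigma>])"] us t(2) evc by simp
  also have "T ?x (Comp D ?x ?y ?x (snd t) (Act D ?x ?y (Sd h) (cmp ?x (acts hs' B @ [act_arrow \<sigma> l]))))
      = T ?x (Comp D ?x ?y ?x (Act D ?y ?x h (snd t)) (cmp ?x (acts hs' B @ [act_arrow \<sigma> l])))"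
    by (rule trace_by_parts[OF c(2,3,4) evcl hc(1)])
  also have "\<dots> = T ?x (cmp ?x ((act_arrow h t # acts hs' B) @ [act_arrow \<sigma> l]))" by simp
  also have "\<dots> = T (tgt l) (cmp (tgt l) (l # act_arrow h t # acts hs' B))" by (rule trace_rotate[OF rot])
  also have "\<dots> = val hs (crot ts)"
    using crot_snoc[of "t # B" l] t B h by (simp add: val_def)
  finally show ?thesis .
qed

theorem gam_cocyclic_morphism:
  "cocyclic_morphism K (hopf_cocyclic K H \<delta> \<sigma>) (nerve_cocyclic K D) gam"
proof -
  interpret N: cocyclic_module K "nerve_cocyclic K D" by (rule nerve_cocyclic_module)
  \<comment> \<open>Double reduction: linear maps on tensors are compared on pure tensors, and the
    resulting functionals on chains.\<close>
  have ext: "gam m (F u) = G (gam n u)"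
    if F: "linear_map K (tp n) (tp m) F" and G: "linear_map K (dual_module K (nerve K D n)) (dual_module K (nerve K D m)) G"
      and u: "u \<in> carrier (tp n)"
      and eq: "\<And>hs ts. \<lbrakk>length hs = n; set hs \<subseteq> carrier H; ts \<in> cchains m\<rbrakk>
        \<Longrightarrow> gam m (F (pt hs)) (npure ts) = G (gam n (pt hs)) (npure ts)" for n m F G u
  proof (rule tp_ext[OF module_dual linear_map_compose[OF gam_linear F] linear_map_compose[OF G gam_linear] _ u])
    fix hs assume hs: "length hs = n" "set hs \<subseteq> carrier H"
    then have p: "pt hs \<in> carrier (tp n)" by (intro pt_closed)
    show "gam m (F (pt hs)) = G (gam n (pt hs))"
      by (rule dual_ext[OF linear_map_closed[OF gam_linear linear_map_closed[OF F p]]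
            linear_map_closed[OF G linear_map_closed[OF gam_linear p]] eq[OF hs]])
  qed
  show ?thesis
  proof (rule cocyclic_morphism.intro[OF hopf_cocyclic_module nerve_cocyclic_module],
      rule cocyclic_morphism_axioms.intro; unfold hopf_cocyclic_simps)
    show "linear_map K (tp n) (cospace (nerve_cocyclic K D) n) (gam n)" for n
      using gam_linear by simp
  next
    fix i n x assume i: "i \<le> Suc n" and x: "x \<in> carrier (tp n)"
    show "gam (Suc n) (dd n i x) = coface (nerve_cocyclic K D) n i (gam n x)"
    proof (rule ext[OF dd_linear[OF i] N.coface_linear[OF i, unfolded nerve_cocyclic_simps(1)] x])
      fix hs ts assume h: "length hs = n" "set hs \<subseteq> carrier H" "ts \<in> cchains (Suc n)"
      show "gam (Suc n) (dd n i (pt hs)) (npure ts) = coface (nerve_cocyclic K D) n i (gam n (pt hs)) (npure ts)"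
        using gam_dd[OF i h] nerve_face(2)[OF i h(3)] gam_pt[OF h(1,2) cface'_cchains[OF h(3)]] npure_closed[OF h(3)]
        by simp
    qed
  next
    fix i n x assume i: "i \<le> n" and x: "x \<in> carrier (tp (Suc n))"
    show "gam n (ss n i x) = codegen (nerve_cocyclic K D) n i (gam (Suc n) x)"
    proof (rule ext[OF ss_linear[OF i] N.codegen_linear[OF i, unfolded nerve_cocyclic_simps(1)] x])
      fix hs ts assume h: "length hs = Suc n" "set hs \<subseteq> carrier H" "ts \<in> cchains n"
      show "gam n (ss n i (pt hs)) (npure ts) = codegen (nerve_cocyclic K D) n i (gam (Suc n) (pt hs)) (npure ts)"
        using gam_ss[OF i h] nerve_degen(2)[OF i h(3)] gam_pt[OF h(1,2) cdeg_cchains[OF h(3) i]] npure_closed[OF h(3)]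
        by simp
    qed
  next
    fix n x assume x: "x \<in> carrier (tp n)"
    show "gam n (tau n x) = cocyc (nerve_cocyclic K D) n (gam n x)"
    proof (rule ext[OF tau_lin[OF linear_map_ident] N.cocyc_linear[unfolded nerve_cocyclic_simps(1)] x])
      fix hs ts assume h: "length hs = n" "set hs \<subseteq> carrier H" "ts \<in> cchains n"
      show "gam n (tau n (pt hs)) (npure ts) = cocyc (nerve_cocyclic K D) n (gam n (pt hs)) (npure ts)"
        using gam_tau[OF h] nerve_cyc(2)[OF h(3)] gam_pt[OF h(1,2) crot_cchains[OF h(3)]] npure_closed[OF h(3)]
        by simp
    qed
  qed
qed

theorem gam_formula:
  assumes hs: "hs \<in> tuples (replicate n H)" and X: "Xs \<in> ob_tuples D n" "fs \<in> tuples (cyc_homs D Xs)"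
  shows "gam n (hpure K H hs) (nerve_pure K D Xs fs) = T (Xs ! 0) (twisted_product D Xs hs fs n)"
proof -
  obtain ts where ts: "ts \<in> cchains n" "map (\<lambda>t. tgt t) ts = Xs" "map snd ts = fs"
    using cchains_exist[OF X] by blast
  have h: "length hs = n" "set hs \<subseteq> carrier H" using hs by (auto simp: tuples_replicate)
  show ?thesis using gam_pt[OF h ts(1)] twisted_product_val[OF ts(1) h] ts unfolding npure_def pt_def by simp
qed

end

theorem theorem2p4:
  fixes K :: "('k, 'z) ring_scheme"
    and H :: "('k, 'h, 'y) hopf_scheme"
    and D :: "('k, 'h, 'o, 'm, 'x) hopf_cat_scheme"
    and \<delta> :: "'h \<Rightarrow> 'k" and \<sigma> :: "'h"
    and T :: "'o \<Rightarrow> 'm \<Rightarrow> 'k"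
  defines "CH \<equiv> hopf_cocyclic K H \<delta> \<sigma>"
    and "CN \<equiv> nerve_cocyclic K D"
    and "\<gamma> \<equiv> hopf_gamma K H D T"
  assumes "field K" and "char_zero K"
    and "hopf_algebra K H"
    and "modular_pair_in_involution K H \<delta> \<sigma>"
    and "left_hopf_category K H D"
    and "sigma_trace K D \<sigma> T"
    and "delta_invariant K H D \<delta> T"
  shows "(\<forall>n. \<forall>hs\<in>tuples (replicate n H). \<forall>Xs\<in>ob_tuples D n. \<forall>fs\<in>tuples (cyc_homs D Xs).
            \<gamma> n (hpure K H hs) (nerve_pure K D Xs fs)
              = T (Xs ! 0) (twisted_product D Xs hs fs n))
       \<and> cocyclic_morphism K CH CN \<gamma>
       \<and> (\<exists>\<Gamma>. \<forall>n. linear_map K (cyclic_cohomology K CH n) (cyclic_cohomology K CN n) (\<Gamma> n)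
            \<and> (\<forall>x\<in>cyclic_cocycles K CH n. \<gamma> n x \<in> cyclic_cocycles K CN n
                 \<and> \<Gamma> n (cyclic_class K CH n x) = cyclic_class K CN n (\<gamma> n x)))"
proof -
  interpret hopf_trace K H \<delta> \<sigma> D T
    by (intro hopf_trace.intro hopf_modular.intro hopf_modular_axioms.intro hopf_trace_axioms.intro assms(6-10))
  show ?thesis
    unfolding CH_def CN_def \<gamma>_def
    using gam_formula gam_cocyclic_morphism cocyclic_morphism.induced_map[OF gam_cocyclic_morphism] by blast
qed

end
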